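(* Let $K$ be a global function field with constant field $\mathbb{F}_q$, let $S\subseteq\mathcal{P}$ have natural density $\delta(S)$, and let $f:\mathbb{N}\to\mathbb{C}$ be a bounded arithmetic function with $f(0)=0$. Then $$\sum_{\deg A=n}Q_S(A)\,f(d^+(A))=\delta(S)c_Kq^n+o(q^n)\quad(n\to\infty)$$ (sum over effective $A$ of degree $n$) holds if and only if $$-\lim_{n\to\infty}\sum_{\substack{1\le\deg A\le n\\ A\in\mathfrak{D}(K,S)}}\frac{\mu(A)f(d_-(A))}{|A|}=\delta(S).$$
   Context: $K$ is a finite extension of $\mathbb{F}_p(x)$ with constant field $\mathbb{F}_q$; $\mathcal{P}$ is its set of prime divisors (places), $|P|=q^{\deg P}$. Effective divisors $D=\sum a_PP$ ($a_P\ge0$), $P\mid D$ iff $a_P\neq0$, $|D|=q^{\deg D}$. $\mu$: Möbius function on effective divisors ($\mu(0)=1$, $(-1)^k$ for a sum of $k$ distinct primes, $0$ otherwise). $d_-(D)=\min\{\deg P:P\mid D\}$, $d^+(D)=\max\{\deg P:P\mid D\}$, $d^+(0)=0$. $D$ is distinguishable if $D\neq0$ and exactly one prime factor $P_{\min}(D)$ has degree $d_-(D)$; $\mathfrak{D}(K,S)$ is the set of effective distinguishable $D$ with $P_{\min}(D)\in S$. $Q_S(D)=\#\{P\in S:P\mid D,\ \deg P=d^+(D)\}$. Natural density: $\delta(S)=\lim_n\#\{P\in S:\deg P=n\}/\#\{P\in\mathcal{P}:\deg P=n\}$. $c_K=h_Kq^{1-g_K}/(q-1)$ with $h_K$ the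 class number and $g_K$ the genus of $K$. *)

theory Defs
  imports
    "HOL-Algebra.Algebra"
    "HOL-Analysis.Analysis"
    "HOL-Library.Landau_Symbols"
begin

section \<open>Global function fields\<close>

definition prime_subfield :: "('a, 'b) ring_scheme \<Rightarrow> 'a set" where
  "prime_subfield K = generate_field K {}"

locale global_function_field = field K for K :: "('a, 'b) ring_scheme" (structure) +
  assumes finite_over_rational_function_field:
    "\<exists>p x. Factorial_Ring.prime (p :: nat) \<and> card (prime_subfield K) = p \<and>
       x \<in> carrier K \<and> (transcendental over prime_subfield K) x \<and>
       finite_dimension (generate_field K (insert x (prime_subfield K))) (carrier K)"

definition constant_field :: "('a, 'b) ring_scheme \<Rightarrow> 'a set" where
  "constant_field K = {c \<in> carrier K. \<not> ring.transcendental K (prime_subfield K) c}"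

section \<open>Places\<close>

definition discrete_valuation_ring :: "('a, 'b) ring_scheme \<Rightarrow> bool" where
  "discrete_valuation_ring A \<longleftrightarrow>
     principal_domain A \<and> \<not> field A \<and> (\<exists>!M. maximalideal M A)"

text \<open>A place is represented by its valuation ring, as a subset of the carrier.\<close>

definition places :: "('a, 'b) ring_scheme \<Rightarrow> 'a set set" where
  "places K = {V. subring V K \<and> constant_field K \<subseteq> V \<and>
     discrete_valuation_ring (K\<lparr>carrier := V\<rparr>) \<and>
     carrier K = {a \<otimes>\<^bsub>K\<^esub> inv\<^bsub>K\<^esub> b | a b. a \<in> V \<and> b \<in> V \<and> b \<noteq> \<zero>\<^bsub>K\<^esub>}}"

definition place_ideal :: "('a, 'b) ring_scheme \<Rightarrow> 'a set \<Rightarrow> 'a set" where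
  "place_ideal K V = (THE M. maximalideal M (K\<lparr>carrier := V\<rparr>))"

definition residue_field :: "('a, 'b) ring_scheme \<Rightarrow> 'a set \<Rightarrow> 'a set ring" where
  "residue_field K V = (K\<lparr>carrier := V\<rparr>) Quot (place_ideal K V)"

text \<open>The degree is the dimension of the residue field over the image of the constant field in it.\<close>

definition place_degree :: "('a, 'b) ring_scheme \<Rightarrow> 'a set \<Rightarrow> nat" where
  "place_degree K V = ring.dim (residue_field K V)
     ((\<lambda>c. place_ideal K V +>\<^bsub>K\<lparr>carrier := V\<rparr>\<^esub> c) ` constant_field K)
     (carrier (residue_field K V))"

text \<open>The normalised valuation at \<open>V\<close>; only meaningful for \<open>a \<noteq> \<zero>\<close>.\<close>

definition place_ord :: "('a, 'b) ring_scheme \<Rightarrow> 'a set \<Rightarrow> 'a \<Rightarrow> int" where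
  "place_ord K V a = (THE n. \<exists>t \<in> V. \<exists>u \<in> Units (K\<lparr>carrier := V\<rparr>).
     place_ideal K V = PIdl\<^bsub>K\<lparr>carrier := V\<rparr>\<^esub> t \<and> a = t [^]\<^bsub>K\<^esub> n \<otimes>\<^bsub>K\<^esub> u)"

section \<open>Divisors, class number and genus\<close>

abbreviation divisor_group ::
  "('a, 'b) ring_scheme \<Rightarrow> ('a set \<Rightarrow>\<^sub>0 int) monoid" where
  "divisor_group K \<equiv> free_Abelian_group (places K)"

definition div_degree :: "('a, 'b) ring_scheme \<Rightarrow> ('a set \<Rightarrow>\<^sub>0 int) \<Rightarrow> int" where
  "div_degree K D =
     (\<Sum>P \<in> Poly_Mapping.keys D. Poly_Mapping.lookup D P * int (place_degree K P))"

definition principal_divisors :: "('a, 'b) ring_scheme \<Rightarrow> ('a set \<Rightarrow>\<^sub>0 int) set" where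
  "principal_divisors K = {D \<in> carrier (divisor_group K).
     \<exists>a \<in> carrier K - {\<zero>\<^bsub>K\<^esub>}. \<forall>P \<in> places K. Poly_Mapping.lookup D P = place_ord K P a}"

definition degree_zero_divisor_group ::
  "('a, 'b) ring_scheme \<Rightarrow> ('a set \<Rightarrow>\<^sub>0 int) monoid" where
  "degree_zero_divisor_group K =
     (divisor_group K)\<lparr>carrier := {D \<in> carrier (divisor_group K). div_degree K D = 0}\<rparr>"

definition class_number :: "('a, 'b) ring_scheme \<Rightarrow> nat" where
  "class_number K = Coset.order (degree_zero_divisor_group K Mod principal_divisors K)"

definition riemann_roch_space ::
  "('a, 'b) ring_scheme \<Rightarrow> ('a set \<Rightarrow>\<^sub>0 int) \<Rightarrow> 'a set" where
  "riemann_roch_space K D = {a \<in> carrier K. a = \<zero>\<^bsub>K\<^esub> \<or>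
     (\<forall>P \<in> places K. place_ord K P a + Poly_Mapping.lookup D P \<ge> 0)}"

text \<open>The genus is the maximum of \<open>deg D - l(D) + 1\<close> over all divisors \<open>D\<close>.\<close>

definition genus :: "('a, 'b) ring_scheme \<Rightarrow> int" where
  "genus K = (GREATEST g. \<exists>D \<in> carrier (divisor_group K).
     g = div_degree K D - int (ring.dim K (constant_field K) (riemann_roch_space K D)) + 1)"

definition c_const :: "('a, 'b) ring_scheme \<Rightarrow> real" where
  "c_const K = (let q = real (card (constant_field K)) in
     real (class_number K) * q powi (1 - genus K) / (q - 1))"

section \<open>Arithmetic of effective divisors\<close>

text \<open>A prime \<open>P\<close> divides \<open>D\<close> iff \<open>P \<in> keys D\<close>.\<close>

definition effective_divisors :: "('a, 'b) ring_scheme \<Rightarrow> ('a set \<Rightarrow>\<^sub>0 int) set" where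
  "effective_divisors K =
     {D \<in> carrier (divisor_group K). \<forall>P. Poly_Mapping.lookup D P \<ge> 0}"

definition div_norm :: "('a, 'b) ring_scheme \<Rightarrow> ('a set \<Rightarrow>\<^sub>0 int) \<Rightarrow> real" where
  "div_norm K D = real (card (constant_field K)) powi (div_degree K D)"

definition div_moebius :: "('a set \<Rightarrow>\<^sub>0 int) \<Rightarrow> int" where
  "div_moebius D =
     (if \<forall>P \<in> Poly_Mapping.keys D. Poly_Mapping.lookup D P = 1
      then (-1) ^ card (Poly_Mapping.keys D) else 0)"

text \<open>The value of \<open>d_minus\<close> at the zero divisor is irrelevant.\<close>

definition d_minus :: "('a, 'b) ring_scheme \<Rightarrow> ('a set \<Rightarrow>\<^sub>0 int) \<Rightarrow> nat" where
  "d_minus K D = Min (place_degree K ` Poly_Mapping.keys D)"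

definition d_plus :: "('a, 'b) ring_scheme \<Rightarrow> ('a set \<Rightarrow>\<^sub>0 int) \<Rightarrow> nat" where
  "d_plus K D = (if D = 0 then 0 else Max (place_degree K ` Poly_Mapping.keys D))"

definition distinguishable :: "('a, 'b) ring_scheme \<Rightarrow> ('a set \<Rightarrow>\<^sub>0 int) \<Rightarrow> bool" where
  "distinguishable K D \<longleftrightarrow> D \<noteq> 0 \<and>
     (\<exists>!P. P \<in> Poly_Mapping.keys D \<and> place_degree K P = d_minus K D)"

definition P_min :: "('a, 'b) ring_scheme \<Rightarrow> ('a set \<Rightarrow>\<^sub>0 int) \<Rightarrow> 'a set" where
  "P_min K D = (THE P. P \<in> Poly_Mapping.keys D \<and> place_degree K P = d_minus K D)"

definition distinguishable_divisors ::
  "('a, 'b) ring_scheme \<Rightarrow> 'a set set \<Rightarrow> ('a set \<Rightarrow>\<^sub>0 int) set" where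
  "distinguishable_divisors K S =
     {D \<in> effective_divisors K. distinguishable K D \<and> P_min K D \<in> S}"

definition Q_count :: "('a, 'b) ring_scheme \<Rightarrow> 'a set set \<Rightarrow> ('a set \<Rightarrow>\<^sub>0 int) \<Rightarrow> nat" where
  "Q_count K S D =
     card {P \<in> S. P \<in> Poly_Mapping.keys D \<and> place_degree K P = d_plus K D}"

definition has_natural_density ::
  "('a, 'b) ring_scheme \<Rightarrow> 'a set set \<Rightarrow> real \<Rightarrow> bool" where
  "has_natural_density K S \<delta> \<longleftrightarrow>
     (\<lambda>n. real (card {P \<in> S. place_degree K P = n}) /
          real (card {P \<in> places K. place_degree K P = n})) \<longlonglongrightarrow> \<delta>"

end

theory Submission
  imports Defs "HOL-Complex_Analysis.Cauchy_Integral_Formula"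
begin

text \<open>
  Write \<open>M k\<close> for the sum of \<open>\<mu>(A) f(d\<^sub>-(A))\<close> over the distinguishable \<open>A\<close> of degree \<open>k\<close> with
  \<open>P\<^sub>m\<^sub>i\<^sub>n(A) \<in> S\<close>. Inclusion-exclusion over the subsets of the support of \<open>B\<close> with a unique prime
  of least degree (Alladi's duality) turns the sum of these terms over all \<open>A \<le> B\<close> into
  \<open>- Q\<^sub>S(B) f(d\<^sup>+(B))\<close>. Hence the sum in question is \<open>- (\<Sum>k\<le>n. M k * a (n - k))\<close>, where \<open>a j\<close>
  counts the effective divisors of degree \<open>j\<close>. Riemann's theorem and the finiteness of the class
  number give \<open>a j = c\<^sub>K q^j + O(1)\<close>, so the equivalence follows once \<open>M k = o(q^k)\<close>.

  For the latter, fix \<open>d\<close>. Divisors without prime factors of degree at most \<open>d\<close> contribute at most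
  a constant times \<open>q^k\<close> times the product of \<open>1 - q^(- deg P)\<close> over \<open>deg P \<le> d\<close>, which tends to \<open>0\<close>
  as \<open>d\<close> grows. For each of the finitely many other values of \<open>P\<^sub>m\<^sub>i\<^sub>n\<close> the Moebius sum saves a
  power of \<open>q\<close>, because the zeta function has no zeros on the boundary circle of its disc of
  convergence; this follows from the positivity of \<open>Z(v)\<^sup>2 Z(\<omega> v) Z(\<omega>\<^sup>-\<^sup>1 v)\<close>.
\<close>

subsection \<open>Power saving for the coefficients of the reciprocal zeta function\<close>

text \<open>The finiteness theorems rest on one counting argument. If a subring V of
  \<open>K\<close> contains N elements that are pairwise incongruent modulo w, then the base-w
  expansions with n such digits are N^n distinct elements; after clearing denominators they lie in a
  set of at most B^(c n + m) elements, where c depends only on \<open>K\<close> and w. Hence N <=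
  B^c. For suitable V and w this yields discreteness of valuations, finite residue fields and
  finitely many zeros. Run inside Riemann-Roch spaces of multiples of a pole divisor, the same
  expansions bound zeros by poles and start Riemann's inequality.

  Two features shape the analytic part. The degrees of divisors are the multiples of
  \<open>degree_gcd\<close>, so the power series live in the variable v =
  x^\<open>degree_gcd\<close>. And the count of effective divisors is a geometric main term plus a
  bounded remainder: convolution of M with the main term gives c_K q^n times the partial sums of the
  series in the theorem, while convolution with the remainder is q^n times a geometric average of M
  k / q^k.\<close>

definition geom_fps :: "complex \<Rightarrow> complex fps" where
  "geom_fps \<alpha> = Abs_fps (\<lambda>n. \<alpha> ^ n)"

definition lin_fps :: "complex \<Rightarrow> complex fps" where
  "lin_fps \<alpha> = 1 - fps_const \<alpha> * fps_X"

definition scale_fps :: "complex \<Rightarrow> complex fps \<Rightarrow> complex fps" where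
  "scale_fps \<omega> f = Abs_fps (\<lambda>n. fps_nth f n * \<omega> ^ n)"

text \<open>The operator v d/dv. Unlike the plain derivative it commutes with
  \<open>scale_fps\<close>, so one logarithmic derivative serves all twisted copies of the zeta
  series.\<close>

definition euler_fps :: "complex fps \<Rightarrow> complex fps" where
  "euler_fps f = fps_X * fps_deriv f"

lemma lin_mult_nth: "fps_nth (f * lin_fps \<alpha>) n = fps_nth f n - (if n = 0 then 0 else \<alpha> * fps_nth f (n - 1))"
proof -
  have "f * lin_fps \<alpha> = f - fps_const \<alpha> * (f * fps_X)"
    unfolding lin_fps_def by (simp add: right_diff_distrib mult.left_commute)
  then show ?thesis by (simp add: fps_X_mult_right_nth)
qed

lemma geom_lin: "geom_fps \<alpha> * lin_fps \<alpha> = 1"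
  by (rule fps_ext) (auto simp: lin_mult_nth geom_fps_def power_eq_if)

lemma scale_fps_mult: "scale_fps \<omega> (f * g) = scale_fps \<omega> f * scale_fps \<omega> g"
proof (rule fps_ext)
  fix n
  have "fps_nth (scale_fps \<omega> f * scale_fps \<omega> g) n
      = (\<Sum>i=0..n. fps_nth f i * fps_nth g (n - i) * (\<omega> ^ i * \<omega> ^ (n - i)))"
    unfolding fps_mult_nth scale_fps_def by (simp add: mult_ac)
  also have "\<dots> = (\<Sum>i=0..n. fps_nth f i * fps_nth g (n - i) * \<omega> ^ n)"
    by (intro sum.cong refl) (simp add: power_add[symmetric])
  finally show "fps_nth (scale_fps \<omega> (f * g)) n = fps_nth (scale_fps \<omega> f * scale_fps \<omega> g) n"
    unfolding scale_fps_def by (simp add: fps_mult_nth sum_distrib_right)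
qed

lemma scale_geom: "scale_fps \<omega> (geom_fps \<alpha>) = geom_fps (\<alpha> * \<omega>)"
  by (rule fps_ext) (simp add: scale_fps_def geom_fps_def power_mult_distrib)

lemma euler_nth: "fps_nth (euler_fps f) n = of_nat n * fps_nth f n"
  unfolding euler_fps_def by (cases n) auto

lemma euler_mult: "euler_fps (f * g) = euler_fps f * g + f * euler_fps g"
  unfolding euler_fps_def by (simp add: algebra_simps)

lemma euler_scale: "euler_fps (scale_fps \<omega> f) = scale_fps \<omega> (euler_fps f)"
  by (rule fps_ext) (simp add: euler_nth scale_fps_def)

lemma fps_conv_radius_finite_support:
  fixes f :: "complex fps"
  assumes "\<And>n. n \<ge> M \<Longrightarrow> fps_nth f n = 0"
  shows "fps_conv_radius f = \<infinity>"
proof -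
  have "eventually (\<lambda>n. fps_nth f n = 0) sequentially"
    using assms unfolding eventually_sequentially by blast
  then have "conv_radius (fps_nth f) = conv_radius (\<lambda>_. 0 :: complex)"
    by (intro conv_radius_cong) auto
  then show ?thesis unfolding fps_conv_radius_def by simp
qed

lemma fps_conv_radius_bound:
  fixes f :: "complex fps"
  assumes "\<And>n. norm (fps_nth f n) \<le> C * R ^ n" "R > 0"
  shows "fps_conv_radius f \<ge> ereal (1 / R)"
  unfolding fps_conv_radius_def
proof (rule conv_radius_geI_ex')
  fix r assume r: "0 < r" "ereal r < ereal (1 / R)"
  then have rR: "r * R < 1" using assms(2) by (simp add: field_simps)
  have S: "summable (\<lambda>n. C * (r * R) ^ n)"
    using rR r assms(2) by (intro summable_mult summable_geometric) auto
  have N: "norm (fps_nth f n * of_real r ^ n) \<le> C * (r * R) ^ n" for n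
  proof -
    have "norm (fps_nth f n * of_real r ^ n) = norm (fps_nth f n) * r ^ n"
      using r by (simp add: norm_mult norm_power)
    also have "\<dots> \<le> C * R ^ n * r ^ n" using assms(1) r by (intro mult_right_mono) auto
    also have "\<dots> = C * (r * R) ^ n" unfolding power_mult_distrib by simp
    finally show ?thesis .
  qed
  show "summable (\<lambda>n. fps_nth f n * of_real r ^ n)"
    by (rule summable_comparison_test'[OF S, of 0]) (rule N)
qed

text \<open>A Cauchy estimate: at a point inside the disc of convergence the terms of the series
  tend to zero, so they are bounded.\<close>

lemma fps_nth_bound:
  fixes f :: "complex fps"
  assumes "ereal (1 / R) < fps_conv_radius f" "R > 0"
  shows "\<exists>C\<ge>0. \<forall>n. norm (fps_nth f n) \<le> C * R ^ n"
proof -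
  have "summable (\<lambda>n. fps_nth f n * of_real (1 / R) ^ n)"
    using assms by (intro summable_fps) (auto simp: norm_divide)
  then have "Bseq (\<lambda>n. fps_nth f n * of_real (1 / R) ^ n)"
    using summable_LIMSEQ_zero convergent_imp_Bseq convergentI by blast
  then obtain C where C: "C > 0" "\<And>n. norm (fps_nth f n * of_real (1 / R) ^ n) \<le> C"
    by (auto elim!: BseqE)
  have "norm (fps_nth f n) \<le> C * R ^ n" for n
    using C(2)[of n] assms(2) by (simp add: norm_mult norm_power norm_divide power_one_over field_simps)
  then show ?thesis using C(1) by (intro exI[of _ C]) auto
qed

lemma geom_conv_radius: "norm \<alpha> \<le> 1 \<Longrightarrow> fps_conv_radius (geom_fps \<alpha>) \<ge> 1"
proof -
  assume "norm \<alpha> \<le> 1"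
  then have "norm (fps_nth (geom_fps \<alpha>) n) \<le> 1 * 1 ^ n" for n
    unfolding geom_fps_def by (simp add: norm_power power_le_one)
  from fps_conv_radius_bound[OF this] show ?thesis by (simp add: one_ereal_def)
qed

text \<open>Division of a polynomial by a linear factor, read off the coefficients: the nth
  coefficient of L / (1 - \<alpha> v) is \<alpha>^n times a partial sum of L(1/\<alpha>), and from M
  on that partial sum is the whole value, which is zero.\<close>

lemma finite_support_divide_root:
  assumes L: "\<And>n. n \<ge> M \<Longrightarrow> fps_nth L n = 0" and \<alpha>: "\<alpha> \<noteq> 0" and root: "eval_fps L (1 / \<alpha>) = 0"
    and n: "n \<ge> M"
  shows "fps_nth (L * geom_fps \<alpha>) n = 0"
proof -
  have "(\<lambda>k. fps_nth L k * (1 / \<alpha>) ^ k) sums (\<Sum>k\<in>{..n}. fps_nth L k * (1 / \<alpha>) ^ k)"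
    using L n by (intro sums_finite) auto
  then have "(\<Sum>k\<le>n. fps_nth L k * (1 / \<alpha>) ^ k) = 0"
    using root unfolding eval_fps_def by (simp add: sums_iff)
  moreover have "fps_nth (L * geom_fps \<alpha>) n = \<alpha> ^ n * (\<Sum>k\<le>n. fps_nth L k * (1 / \<alpha>) ^ k)"
    unfolding fps_mult_nth geom_fps_def sum_distrib_left atLeast0AtMost
    using \<alpha> by (intro sum.cong refl) (simp add: power_diff power_one_over field_simps)
  ultimately show ?thesis by simp
qed

text \<open>A logarithmic derivative with coefficients of size \<rho>^k forces growth at most
  (\<rho> s)^n for every s > 1. In the induction the convolution leaves a geometric sum of s^(-k),
  bounded by 1 / (s - 1), and the division by n beats the factor C / (s - 1) as soon as n exceeds
  N.\<close>

lemma recursion_growth: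
  fixes A :: "nat \<Rightarrow> real"
  assumes A: "\<And>n. 0 \<le> A n" and C: "0 \<le> C" and \<rho>: "1 \<le> \<rho>" and s: "1 < s"
    and rec: "\<And>n. real n * A n \<le> C * (\<Sum>k=1..n. \<rho> ^ k * A (n - k))"
  shows "\<exists>B. \<forall>n. A n \<le> B * (\<rho> * s) ^ n"
proof -
  obtain N :: nat where N: "C / (s - 1) < real N" using reals_Archimedean2 by blast
  define B where "B = (\<Sum>j\<le>N. A j)"
  have B: "0 \<le> B" unfolding B_def using A by (simp add: sum_nonneg)
  have \<sigma>: "1 \<le> \<rho> * s" using mult_mono[of 1 \<rho> 1 s] \<rho> s by simp
  have "A n \<le> B * (\<rho> * s) ^ n" for n
  proof (induction n rule: less_induct)
    case (less n)
    show ?case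
    proof (cases "n \<le> N")
      case True
      have "A n \<le> B" unfolding B_def using True A by (intro member_le_sum) auto
      also have "\<dots> \<le> B * (\<rho> * s) ^ n" using B \<sigma> by (simp add: mult_le_cancel_left1)
      finally show ?thesis .
    next
      case False
      have "real n * A n \<le> C * (\<Sum>k=1..n. \<rho> ^ k * A (n - k))" by (rule rec)
      also have "\<dots> \<le> C * (\<Sum>k=1..n. \<rho> ^ k * (B * (\<rho> * s) ^ (n - k)))"
        using less C \<rho> by (intro mult_left_mono sum_mono) auto
      also have "(\<Sum>k=1..n. \<rho> ^ k * (B * (\<rho> * s) ^ (n - k))) = B * (\<rho> * s) ^ n * (\<Sum>k=1..n. (1 / s) ^ k)"
        unfolding sum_distrib_left
      proof (intro sum.cong refl)
        fix k assume "k \<in> {1..n}"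
        then have "(\<rho> * s) ^ n = (\<rho> * s) ^ (n - k) * (\<rho> * s) ^ k" by (simp add: power_add[symmetric])
        then show "\<rho> ^ k * (B * (\<rho> * s) ^ (n - k)) = B * (\<rho> * s) ^ n * (1 / s) ^ k"
          using s by (simp add: power_mult_distrib power_one_over field_simps)
      qed
      also have "C * (B * (\<rho> * s) ^ n * (\<Sum>k=1..n. (1 / s) ^ k)) \<le> C * (B * (\<rho> * s) ^ n * (1 / (s - 1)))"
      proof -
        have "(\<Sum>k=1..n. (1 / s) ^ k) \<le> 1 / (s - 1)"
        proof -
          have "(s - 1) * (\<Sum>k=1..n. (1 / s) ^ k) = 1 - (1 / s) ^ n"
            using s by (induction n) (auto simp: field_simps)
          also have "\<dots> \<le> 1" using s by simp
          finally show ?thesis using s by (simp add: field_simps)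
        qed
        then show ?thesis using B C \<sigma> by (intro mult_left_mono) auto
      qed
      also have "\<dots> = (C / (s - 1)) * (B * (\<rho> * s) ^ n)" by simp
      also have "\<dots> \<le> real n * (B * (\<rho> * s) ^ n)" using N False B \<sigma> by (intro mult_right_mono) auto
      finally show ?thesis using False by simp
    qed
  qed
  then show ?thesis by blast
qed

lemma eventually_exceeds:
  fixes c1 c2 B Q \<sigma> :: real
  assumes "c1 > 0" "1 \<le> \<sigma>" "\<sigma> < Q" and le: "\<And>n. n \<ge> N \<Longrightarrow> c1 * Q ^ n - c2 \<le> B * \<sigma> ^ n"
  shows False
proof -
  define r where "r = Q / \<sigma>"
  have r: "1 < r" unfolding r_def using assms by simp
  obtain n where n: "(\<bar>B\<bar> + \<bar>c2\<bar>) / c1 < r ^ n" using real_arch_pow[OF r] by blast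
  define m where "m = max n N"
  have "r ^ n \<le> r ^ m" unfolding m_def using r by (intro power_increasing) auto
  then have "(\<bar>B\<bar> + \<bar>c2\<bar>) / c1 < r ^ m" using n by linarith
  then have "\<bar>B\<bar> + \<bar>c2\<bar> < c1 * r ^ m" using assms(1) by (simp add: field_simps)
  then have "(\<bar>B\<bar> + \<bar>c2\<bar>) * \<sigma> ^ m < c1 * r ^ m * \<sigma> ^ m" using assms(2) by (intro mult_strict_right_mono) auto
  also have "c1 * r ^ m * \<sigma> ^ m = c1 * Q ^ m" unfolding r_def using assms(2) by (simp add: power_divide)
  also have "\<dots> \<le> B * \<sigma> ^ m + c2" using le[of m] unfolding m_def by simp
  also have "\<dots> \<le> \<bar>B\<bar> * \<sigma> ^ m + \<bar>c2\<bar> * \<sigma> ^ m"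
  proof (rule add_mono)
    show "B * \<sigma> ^ m \<le> \<bar>B\<bar> * \<sigma> ^ m" using assms(2) by (intro mult_right_mono) auto
    have "\<bar>c2\<bar> * 1 \<le> \<bar>c2\<bar> * \<sigma> ^ m" using assms(2) by (intro mult_left_mono) auto
    then show "c2 \<le> \<bar>c2\<bar> * \<sigma> ^ m" by linarith
  qed
  finally show False by (simp add: distrib_right)
qed

text \<open>A zeta series Z in the variable v. In the application \<open>A\<close> counts effective
  divisors, \<open>b\<close> sums the Moebius function and \<open>\<Lambda>\<close> is a von
  Mangoldt function, so \<open>inversion\<close> says that \<open>b\<close> has the generating
  series 1/Z, and \<open>log_derivative\<close> is v Z' = \<Lambda> Z coefficientwise. The exact
  formula \<open>A_eq\<close> encodes the poles at 1 and 1/Q. The inequality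
  \<open>\<Lambda>_double\<close> reflects that a degree dividing k also divides 2k.\<close>

locale zeta_coefficients =
  fixes A b \<Lambda> :: "nat \<Rightarrow> real" and Q c1 c2 :: real and m0 :: nat
  assumes Q: "1 < Q" and c1: "0 < c1" and A_0: "A 0 = 1"
    and inversion: "\<And>n. (\<Sum>k\<le>n. A k * b (n - k)) = (if n = 0 then 1 else 0)"
    and log_derivative: "\<And>n. real n * A n = (\<Sum>k=1..n. \<Lambda> k * A (n - k))"
    and \<Lambda>_nonneg: "\<And>k. 0 \<le> \<Lambda> k" and \<Lambda>_double: "\<And>k. \<Lambda> k \<le> \<Lambda> (2 * k)"
    and b_le: "\<And>n. \<bar>b n\<bar> \<le> A n" and A_eq: "\<And>n. n \<ge> m0 \<Longrightarrow> A n = c1 * Q ^ n - c2"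
begin

lemma A_nonneg: "0 \<le> A n"
  using b_le[of n] by linarith

definition zeta :: "complex fps" where "zeta = Abs_fps (\<lambda>n. of_real (A n))"

definition moeb :: "complex fps" where "moeb = Abs_fps (\<lambda>n. of_real (b n))"

text \<open>The L-polynomial: Z(v) = L(v) / ((1 - v) (1 - Q v)).\<close>

definition lpoly :: "complex fps" where "lpoly = zeta * lin_fps 1 * lin_fps (of_real Q)"

lemma zeta_moeb: "zeta * moeb = 1"
proof (rule fps_ext)
  fix n
  have "fps_nth (zeta * moeb) n = of_real (\<Sum>k\<le>n. A k * b (n - k))"
    unfolding zeta_def moeb_def by (simp add: fps_mult_nth atLeast0AtMost)
  then show "fps_nth (zeta * moeb) n = fps_nth 1 n" unfolding inversion by simp
qed

text \<open>The recurrence with characteristic roots 1 and Q annihilates c1 Q^n - c2. It reaches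
  back two places, whence the offset 2.\<close>

lemma lpoly_finite: "n \<ge> m0 + 2 \<Longrightarrow> fps_nth lpoly n = 0"
proof -
  assume n: "n \<ge> m0 + 2"
  then obtain k where k: "n = Suc (Suc k)" "k \<ge> m0" by (metis add_2_eq_Suc' less_eqE add.commute add.assoc le_add1)
  have "fps_nth lpoly n = of_real (A n - (1 + Q) * A (Suc k) + Q * A k)"
    unfolding lpoly_def lin_mult_nth k by (simp add: zeta_def algebra_simps)
  also have "A n - (1 + Q) * A (Suc k) + Q * A k = 0"
  proof -
    have "A n = c1 * (Q * (Q * Q ^ k)) - c2" "A (Suc k) = c1 * (Q * Q ^ k) - c2" "A k = c1 * Q ^ k - c2"
      using A_eq[of n] A_eq[of "Suc k"] A_eq[of k] k by auto
    then show ?thesis by (simp only:) (simp add: algebra_simps)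
  qed
  finally show ?thesis by simp
qed

lemma lpoly_conv: "fps_conv_radius lpoly = \<infinity>"
  using lpoly_finite by (rule fps_conv_radius_finite_support)

lemma zeta_eq: "zeta = lpoly * geom_fps 1 * geom_fps (of_real Q)"
proof -
  have "lpoly * geom_fps 1 * geom_fps (of_real Q)
      = zeta * (geom_fps 1 * lin_fps 1) * (geom_fps (of_real Q) * lin_fps (of_real Q))"
    unfolding lpoly_def by (simp add: mult_ac)
  then show ?thesis unfolding geom_lin by simp
qed

lemma lpoly_cnj: "cnj (fps_nth lpoly n) = fps_nth lpoly n"
  unfolding lpoly_def lin_mult_nth zeta_def by simp

lemma zeta_conv: "fps_conv_radius zeta \<ge> ereal (1 / Q)" and moeb_conv: "fps_conv_radius moeb \<ge> ereal (1 / Q)"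
proof -
  define C where "C = (\<Sum>j\<le>m0. A j) + c1 + \<bar>c2\<bar>"
  have bound: "A n \<le> C * Q ^ n" for n
  proof -
    have Qn: "1 \<le> Q ^ n" using Q by simp
    have sum0: "0 \<le> (\<Sum>j\<le>m0. A j)" using A_nonneg by (simp add: sum_nonneg)
    show ?thesis
    proof (cases "n \<le> m0")
      case True
      then have "A n \<le> (\<Sum>j\<le>m0. A j)" using A_nonneg by (intro member_le_sum) auto
      then have "A n \<le> C * 1" unfolding C_def using c1 by simp
      also have "\<dots> \<le> C * Q ^ n" unfolding C_def using Qn sum0 c1 by (intro mult_left_mono) auto
      finally show ?thesis .
    next
      case False
      then have "A n = c1 * Q ^ n - c2" using A_eq by simp
      also have "\<dots> \<le> c1 * Q ^ n + \<bar>c2\<bar> * Q ^ n"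
        using mult_left_mono[OF Qn, of "\<bar>c2\<bar>"] by linarith
      also have "\<dots> = (c1 + \<bar>c2\<bar>) * Q ^ n" by (simp add: distrib_right)
      also have "\<dots> \<le> C * Q ^ n" unfolding C_def using sum0 Q by (intro mult_right_mono) auto
      finally show ?thesis .
    qed
  qed
  have n: "norm (fps_nth zeta n) \<le> C * Q ^ n" "norm (fps_nth moeb n) \<le> C * Q ^ n" for n
    unfolding zeta_def moeb_def using bound[of n] b_le[of n] A_nonneg[of n] by auto
  show "fps_conv_radius zeta \<ge> ereal (1 / Q)" by (rule fps_conv_radius_bound[OF n(1)]) (use Q in simp)
  show "fps_conv_radius moeb \<ge> ereal (1 / Q)" by (rule fps_conv_radius_bound[OF n(2)]) (use Q in simp)
qed

text \<open>If \<open>1/(Q \<omega>)\<close> were a zero, all poles of \<open>Z(v)\<^sup>2 Z(\<omega> v) Z(\<omega>\<^sup>-\<^sup>1 v)\<close> in the open unit disc would cancel;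
  its non-negative coefficients would then grow too slowly for \<open>\<Lambda>\<close>.\<close>

lemma no_zero_on_circle:
  assumes \<omega>: "norm \<omega> = 1" and zero: "eval_fps lpoly (1 / (of_real Q * \<omega>)) = 0"
  shows False
proof -
  define \<alpha> where "\<alpha> = of_real Q * \<omega>"
  have \<omega>0: "\<omega> \<noteq> 0" using \<omega> by auto
  have \<alpha>0: "\<alpha> \<noteq> 0" unfolding \<alpha>_def using Q \<omega>0 by simp
  have oo: "\<omega> * cnj \<omega> = 1" using \<omega> by (simp add: complex_norm_square[symmetric])
  \<comment> \<open>\<open>L1\<close> and \<open>L2\<close> are the L-polynomial with the linear
    factor of the assumed zero 1/\<alpha>, respectively of its conjugate, divided out. The conjugate
    is a zero as well because the coefficients are real.\<close>
  define L1 where "L1 = lpoly * geom_fps \<alpha>"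
  define L2 where "L2 = lpoly * geom_fps (cnj \<alpha>)"
  have L1: "fps_nth L1 n = 0" if "n \<ge> m0 + 2" for n
    unfolding L1_def using finite_support_divide_root[OF lpoly_finite \<alpha>0 _ that] zero unfolding \<alpha>_def by simp
  have "fps_nth L2 n = cnj (fps_nth L1 n)" for n
    unfolding L1_def L2_def fps_mult_nth geom_fps_def by (simp add: lpoly_cnj)
  then have L2: "fps_nth L2 n = 0" if "n \<ge> m0 + 2" for n using L1[OF that] by simp
  define G where "G = geom_fps"
  define F where "F = zeta * zeta * scale_fps \<omega> zeta * scale_fps (cnj \<omega>) zeta"
  have s1: "scale_fps \<omega> zeta = scale_fps \<omega> lpoly * G \<omega> * G \<alpha>"
    unfolding zeta_eq scale_fps_mult scale_geom G_def \<alpha>_def by simp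
  have s2: "scale_fps (cnj \<omega>) zeta = scale_fps (cnj \<omega>) lpoly * G (cnj \<omega>) * G (cnj \<alpha>)"
    unfolding zeta_eq scale_fps_mult scale_geom G_def \<alpha>_def by simp
  have t1: "scale_fps \<omega> L2 = scale_fps \<omega> lpoly * G (of_real Q)"
  proof -
    have "cnj \<alpha> * \<omega> = of_real Q" unfolding \<alpha>_def using oo by (simp add: mult_ac)
    then show ?thesis unfolding L2_def scale_fps_mult scale_geom G_def by simp
  qed
  have t2: "scale_fps (cnj \<omega>) L1 = scale_fps (cnj \<omega>) lpoly * G (of_real Q)"
  proof -
    have "\<alpha> * cnj \<omega> = of_real Q" unfolding \<alpha>_def using oo by (simp add: mult_ac)
    then show ?thesis unfolding L1_def scale_fps_mult scale_geom G_def by simp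
  qed
  \<comment> \<open>The double pole of Z(v)^2 at 1/Q is cancelled by the zeros of the two twisted
    L-polynomials, and the poles of the twisted factors at 1/\<alpha> and its conjugate by the zeros
    of the two untwisted ones. Only poles on the unit circle are left.\<close>
  have F_eq: "F = L1 * L2 * scale_fps \<omega> L2 * scale_fps (cnj \<omega>) L1 * (G 1 * G 1 * G \<omega> * G (cnj \<omega>))"
  proof -
    have "F = (lpoly * G 1 * G (of_real Q)) * (lpoly * G 1 * G (of_real Q))
        * (scale_fps \<omega> lpoly * G \<omega> * G \<alpha>) * (scale_fps (cnj \<omega>) lpoly * G (cnj \<omega>) * G (cnj \<alpha>))"
      unfolding F_def s1 s2 unfolding zeta_eq G_def ..
    also have "\<dots> = (lpoly * G \<alpha>) * (lpoly * G (cnj \<alpha>)) * (scale_fps \<omega> lpoly * G (of_real Q))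
        * (scale_fps (cnj \<omega>) lpoly * G (of_real Q)) * (G 1 * G 1 * G \<omega> * G (cnj \<omega>))"
      by (simp only: mult_ac)
    finally show ?thesis unfolding L1_def L2_def t1[unfolded L2_def] t2[unfolded L1_def] G_def .
  qed
  have "fps_conv_radius F \<ge> 1"
  proof -
    have mult: "fps_conv_radius (f * g) \<ge> 1" if "fps_conv_radius f \<ge> 1" "fps_conv_radius g \<ge> 1" for f g :: "complex fps"
      using fps_conv_radius_mult[of f g] that by (meson min.boundedI order_trans)
    have fin: "fps_conv_radius f \<ge> 1" if "\<And>n. n \<ge> m0 + 2 \<Longrightarrow> fps_nth f n = 0" for f :: "complex fps"
      using fps_conv_radius_finite_support[OF that] by simp
    show ?thesis
      unfolding F_eq G_def using L1 L2 \<omega>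
      by (intro mult fin geom_conv_radius) (auto simp: scale_fps_def)
  qed
  define Lam where "Lam = Abs_fps (\<lambda>k. if k = 0 then 0 else of_real (\<Lambda> k) :: complex)"
  have eZ: "euler_fps zeta = Lam * zeta"
  proof (rule fps_ext)
    fix n
    have "fps_nth (Lam * zeta) n = (\<Sum>k=0..n. if k = 0 then 0 else of_real (\<Lambda> k * A (n - k)))"
      unfolding fps_mult_nth Lam_def zeta_def by (intro sum.cong) auto
    also have "\<dots> = of_real (\<Sum>k=1..n. \<Lambda> k * A (n - k))"
      by (simp add: sum.atLeast_Suc_atMost)
    finally show "fps_nth (euler_fps zeta) n = fps_nth (Lam * zeta) n"
      unfolding euler_nth log_derivative[symmetric] by (simp add: zeta_def)
  qed
  define W where "W = Lam + Lam + scale_fps \<omega> Lam + scale_fps (cnj \<omega>) Lam"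
  have eF: "euler_fps F = W * F"
    unfolding F_def euler_mult euler_scale eZ scale_fps_mult W_def by (simp add: algebra_simps)
  define x where "x k = Re (\<omega> ^ k)" for k :: nat
  \<comment> \<open>Since |\<omega>| = 1, this is |1 + \<omega>^k|^2, the weight with which
    \<open>\<Lambda>\<close> enters the logarithmic derivative of \<open>F\<close>. As it is
    nonnegative, the recursion gives \<open>F\<close> nonnegative coefficients.\<close>
  define m where "m k = 2 + 2 * x k" for k
  have x_abs: "\<bar>x k\<bar> \<le> 1" for k
    using abs_Re_le_cmod[of "\<omega> ^ k"] \<omega> unfolding x_def by (simp add: norm_power)
  have m0: "0 \<le> m k" for k unfolding m_def using x_abs[of k] by linarith
  have W_nth: "fps_nth W k = of_real (if k = 0 then 0 else \<Lambda> k * m k)" for k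
  proof -
    have "\<omega> ^ k + cnj \<omega> ^ k = of_real (2 * x k)"
      unfolding x_def using complex_add_cnj[of "\<omega> ^ k"] by simp
    then have "of_real (\<Lambda> k) * (2 + (\<omega> ^ k + cnj \<omega> ^ k)) = of_real (\<Lambda> k * m k)"
      unfolding m_def by (simp only: of_real_mult of_real_add of_real_numeral)
    then show ?thesis unfolding W_def Lam_def scale_fps_def by (simp add: algebra_simps)
  qed
  have F0: "fps_nth F 0 = 1" unfolding F_def zeta_def scale_fps_def using A_0 by simp
  have rec: "of_nat n * fps_nth F n = (\<Sum>k=1..n. of_real (\<Lambda> k * m k) * fps_nth F (n - k))" for n
  proof -
    have "of_nat n * fps_nth F n = fps_nth (W * F) n" using euler_nth[of F n] eF by simp
    also have "\<dots> = (\<Sum>k=1..n. of_real (\<Lambda> k * m k) * fps_nth F (n - k))"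
      unfolding fps_mult_nth W_nth by (simp add: sum.atLeast_Suc_atMost)
    finally show ?thesis .
  qed
  have real: "fps_nth F n \<in> \<real> \<and> 0 \<le> Re (fps_nth F n)" for n
  proof (induction n rule: less_induct)
    case (less n)
    show ?case
    proof (cases "n = 0")
      case True
      then show ?thesis using F0 by simp
    next
      case False
      define S where "S = (\<Sum>k=1..n. of_real (\<Lambda> k * m k) * fps_nth F (n - k))"
      have "S \<in> \<real>" unfolding S_def using less by (intro sum_in_Reals Reals_mult Reals_of_real) auto
      moreover have "0 \<le> Re S"
        unfolding S_def Re_sum using less \<Lambda>_nonneg m0 by (intro sum_nonneg) auto
      moreover have "fps_nth F n = S / of_nat n" using rec[of n] False unfolding S_def by (simp add: field_simps)
      ultimately show ?thesis by (auto simp: Re_divide_of_nat intro!: Reals_divide)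
    qed
  qed
  define f where "f n = Re (fps_nth F n)" for n
  \<comment> \<open>Only the term k = n of the recursion is kept. It carries the constant
    coefficient 1 of \<open>F\<close>, and the other terms are nonnegative.\<close>
  have f_le: "\<Lambda> n * m n \<le> real n * f n" if "n \<ge> 1" for n
  proof -
    have "real n * f n = Re (of_nat n * fps_nth F n)" unfolding f_def by simp
    also have "\<dots> = (\<Sum>k=1..n. \<Lambda> k * m k * f (n - k))" unfolding rec Re_sum f_def by simp
    also have "\<dots> \<ge> \<Lambda> n * m n * f (n - n)"
      using that \<Lambda>_nonneg m0 real unfolding f_def
      by (intro member_le_sum[of n "{1..n}" "\<lambda>k. \<Lambda> k * m k * Re (fps_nth F (n - k))"]) auto
    finally show ?thesis using F0 unfolding f_def by simp
  qed
  \<comment> \<open>The budget of exponents: the coefficients of \<open>F\<close> cost s^2 per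
    degree, hence s^4 at degree 2k; a linear factor k costs another s;
    \<open>recursion_growth\<close> costs one more. The total s^6 stays below Q = s^8.\<close>
  define s where "s = root 8 Q"
  have s: "1 < s" "s ^ 8 = Q" unfolding s_def using Q by auto
  have "ereal (1 / s\<^sup>2) < 1" using s by (simp add: one_ereal_def)
  then have "ereal (1 / s\<^sup>2) < fps_conv_radius F" using \<open>fps_conv_radius F \<ge> 1\<close> less_le_trans by blast
  then obtain C where C: "C \<ge> 0" "\<And>n. norm (fps_nth F n) \<le> C * (s\<^sup>2) ^ n"
    using fps_nth_bound[of "s\<^sup>2" F] s by auto
  have fC: "f n \<le> C * s ^ (2 * n)" for n
    unfolding f_def power_mult using C(2)[of n] complex_Re_le_cmod[of "fps_nth F n"] by linarith
  define C' where "C' = 3 * C / (s - 1)"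
  have C': "C' \<ge> 0" unfolding C'_def using C s by simp
  \<comment> \<open>The weight \<open>m k\<close> may vanish, but \<open>m k\<close> and
    \<open>m (2 * k)\<close> are never small together: with x = Re(\<omega>^k) their sum is 4 x^2 +
    2 x + 2, which exceeds 1. By \<open>\<Lambda>_double\<close> the value at k is therefore
    controlled by the coefficients of \<open>F\<close> at k and 2k.\<close>
  have \<Lambda>_le: "\<Lambda> k \<le> C' * (s ^ 5) ^ k" if "k \<ge> 1" for k
  proof -
    have "Re (\<omega> ^ (2 * k)) = 2 * (x k)\<^sup>2 - 1"
    proof -
      have "(cmod (\<omega> ^ k))\<^sup>2 = (Re (\<omega> ^ k))\<^sup>2 + (Im (\<omega> ^ k))\<^sup>2" by (rule cmod_power2)
      then have "(Im (\<omega> ^ k))\<^sup>2 = 1 - (x k)\<^sup>2" using \<omega> unfolding x_def by (simp add: norm_power)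
      moreover have "\<omega> ^ (2 * k) = \<omega> ^ k * \<omega> ^ k" by (simp add: power_add[symmetric] mult_2)
      then have "Re (\<omega> ^ (2 * k)) = (Re (\<omega> ^ k))\<^sup>2 - (Im (\<omega> ^ k))\<^sup>2" by (simp add: power2_eq_square)
      ultimately show ?thesis unfolding x_def by simp
    qed
    then have "m k + m (2 * k) = 2 + 2 * x k + 4 * (x k)\<^sup>2" unfolding m_def x_def by simp
    also have "\<dots> = (2 * x k + 1 / 2)\<^sup>2 + 7 / 4" by (simp add: power2_eq_square algebra_simps)
    also have "\<dots> \<ge> 1" using zero_le_power2[of "2 * x k + 1 / 2"] by linarith
    finally have "\<Lambda> k * 1 \<le> \<Lambda> k * (m k + m (2 * k))" using \<Lambda>_nonneg by (intro mult_left_mono) auto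
    also have "\<dots> \<le> \<Lambda> k * m k + \<Lambda> (2 * k) * m (2 * k)"
      unfolding distrib_left using \<Lambda>_double m0 by (intro add_left_mono mult_right_mono) auto
    also have "\<dots> \<le> real k * f k + real (2 * k) * f (2 * k)"
      using f_le[of k] f_le[of "2 * k"] that by (intro add_mono) auto
    also have "\<dots> \<le> real k * (C * s ^ (4 * k)) + real (2 * k) * (C * s ^ (4 * k))"
    proof (intro add_mono mult_left_mono)
      have "C * s ^ (2 * k) \<le> C * s ^ (4 * k)" using C s by (intro mult_left_mono power_increasing) auto
      then show "f k \<le> C * s ^ (4 * k)" using fC[of k] by linarith
      show "f (2 * k) \<le> C * s ^ (4 * k)" using fC[of "2 * k"] by simp
    qed auto
    also have "\<dots> = 3 * C * (real k * s ^ (4 * k))" by simp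
    also have "\<dots> \<le> 3 * C * (s ^ k / (s - 1) * s ^ (4 * k))"
    proof (intro mult_left_mono mult_right_mono)
      have "1 + real k * (s - 1) \<le> (1 + (s - 1)) ^ k" using s by (intro Bernoulli_inequality) auto
      then have "real k * (s - 1) \<le> s ^ k" by simp
      then show "real k \<le> s ^ k / (s - 1)" using s by (simp add: field_simps)
    qed (use C s in auto)
    also have "\<dots> = C' * (s ^ 5) ^ k" unfolding C'_def by (simp add: power_add[symmetric] power_mult[symmetric])
    finally show ?thesis by simp
  qed
  have "\<exists>B. \<forall>n. A n \<le> B * (s ^ 5 * s) ^ n"
  proof (rule recursion_growth[OF A_nonneg C' _ s(1)])
    show "1 \<le> s ^ 5" using s by simp
    fix n
    have "real n * A n \<le> (\<Sum>k=1..n. C' * (s ^ 5) ^ k * A (n - k))"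
      unfolding log_derivative using \<Lambda>_le A_nonneg by (intro sum_mono mult_right_mono) auto
    then show "real n * A n \<le> C' * (\<Sum>k=1..n. (s ^ 5) ^ k * A (n - k))"
      by (simp add: sum_distrib_left mult.assoc)
  qed
  then obtain B where B: "\<And>n. A n \<le> B * (s ^ 6) ^ n" by (auto simp: power_Suc2[symmetric])
  have "s ^ 6 < Q" unfolding s(2)[symmetric] using s(1) by (intro power_strict_increasing) auto
  then show False
    using eventually_exceeds[of c1 "s ^ 6" Q "m0" c2 B] c1 s(1) B A_eq by (metis less_imp_le one_le_power)
qed

text \<open>The series of \<open>b\<close> is (1 - v)(1 - Q v) / L(v), so its radius of convergence
  is governed by the zeros of L. There are none inside the disc of radius 1/Q, where Z and its
  inverse both converge, and none on its boundary by \<open>no_zero_on_circle\<close>. A closed zero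
  set disjoint from a compact disc keeps a positive distance from it, so the radius is larger than
  1/Q.\<close>

theorem moeb_power_saving: "\<exists>r C. 1 < r \<and> r < Q \<and> 0 \<le> C \<and> (\<forall>n. \<bar>b n\<bar> \<le> C * r ^ n)"
proof -
  have nz: "eval_fps lpoly v \<noteq> 0" if v: "norm v \<le> 1 / Q" for v
  proof (cases "norm v < 1 / Q")
    case True
    have r: "ereal (norm v) < fps_conv_radius zeta" "ereal (norm v) < fps_conv_radius moeb"
    proof -
      have "ereal (norm v) < ereal (1 / Q)" using True by simp
      then show "ereal (norm v) < fps_conv_radius zeta" "ereal (norm v) < fps_conv_radius moeb"
        using less_le_trans[OF _ zeta_conv] less_le_trans[OF _ moeb_conv] by blast+
    qed
    have "eval_fps zeta v * eval_fps moeb v = 1"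
      using eval_fps_mult[OF r] zeta_moeb by simp
    then have z: "eval_fps zeta v \<noteq> 0" by auto
    have Qv: "norm (of_real Q * v) < 1" using True Q by (simp add: norm_mult field_simps)
    have "1 / Q < 1" using Q by simp
    then have v1: "norm v < 1" using True by linarith
    have lin: "eval_fps (lin_fps \<beta>) v = 1 - \<beta> * v" "fps_conv_radius (lin_fps \<beta>) = \<infinity>" for \<beta>
    proof -
      have nth: "fps_nth (lin_fps \<beta>) n = (if n = 0 then 1 else if n = 1 then - \<beta> else 0)" for n
        unfolding lin_fps_def by (auto simp: fps_X_def)
      show "fps_conv_radius (lin_fps \<beta>) = \<infinity>" by (rule fps_conv_radius_finite_support[of 2]) (simp add: nth)
      have "(\<lambda>n. fps_nth (lin_fps \<beta>) n * v ^ n) sums (\<Sum>n\<in>{0, 1}. fps_nth (lin_fps \<beta>) n * v ^ n)"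
        by (rule sums_finite) (auto simp: nth)
      then show "eval_fps (lin_fps \<beta>) v = 1 - \<beta> * v" unfolding eval_fps_def by (simp add: sums_iff nth)
    qed
    have zl: "ereal (norm v) < fps_conv_radius (zeta * lin_fps 1)"
      using fps_conv_radius_mult[of zeta "lin_fps 1"] r(1) lin(2) by (auto intro: less_le_trans)
    have "eval_fps lpoly v = eval_fps zeta v * (1 - v) * (1 - of_real Q * v)"
      unfolding lpoly_def using eval_fps_mult[OF zl] eval_fps_mult[OF r(1)] lin by simp
    moreover have "1 - v \<noteq> 0" "1 - of_real Q * v \<noteq> 0" using v1 Qv by auto
    ultimately show ?thesis using z by simp
  next
    case False
    then have nv: "norm v = 1 / Q" using v by simp
    then have v0: "v \<noteq> 0" using Q by auto
    define \<omega> where "\<omega> = 1 / (of_real Q * v)"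
    have "norm \<omega> = 1" unfolding \<omega>_def using nv Q by (simp add: norm_divide norm_mult)
    moreover have "1 / (of_real Q * \<omega>) = v" unfolding \<omega>_def using Q v0 by simp
    ultimately show ?thesis using no_zero_on_circle by metis
  qed
  define Zs where "Zs = {v. eval_fps lpoly v = 0}"
  have cont: "continuous_on UNIV (eval_fps lpoly)"
    using continuous_on_eval_fps[of lpoly] lpoly_conv by simp
  have "closed Zs"
    unfolding Zs_def using continuous_closed_preimage_constant[OF cont closed_UNIV, of 0] by simp
  moreover have "cball 0 (1 / Q) \<inter> Zs = {}" unfolding Zs_def using nz by auto
  ultimately have "\<exists>d>0. \<forall>x\<in>cball 0 (1 / Q). \<forall>y\<in>Zs. d \<le> dist x y"
    by (intro separate_compact_closed compact_cball)
  then obtain d where d: "d > 0" "\<forall>x\<in>cball 0 (1 / Q). \<forall>y\<in>Zs. d \<le> dist x y" by blast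
  define \<rho> where "\<rho> = 1 / Q + d"
  have \<rho>: "1 / Q < \<rho>" "0 < \<rho>" unfolding \<rho>_def using d Q by (auto simp: add_pos_pos)
  have nz': "eval_fps lpoly v \<noteq> 0" if v: "ereal (norm v) < ereal \<rho>" for v
  proof
    assume z: "eval_fps lpoly v = 0"
    then have "\<not> norm v \<le> 1 / Q" using nz by blast
    then have nv: "1 / Q < norm v" "v \<noteq> 0" using Q by auto
    \<comment> \<open>The radial projection of the zero v onto the circle of radius 1/Q. Its
      distance from v is |v| - 1/Q, which is less than d.\<close>
    define u where "u = of_real (1 / (Q * norm v)) * v"
    have "norm u = 1 / Q" unfolding u_def using nv Q by (simp add: norm_mult norm_divide)
    then have "d \<le> dist u v" using d(2) z unfolding Zs_def by simp
    moreover have "dist u v = norm v - 1 / Q"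
    proof -
      have "u - v = of_real (1 / (Q * norm v) - 1) * v" unfolding u_def by (simp add: left_diff_distrib)
      then have "dist u v = \<bar>1 / (Q * norm v) - 1\<bar> * norm v" unfolding dist_norm by (simp add: norm_mult flip: of_real_diff)
      moreover have "1 / (Q * norm v) \<le> 1" using nv Q by (simp add: field_simps)
      ultimately show ?thesis using nv Q by (simp add: field_simps)
    qed
    ultimately show False using v unfolding \<rho>_def by simp
  qed
  have l0: "fps_nth lpoly 0 \<noteq> 0" using nz[of 0] Q by (simp add: eval_fps_at_0)
  have "lpoly * moeb = (zeta * moeb) * (lin_fps 1 * lin_fps (of_real Q))" unfolding lpoly_def by (simp add: mult_ac)
  then have lm: "lpoly * moeb = lin_fps 1 * lin_fps (of_real Q)" using zeta_moeb by simp
  have "moeb = inverse lpoly * (lpoly * moeb)" using inverse_mult_eq_1[OF l0] by (simp flip: mult.assoc)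
  also have "\<dots> = inverse lpoly * lin_fps 1 * lin_fps (of_real Q)" unfolding lm by (simp add: mult.assoc)
  finally have meq: "moeb = inverse lpoly * lin_fps 1 * lin_fps (of_real Q)" .
  have linr: "fps_conv_radius (lin_fps \<beta>) = \<infinity>" for \<beta>
    by (rule fps_conv_radius_finite_support[of 2]) (simp add: lin_fps_def fps_X_def)
  have "fps_conv_radius (inverse lpoly) \<ge> min (ereal \<rho>) \<infinity>"
    using fps_conv_radius_inverse[of "ereal \<rho>" lpoly] nz' lpoly_conv by simp
  then have "fps_conv_radius (inverse lpoly) \<ge> ereal \<rho>" by simp
  then have rm: "ereal \<rho> \<le> fps_conv_radius moeb"
  proof -
    have step: "ereal \<rho> \<le> fps_conv_radius (f * lin_fps \<beta>)" if "ereal \<rho> \<le> fps_conv_radius f" for f \<beta>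
      using fps_conv_radius_mult[of f "lin_fps \<beta>"] that linr[of \<beta>] by (simp add: min_def split: if_splits)
    show ?thesis unfolding meq by (intro step) fact
  qed
  \<comment> \<open>Besides 1/\<rho> < r < Q the condition r > 1 is kept: later this series is
    divided by factors whose zeros lie on the unit circle, and these must not affect the
    rate.\<close>
  obtain r where r: "max 1 (1 / \<rho>) < r" "r < Q"
  proof -
    have "max 1 (1 / \<rho>) < Q" using Q \<rho> by (simp add: field_simps)
    then show thesis using that dense by blast
  qed
  have "1 / r < \<rho>" using r \<rho> by (simp add: field_simps)
  then have "ereal (1 / r) < fps_conv_radius moeb"
    by (intro less_le_trans[OF _ rm]) simp
  moreover have "0 < r" using r(1) by linarith
  ultimately have "\<exists>C\<ge>0. \<forall>n. norm (fps_nth moeb n) \<le> C * r ^ n" by (rule fps_nth_bound)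
  then obtain C where C: "C \<ge> 0" "\<forall>n. norm (fps_nth moeb n) \<le> C * r ^ n" by blast
  have "\<bar>b n\<bar> \<le> C * r ^ n" for n using C(2)[rule_format, of n] unfolding moeb_def by simp
  moreover have "1 < r" using r(1) by simp
  ultimately show ?thesis using r(2) C(1) by blast
qed

end

subsection \<open>Digit sums and the finiteness of quotients of subrings\<close>

lemma (in domain) nat_pow_nonzero:
  "a \<in> carrier R \<Longrightarrow> a \<noteq> \<zero> \<Longrightarrow> a [^] (n :: nat) \<noteq> \<zero>"
  by (induction n) (auto dest: integral)

text \<open>Base-w expansions with n digits from E. With digits from a subring V the same sets
  consist of the polynomial expressions in w over V of degree below n. Both readings are
  used.\<close>

primrec (in ring) horner_sums :: "'a set \<Rightarrow> 'a \<Rightarrow> nat \<Rightarrow> 'a set" where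
  "horner_sums E w 0 = {\<zero>}"
| "horner_sums E w (Suc n) = (\<lambda>(e, y). e \<oplus> w \<otimes> y) ` (E \<times> horner_sums E w n)"

lemma (in ring) horner_sums_closed:
  assumes "E \<subseteq> carrier R" "w \<in> carrier R"
  shows "horner_sums E w n \<subseteq> carrier R"
  using assms by (induction n) auto

lemma (in ring) horner_sums_subring:
  assumes "subring V R" "E \<subseteq> V" "w \<in> V"
  shows "horner_sums E w n \<subseteq> V"
proof (induction n)
  case 0
  then show ?case using subringE(2)[OF assms(1)] by simp
next
  case (Suc n)
  then show ?case using assms subringE(6,7)[OF assms(1)] by (auto simp: subset_iff)
qed

text \<open>Expansions are unique: if two agree, their lowest digits are congruent modulo w inside
  V, hence equal, and then w can be cancelled in a domain.\<close>

lemma (in domain) card_horner_sums: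
  assumes V: "subring V R" and E: "E \<subseteq> V" and w: "w \<in> V" "w \<noteq> \<zero>" and fin: "finite E"
    and distinct: "\<And>e e' y. e \<in> E \<Longrightarrow> e' \<in> E \<Longrightarrow> y \<in> V \<Longrightarrow> e \<ominus> e' = w \<otimes> y \<Longrightarrow> e = e'"
  shows "finite (horner_sums E w n) \<and> card (horner_sums E w n) = card E ^ n"
proof (induction n)
  case 0
  then show ?case by simp
next
  case (Suc n)
  have sub: "horner_sums E w n \<subseteq> V"
    using horner_sums_subring[OF V E w(1)] .
  have VR: "V \<subseteq> carrier R" using subringE(1)[OF V] .
  have "inj_on (\<lambda>(e, y). e \<oplus> w \<otimes> y) (E \<times> horner_sums E w n)"
  proof (rule inj_onI, clarify)
    fix e y e' y'
    assume e: "e \<in> E" "e' \<in> E" and y: "y \<in> horner_sums E w n" "y' \<in> horner_sums E w n"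
      and eq: "e \<oplus> w \<otimes> y = e' \<oplus> w \<otimes> y'"
    have c: "e \<in> carrier R" "e' \<in> carrier R" "y \<in> carrier R" "y' \<in> carrier R" "w \<in> carrier R"
      using e y sub E VR w by auto
    have "e \<ominus> e' = (e \<oplus> w \<otimes> y) \<ominus> e' \<ominus> w \<otimes> y"
      using c by algebra
    also have "\<dots> = w \<otimes> (y' \<ominus> y)"
      unfolding eq using c by algebra
    finally have "e \<ominus> e' = w \<otimes> (y' \<ominus> y)" .
    moreover have "y' \<ominus> y \<in> V"
      using y sub subringE(5,7)[OF V] by (auto simp: a_minus_def subset_iff)
    ultimately have ee: "e = e'"
      using distinct e by blast
    then have "w \<otimes> y = w \<otimes> y'"
      using eq c add.l_cancel[of e' "w \<otimes> y" "w \<otimes> y'"] by auto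
    then have "y = y'"
      using w(2) c m_lcancel by auto
    then show "e = e' \<and> y = y'" using ee by simp
  qed
  then show ?case
    using Suc fin by (simp add: card_image card_cartesian_product)
qed

section \<open>Finite extensions of a rational function field, filtered by degree\<close>

locale filtered_span = field K for K :: "('a, 'b) ring_scheme" (structure) +
  fixes k0 :: "'a set" and x :: 'a
  assumes subfield_k0: "subfield k0 K" and finite_k0: "finite k0" and x_closed: "x \<in> carrier K"
begin

text \<open>Polynomials in \<open>x\<close> with n coefficients from \<open>k0\<close>, in Horner
  form; \<open>span_polys\<close> takes combinations of a list of generators with such coefficients.
  Bounding n makes both sets finite, with cardinality exponential in n.\<close>

primrec polys :: "nat \<Rightarrow> 'a set" where
  "polys 0 = {\<zero>}"
| "polys (Suc n) = (\<lambda>(c, a). c \<oplus> x \<otimes> a) ` (k0 \<times> polys n)"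

primrec span_polys :: "'a list \<Rightarrow> nat \<Rightarrow> 'a set" where
  "span_polys [] n = {\<zero>}"
| "span_polys (u # us) n = (\<lambda>(a, b). a \<otimes> u \<oplus> b) ` (polys n \<times> span_polys us n)"

lemma k0_closed: "c \<in> k0 \<Longrightarrow> c \<in> carrier K"
  and k0_zero: "\<zero> \<in> k0" and k0_one: "\<one> \<in> k0"
  and k0_add: "c \<in> k0 \<Longrightarrow> d \<in> k0 \<Longrightarrow> c \<oplus> d \<in> k0"
  and k0_mult: "c \<in> k0 \<Longrightarrow> d \<in> k0 \<Longrightarrow> c \<otimes> d \<in> k0"
  and k0_neg: "c \<in> k0 \<Longrightarrow> \<ominus> c \<in> k0"
  using subringE[OF subfieldE(1)[OF subfield_k0]] by auto

lemma polys_closed: "a \<in> polys n \<Longrightarrow> a \<in> carrier K"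
  by (induction n arbitrary: a) (use k0_closed x_closed in auto)

lemma polys_zero: "\<zero> \<in> polys n"
proof (induction n)
  case (Suc n)
  then have "\<zero> \<oplus> x \<otimes> \<zero> \<in> polys (Suc n)" using k0_zero by force
  then show ?case using x_closed by simp
qed simp

lemma polys_mono: "m \<le> n \<Longrightarrow> polys m \<subseteq> polys n"
proof (induction m arbitrary: n)
  case 0
  then show ?case using polys_zero by simp
next
  case (Suc m)
  then obtain n' where "n = Suc n'" "m \<le> n'" by (cases n) auto
  then show ?case using Suc.IH[of n'] by auto
qed

lemma polys_add: "a \<in> polys n \<Longrightarrow> b \<in> polys n \<Longrightarrow> a \<oplus> b \<in> polys n"
proof (induction n arbitrary: a b)
  case (Suc n)
  then obtain c a' d b' where a: "a = c \<oplus> x \<otimes> a'" "c \<in> k0" "a' \<in> polys n"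
    and b: "b = d \<oplus> x \<otimes> b'" "d \<in> k0" "b' \<in> polys n" by auto
  have "a \<oplus> b = (c \<oplus> d) \<oplus> x \<otimes> (a' \<oplus> b')"
    unfolding a(1) b(1) using k0_closed[OF a(2)] k0_closed[OF b(2)] polys_closed[OF a(3)]
      polys_closed[OF b(3)] x_closed by algebra
  then show ?case using a b Suc.IH k0_add by auto
qed simp

lemma polys_neg: "a \<in> polys n \<Longrightarrow> \<ominus> a \<in> polys n"
proof (induction n arbitrary: a)
  case (Suc n)
  then obtain c a' where a: "a = c \<oplus> x \<otimes> a'" "c \<in> k0" "a' \<in> polys n" by auto
  have "\<ominus> a = (\<ominus> c) \<oplus> x \<otimes> (\<ominus> a')"
    unfolding a(1) using k0_closed[OF a(2)] polys_closed[OF a(3)] x_closed by algebra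
  then show ?case using a Suc.IH k0_neg by auto
qed simp

lemma polys_smult: "c \<in> k0 \<Longrightarrow> a \<in> polys n \<Longrightarrow> c \<otimes> a \<in> polys n"
proof (induction n arbitrary: a)
  case 0
  then show ?case using k0_closed by simp
next
  case (Suc n)
  then obtain d a' where a: "a = d \<oplus> x \<otimes> a'" "d \<in> k0" "a' \<in> polys n" by auto
  have "c \<otimes> a = (c \<otimes> d) \<oplus> x \<otimes> (c \<otimes> a')"
    unfolding a(1) using k0_closed[OF a(2)] k0_closed[OF Suc.prems(1)] polys_closed[OF a(3)]
      x_closed by algebra
  then show ?case using a Suc k0_mult by auto
qed

lemma polys_times_x: "a \<in> polys n \<Longrightarrow> x \<otimes> a \<in> polys (Suc n)"
proof -
  assume a: "a \<in> polys n"
  then have "x \<otimes> a = \<zero> \<oplus> x \<otimes> a" using x_closed polys_closed by auto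
  then show "x \<otimes> a \<in> polys (Suc n)" using k0_zero a by force
qed

lemma polys_mult: "a \<in> polys m \<Longrightarrow> b \<in> polys n \<Longrightarrow> a \<otimes> b \<in> polys (m + n)"
proof (induction m arbitrary: a)
  case 0
  then show ?case using polys_closed polys_zero by auto
next
  case (Suc m)
  then obtain c a' where a: "a = c \<oplus> x \<otimes> a'" "c \<in> k0" "a' \<in> polys m" by auto
  have "a \<otimes> b = c \<otimes> b \<oplus> x \<otimes> (a' \<otimes> b)"
    unfolding a(1) using k0_closed[OF a(2)] polys_closed[OF Suc.prems(2)] polys_closed[OF a(3)]
      x_closed by algebra
  moreover have "c \<otimes> b \<in> polys (Suc m + n)"
    using polys_smult[OF a(2) Suc.prems(2)] polys_mono[of n "Suc m + n"] by auto
  moreover have "x \<otimes> (a' \<otimes> b) \<in> polys (Suc m + n)"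
    using polys_times_x[OF Suc.IH[OF a(3) Suc.prems(2)]] by simp
  ultimately show ?case using polys_add by metis
qed

lemma finite_polys: "finite (polys n)" and card_polys: "card (polys n) \<le> card k0 ^ n"
proof -
  have "finite (polys n) \<and> card (polys n) \<le> card k0 ^ n"
  proof (induction n)
    case (Suc n)
    have "card (polys (Suc n)) \<le> card (k0 \<times> polys n)"
      unfolding polys.simps using Suc finite_k0 by (intro card_image_le) simp
    also have "\<dots> \<le> card k0 * card k0 ^ n"
      using Suc by (simp add: card_cartesian_product)
    finally show ?case using Suc finite_k0 by simp
  qed simp
  then show "finite (polys n)" "card (polys n) \<le> card k0 ^ n" by auto
qed

definition poly_ring :: "'a set" where "poly_ring = (\<Union>n. polys n)"

lemma poly_ringE: assumes "a \<in> poly_ring" obtains n where "a \<in> polys n"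
  using assms unfolding poly_ring_def by auto

lemma poly_ringI: "a \<in> polys n \<Longrightarrow> a \<in> poly_ring"
  unfolding poly_ring_def by auto

lemma poly_ring_k0: "c \<in> k0 \<Longrightarrow> c \<in> polys 1"
proof -
  assume "c \<in> k0"
  then have "c = c \<oplus> x \<otimes> \<zero>" using x_closed k0_closed by simp
  then show "c \<in> polys 1" using \<open>c \<in> k0\<close> by force
qed

lemma x_in_polys: "x \<in> polys 2"
proof -
  have "x = x \<otimes> \<one>" using x_closed by simp
  then show ?thesis
    using polys_times_x[OF poly_ring_k0[OF k0_one]] by (simp add: numeral_2_eq_2)
qed

lemma subring_poly_ring: "subring poly_ring K"
proof (rule subringI)
  show "poly_ring \<subseteq> carrier K" using polys_closed poly_ring_def by auto
  show "\<one> \<in> poly_ring" using poly_ring_k0[OF k0_one] poly_ringI by blast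
next
  fix a b assume "a \<in> poly_ring" "b \<in> poly_ring"
  then obtain m n where mn: "a \<in> polys m" "b \<in> polys n" by (metis poly_ringE)
  show "\<ominus> a \<in> poly_ring" using polys_neg[OF mn(1)] poly_ringI by blast
  show "a \<otimes> b \<in> poly_ring" using polys_mult[OF mn] poly_ringI by blast
  have "a \<in> polys (m + n)" "b \<in> polys (m + n)"
    using mn polys_mono[of m "m + n"] polys_mono[of n "m + n"] by auto
  then show "a \<oplus> b \<in> poly_ring" using polys_add poly_ringI by blast
qed

text \<open>The elements that become polynomials after multiplication by some nonzero polynomial are
  closed under all field operations; for an inverse, the former numerator is the new
  denominator.\<close>

lemma generate_field_fractions:
  assumes "a \<in> generate_field K (insert x k0)"
  shows "\<exists>d \<in> poly_ring. d \<noteq> \<zero> \<and> d \<otimes> a \<in> poly_ring"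
  using assms
proof (induction rule: generate_field.induct)
  case one
  show ?case
    using subringE(3)[OF subring_poly_ring] by (intro bexI[of _ \<one>]) auto
next
  case (incl h)
  then have "h \<in> poly_ring"
    using x_in_polys poly_ring_k0 poly_ringI by blast
  then show ?case
    using subringE(1,3)[OF subring_poly_ring] by (intro bexI[of _ \<one>]) auto
next
  case (a_inv h)
  then obtain d where d: "d \<in> poly_ring" "d \<noteq> \<zero>" "d \<otimes> h \<in> poly_ring" by auto
  have "h \<in> carrier K"
    using a_inv.hyps generate_field_in_carrier[of "insert x k0"] k0_closed x_closed by blast
  then have "d \<otimes> (\<ominus> h) = \<ominus> (d \<otimes> h)"
    using d subringE(1)[OF subring_poly_ring] by (auto simp: r_minus)
  then show ?case using d subringE(5)[OF subring_poly_ring] by auto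
next
  case (m_inv h)
  then obtain d where d: "d \<in> poly_ring" "d \<noteq> \<zero>" "d \<otimes> h \<in> poly_ring" by auto
  have h: "h \<in> carrier K"
    using m_inv.hyps(1) generate_field_in_carrier[of "insert x k0"] k0_closed x_closed by blast
  have dc: "d \<in> carrier K" using d subringE(1)[OF subring_poly_ring] by auto
  have "h \<in> Units K" using h m_inv.hyps field_Units by simp
  then have "(d \<otimes> h) \<otimes> inv h = d"
    using h dc by (simp add: m_assoc)
  moreover have "d \<otimes> h \<noteq> \<zero>" using d(2) m_inv.hyps(2) h dc integral by blast
  ultimately show ?case using d by (intro bexI[of _ "d \<otimes> h"]) auto
next
  case (eng_add h1 h2)
  then obtain d1 d2 where d1: "d1 \<in> poly_ring" "d1 \<noteq> \<zero>" "d1 \<otimes> h1 \<in> poly_ring"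
    and d2: "d2 \<in> poly_ring" "d2 \<noteq> \<zero>" "d2 \<otimes> h2 \<in> poly_ring" by auto
  have h: "h1 \<in> carrier K" "h2 \<in> carrier K"
    using eng_add.hyps generate_field_in_carrier[of "insert x k0"] k0_closed x_closed by blast+
  have dc: "d1 \<in> carrier K" "d2 \<in> carrier K" using d1 d2 subringE(1)[OF subring_poly_ring] by auto
  have "(d1 \<otimes> d2) \<otimes> (h1 \<oplus> h2) = d2 \<otimes> (d1 \<otimes> h1) \<oplus> d1 \<otimes> (d2 \<otimes> h2)"
    using h dc by algebra
  also have "\<dots> \<in> poly_ring"
    using d1 d2 subringE(6,7)[OF subring_poly_ring] by auto
  finally show ?case
    using d1 d2 dc subringE(6)[OF subring_poly_ring] integral
    by (intro bexI[of _ "d1 \<otimes> d2"]) auto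
next
  case (eng_mult h1 h2)
  then obtain d1 d2 where d1: "d1 \<in> poly_ring" "d1 \<noteq> \<zero>" "d1 \<otimes> h1 \<in> poly_ring"
    and d2: "d2 \<in> poly_ring" "d2 \<noteq> \<zero>" "d2 \<otimes> h2 \<in> poly_ring" by auto
  have h: "h1 \<in> carrier K" "h2 \<in> carrier K"
    using eng_mult.hyps generate_field_in_carrier[of "insert x k0"] k0_closed x_closed by blast+
  have dc: "d1 \<in> carrier K" "d2 \<in> carrier K" using d1 d2 subringE(1)[OF subring_poly_ring] by auto
  have "(d1 \<otimes> d2) \<otimes> (h1 \<otimes> h2) = (d1 \<otimes> h1) \<otimes> (d2 \<otimes> h2)"
    using h dc by algebra
  also have "\<dots> \<in> poly_ring"
    using d1 d2 subringE(6,7)[OF subring_poly_ring] by auto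
  finally show ?case
    using d1 d2 dc subringE(6)[OF subring_poly_ring] integral
    by (intro bexI[of _ "d1 \<otimes> d2"]) auto
qed

lemma span_polys_closed:
  "set us \<subseteq> carrier K \<Longrightarrow> b \<in> span_polys us n \<Longrightarrow> b \<in> carrier K"
  by (induction us arbitrary: b) (auto intro: polys_closed)

lemma span_polys_mono: "m \<le> n \<Longrightarrow> span_polys us m \<subseteq> span_polys us n"
proof (induction us)
  case (Cons u us)
  show ?case using Cons.IH[OF Cons.prems] polys_mono[OF Cons.prems] by auto
qed simp

lemma span_polys_zero: "set us \<subseteq> carrier K \<Longrightarrow> \<zero> \<in> span_polys us n"
proof (induction us)
  case (Cons u us)
  then have "\<zero> \<otimes> u \<oplus> \<zero> \<in> span_polys (u # us) n" using polys_zero by force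
  then show ?case using Cons.prems by simp
qed simp

lemma span_polys_add:
  "set us \<subseteq> carrier K \<Longrightarrow> a \<in> span_polys us n \<Longrightarrow> b \<in> span_polys us n \<Longrightarrow> a \<oplus> b \<in> span_polys us n"
proof (induction us arbitrary: a b)
  case (Cons u us)
  then obtain p a' r b' where a: "a = p \<otimes> u \<oplus> a'" "p \<in> polys n" "a' \<in> span_polys us n"
    and b: "b = r \<otimes> u \<oplus> b'" "r \<in> polys n" "b' \<in> span_polys us n" by auto
  have c: "u \<in> carrier K" "a' \<in> carrier K" "b' \<in> carrier K" "p \<in> carrier K" "r \<in> carrier K"
    using Cons.prems a b span_polys_closed[of us] polys_closed by auto
  have "a \<oplus> b = (p \<oplus> r) \<otimes> u \<oplus> (a' \<oplus> b')"
    unfolding a(1) b(1) using c by algebra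
  then show ?case using a b Cons polys_add by auto
qed simp

lemma span_polys_smult:
  "set us \<subseteq> carrier K \<Longrightarrow> a \<in> polys m \<Longrightarrow> b \<in> span_polys us n \<Longrightarrow> a \<otimes> b \<in> span_polys us (m + n)"
proof (induction us arbitrary: b)
  case Nil
  then show ?case using polys_closed by simp
next
  case (Cons u us)
  then obtain r b' where b: "b = r \<otimes> u \<oplus> b'" "r \<in> polys n" "b' \<in> span_polys us n" by auto
  have c: "u \<in> carrier K" "a \<in> carrier K" "b' \<in> carrier K" "r \<in> carrier K"
    using Cons.prems b span_polys_closed[of us] polys_closed by auto
  have "a \<otimes> b = (a \<otimes> r) \<otimes> u \<oplus> (a \<otimes> b')"
    unfolding b(1) using c by algebra
  then show ?case using b Cons polys_mult by auto
qed

lemma finite_span_polys: "finite (span_polys us n)"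
  and card_span_polys: "card (span_polys us n) \<le> (card k0 ^ length us) ^ n"
proof -
  have "finite (span_polys us n) \<and> card (span_polys us n) \<le> (card k0 ^ n) ^ length us"
  proof (induction us)
    case (Cons u us)
    have "card (span_polys (u # us) n) \<le> card (polys n \<times> span_polys us n)"
      unfolding span_polys.simps using Cons finite_polys by (intro card_image_le) simp
    also have "\<dots> \<le> card k0 ^ n * (card k0 ^ n) ^ length us"
      using Cons card_polys by (simp add: card_cartesian_product mult_le_mono)
    finally show ?case using Cons finite_polys by simp
  qed simp
  then show "finite (span_polys us n)" "card (span_polys us n) \<le> (card k0 ^ length us) ^ n"
    by (auto simp: power_mult[symmetric] mult.commute)
qed

lemma Span_denominator:
  assumes "set us \<subseteq> carrier K" "a \<in> Span (generate_field K (insert x k0)) us"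
  shows "\<exists>d \<in> poly_ring. \<exists>n. d \<noteq> \<zero> \<and> d \<otimes> a \<in> span_polys us n"
  using assms
proof (induction us arbitrary: a)
  case Nil
  then show ?case
    using subringE(3)[OF subring_poly_ring] by (intro bexI[of _ \<one>]) auto
next
  case (Cons u us)
  let ?F = "generate_field K (insert x k0)"
  obtain f b where a: "a = f \<otimes> u \<oplus> b" "f \<in> ?F" "b \<in> Span ?F us"
    using Cons.prems by (auto simp: line_extension_mem_iff)
  obtain d n where d: "d \<in> poly_ring" "d \<noteq> \<zero>" "d \<otimes> b \<in> span_polys us n"
    using Cons.IH[OF _ a(3)] Cons.prems by auto
  obtain d' where d': "d' \<in> poly_ring" "d' \<noteq> \<zero>" "d' \<otimes> f \<in> poly_ring"
    using generate_field_fractions[OF a(2)] by auto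
  have sub: "insert x k0 \<subseteq> carrier K" using x_closed k0_closed by auto
  have c: "u \<in> carrier K" "d \<in> carrier K" "d' \<in> carrier K" "f \<in> carrier K" "b \<in> carrier K"
    using Cons.prems(1) a(2,3) d(1) d'(1) generate_field_in_carrier[OF sub]
      subringE(1)[OF subring_poly_ring] Span_in_carrier[OF generate_field_incl[OF sub], of us]
    by (auto simp del: Span.simps)
  have eq: "(d \<otimes> d') \<otimes> a = (d \<otimes> (d' \<otimes> f)) \<otimes> u \<oplus> d' \<otimes> (d \<otimes> b)"
    unfolding a(1) using c by algebra
  have "d \<otimes> (d' \<otimes> f) \<in> poly_ring"
    using d d' subringE(6)[OF subring_poly_ring] by auto
  then obtain m1 m2 where m: "d \<otimes> (d' \<otimes> f) \<in> polys m1" "d' \<in> polys m2"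
    using d' by (meson poly_ringE)
  have us: "set us \<subseteq> carrier K" using Cons.prems by simp
  have "d' \<otimes> (d \<otimes> b) \<in> span_polys us (m1 + (m2 + n))"
    using span_polys_smult[OF us m(2) d(3)] span_polys_mono[of "m2 + n" "m1 + (m2 + n)"] by auto
  moreover have "d \<otimes> (d' \<otimes> f) \<in> polys (m1 + (m2 + n))"
    using m(1) polys_mono[of m1 "m1 + (m2 + n)"] by auto
  ultimately have "(d \<otimes> d') \<otimes> a \<in> span_polys (u # us) (m1 + (m2 + n))"
    unfolding eq by auto
  moreover have "d \<otimes> d' \<in> poly_ring" "d \<otimes> d' \<noteq> \<zero>"
    using d d' c subringE(6)[OF subring_poly_ring] integral by auto
  ultimately show ?case by blast
qed

lemma common_denominator:
  assumes us: "set us \<subseteq> carrier K" and "finite E" and "E \<subseteq> Span (generate_field K (insert x k0)) us"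
  shows "\<exists>d n. d \<in> polys n \<and> d \<noteq> \<zero> \<and> (\<forall>a\<in>E. d \<otimes> a \<in> span_polys us n)"
  using assms(2,3)
proof (induction E rule: finite_induct)
  case empty
  then show ?case using poly_ring_k0[OF k0_one] by (intro exI[of _ \<one>] exI[of _ 1]) simp
next
  case (insert a E)
  then obtain d n where d: "d \<in> polys n" "d \<noteq> \<zero>" "\<forall>a\<in>E. d \<otimes> a \<in> span_polys us n" by auto
  obtain d' m m' where d': "d' \<in> polys m'" "d' \<noteq> \<zero>" "d' \<otimes> a \<in> span_polys us m"
    using Span_denominator[OF us, of a] insert.prems poly_ringE by blast
  have sub: "insert x k0 \<subseteq> carrier K" using x_closed k0_closed by auto
  have EK: "insert a E \<subseteq> carrier K"
    using insert.prems Span_in_carrier[OF generate_field_incl[OF sub] us] by auto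
  have c: "d \<in> carrier K" "d' \<in> carrier K" using d d' polys_closed by auto
  let ?N = "m + m' + n"
  have "(d \<otimes> d') \<otimes> b \<in> span_polys us ?N" if "b \<in> insert a E" for b
  proof (cases "b = a")
    case True
    have "(d \<otimes> d') \<otimes> b = d \<otimes> (d' \<otimes> a)" using True c EK by (simp add: m_assoc)
    moreover have "d \<otimes> (d' \<otimes> a) \<in> span_polys us (n + m)"
      by (rule span_polys_smult[OF us d(1) d'(3)])
    ultimately show ?thesis using span_polys_mono[of "n + m" ?N] by auto
  next
    case False
    then have b: "b \<in> E" using that by simp
    then have "b \<in> carrier K" using EK by auto
    then have "(d \<otimes> d') \<otimes> b = d' \<otimes> (d \<otimes> b)" using c by algebra
    moreover have "d' \<otimes> (d \<otimes> b) \<in> span_polys us (m' + n)"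
      using span_polys_smult[OF us d'(1)] d(3) b by auto
    ultimately show ?thesis using span_polys_mono[of "m' + n" ?N] by auto
  qed
  moreover have "d \<otimes> d' \<in> polys ?N"
    using polys_mult[OF d(1) d'(1)] polys_mono[of "n + m'" ?N] by auto
  moreover have "d \<otimes> d' \<noteq> \<zero>" using c d(2) d'(2) integral by blast
  ultimately show ?case by blast
qed

text \<open>Multiplication by w acts on the generators through a matrix over k0(x) with common
  denominator d. Each further digit therefore costs one factor d and at most c further degrees, so
  the degree grows linearly in n with a slope that does not depend on the digits.\<close>

lemma horner_sums_denominator:
  assumes us: "set us \<subseteq> carrier K" and w: "w \<in> carrier K" and E: "E \<subseteq> carrier K"
    and d: "d \<in> polys c" "\<forall>u\<in>set us. d \<otimes> (w \<otimes> u) \<in> span_polys us c"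
    and d': "d' \<in> polys m" "\<forall>e\<in>E. d' \<otimes> e \<in> span_polys us m"
  shows "y \<in> horner_sums E w n \<Longrightarrow> (d [^] n \<otimes> d') \<otimes> y \<in> span_polys us (c * n + m)"
proof (induction n arbitrary: y)
  case 0
  then show ?case using polys_closed[OF d'(1)] span_polys_zero[OF us] by simp
next
  case (Suc n)
  have dc: "d \<in> carrier K" "d' \<in> carrier K" using d d' polys_closed by auto
  have dpow: "d [^] Suc k \<in> polys (c * Suc k)" for k :: nat
  proof (induction k)
    case 0
    then show ?case using d(1) dc by simp
  next
    case (Suc k)
    show ?case using polys_mult[OF Suc d(1)] by (simp add: ac_simps)
  qed
  \<comment> \<open>The list vs varies because \<open>span_polys\<close> recurses along its list,
    while the result is expressed in all of the generators us.\<close>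
  have step: "d \<otimes> (w \<otimes> b) \<in> span_polys us (c + k)" if "b \<in> span_polys vs k" "set vs \<subseteq> set us" for b vs k
    using that
  proof (induction vs arbitrary: b)
    case Nil
    then show ?case using dc w span_polys_zero[OF us] by simp
  next
    case (Cons v vs)
    then obtain p b' where b: "b = p \<otimes> v \<oplus> b'" "p \<in> polys k" "b' \<in> span_polys vs k" by auto
    have cl: "p \<in> carrier K" "v \<in> carrier K" "b' \<in> carrier K"
      using polys_closed[OF b(2)] Cons.prems(2) us span_polys_closed[OF _ b(3)] by auto
    have "d \<otimes> (w \<otimes> b) = p \<otimes> (d \<otimes> (w \<otimes> v)) \<oplus> d \<otimes> (w \<otimes> b')"
      unfolding b(1) using cl dc w by algebra
    moreover have "p \<otimes> (d \<otimes> (w \<otimes> v)) \<in> span_polys us (c + k)"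
      using span_polys_smult[OF us b(2), of "d \<otimes> (w \<otimes> v)" c] d(2) Cons.prems(2)
      by (simp add: add.commute)
    moreover have "d \<otimes> (w \<otimes> b') \<in> span_polys us (c + k)"
      using Cons.IH[OF b(3)] Cons.prems(2) by simp
    ultimately show ?case using span_polys_add[OF us] by simp
  qed
  obtain e z where y: "y = e \<oplus> w \<otimes> z" "e \<in> E" "z \<in> horner_sums E w n"
    using Suc.prems by auto
  have cl: "e \<in> carrier K" "z \<in> carrier K"
    using y E horner_sums_closed[OF E w] by auto
  have dn: "d [^] n \<in> carrier K" using dc by simp
  have "(d [^] Suc n \<otimes> d') \<otimes> y
      = d [^] Suc n \<otimes> (d' \<otimes> e) \<oplus> d \<otimes> (w \<otimes> ((d [^] n \<otimes> d') \<otimes> z))"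
    unfolding y(1) nat_pow_Suc using cl dc dn w by algebra
  moreover have "d \<otimes> (w \<otimes> ((d [^] n \<otimes> d') \<otimes> z)) \<in> span_polys us (c * Suc n + m)"
    using step[OF Suc.IH[OF y(3)]] by (simp add: add.assoc)
  moreover have "d [^] Suc n \<otimes> (d' \<otimes> e) \<in> span_polys us (c * Suc n + m)"
    using span_polys_smult[OF us dpow] d'(2) y(2) by blast
  ultimately show ?case using span_polys_add[OF us] by metis
qed

text \<open>N incongruent digits give N^n expansions, and multiplication by the nonzero element d^n
  d' embeds these into a set of at most B^(c n + m) elements. Letting n grow leaves N <= B^c. Here
  d' and m depend on E, but c comes from w and the generators alone, so the bound is uniform in V
  and E.\<close>

lemma card_quotient_bound:
  assumes us: "set us \<subseteq> carrier K" "Span (generate_field K (insert x k0)) us = carrier K"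
    and w: "w \<in> carrier K" "w \<noteq> \<zero>"
  shows "\<exists>M. \<forall>V E. subring V K \<longrightarrow> w \<in> V \<longrightarrow> E \<subseteq> V \<longrightarrow>
    (\<forall>e\<in>E. \<forall>e'\<in>E. \<forall>y\<in>V. e \<ominus> e' = w \<otimes> y \<longrightarrow> e = e') \<longrightarrow> finite E \<and> card E \<le> M"
proof -
  have "finite ((\<lambda>u. w \<otimes> u) ` set us)" "(\<lambda>u. w \<otimes> u) ` set us \<subseteq> Span (generate_field K (insert x k0)) us"
    using us w by auto
  from common_denominator[OF us(1) this] obtain d c where d: "d \<in> polys c" "d \<noteq> \<zero>"
    "\<forall>u\<in>set us. d \<otimes> (w \<otimes> u) \<in> span_polys us c"
    by auto
  define B where "B = card k0 ^ length us"
  have main: "card E \<le> B ^ c" if V: "subring V K" and wV: "w \<in> V" and E: "E \<subseteq> V" and fin: "finite E"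
    and dist: "\<forall>e\<in>E. \<forall>e'\<in>E. \<forall>y\<in>V. e \<ominus> e' = w \<otimes> y \<longrightarrow> e = e'" for V E
  proof -
    have EK: "E \<subseteq> carrier K" using E subringE(1)[OF V] by auto
    obtain d' m where d': "d' \<in> polys m" "d' \<noteq> \<zero>" "\<forall>e\<in>E. d' \<otimes> e \<in> span_polys us m"
      using common_denominator[OF us(1) fin] EK us(2) by auto
    have dc: "d \<in> carrier K" "d' \<in> carrier K" using d d' polys_closed by auto
    have bound: "card E ^ n \<le> B ^ (c * n + m)" for n
    proof -
      let ?D = "d [^] n \<otimes> d'"
      have D: "?D \<in> carrier K" "?D \<noteq> \<zero>"
        using dc d(2) d'(2) integral nat_pow_nonzero by (simp, metis nat_pow_closed)
      have "card E ^ n = card (horner_sums E w n)"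
        using card_horner_sums[OF V E wV w(2) fin] dist by metis
      also have "\<dots> = card ((\<lambda>y. ?D \<otimes> y) ` horner_sums E w n)"
      proof (rule card_image[symmetric], rule inj_onI)
        fix a b assume "a \<in> horner_sums E w n" "b \<in> horner_sums E w n" "?D \<otimes> a = ?D \<otimes> b"
        then show "a = b"
          using D m_lcancel horner_sums_closed[OF EK w(1)] by (metis subsetD)
      qed
      also have "\<dots> \<le> card (span_polys us (c * n + m))"
        using horner_sums_denominator[OF us(1) w(1) EK d(1,3) d'(1,3)]
        by (intro card_mono finite_span_polys) auto
      also have "\<dots> \<le> B ^ (c * n + m)"
        using card_span_polys unfolding B_def .
      finally show ?thesis .
    qed
    show ?thesis
    proof (rule ccontr)
      assume "\<not> card E \<le> B ^ c"
      then have gt: "real (card E) \<ge> real (B ^ c) + 1"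
        by linarith
      have "k0 \<noteq> {}" using k0_zero by auto
      then have B: "B \<ge> 1" using finite_k0 unfolding B_def by (simp add: Suc_le_eq card_gt_0_iff)
      \<comment> \<open>An excess of one over B^c is a gain by the factor r > 1 for every digit, so
        the powers of r would all stay below the constant B^m.\<close>
      define r where "r = 1 + 1 / real (B ^ c)"
      have r: "r > 1" unfolding r_def using B by simp
      have "r ^ n \<le> real (B ^ m)" for n
      proof -
        have "r * real (B ^ c) = real (B ^ c) + 1"
          using B unfolding r_def by (simp add: distrib_right)
        then have "r * real (B ^ c) \<le> real (card E)"
          using gt by simp
        then have "(r * real (B ^ c)) ^ n \<le> real (card E) ^ n"
          using r by (intro power_mono) auto
        also have "\<dots> \<le> real (B ^ (c * n + m))"
          using bound[of n] by (metis of_nat_le_iff of_nat_power)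
        also have "\<dots> = real (B ^ c) ^ n * real (B ^ m)"
          by (simp add: power_add power_mult)
        finally have "r ^ n * real (B ^ c) ^ n \<le> real (B ^ c) ^ n * real (B ^ m)"
          by (simp add: power_mult_distrib)
        moreover have "real (B ^ c) ^ n > 0" using B by simp
        ultimately show ?thesis by (simp add: mult.commute)
      qed
      then show False
        using real_arch_pow[OF r, of "real (B ^ m)"] by (meson not_less)
    qed
  qed
  have "finite E \<and> card E \<le> B ^ c" if V: "subring V K" and wV: "w \<in> V" and E: "E \<subseteq> V"
    and dist: "\<forall>e\<in>E. \<forall>e'\<in>E. \<forall>y\<in>V. e \<ominus> e' = w \<otimes> y \<longrightarrow> e = e'" for V E
  proof -
    have "finite E"
    proof (rule ccontr)
      assume "infinite E"
      then obtain T where "T \<subseteq> E" "finite T" "card T = Suc (B ^ c)"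
        by (meson infinite_arbitrarily_large)
      moreover from this have "\<forall>e\<in>T. \<forall>e'\<in>T. \<forall>y\<in>V. e \<ominus> e' = w \<otimes> y \<longrightarrow> e = e'"
        using dist by (meson subsetD)
      ultimately show False using main[OF V wV, of T] E by (metis Suc_n_not_le_n order_trans)
    qed
    then show ?thesis using main[OF V wV E _ dist] by simp
  qed
  then show ?thesis by (intro exI[of _ "B ^ c"] allI impI) simp
qed

end

context global_function_field
begin

lemma subfield_prime_subfield: "subfield (prime_subfield K) K"
  unfolding prime_subfield_def by (rule generate_field_is_subfield) simp

lemma finite_prime_subfield: "finite (prime_subfield K)"
proof -
  obtain p where "Factorial_Ring.prime (p :: nat)" "card (prime_subfield K) = p"
    using finite_over_rational_function_field by blast
  then show ?thesis by (metis card.infinite not_prime_0)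
qed

text \<open>The bound M is the same for all subrings. This matters for valuation rings that are only
  known to exist and for intersections of arbitrarily many of them.\<close>

lemma subring_quotient_bounded:
  assumes w: "w \<in> carrier K" "w \<noteq> \<zero>"
  shows "\<exists>M. \<forall>V E. subring V K \<longrightarrow> w \<in> V \<longrightarrow> E \<subseteq> V \<longrightarrow>
    (\<forall>e\<in>E. \<forall>e'\<in>E. \<forall>y\<in>V. e \<ominus> e' = w \<otimes> y \<longrightarrow> e = e') \<longrightarrow> finite E \<and> card E \<le> M"
proof -
  obtain x where x: "x \<in> carrier K"
    "finite_dimension (generate_field K (insert x (prime_subfield K))) (carrier K)"
    using finite_over_rational_function_field by blast
  interpret filtered_span K "prime_subfield K" x
    by (intro filtered_span.intro field_axioms filtered_span_axioms.intro
        subfield_prime_subfield finite_prime_subfield x)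
  have "subfield (generate_field K (insert x (prime_subfield K))) K"
    using x k0_closed by (intro generate_field_is_subfield) auto
  from exists_base[OF this] x(2) obtain us where us: "set us \<subseteq> carrier K"
    "Span (generate_field K (insert x (prime_subfield K))) us = carrier K"
    unfolding finite_dimension_def by blast
  show ?thesis by (rule card_quotient_bound[OF us w])
qed

end

subsection \<open>Integer powers in a field\<close>

context field
begin

text \<open>Laws for integer exponents belong to groups, and the monoid of the field contains zero.
  Powers are therefore read in the multiplicative group and translated back.\<close>

lemma int_pow_mult_of:
  assumes "a \<in> carrier R" "a \<noteq> \<zero>"
  shows "a [^]\<^bsub>Multiplicative_Group.mult_of R\<^esub> (n :: int) = a [^] n"
proof -
  have "inv\<^bsub>Multiplicative_Group.mult_of R\<^esub> (a [^] m) = inv (a [^] m)" for m :: nat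
    using assms nat_pow_nonzero by (intro m_inv_mult_of) auto
  moreover have "a [^]\<^bsub>Multiplicative_Group.mult_of R\<^esub> m = a [^] m" for m :: nat
    by (induction m) simp_all
  ultimately show ?thesis
    unfolding int_pow_def2 by (simp only:)
qed

lemma int_pow_nonzero_closed:
  assumes "a \<in> carrier R" "a \<noteq> \<zero>"
  shows "a [^] (n :: int) \<in> carrier R" "a [^] (n :: int) \<noteq> \<zero>"
proof -
  have "a [^]\<^bsub>Multiplicative_Group.mult_of R\<^esub> n \<in> carrier (Multiplicative_Group.mult_of R)"
    by (rule group.int_pow_closed[OF field_mult_group]) (use assms in simp)
  then show "a [^] n \<in> carrier R" "a [^] n \<noteq> \<zero>"
    unfolding int_pow_mult_of[OF assms] carrier_mult_of by auto
qed

lemma int_pow_add: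
  assumes "a \<in> carrier R" "a \<noteq> \<zero>"
  shows "a [^] (n + m :: int) = a [^] n \<otimes> a [^] m"
proof -
  have "a [^]\<^bsub>Multiplicative_Group.mult_of R\<^esub> (n + m) = a [^]\<^bsub>Multiplicative_Group.mult_of R\<^esub> n
      \<otimes>\<^bsub>Multiplicative_Group.mult_of R\<^esub> a [^]\<^bsub>Multiplicative_Group.mult_of R\<^esub> m"
    by (rule group.int_pow_mult[OF field_mult_group]) (use assms in simp)
  then show ?thesis
    unfolding int_pow_mult_of[OF assms] by simp
qed

lemma inv_closed_nonzero:
  assumes "a \<in> carrier R" "a \<noteq> \<zero>"
  shows "inv a \<in> carrier R" "inv a \<noteq> \<zero>" "a \<otimes> inv a = \<one>" "inv a \<otimes> a = \<one>"
proof -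
  have u: "a \<in> Units R" using assms field_Units by simp
  show "inv a \<in> carrier R" "a \<otimes> inv a = \<one>" "inv a \<otimes> a = \<one>" using u by auto
  then show "inv a \<noteq> \<zero>" using assms(1) by (metis r_null one_not_zero)
qed

lemma inv_mult_field:
  assumes "a \<in> carrier R" "a \<noteq> \<zero>" "b \<in> carrier R" "b \<noteq> \<zero>"
  shows "inv (a \<otimes> b) = inv a \<otimes> inv b" "a \<otimes> b \<noteq> \<zero>"
proof -
  note ia = inv_closed_nonzero[OF assms(1,2)] and ib = inv_closed_nonzero[OF assms(3,4)]
  have "(a \<otimes> b) \<otimes> (inv a \<otimes> inv b) = (a \<otimes> inv a) \<otimes> (b \<otimes> inv b)"
    using assms(1,3) ia(1) ib(1) by (simp add: m_ac)
  then have "(a \<otimes> b) \<otimes> (inv a \<otimes> inv b) = \<one>" unfolding ia(3) ib(3) by simp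
  then show "inv (a \<otimes> b) = inv a \<otimes> inv b"
    using comm_inv_char[of "a \<otimes> b"] assms(1,3) ia(1) ib(1) by simp
  show "a \<otimes> b \<noteq> \<zero>" using assms integral by blast
qed

lemma subring_Units_iff:
  assumes V: "subring V R"
  shows "u \<in> Units (R\<lparr>carrier := V\<rparr>) \<longleftrightarrow> u \<in> V \<and> u \<noteq> \<zero> \<and> inv u \<in> V"
proof
  assume "u \<in> Units (R\<lparr>carrier := V\<rparr>)"
  then obtain y where y: "u \<in> V" "y \<in> V" "y \<otimes> u = \<one>" "u \<otimes> y = \<one>"
    unfolding Units_def by auto
  then have c: "u \<in> carrier R" "y \<in> carrier R" using subringE(1)[OF V] by auto
  then have "u \<noteq> \<zero>" using y by auto
  moreover have "inv u = y" using inv_char[of u y] c y by simp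
  ultimately show "u \<in> V \<and> u \<noteq> \<zero> \<and> inv u \<in> V" using y by simp
next
  assume u: "u \<in> V \<and> u \<noteq> \<zero> \<and> inv u \<in> V"
  then show "u \<in> Units (R\<lparr>carrier := V\<rparr>)"
    using subringE(1)[OF V] inv_closed_nonzero[of u] unfolding Units_def by auto
qed

end

subsection \<open>The valuation of a place\<close>

context global_function_field
begin

lemma place_subring: "P \<in> places K \<Longrightarrow> subring P K"
  and place_constants: "P \<in> places K \<Longrightarrow> constant_field K \<subseteq> P"
  and place_dvr: "P \<in> places K \<Longrightarrow> discrete_valuation_ring (K\<lparr>carrier := P\<rparr>)"
  unfolding places_def by auto

lemma place_carrier: "P \<in> places K \<Longrightarrow> P \<subseteq> carrier K"
  using subringE(1)[OF place_subring] .

lemma place_maximalideal: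
  assumes "P \<in> places K"
  shows "maximalideal (place_ideal K P) (K\<lparr>carrier := P\<rparr>)"
  using theI'[of "\<lambda>M. maximalideal M (K\<lparr>carrier := P\<rparr>)"] place_dvr[OF assms]
  unfolding discrete_valuation_ring_def place_ideal_def by blast

lemma place_ideal_unique:
  assumes "P \<in> places K" "maximalideal M (K\<lparr>carrier := P\<rparr>)"
  shows "M = place_ideal K P"
  using place_maximalideal[OF assms(1)] assms(2) place_dvr[OF assms(1)]
  unfolding discrete_valuation_ring_def by blast

definition uniformizer :: "'a set \<Rightarrow> 'a \<Rightarrow> bool" where
  "uniformizer P t \<longleftrightarrow> t \<in> P \<and> place_ideal K P = PIdl\<^bsub>K\<lparr>carrier := P\<rparr>\<^esub> t"

definition punits :: "'a set \<Rightarrow> 'a set" where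
  "punits P = {u \<in> P. u \<noteq> \<zero> \<and> inv u \<in> P}"

lemma punits_eq: "P \<in> places K \<Longrightarrow> punits P = Units (K\<lparr>carrier := P\<rparr>)"
  unfolding punits_def using subring_Units_iff[OF place_subring] by blast

lemma punits_mult:
  assumes "P \<in> places K" "u \<in> punits P" "v \<in> punits P"
  shows "u \<otimes> v \<in> punits P"
proof -
  have c: "u \<in> carrier K" "v \<in> carrier K"
    using assms place_carrier unfolding punits_def by auto
  then have "inv (u \<otimes> v) = inv u \<otimes> inv v" "u \<otimes> v \<noteq> \<zero>"
    using assms(2,3) inv_mult_field unfolding punits_def by auto
  then show ?thesis
    using assms subringE(6)[OF place_subring[OF assms(1)]] unfolding punits_def by auto
qed

lemma punits_inv:
  assumes "P \<in> places K" "u \<in> punits P"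
  shows "inv u \<in> punits P"
proof -
  have "u \<in> carrier K" "u \<noteq> \<zero>" using assms place_carrier[OF assms(1)] unfolding punits_def by auto
  moreover from this have "inv (inv u) = u" using field_Units by simp
  ultimately show ?thesis using inv_closed_nonzero[of u] assms(2) unfolding punits_def by simp
qed

lemma uniformizerE:
  assumes P: "P \<in> places K" and t: "uniformizer P t"
  shows "t \<in> carrier K" "t \<noteq> \<zero>" "t \<notin> punits P" "place_ideal K P = {a \<otimes> t | a. a \<in> P}"
proof -
  interpret M: maximalideal "place_ideal K P" "K\<lparr>carrier := P\<rparr>"
    by (rule place_maximalideal[OF P])
  interpret D: principal_domain "K\<lparr>carrier := P\<rparr>"
    using place_dvr[OF P] unfolding discrete_valuation_ring_def by blast
  show "t \<in> carrier K" using t place_carrier[OF P] unfolding uniformizer_def by auto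
  show eq: "place_ideal K P = {a \<otimes> t | a. a \<in> P}"
    using t unfolding uniformizer_def cgenideal_def by auto
  show "t \<notin> punits P"
    using D.ideal_eq_carrier_iff[of t] M.I_notcarr t punits_eq[OF P] unfolding uniformizer_def by auto
  show "t \<noteq> \<zero>"
  proof
    assume t0: "t = \<zero>"
    then have M0: "place_ideal K P = {\<zero>}"
      using eq place_carrier[OF P] subringE(2)[OF place_subring[OF P]] by (auto simp: subset_iff)
    have "field (K\<lparr>carrier := P\<rparr>)"
      using D.zeromaximalideal_fieldI M.is_maximalideal M0 by simp
    then show False
      using place_dvr[OF P] unfolding discrete_valuation_ring_def by simp
  qed
qed

lemma uniformizer_assoc:
  assumes P: "P \<in> places K" and t: "uniformizer P t" and f: "f \<in> P"
    and eq: "place_ideal K P = PIdl\<^bsub>K\<lparr>carrier := P\<rparr>\<^esub> f"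
  shows "\<exists>w \<in> punits P. f = w \<otimes> t"
proof -
  interpret D: principal_domain "K\<lparr>carrier := P\<rparr>"
    using place_dvr[OF P] unfolding discrete_valuation_ring_def by blast
  have "f \<sim>\<^bsub>K\<lparr>carrier := P\<rparr>\<^esub> t"
    using D.associated_iff_same_ideal[of f t] f t eq unfolding uniformizer_def by simp
  then show ?thesis
    using D.ring_associated_iff[of f t] f t punits_eq[OF P] unfolding uniformizer_def by simp
qed

lemma ex_uniformizer:
  assumes P: "P \<in> places K"
  obtains t where "uniformizer P t"
proof -
  interpret M: maximalideal "place_ideal K P" "K\<lparr>carrier := P\<rparr>"
    by (rule place_maximalideal[OF P])
  interpret D: principal_domain "K\<lparr>carrier := P\<rparr>"
    using place_dvr[OF P] unfolding discrete_valuation_ring_def by blast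
  show thesis
    using D.exists_gen[OF M.ideal_axioms] that unfolding uniformizer_def by auto
qed

lemma one_in_punits: "P \<in> places K \<Longrightarrow> \<one> \<in> punits P"
  unfolding punits_def using subringE(3)[OF place_subring] by auto

lemma punits_carrier: "P \<in> places K \<Longrightarrow> u \<in> punits P \<Longrightarrow> u \<in> carrier K \<and> u \<noteq> \<zero> \<and> u \<in> P"
  unfolding punits_def using place_carrier by auto

text \<open>In a principal domain a nonzero nonunit is a product of irreducibles, and each of them
  generates a maximal ideal. There is only one such ideal, so every factor is a unit times t; the
  exponent is the number of factors.\<close>

lemma place_element_form:
  assumes P: "P \<in> places K" and t: "uniformizer P t" and a: "a \<in> P" "a \<noteq> \<zero>"
  shows "\<exists>n u. u \<in> punits P \<and> a = t [^] (n :: nat) \<otimes> u"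
proof (cases "a \<in> punits P")
  case True
  then show ?thesis using punits_carrier[OF P] by (intro exI[of _ 0] exI[of _ a]) auto
next
  case False
  interpret D: principal_domain "K\<lparr>carrier := P\<rparr>"
    using place_dvr[OF P] unfolding discrete_valuation_ring_def by blast
  have tc: "t \<in> carrier K" using uniformizerE[OF P t] by simp
  obtain fs where fs: "set fs \<subseteq> P - {\<zero>}" "wfactors (mult_of (K\<lparr>carrier := P\<rparr>)) fs a"
    using D.factorization_property[of a] a False punits_eq[OF P] by auto
  have "\<exists>u \<in> punits P. foldr (\<otimes>) gs \<one> = t [^] length gs \<otimes> u" if "set gs \<subseteq> set fs" for gs
    using that
  proof (induction gs)
    case Nil
    show ?case using one_in_punits[OF P] by (intro bexI[of _ \<one>]) auto
  next
    case (Cons g gs)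
    then obtain u where u: "u \<in> punits P" "foldr (\<otimes>) gs \<one> = t [^] length gs \<otimes> u" by auto
    have g: "g \<in> P - {\<zero>}" "irreducible (mult_of (K\<lparr>carrier := P\<rparr>)) g"
      using Cons.prems fs unfolding wfactors_def by auto
    have "ring_irreducible\<^bsub>K\<lparr>carrier := P\<rparr>\<^esub> g"
      using D.ring_irreducibleI'[of g] g by simp
    then have "maximalideal (PIdl\<^bsub>K\<lparr>carrier := P\<rparr>\<^esub> g) (K\<lparr>carrier := P\<rparr>)"
      using D.irreducible_imp_maximalideal[of g] g by simp
    then obtain w where w: "w \<in> punits P" "g = w \<otimes> t"
      using uniformizer_assoc[OF P t, of g] place_ideal_unique[OF P] g by auto
    have c: "u \<in> carrier K" "w \<in> carrier K" "t [^] length gs \<in> carrier K"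
      using punits_carrier[OF P] u w tc by auto
    have "foldr (\<otimes>) (g # gs) \<one> = (w \<otimes> t) \<otimes> (t [^] length gs \<otimes> u)"
      using u w by simp
    also have "\<dots> = (t [^] length gs \<otimes> t) \<otimes> (w \<otimes> u)"
      using c tc by algebra
    finally show ?case using punits_mult[OF P w(1) u(1)] by auto
  qed
  then obtain u where u: "u \<in> punits P" "foldr (\<otimes>) fs \<one> = t [^] length fs \<otimes> u" by auto
  have fP: "foldr (\<otimes>) fs \<one> \<in> P"
    unfolding u(2) using subringE(6)[OF place_subring[OF P]] punits_carrier[OF P u(1)]
      D.nat_pow_closed[of t "length fs"] t nat_pow_consistent unfolding uniformizer_def by auto
  have "a \<sim>\<^bsub>mult_of (K\<lparr>carrier := P\<rparr>)\<^esub> foldr (\<otimes>) fs \<one>"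
    using fs(2) unfolding wfactors_def by (auto simp: associated_def)
  then have "a \<sim>\<^bsub>K\<lparr>carrier := P\<rparr>\<^esub> foldr (\<otimes>) fs \<one>"
    using D.assoc_iff_assoc_mult[of a "foldr (\<otimes>) fs \<one>"] a fP by simp
  then obtain v where v: "v \<in> punits P" "a = v \<otimes> foldr (\<otimes>) fs \<one>"
    using D.ring_associated_iff[of a] a fP punits_eq[OF P] by auto
  have c: "u \<in> carrier K" "v \<in> carrier K" "t [^] length fs \<in> carrier K"
    using punits_carrier[OF P] u v tc by auto
  have "a = t [^] length fs \<otimes> (v \<otimes> u)"
    unfolding v(2) u(2) using c by algebra
  then show ?thesis using punits_mult[OF P v(1) u(1)] by blast
qed

lemma place_form:
  assumes P: "P \<in> places K" and t: "uniformizer P t" and a: "a \<in> carrier K" "a \<noteq> \<zero>"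
  shows "\<exists>n u. u \<in> punits P \<and> a = t [^] (n :: int) \<otimes> u"
proof -
  have tc: "t \<in> carrier K" "t \<noteq> \<zero>" using uniformizerE[OF P t] by auto
  have "a \<in> {b \<otimes> inv c | b c. b \<in> P \<and> c \<in> P \<and> c \<noteq> \<zero>}"
    using P a unfolding places_def by auto
  then obtain b c where bc: "a = b \<otimes> inv c" "b \<in> P" "c \<in> P" "c \<noteq> \<zero>" by auto
  have cc: "b \<in> carrier K" "c \<in> carrier K" using bc place_carrier[OF P] by auto
  then have "b \<noteq> \<zero>" using a bc inv_closed_nonzero[of c] by auto
  then obtain m u n v where u: "u \<in> punits P" "b = t [^] (m :: nat) \<otimes> u"
    and v: "v \<in> punits P" "c = t [^] (n :: nat) \<otimes> v"
    using place_element_form[OF P t] bc by metis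
  have uc: "u \<in> carrier K" "v \<in> carrier K" "inv v \<in> carrier K" "v \<otimes> inv v = \<one>"
    using punits_carrier[OF P] u v inv_closed_nonzero[of v] by auto
  define s where "s = t [^] (int m - int n)"
  have s: "s \<in> carrier K" unfolding s_def using int_pow_nonzero_closed[OF tc] by simp
  have tn: "t [^] n \<in> carrier K" "t [^] m \<in> carrier K" using tc by auto
  have st: "s \<otimes> t [^] n = t [^] m"
    using int_pow_add[OF tc, of "int m - int n" "int n"] unfolding s_def by (simp add: int_pow_int)
  have "s \<otimes> (u \<otimes> inv v) \<otimes> c = (s \<otimes> t [^] n) \<otimes> u \<otimes> (v \<otimes> inv v)"
    unfolding v(2) using s uc tn by algebra
  also have "\<dots> = b" unfolding st uc(4) u(2) using uc tn by simp
  also have "\<dots> = a \<otimes> c" using bc cc inv_closed_nonzero[of c] by (simp add: m_assoc)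
  finally have "a = s \<otimes> (u \<otimes> inv v)"
    using m_rcancel[of c a "s \<otimes> (u \<otimes> inv v)"] cc bc(4) s uc a by simp
  then show ?thesis
    unfolding s_def using punits_mult[OF P u(1) punits_inv[OF P v(1)]] by blast
qed

lemma uniformizer_pow_unit:
  assumes P: "P \<in> places K" and t: "uniformizer P t" and u: "t [^] (k :: int) \<in> punits P"
  shows "k = 0"
proof -
  have tc: "t \<in> carrier K" "t \<noteq> \<zero>" "t \<notin> punits P" using uniformizerE[OF P t] by auto
  have pos: "\<not> t [^] Suc j \<in> punits P" for j :: nat
  proof
    assume A: "t [^] Suc j \<in> punits P"
    have tj: "t [^] j \<in> P"
      using t subringE(3,6)[OF place_subring[OF P]] unfolding uniformizer_def by (induction j) auto
    have c: "t [^] j \<in> carrier K" "inv (t [^] Suc j) \<in> carrier K" "inv t \<in> carrier K"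
      using A punits_carrier[OF P A] inv_closed_nonzero tc by auto
    have "t \<otimes> (t [^] j \<otimes> inv (t [^] Suc j)) = t [^] Suc j \<otimes> inv (t [^] Suc j)"
      using c tc by (simp add: m_ac)
    also have "\<dots> = \<one>" using A punits_carrier[OF P A] inv_closed_nonzero(3) by blast
    finally have "inv t = t [^] j \<otimes> inv (t [^] Suc j)"
      using comm_inv_char[of t "t [^] j \<otimes> inv (t [^] Suc j)"] c tc by simp
    moreover have "t [^] j \<otimes> inv (t [^] Suc j) \<in> P"
      using tj A subringE(6)[OF place_subring[OF P]] unfolding punits_def by auto
    ultimately have "t \<in> punits P"
      using tc t unfolding punits_def uniformizer_def by simp
    then show False using tc by simp
  qed
  have "t [^] k \<otimes> t [^] (- k) = \<one>"
    using int_pow_add[OF tc(1,2), of k "- k"] by simp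
  then have "inv (t [^] k) = t [^] (- k)"
    using comm_inv_char int_pow_nonzero_closed[OF tc(1,2)] by simp
  then have neg: "t [^] (- k) \<in> punits P" using punits_inv[OF P u] by simp
  have no: "\<not> 0 < j" if "t [^] j \<in> punits P" for j :: int
  proof
    assume "0 < j"
    then obtain i where "j = int (Suc i)" using pos_int_cases gr0_implies_Suc by metis
    then show False using pos[of i] that int_pow_int[of K t "Suc i"] by metis
  qed
  show "k = 0" using no[OF u] no[OF neg] by simp
qed

lemma punits_int_pow:
  assumes P: "P \<in> places K" and w: "w \<in> punits P"
  shows "w [^] (k :: int) \<in> punits P"
proof -
  have wc: "w \<in> carrier K" "w \<noteq> \<zero>" using punits_carrier[OF P w] by auto
  have nat: "w [^] j \<in> punits P" for j :: nat
    by (induction j) (use one_in_punits[OF P] punits_mult[OF P] w in auto)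
  show ?thesis
    unfolding int_pow_def2 using nat punits_inv[OF P nat] by presburger
qed

text \<open>The description in \<open>place_ord\<close> admits every generator s of the ideal, so
  uniqueness must compare different uniformizers. Writing s = w t with a unit w turns two
  representations of one element into a power of t that is a unit, and its exponent is zero.\<close>

lemma place_ord_eq:
  assumes P: "P \<in> places K" and t: "uniformizer P t" and u: "u \<in> punits P"
  shows "place_ord K P (t [^] (n :: int) \<otimes> u) = n"
  unfolding place_ord_def
proof (rule the_equality)
  show "\<exists>s\<in>P. \<exists>v\<in>Units (K\<lparr>carrier := P\<rparr>). place_ideal K P = PIdl\<^bsub>K\<lparr>carrier := P\<rparr>\<^esub> s \<and>
      t [^] n \<otimes> u = s [^] n \<otimes> v"
    using t u punits_eq[OF P] unfolding uniformizer_def by auto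
next
  fix m :: int assume "\<exists>s\<in>P. \<exists>v\<in>Units (K\<lparr>carrier := P\<rparr>). place_ideal K P = PIdl\<^bsub>K\<lparr>carrier := P\<rparr>\<^esub> s \<and>
      t [^] n \<otimes> u = s [^] m \<otimes> v"
  then obtain s v where s: "s \<in> P" "place_ideal K P = PIdl\<^bsub>K\<lparr>carrier := P\<rparr>\<^esub> s"
    and v: "v \<in> punits P" and eq: "t [^] n \<otimes> u = s [^] m \<otimes> v"
    using punits_eq[OF P] by auto
  have tc: "t \<in> carrier K" "t \<noteq> \<zero>" using uniformizerE[OF P t] by auto
  obtain w where w: "w \<in> punits P" "s = w \<otimes> t"
    using uniformizer_assoc[OF P t s] by auto
  have wc: "w \<in> carrier K" "w \<noteq> \<zero>" using punits_carrier[OF P w(1)] by auto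
  have uc: "u \<in> carrier K" "v \<in> carrier K" "inv u \<in> carrier K" "u \<otimes> inv u = \<one>"
    using punits_carrier[OF P] u v inv_closed_nonzero[of u] by auto
  have sm: "s [^] m = w [^] m \<otimes> t [^] m"
  proof -
    have "(w \<otimes>\<^bsub>Multiplicative_Group.mult_of K\<^esub> t) [^]\<^bsub>Multiplicative_Group.mult_of K\<^esub> m = w [^]\<^bsub>Multiplicative_Group.mult_of K\<^esub> m \<otimes>\<^bsub>Multiplicative_Group.mult_of K\<^esub> t [^]\<^bsub>Multiplicative_Group.mult_of K\<^esub> m"
      using group.int_pow_mult_distrib[OF field_mult_group, of w t m] wc tc m_comm by auto
    then show ?thesis
      using int_pow_mult_of inv_mult_field(2)[OF wc tc] wc tc w(2) by simp
  qed
  define a b c where "a = t [^] (n - m)" and "b = t [^] m" and "c = w [^] m"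
  have abc: "a \<in> carrier K" "b \<in> carrier K" "b \<noteq> \<zero>" "c \<in> carrier K" "c \<in> punits P"
    using int_pow_nonzero_closed[OF tc] int_pow_nonzero_closed[OF wc] punits_int_pow[OF P w(1)]
    unfolding a_def b_def c_def by auto
  have "t [^] n = a \<otimes> b"
    unfolding a_def b_def using int_pow_add[OF tc, of "n - m" m] by simp
  then have "(a \<otimes> b) \<otimes> u = (c \<otimes> b) \<otimes> v"
    using eq sm unfolding b_def c_def by simp
  then have "b \<otimes> (a \<otimes> u) = b \<otimes> (c \<otimes> v)"
    using abc uc by (simp add: m_ac)
  then have "a \<otimes> u = c \<otimes> v"
    using m_lcancel[of b "a \<otimes> u" "c \<otimes> v"] abc uc by auto
  then have "a \<otimes> (u \<otimes> inv u) = (c \<otimes> v) \<otimes> inv u"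
    using m_assoc[of a u "inv u"] abc(1) uc(1,3) by argo
  then have "a = (c \<otimes> v) \<otimes> inv u"
    unfolding uc(4) using abc(1) by simp
  then have "a \<in> punits P"
    using punits_mult[OF P punits_mult[OF P abc(5) v] punits_inv[OF P u]] by simp
  then show "m = n"
    using uniformizer_pow_unit[OF P t, of "n - m"] unfolding a_def by simp
qed

lemma place_ord_unit:
  assumes P: "P \<in> places K" and u: "u \<in> punits P"
  shows "place_ord K P u = 0"
proof -
  obtain t where t: "uniformizer P t" using ex_uniformizer[OF P] .
  have "place_ord K P (t [^] (0 :: int) \<otimes> u) = 0" by (rule place_ord_eq[OF P t u])
  moreover have "t [^] (0 :: int) \<otimes> u = u" using punits_carrier[OF P u] by simp
  ultimately show ?thesis by simp
qed

lemma place_ord_mult: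
  assumes P: "P \<in> places K" and a: "a \<in> carrier K" "a \<noteq> \<zero>" and b: "b \<in> carrier K" "b \<noteq> \<zero>"
  shows "place_ord K P (a \<otimes> b) = place_ord K P a + place_ord K P b"
proof -
  obtain t where t: "uniformizer P t" using ex_uniformizer[OF P] .
  have tc: "t \<in> carrier K" "t \<noteq> \<zero>" using uniformizerE[OF P t] by auto
  obtain n u where u: "u \<in> punits P" "a = t [^] (n :: int) \<otimes> u" using place_form[OF P t a] by blast
  obtain m v where v: "v \<in> punits P" "b = t [^] (m :: int) \<otimes> v" using place_form[OF P t b] by blast
  have c: "u \<in> carrier K" "v \<in> carrier K" using punits_carrier[OF P] u v by auto
  have pc: "t [^] n \<in> carrier K" "t [^] m \<in> carrier K" using int_pow_nonzero_closed[OF tc] by auto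
  have "a \<otimes> b = t [^] (n + m) \<otimes> (u \<otimes> v)"
    unfolding u(2) v(2) int_pow_add[OF tc] using c pc by (simp add: m_ac)
  then have "place_ord K P (a \<otimes> b) = n + m"
    using place_ord_eq[OF P t punits_mult[OF P u(1) v(1)], of "n + m"] by simp
  moreover have "place_ord K P a = n" unfolding u(2) by (rule place_ord_eq[OF P t u(1)])
  moreover have "place_ord K P b = m" unfolding v(2) by (rule place_ord_eq[OF P t v(1)])
  ultimately show ?thesis by simp
qed

lemma place_ord_one: "P \<in> places K \<Longrightarrow> place_ord K P \<one> = 0"
  by (rule place_ord_unit[OF _ one_in_punits])

lemma place_ord_inv:
  assumes P: "P \<in> places K" and a: "a \<in> carrier K" "a \<noteq> \<zero>"
  shows "place_ord K P (inv a) = - place_ord K P a"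
proof -
  have "place_ord K P (a \<otimes> inv a) = place_ord K P a + place_ord K P (inv a)"
    by (rule place_ord_mult[OF P a inv_closed_nonzero(1,2)[OF a]])
  then show ?thesis unfolding inv_closed_nonzero(3)[OF a] place_ord_one[OF P] by simp
qed

lemma place_ord_nonneg_iff:
  assumes P: "P \<in> places K" and a: "a \<in> carrier K" "a \<noteq> \<zero>"
  shows "a \<in> P \<longleftrightarrow> 0 \<le> place_ord K P a"
proof -
  obtain t where t: "uniformizer P t" using ex_uniformizer[OF P] .
  have "0 \<le> place_ord K P a" if aP: "a \<in> P"
  proof -
    obtain n u where "u \<in> punits P" "a = t [^] (n :: nat) \<otimes> u"
      using place_element_form[OF P t aP a(2)] by blast
    then show ?thesis using place_ord_eq[OF P t, of u "int n"] by (simp add: int_pow_int)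
  qed
  moreover have "a \<in> P" if "0 \<le> place_ord K P a"
  proof -
    obtain n u where u: "u \<in> punits P" "a = t [^] (n :: int) \<otimes> u" using place_form[OF P t a] by blast
    then have "n \<ge> 0" using place_ord_eq[OF P t] that by simp
    then obtain j where "n = int j" using nonneg_int_cases by blast
    then have "a = t [^] j \<otimes> u" using u by (simp add: int_pow_int)
    moreover have "t [^] j \<in> P"
      using t subringE(3,6)[OF place_subring[OF P]] unfolding uniformizer_def by (induction j) auto
    ultimately show ?thesis
      using u(1) subringE(6)[OF place_subring[OF P]] unfolding punits_def by auto
  qed
  ultimately show ?thesis by blast
qed

lemma place_ord_uminus:
  assumes P: "P \<in> places K" and a: "a \<in> carrier K" "a \<noteq> \<zero>"
  shows "place_ord K P (\<ominus> a) = place_ord K P a"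
proof -
  have m: "\<ominus> \<one> \<in> carrier K" "\<ominus> \<one> \<noteq> \<zero>" "(\<ominus> \<one>) \<otimes> (\<ominus> \<one>) = \<one>"
    by (simp, metis minus_zero minus_minus one_closed one_not_zero, simp add: l_minus)
  have "2 * place_ord K P (\<ominus> \<one>) = 0"
    using place_ord_mult[OF P m(1,2) m(1,2)] m(3) place_ord_one[OF P] by simp
  moreover have "\<ominus> a = (\<ominus> \<one>) \<otimes> a" using a by (simp add: l_minus)
  ultimately show ?thesis using place_ord_mult[OF P m(1,2) a] by simp
qed

text \<open>The ultrametric inequality, obtained by dividing by the summand of smaller order: c = b
  / a lies in P, hence so does 1 + c.\<close>

lemma place_ord_add:
  assumes P: "P \<in> places K" and a: "a \<in> carrier K" "a \<noteq> \<zero>" and b: "b \<in> carrier K"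
    and ab: "a \<oplus> b \<noteq> \<zero>" and le: "b = \<zero> \<or> place_ord K P a \<le> place_ord K P b"
  shows "place_ord K P a \<le> place_ord K P (a \<oplus> b)"
proof -
  define c where "c = b \<otimes> inv a"
  have ia: "inv a \<in> carrier K" "inv a \<noteq> \<zero>" "inv a \<otimes> a = \<one>" using inv_closed_nonzero[OF a] by auto
  have cc: "c \<in> carrier K" unfolding c_def using b ia by simp
  have "c \<otimes> a = b \<otimes> (inv a \<otimes> a)" unfolding c_def using a b ia(1) by (simp add: m_assoc)
  then have ca: "c \<otimes> a = b" using b ia(3) by simp
  have "c \<in> P"
  proof (cases "b = \<zero>")
    case True
    then show ?thesis unfolding c_def using ia subringE(2)[OF place_subring[OF P]] by simp
  next
    case False
    then have "place_ord K P c = place_ord K P b - place_ord K P a"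
      unfolding c_def using place_ord_mult[OF P b False ia(1,2)] place_ord_inv[OF P a] by simp
    moreover have "c \<noteq> \<zero>" using False ca a by auto
    ultimately show ?thesis using place_ord_nonneg_iff[OF P cc] le False by simp
  qed
  then have P1: "\<one> \<oplus> c \<in> P" using subringE(3,7)[OF place_subring[OF P]] by auto
  have eq: "a \<oplus> b = (\<one> \<oplus> c) \<otimes> a" using ca a cc by (simp add: l_distr)
  have c1: "\<one> \<oplus> c \<in> carrier K" "\<one> \<oplus> c \<noteq> \<zero>" using cc eq ab a by auto
  then have "0 \<le> place_ord K P (\<one> \<oplus> c)" using P1 place_ord_nonneg_iff[OF P c1] by simp
  then show ?thesis unfolding eq using place_ord_mult[OF P c1 a] by simp
qed

lemma mem_place_ideal_iff:
  assumes P: "P \<in> places K" and a: "a \<in> carrier K" "a \<noteq> \<zero>"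
  shows "a \<in> place_ideal K P \<longleftrightarrow> 1 \<le> place_ord K P a"
proof -
  obtain t where t: "uniformizer P t" using ex_uniformizer[OF P] .
  have tc: "t \<in> carrier K" "t \<noteq> \<zero>" using uniformizerE[OF P t] by auto
  have ot: "place_ord K P t = 1"
    using place_ord_eq[OF P t one_in_punits[OF P], of 1] tc int_pow_int[of K t 1] by simp
  have it: "inv t \<in> carrier K" "inv t \<noteq> \<zero>" "inv t \<otimes> t = \<one>" using inv_closed_nonzero[OF tc] by auto
  show ?thesis
  proof
    assume "a \<in> place_ideal K P"
    then obtain b where b: "a = b \<otimes> t" "b \<in> P" using uniformizerE(4)[OF P t] by auto
    then have "b \<in> carrier K" "b \<noteq> \<zero>" using place_carrier[OF P] a tc by auto
    then show "1 \<le> place_ord K P a"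
      using b place_ord_mult[OF P _ _ tc, of b] ot place_ord_nonneg_iff[OF P, of b] by simp
  next
    assume A: "1 \<le> place_ord K P a"
    have "place_ord K P (a \<otimes> inv t) = place_ord K P a - 1"
      using place_ord_mult[OF P a it(1,2)] place_ord_inv[OF P tc] ot by simp
    moreover have "a \<otimes> inv t \<noteq> \<zero>" using a it integral by blast
    ultimately have "a \<otimes> inv t \<in> P" using place_ord_nonneg_iff[OF P, of "a \<otimes> inv t"] a it A by simp
    moreover have "a = (a \<otimes> inv t) \<otimes> t" using a it tc by (simp add: m_assoc)
    ultimately show "a \<in> place_ideal K P" using uniformizerE(4)[OF P t] by blast
  qed
qed

lemma ex_place_ord:
  assumes P: "P \<in> places K"
  obtains s where "s \<in> carrier K" "s \<noteq> \<zero>" "place_ord K P s = n"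
proof -
  obtain t where t: "uniformizer P t" using ex_uniformizer[OF P] .
  have tc: "t \<in> carrier K" "t \<noteq> \<zero>" using uniformizerE[OF P t] by auto
  show thesis
    using that[of "t [^] n \<otimes> \<one>"] place_ord_eq[OF P t one_in_punits[OF P]] int_pow_nonzero_closed[OF tc]
    by simp
qed

end

subsection \<open>Valuation rings are discrete\<close>

definition (in field) valuation_subring :: "'a set \<Rightarrow> bool" where
  "valuation_subring V \<longleftrightarrow> subring V R \<and> (\<forall>a\<in>carrier R. a \<noteq> \<zero> \<longrightarrow> a \<in> V \<or> inv a \<in> V)"

definition (in field) unit_in :: "'a set \<Rightarrow> 'a \<Rightarrow> bool" where
  "unit_in V u \<longleftrightarrow> u \<in> V \<and> u \<noteq> \<zero> \<and> inv u \<in> V"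

context field
begin

lemma unit_in_factor:
  assumes V: "subring V R" and a: "a \<in> V" and b: "b \<in> V" and u: "unit_in V (a \<otimes> b)"
  shows "unit_in V a"
proof -
  have c: "a \<in> carrier R" "b \<in> carrier R" using a b subringE(1)[OF V] by auto
  then have nz: "a \<noteq> \<zero>" "b \<noteq> \<zero>" using u unfolding unit_in_def by auto
  note ia = inv_closed_nonzero[OF c(1) nz(1)] and ib = inv_closed_nonzero[OF c(2) nz(2)]
  have "b \<otimes> inv (a \<otimes> b) = (b \<otimes> inv b) \<otimes> inv a"
    unfolding inv_mult_field(1)[OF c(1) nz(1) c(2) nz(2)] using c ia(1) ib(1) by (simp add: m_ac)
  then have "inv a = b \<otimes> inv (a \<otimes> b)" unfolding ib(3) using ia(1) by simp
  moreover have "b \<otimes> inv (a \<otimes> b) \<in> V"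
    using b u subringE(6)[OF V] unfolding unit_in_def by auto
  ultimately show ?thesis using a nz unfolding unit_in_def by simp
qed

lemma subring_nat_pow: "subring V R \<Longrightarrow> a \<in> V \<Longrightarrow> a [^] (n :: nat) \<in> V"
  by (induction n) (auto simp: subringE)

text \<open>A valuation ring is local; the test element is r = c / (1 - c). If r is in V, then so is
  1 / (1 - c) = r + 1. Otherwise 1/r is in V, and 1/c = 1/r + 1 would make c a unit.\<close>

lemma valuation_one_minus:
  assumes V: "valuation_subring V" and c: "c \<in> V" "\<not> unit_in V c"
  shows "unit_in V (\<one> \<ominus> c)"
proof -
  have sub: "subring V R" using V unfolding valuation_subring_def by simp
  have cc: "c \<in> carrier R" using c subringE(1)[OF sub] by auto
  have d: "\<one> \<ominus> c \<in> V" using c subringE(3,5,7)[OF sub] unfolding a_minus_def by auto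
  have one: "unit_in V \<one>" using subringE(3)[OF sub] unfolding unit_in_def by simp
  show ?thesis
  proof (cases "c = \<zero>")
    case True
    then show ?thesis using one by (simp add: a_minus_def)
  next
    case False
    have d0: "\<one> \<ominus> c \<noteq> \<zero>"
    proof
      assume "\<one> \<ominus> c = \<zero>"
      then have "c = \<one>" using cc r_right_minus_eq[of \<one> c] by simp
      then show False using c one by simp
    qed
    have dc: "\<one> \<ominus> c \<in> carrier R" using cc by simp
    note ic = inv_closed_nonzero[OF cc False] and id = inv_closed_nonzero[OF dc d0]
    let ?r = "c \<otimes> inv (\<one> \<ominus> c)"
    have r: "?r \<in> carrier R" "?r \<noteq> \<zero>" using cc id integral False by auto
    have inv_r: "inv ?r = inv c \<otimes> (\<one> \<ominus> c)"
      using inv_mult_field(1)[OF cc False id(1,2)] field_Units dc d0 by simp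
    consider "?r \<in> V" | "inv ?r \<in> V"
      using V r unfolding valuation_subring_def by blast
    then show ?thesis
    proof cases
      case 1
      have "?r \<oplus> \<one> = (c \<oplus> (\<one> \<ominus> c)) \<otimes> inv (\<one> \<ominus> c)"
        using cc id(1) dc id(3) by (simp add: l_distr)
      also have "c \<oplus> (\<one> \<ominus> c) = \<one>" using cc by algebra
      finally have "inv (\<one> \<ominus> c) = ?r \<oplus> \<one>" using id(1) by simp
      moreover have "?r \<oplus> \<one> \<in> V" using 1 subringE(3,7)[OF sub] by auto
      ultimately show ?thesis using d d0 unfolding unit_in_def by simp
    next
      case 2
      have "inv ?r \<oplus> \<one> = inv c \<otimes> ((\<one> \<ominus> c) \<oplus> c)"
        unfolding inv_r using cc ic(1,4) dc by (simp add: r_distr)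
      also have "(\<one> \<ominus> c) \<oplus> c = \<one>" using cc by algebra
      finally have "inv c = inv ?r \<oplus> \<one>" using ic(1) by simp
      moreover have "inv ?r \<oplus> \<one> \<in> V" using 2 subringE(3,7)[OF sub] by auto
      ultimately have "unit_in V c" using c False unfolding unit_in_def by simp
      then show ?thesis using c by simp
    qed
  qed
qed

text \<open>Divisibility is total in a valuation ring: b / a can only fail to lie in V if its
  inverse does, and then b divides a. The same remark shows that the quotient is not a unit.\<close>

lemma valuation_total:
  assumes V: "valuation_subring V" and a: "a \<in> V" "a \<noteq> \<zero>" and b: "b \<in> V"
    and nd: "\<not> (\<exists>v\<in>V. a = b \<otimes> v)"
  shows "\<exists>s\<in>V. b = a \<otimes> s \<and> \<not> unit_in V s"
proof -
  have sub: "subring V R" using V unfolding valuation_subring_def by simp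
  have c: "a \<in> carrier R" "b \<in> carrier R" using a b subringE(1)[OF sub] by auto
  note ia = inv_closed_nonzero[OF c(1) a(2)]
  define s where "s = b \<otimes> inv a"
  have sc: "s \<in> carrier R" unfolding s_def using c ia by simp
  have "a \<otimes> s = b \<otimes> (a \<otimes> inv a)" unfolding s_def using c ia(1) by (simp add: m_ac)
  then have bs: "b = a \<otimes> s" unfolding ia(3) using c by simp
  have key: "\<not> (s \<noteq> \<zero> \<and> inv s \<in> V)"
  proof
    assume s: "s \<noteq> \<zero> \<and> inv s \<in> V"
    then have ivs: "inv s \<in> carrier R" "s \<otimes> inv s = \<one>" using inv_closed_nonzero[OF sc] by auto
    have "b \<otimes> inv s = a \<otimes> (s \<otimes> inv s)" unfolding bs using c sc ivs(1) by (simp add: m_assoc)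
    then have "a = b \<otimes> inv s" unfolding ivs(2) using c by simp
    then show False using nd s by blast
  qed
  then have "s \<in> V"
    using V sc subringE(2)[OF sub] unfolding valuation_subring_def by (cases "s = \<zero>") auto
  then show ?thesis using bs key unfolding unit_in_def by blast
qed

end

lemma (in global_function_field) finite_incongruent:
  assumes V: "subring V K" and w: "w \<in> V" "w \<noteq> \<zero>" and E: "E \<subseteq> V"
    and inc: "\<And>e e' y. e \<in> E \<Longrightarrow> e' \<in> E \<Longrightarrow> y \<in> V \<Longrightarrow> e \<ominus> e' = w \<otimes> y \<Longrightarrow> e = e'"
  shows "finite E"
proof -
  have "w \<in> carrier K" using w subringE(1)[OF V] by auto
  then obtain M where "\<forall>V E. subring V K \<longrightarrow> w \<in> V \<longrightarrow> E \<subseteq> V \<longrightarrow>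
    (\<forall>e\<in>E. \<forall>e'\<in>E. \<forall>y\<in>V. e \<ominus> e' = w \<otimes> y \<longrightarrow> e = e') \<longrightarrow> finite E \<and> card E \<le> M"
    using subring_quotient_bounded[OF _ w(2)] by blast
  from this[rule_format, OF V w(1) E] inc show ?thesis by blast
qed

text \<open>Only finitely many principal ideals lie strictly between xV and V, because nonunits
  generating different ones are incongruent modulo x. As divisibility is total, a maximal one among
  them contains every nonunit; if there are none, xV itself does.\<close>

lemma (in global_function_field) valuation_generator:
  assumes V: "valuation_subring V" and x: "x \<in> V" "x \<noteq> \<zero>" "\<not> unit_in V x"
  obtains t where "t \<in> V" "t \<noteq> \<zero>" "\<not> unit_in V t"
    "\<And>a. a \<in> V \<Longrightarrow> \<not> unit_in V a \<Longrightarrow> \<exists>b\<in>V. a = t \<otimes> b"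
proof -
  have sub: "subring V K" using V unfolding valuation_subring_def by simp
  have VK: "V \<subseteq> carrier K" using subringE(1)[OF sub] .
  define I where "I a = {a \<otimes> v | v. v \<in> V}" for a
  define T where "T = {a \<in> V. \<not> unit_in V a \<and> a \<notin> I x}"
  have T0: "a \<noteq> \<zero>" if "a \<in> T" for a
  proof
    assume "a = \<zero>"
    then have "a = x \<otimes> \<zero>" using x VK by auto
    then show False using that subringE(2)[OF sub] unfolding T_def I_def by blast
  qed
  have self: "a \<in> I a" if "a \<in> V" for a
    unfolding I_def using that VK subringE(3)[OF sub] by (intro CollectI exI[of _ \<one>]) auto
  have I_sub: "I b \<subseteq> I a" if "b \<in> I a" "a \<in> V" for a b
  proof
    fix c assume "c \<in> I b"
    then obtain v w where vw: "v \<in> V" "w \<in> V" "b = a \<otimes> w" "c = b \<otimes> v"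
      using \<open>b \<in> I a\<close> unfolding I_def by blast
    have "a \<in> carrier K" "w \<in> carrier K" "v \<in> carrier K" using vw VK that by auto
    then have "c = a \<otimes> (w \<otimes> v)" unfolding vw(4) vw(3) by (rule m_assoc)
    then show "c \<in> I a" unfolding I_def using vw subringE(6)[OF sub] by blast
  qed
  have fin: "finite (I ` T)"
  proof -
    define r where "r J = (SOME a. a \<in> T \<and> I a = J)" for J
    have r: "r J \<in> T \<and> I (r J) = J" if "J \<in> I ` T" for J
      unfolding r_def using that by (intro someI_ex[of "\<lambda>a. a \<in> T \<and> I a = J"]) auto
    \<comment> \<open>Here x = a s with a nonunit s, so b = a - x y = a (1 - s y), and 1 - s y is a
      unit. Thus members of T that are congruent modulo x generate the same ideal.\<close>
    have key: "I a = I b" if ab: "a \<in> T" "b \<in> T" "y \<in> V" "a \<ominus> b = x \<otimes> y" for a b y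
    proof -
      have c: "a \<in> carrier K" "b \<in> carrier K" "y \<in> carrier K" "x \<in> carrier K"
        using ab x VK unfolding T_def by auto
      have "\<not> (\<exists>v\<in>V. a = x \<otimes> v)" using ab unfolding T_def I_def by blast
      then obtain s where s: "s \<in> V" "x = a \<otimes> s" "\<not> unit_in V s"
        using valuation_total[OF V _ T0[OF ab(1)], of x] ab(1) x unfolding T_def by blast
      have sc: "s \<in> carrier K" using s VK by auto
      have sy: "s \<otimes> y \<in> V" "\<not> unit_in V (s \<otimes> y)"
        using s ab subringE(6)[OF sub] unit_in_factor[OF sub s(1) ab(3)] by auto
      define u where "u = \<one> \<ominus> s \<otimes> y"
      have u: "unit_in V u" unfolding u_def using valuation_one_minus[OF V sy] .
      have uc: "u \<in> carrier K" "u \<noteq> \<zero>" using u VK unfolding unit_in_def by auto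
      have "b = a \<ominus> (a \<ominus> b)" using c by algebra
      also have "\<dots> = a \<otimes> u" unfolding ab(4) u_def s(2) using c sc by algebra
      finally have b: "b = a \<otimes> u" .
      note iu = inv_closed_nonzero[OF uc]
      have "b \<otimes> inv u = a \<otimes> (u \<otimes> inv u)" unfolding b using c uc iu(1) by (simp add: m_assoc)
      then have a: "a = b \<otimes> inv u" unfolding iu(3) using c by simp
      have "b \<in> I a" "a \<in> I b" using a b u unfolding I_def unit_in_def by blast+
      then show ?thesis using I_sub ab unfolding T_def by blast
    qed
    have "finite (r ` I ` T)"
    proof (rule finite_incongruent[OF sub x(1,2)])
      show "r ` I ` T \<subseteq> V" using r unfolding T_def by blast
      fix e e' y assume e: "e \<in> r ` I ` T" "e' \<in> r ` I ` T" "y \<in> V" "e \<ominus> e' = x \<otimes> y"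
      then obtain J J' where J: "J \<in> I ` T" "e = r J" "J' \<in> I ` T" "e' = r J'" by blast
      then have "I e = I e'" using key[of e e' y] e r by metis
      then have "J = J'" using J r by metis
      then show "e = e'" using J by simp
    qed
    moreover have "inj_on r (I ` T)" using r by (metis inj_onI)
    ultimately show ?thesis using finite_imageD by blast
  qed
  show thesis
  proof (cases "T = {}")
    case True
    show thesis
    proof (rule that[OF x(1) x(2) x(3)])
      fix a assume "a \<in> V" "\<not> unit_in V a"
      then show "\<exists>b\<in>V. a = x \<otimes> b" using True unfolding T_def I_def by blast
    qed
  next
    case False
    then obtain J where J: "J \<in> I ` T" "\<And>J'. J' \<in> I ` T \<Longrightarrow> J \<subseteq> J' \<Longrightarrow> J = J'"
      using finite_has_maximal[OF fin] by blast
    then obtain t where t: "t \<in> T" "J = I t" by blast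
    have tV: "t \<in> V" "\<not> unit_in V t" "t \<notin> I x" using t unfolding T_def by auto
    show thesis
    proof (rule that[OF tV(1) T0[OF t(1)] tV(2)])
      fix a assume a: "a \<in> V" "\<not> unit_in V a"
      have xt: "x \<in> I t"
        using valuation_total[OF V tV(1) T0[OF t(1)] x(1)] tV(3) unfolding I_def by blast
      have "a \<in> I t"
      proof (cases "a \<in> I x")
        case True
        then show ?thesis using I_sub[OF xt tV(1)] by auto
      next
        case False
        then have aT: "a \<in> T" using a unfolding T_def by simp
        show ?thesis
        proof (rule ccontr)
          assume "a \<notin> I t"
          then have "t \<in> I a"
            using valuation_total[OF V a(1) T0[OF aT] tV(1)] unfolding I_def by blast
          then have "I t \<subseteq> I a" using I_sub a by blast
          then have "I t = I a" using J(2)[of "I a"] aT t by blast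
          then show False using self[OF a(1)] \<open>a \<notin> I t\<close> by simp
        qed
      qed
      then show "\<exists>b\<in>V. a = t \<otimes> b" unfolding I_def by blast
    qed
  qed
qed

text \<open>If splitting off t never ends, then a is divisible by every power of t. The powers of t
  are then pairwise incongruent modulo a: for i < j the difference t^i - t^j is t^i times a unit,
  whereas every multiple of a is divisible by t^j. This contradicts the finiteness of sets of
  incongruent elements.\<close>

lemma (in global_function_field) valuation_element_form:
  assumes V: "valuation_subring V" and t: "t \<in> V" "t \<noteq> \<zero>" "\<not> unit_in V t"
    and gen: "\<And>a. a \<in> V \<Longrightarrow> \<not> unit_in V a \<Longrightarrow> \<exists>b\<in>V. a = t \<otimes> b"
    and a: "a \<in> V" "a \<noteq> \<zero>"
  shows "\<exists>n u. unit_in V u \<and> a = t [^] (n :: nat) \<otimes> u"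
proof (rule ccontr)
  assume neg: "\<nexists>n u. unit_in V u \<and> a = t [^] (n :: nat) \<otimes> u"
  have sub: "subring V K" using V unfolding valuation_subring_def by simp
  have VK: "V \<subseteq> carrier K" using subringE(1)[OF sub] .
  have tc: "t \<in> carrier K" "a \<in> carrier K" using t a VK by auto
  have div: "\<exists>b\<in>V. a = t [^] n \<otimes> b" for n :: nat
  proof (induction n)
    case 0
    then show ?case using a tc by (intro bexI[of _ a]) auto
  next
    case (Suc n)
    then obtain b where b: "b \<in> V" "a = t [^] n \<otimes> b" by blast
    then have "\<not> unit_in V b" using neg by blast
    then obtain c where c: "c \<in> V" "b = t \<otimes> c" using gen b by blast
    then have cc: "c \<in> carrier K" using VK by auto
    have "t [^] n \<otimes> (t \<otimes> c) = t [^] Suc n \<otimes> c" using tc cc by (simp add: m_assoc)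
    then have "a = t [^] Suc n \<otimes> c" unfolding b(2) c(2) .
    then show ?case using c by blast
  qed
  have pow_nonunit: "\<not> unit_in V (t [^] Suc n)" for n
  proof
    assume "unit_in V (t [^] Suc n)"
    then have "unit_in V (t \<otimes> t [^] n)" using tc by (simp add: m_comm)
    then show False using unit_in_factor[OF sub t(1) subring_nat_pow[OF sub t(1)]] t(3) by blast
  qed
  have key: "\<not> (i < j \<and> y \<in> V \<and> t [^] i \<ominus> t [^] j = a \<otimes> y)" for i j :: nat and y
  proof
    assume A: "i < j \<and> y \<in> V \<and> t [^] i \<ominus> t [^] j = a \<otimes> y"
    obtain d where d: "j = i + Suc d" using A less_iff_Suc_add by auto
    obtain b where b: "b \<in> V" "a = t [^] j \<otimes> b" using div by blast
    have c: "b \<in> carrier K" "y \<in> carrier K" "t [^] i \<in> carrier K" "t [^] Suc d \<in> carrier K"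
      using b A VK tc by auto
    have tj: "t [^] j = t [^] i \<otimes> t [^] Suc d" unfolding d by (rule nat_pow_mult[OF tc(1), symmetric])
    have "t [^] i \<otimes> (\<one> \<ominus> t [^] Suc d) = t [^] i \<ominus> t [^] j"
      unfolding tj using c(3,4) by algebra
    also have "\<dots> = t [^] i \<otimes> (t [^] Suc d \<otimes> (b \<otimes> y))"
      using A unfolding b(2) tj using c by (simp add: m_assoc del: nat_pow_Suc)
    finally have eq: "\<one> \<ominus> t [^] Suc d = t [^] Suc d \<otimes> (b \<otimes> y)"
      using m_lcancel[of "t [^] i"] nat_pow_nonzero[OF tc(1) t(2)] c by auto
    have "unit_in V (\<one> \<ominus> t [^] Suc d)"
      by (rule valuation_one_minus[OF V subring_nat_pow[OF sub t(1)] pow_nonunit])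
    then have "unit_in V (t [^] Suc d \<otimes> (b \<otimes> y))" unfolding eq .
    moreover have "b \<otimes> y \<in> V" using b A subringE(6)[OF sub] by blast
    ultimately have "unit_in V (t [^] Suc d)"
      using unit_in_factor[OF sub subring_nat_pow[OF sub t(1)]] by blast
    then show False using pow_nonunit by blast
  qed
  have ne: "t [^] i = t [^] j \<Longrightarrow> i = j" for i j :: nat
  proof (rule ccontr)
    assume A: "t [^] i = t [^] j" "i \<noteq> j"
    have "t [^] i \<ominus> t [^] j = a \<otimes> \<zero>" "t [^] j \<ominus> t [^] i = a \<otimes> \<zero>"
      using A tc by (simp_all add: r_right_minus_eq)
    then show False using key[of i j \<zero>] key[of j i \<zero>] A(2) subringE(2)[OF sub] by (meson nat_neq_iff)
  qed
  have "finite (range (\<lambda>n :: nat. t [^] n))"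
  proof (rule finite_incongruent[OF sub a])
    show "range (\<lambda>n :: nat. t [^] n) \<subseteq> V" using subring_nat_pow[OF sub t(1)] by blast
    fix e e' y assume e: "e \<in> range (\<lambda>n :: nat. t [^] n)" "e' \<in> range (\<lambda>n :: nat. t [^] n)" "y \<in> V"
      and eq: "e \<ominus> e' = a \<otimes> y"
    then obtain i j :: nat where ij: "e = t [^] i" "e' = t [^] j" by blast
    have "t [^] j \<ominus> t [^] i = a \<otimes> (\<ominus> y)"
    proof -
      have yc: "y \<in> carrier K" using e VK by auto
      have "t [^] j \<ominus> t [^] i = \<ominus> (t [^] i \<ominus> t [^] j)" using tc by (simp add: minus_add a_minus_def a_comm)
      then show ?thesis using eq ij yc tc by (simp add: r_minus)
    qed
    moreover have "\<ominus> y \<in> V" using e subringE(5)[OF sub] by blast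
    ultimately have "\<not> i < j" "\<not> j < i"
      using key[of i j y] key[of j i "\<ominus> y"] eq e(3) unfolding ij by blast+
    then show "e = e'" using ij by simp
  qed
  moreover have "inj (\<lambda>n :: nat. t [^] n)" using ne by (intro injI) blast
  ultimately show False using finite_imageD by (metis infinite_UNIV_nat)
qed

subsection \<open>Existence of places\<close>

text \<open>A nonzero ideal is generated by the lowest power of t that it contains, so the nonzero
  ideals form the chain of powers of (t), and (t) is the only maximal one.\<close>

lemma (in field) discrete_valuation_ringI:
  assumes V: "subring V R" and t: "t \<in> V" "t \<noteq> \<zero>" "\<not> unit_in V t"
    and form: "\<And>a. a \<in> V \<Longrightarrow> a \<noteq> \<zero> \<Longrightarrow> \<exists>n u. unit_in V u \<and> a = t [^] (n :: nat) \<otimes> u"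
  shows "discrete_valuation_ring (R\<lparr>carrier := V\<rparr>)"
proof -
  let ?A = "R\<lparr>carrier := V\<rparr>"
  interpret A: domain ?A using subring_is_domain[OF V] .
  have VR: "V \<subseteq> carrier R" using subringE(1)[OF V] .
  have tc: "t \<in> carrier R" using t VR by auto
  have tn: "t [^] n \<in> V" for n :: nat using subring_nat_pow[OF V t(1)] .
  have absorb: "a \<in> I" if I: "ideal I ?A" and b: "b \<in> I" and a: "a = v \<otimes> b" "v \<in> V" for I a b v
    using ideal.I_l_closed[OF I b, of v] a by simp
  have pow_in: "t [^] n \<in> I" if I: "ideal I ?A" and a: "t [^] (n :: nat) \<otimes> u \<in> I" and u: "unit_in V u" for I n u
  proof (rule absorb[OF I a])
    have c: "u \<in> carrier R" "u \<noteq> \<zero>" using u VR unfolding unit_in_def by auto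
    note iu = inv_closed_nonzero[OF c]
    have "inv u \<otimes> (t [^] n \<otimes> u) = t [^] n \<otimes> (inv u \<otimes> u)" using tc c iu(1) by (simp add: m_ac)
    then show "t [^] n = inv u \<otimes> (t [^] n \<otimes> u)" unfolding iu(4) using tc by simp
    show "inv u \<in> V" using u unfolding unit_in_def by simp
  qed
  have gen: "\<exists>a\<in>V. I = PIdl\<^bsub>?A\<^esub> a" if I: "ideal I ?A" for I
  proof (cases "I \<subseteq> {\<zero>}")
    case True
    then have "I = {\<zero>}"
      using additive_subgroup.zero_closed[OF ideal.axioms(1)[OF I]] by auto
    moreover have "\<zero> = \<zero> \<otimes> \<zero>" by simp
    then have "PIdl\<^bsub>?A\<^esub> \<zero> = {\<zero>}"
      unfolding cgenideal_def using VR subringE(2)[OF V] by force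
    ultimately show ?thesis using subringE(2)[OF V] by blast
  next
    case False
    have IV: "I \<subseteq> V" using additive_subgroup.a_subset[OF ideal.axioms(1)[OF I]] by simp
    obtain a where a: "a \<in> I" "a \<noteq> \<zero>" using False by blast
    then have ex: "\<exists>n :: nat. t [^] n \<in> I" using form[of a] pow_in[OF I] IV by blast
    define n where "n = (LEAST n :: nat. t [^] n \<in> I)"
    have n: "t [^] n \<in> I" unfolding n_def using LeastI_ex[OF ex] .
    have least: "n \<le> m" if "t [^] m \<in> I" for m :: nat unfolding n_def using that by (rule Least_le)
    have "I = PIdl\<^bsub>?A\<^esub> (t [^] n)"
    proof
      show "PIdl\<^bsub>?A\<^esub> (t [^] n) \<subseteq> I"
        unfolding cgenideal_def using absorb[OF I n] by auto
      show "I \<subseteq> PIdl\<^bsub>?A\<^esub> (t [^] n)"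
      proof
        fix b assume b: "b \<in> I"
        show "b \<in> PIdl\<^bsub>?A\<^esub> (t [^] n)"
        proof (cases "b = \<zero>")
          case True
          then have "b = \<zero> \<otimes> t [^] n" using tc by simp
          then show ?thesis unfolding cgenideal_def using subringE(2)[OF V] by auto
        next
          case False
          then obtain m u where u: "unit_in V u" "b = t [^] (m :: nat) \<otimes> u" using form b IV by blast
          then have "n \<le> m" using least pow_in[OF I] b by blast
          then obtain d where d: "m = d + n" using le_Suc_ex by (metis add.commute)
          have uV: "u \<in> V" "u \<in> carrier R" using u VR unfolding unit_in_def by auto
          have "t [^] m = t [^] d \<otimes> t [^] n" unfolding d by (rule nat_pow_mult[OF tc, symmetric])
          then have "b = (u \<otimes> t [^] d) \<otimes> t [^] n" unfolding u(2) using uV tc by (simp add: m_ac)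
          then show ?thesis unfolding cgenideal_def using uV tn subringE(6)[OF V] by auto
        qed
      qed
    qed
    then show ?thesis using tn by blast
  qed
  interpret A: principal_domain ?A
    using gen by (intro principal_domain.intro A.domain_axioms principal_domain_axioms.intro) simp
  have nonunit: "t \<notin> Units ?A"
    using subring_Units_iff[OF V] t(3) unfolding unit_in_def by simp
  have "\<not> field ?A"
  proof
    assume "field ?A"
    then have "t \<in> Units ?A" using field.field_Units[of ?A] t by simp
    then show False using nonunit by simp
  qed
  moreover have "\<exists>!M. maximalideal M ?A"
  proof (rule ex1I)
    have sub: "J \<subseteq> PIdl\<^bsub>?A\<^esub> t" if J: "ideal J ?A" "J \<noteq> V" for J
    proof
      fix b assume b: "b \<in> J"
      have JV: "J \<subseteq> V" using additive_subgroup.a_subset[OF ideal.axioms(1)[OF J(1)]] by simp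
      show "b \<in> PIdl\<^bsub>?A\<^esub> t"
      proof (cases "b = \<zero>")
        case True
        then have "b = \<zero> \<otimes> t" using tc by simp
        then show ?thesis unfolding cgenideal_def using subringE(2)[OF V] by auto
      next
        case False
        then obtain m u where u: "unit_in V u" "b = t [^] (m :: nat) \<otimes> u" using form b JV by blast
        have "m \<noteq> 0"
        proof
          assume "m = 0"
          then have one: "\<one> \<in> J" using pow_in[OF J(1), of 0 u] u b by simp
          have "V \<subseteq> J"
          proof
            fix v assume v: "v \<in> V"
            then have "v = v \<otimes> \<one>" using VR by auto
            then show "v \<in> J" using absorb[OF J(1) one] v by blast
          qed
          then show False using J JV by blast
        qed
        then obtain d where d: "m = Suc d" using not0_implies_Suc by blast
        have uV: "u \<in> V" "u \<in> carrier R" using u VR unfolding unit_in_def by auto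
        have "b = (u \<otimes> t [^] d) \<otimes> t" unfolding u(2) d using uV tc by (simp add: m_ac)
        then show ?thesis unfolding cgenideal_def using uV tn subringE(6)[OF V] by auto
      qed
    qed
    have id: "ideal (PIdl\<^bsub>?A\<^esub> t) ?A" using A.cgenideal_ideal[of t] t by simp
    have ne: "PIdl\<^bsub>?A\<^esub> t \<noteq> V" using A.ideal_eq_carrier_iff[of t] nonunit t by auto
    show max: "maximalideal (PIdl\<^bsub>?A\<^esub> t) ?A"
    proof (rule maximalidealI[OF id])
      show "carrier ?A \<noteq> PIdl\<^bsub>?A\<^esub> t" using ne by auto
      fix J assume "ideal J ?A" "PIdl\<^bsub>?A\<^esub> t \<subseteq> J" "J \<subseteq> carrier ?A"
      then show "J = PIdl\<^bsub>?A\<^esub> t \<or> J = carrier ?A" using sub[of J] by auto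
    qed
    fix M assume M: "maximalideal M ?A"
    then have "M \<subseteq> PIdl\<^bsub>?A\<^esub> t"
      using sub[of M] maximalideal.axioms(1) maximalideal.I_notcarr by fastforce
    moreover have "PIdl\<^bsub>?A\<^esub> t \<subseteq> carrier ?A"
      using additive_subgroup.a_subset[OF ideal.axioms(1)[OF id]] .
    ultimately have "PIdl\<^bsub>?A\<^esub> t = M \<or> PIdl\<^bsub>?A\<^esub> t = carrier ?A"
      using maximalideal.I_maximal[OF M id] by blast
    then show "M = PIdl\<^bsub>?A\<^esub> t" using ne by simp
  qed
  ultimately show ?thesis
    unfolding discrete_valuation_ring_def using A.principal_domain_axioms by blast
qed

lemma (in ring) horner_sums_SucI:
  "e \<in> E \<Longrightarrow> y \<in> horner_sums E w n \<Longrightarrow> e \<oplus> w \<otimes> y \<in> horner_sums E w (Suc n)"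
  by auto

lemma (in ring) horner_sums_SucE:
  assumes "z \<in> horner_sums E w (Suc n)"
  obtains e y where "z = e \<oplus> w \<otimes> y" "e \<in> E" "y \<in> horner_sums E w n"
  using assms by auto

declare (in ring) horner_sums.simps(2) [simp del]

text \<open>With digits from the subring V itself these sets filter V[a] by degree; the five parts
  are the closure properties of that filtration.\<close>

lemma (in ring) horner_sums_props:
  assumes V: "subring V R" and a: "a \<in> carrier R"
  shows "\<zero> \<in> horner_sums V a n"
    and "y \<in> horner_sums V a n \<Longrightarrow> y' \<in> horner_sums V a n \<Longrightarrow> y \<oplus> y' \<in> horner_sums V a n"
    and "y \<in> horner_sums V a n \<Longrightarrow> y \<in> horner_sums V a (Suc n)"
    and "y \<in> horner_sums V a n \<Longrightarrow> a \<otimes> y \<in> horner_sums V a (Suc n)"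
    and "c \<in> V \<Longrightarrow> c \<in> horner_sums V a 1"
proof -
  have VR: "V \<subseteq> carrier R" using subringE(1)[OF V] .
  note hc = horner_sums_closed[OF VR a]
  have zero: "\<zero> \<in> horner_sums V a n" for n
  proof (induction n)
    case (Suc n)
    have "\<zero> = \<zero> \<oplus> a \<otimes> \<zero>" using a by simp
    then show ?case using horner_sums_SucI[OF subringE(2)[OF V] Suc] by metis
  qed simp
  then show "\<zero> \<in> horner_sums V a n" .
  show "y \<in> horner_sums V a n \<Longrightarrow> y' \<in> horner_sums V a n \<Longrightarrow> y \<oplus> y' \<in> horner_sums V a n"
  proof (induction n arbitrary: y y')
    case (Suc n)
    obtain e z where y: "y = e \<oplus> a \<otimes> z" "e \<in> V" "z \<in> horner_sums V a n"
      using horner_sums_SucE[OF Suc.prems(1)] .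
    obtain e' z' where y': "y' = e' \<oplus> a \<otimes> z'" "e' \<in> V" "z' \<in> horner_sums V a n"
      using horner_sums_SucE[OF Suc.prems(2)] .
    have c: "e \<in> carrier R" "e' \<in> carrier R" "z \<in> carrier R" "z' \<in> carrier R"
      using y y' VR hc by auto
    have "y \<oplus> y' = (e \<oplus> e') \<oplus> a \<otimes> (z \<oplus> z')"
      unfolding y(1) y'(1) using c a by (simp add: r_distr a_ac)
    then show ?case
      using horner_sums_SucI[OF subringE(7)[OF V y(2) y'(2)] Suc.IH[OF y(3) y'(3)]] by metis
  qed simp
  show "y \<in> horner_sums V a n \<Longrightarrow> y \<in> horner_sums V a (Suc n)"
  proof (induction n arbitrary: y)
    case 0
    then show ?case using zero[of "Suc 0"] by simp
  next
    case (Suc n)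
    then show ?case using horner_sums_SucE[OF Suc.prems] horner_sums_SucI by metis
  qed
  show "y \<in> horner_sums V a n \<Longrightarrow> a \<otimes> y \<in> horner_sums V a (Suc n)"
  proof -
    assume y: "y \<in> horner_sums V a n"
    have "y \<in> carrier R" using y hc by blast
    then have "a \<otimes> y = \<zero> \<oplus> a \<otimes> y" using a by simp
    then show ?thesis using horner_sums_SucI[OF subringE(2)[OF V] y] by metis
  qed
  show "c \<in> V \<Longrightarrow> c \<in> horner_sums V a 1"
  proof -
    assume c: "c \<in> V"
    then have "c = c \<oplus> a \<otimes> \<zero>" using a VR by auto
    then show ?thesis using horner_sums_SucI[OF c zero[of 0]] by simp
  qed
qed

lemma (in cring) horner_sums_smult:
  assumes V: "subring V R" and a: "a \<in> carrier R" and c: "c \<in> V"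
  shows "y \<in> horner_sums V a n \<Longrightarrow> c \<otimes> y \<in> horner_sums V a n"
proof (induction n arbitrary: y)
  case 0
  then show ?case using c subringE(1)[OF V] by auto
next
  case (Suc n)
  have VR: "V \<subseteq> carrier R" using subringE(1)[OF V] .
  obtain e z where y: "y = e \<oplus> a \<otimes> z" "e \<in> V" "z \<in> horner_sums V a n"
    using horner_sums_SucE[OF Suc.prems] .
  have cc: "e \<in> carrier R" "z \<in> carrier R" "c \<in> carrier R"
    using y VR c horner_sums_closed[OF VR a] by auto
  have "c \<otimes> y = (c \<otimes> e) \<oplus> a \<otimes> (c \<otimes> z)" unfolding y(1) using cc a by algebra
  then show ?case using horner_sums_SucI[OF subringE(6)[OF V c y(2)] Suc.IH[OF y(3)]] by metis
qed

lemma (in ring) simple_extension_horner: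
  assumes V: "subring V R" and a: "a \<in> carrier R" and y: "y \<in> simple_extension V a" and comm: "cring R"
  shows "\<exists>n. y \<in> horner_sums V a n"
  using y
proof (induction rule: simple_extension.induct)
  case zero
  then show ?case using horner_sums_props(1)[OF V a] by blast
next
  case (lin k1 k2)
  then obtain n where n: "k1 \<in> horner_sums V a n" by blast
  have c: "k1 \<in> carrier R" "k2 \<in> carrier R"
    using n lin horner_sums_closed[OF subringE(1)[OF V] a] subringE(1)[OF V] by auto
  have "k1 \<otimes> a \<oplus> k2 = k2 \<oplus> a \<otimes> k1"
    using c a cring.cring_simprules(14)[OF comm] a_comm by simp
  then have "k1 \<otimes> a \<oplus> k2 \<in> horner_sums V a (Suc n)" using horner_sums_SucI[OF lin(2) n] by simp
  then show ?case by blast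
qed

lemma (in field) horner_sums_pow:
  assumes V: "subring V R" and a: "a \<in> carrier R" and c: "c \<in> V"
  shows "c \<otimes> a [^] n \<in> horner_sums V a (Suc n)"
proof (induction n)
  case 0
  have "c \<otimes> a [^] (0 :: nat) = c" using c subringE(1)[OF V] by auto
  then show ?case using horner_sums_props(5)[OF V a c] by simp
next
  case (Suc n)
  have "c \<otimes> a [^] Suc n = a \<otimes> (c \<otimes> a [^] n)" using a c subringE(1)[OF V] by (auto simp: m_ac)
  then show ?case using horner_sums_props(4)[OF V a Suc] by simp
qed

lemma (in field) horner_sums_top:
  assumes V: "subring V R" and a: "a \<in> carrier R"
  shows "y \<in> horner_sums V a (Suc n) \<Longrightarrow> \<exists>g\<in>horner_sums V a n. \<exists>c\<in>V. y = g \<oplus> c \<otimes> a [^] n"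
proof (induction n arbitrary: y)
  case 0
  then obtain e where "y = e \<oplus> a \<otimes> \<zero>" "e \<in> V" by (auto elim: horner_sums_SucE)
  then have "y = \<zero> \<oplus> e \<otimes> a [^] (0 :: nat)" using a subringE(1)[OF V] by auto
  then show ?case using \<open>e \<in> V\<close> by auto
next
  case (Suc n)
  obtain e z where y: "y = e \<oplus> a \<otimes> z" "e \<in> V" "z \<in> horner_sums V a (Suc n)"
    using horner_sums_SucE[OF Suc.prems] .
  obtain g c where g: "g \<in> horner_sums V a n" "c \<in> V" "z = g \<oplus> c \<otimes> a [^] n" using Suc.IH[OF y(3)] by blast
  have cc: "e \<in> carrier R" "g \<in> carrier R" "c \<in> carrier R" "a [^] n \<in> carrier R"
    using y g subringE(1)[OF V] horner_sums_closed[OF subringE(1)[OF V] a] a by auto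
  have "y = (e \<oplus> a \<otimes> g) \<oplus> c \<otimes> a [^] Suc n"
    unfolding y(1) g(3) nat_pow_Suc using cc a by algebra
  moreover have "e \<oplus> a \<otimes> g \<in> horner_sums V a (Suc n)" using horner_sums_SucI[OF y(2) g(1)] .
  ultimately show ?case using g by blast
qed

text \<open>Reversal of coefficients: a^i times a polynomial of degree at most i in b = 1/a is a
  polynomial of degree at most i in a.\<close>

lemma (in field) horner_sums_shift:
  assumes V: "subring V R" and a: "a \<in> carrier R" "b \<in> carrier R" "a \<otimes> b = \<one>"
  shows "y \<in> horner_sums V b j \<Longrightarrow> j \<le> Suc i \<Longrightarrow> a [^] i \<otimes> y \<in> horner_sums V a (Suc i)"
proof (induction i arbitrary: j y)
  case 0
  then consider "j = 0" | "j = Suc 0" by linarith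
  then show ?case
  proof cases
    case 1
    then show ?thesis using 0 horner_sums_props(1)[OF V a(1), of "Suc 0"] by simp
  next
    case 2
    then obtain e where e: "y = e \<oplus> b \<otimes> \<zero>" "e \<in> V" using 0 by (auto elim: horner_sums_SucE)
    then have "a [^] (0 :: nat) \<otimes> y = e" using a subringE(1)[OF V] by auto
    then show ?thesis using horner_sums_props(5)[OF V a(1) e(2)] by simp
  qed
next
  case (Suc i)
  show ?case
  proof (cases j)
    case 0
    then show ?thesis using Suc.prems horner_sums_props(1)[OF V a(1)] a
      by (metis horner_sums.simps(1) nat_pow_closed r_null singletonD)
  next
    case (Suc j')
    then obtain e z where y: "y = e \<oplus> b \<otimes> z" "e \<in> V" "z \<in> horner_sums V b j'"
      using Suc.prems by (auto elim: horner_sums_SucE)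
    have IH: "a [^] i \<otimes> z \<in> horner_sums V a (Suc i)" using Suc.IH[OF y(3)] Suc Suc.prems by simp
    have c: "e \<in> carrier R" "z \<in> carrier R" "a [^] i \<in> carrier R"
      using y subringE(1)[OF V] horner_sums_closed[OF subringE(1)[OF V] a(2)] a by auto
    have "a [^] Suc i \<otimes> y = e \<otimes> a [^] Suc i \<oplus> a [^] i \<otimes> ((a \<otimes> b) \<otimes> z)"
      unfolding y(1) nat_pow_Suc using c a(1,2) by algebra
    then have "a [^] Suc i \<otimes> y = e \<otimes> a [^] Suc i \<oplus> a [^] i \<otimes> z" unfolding a(3) using c by simp
    moreover have "e \<otimes> a [^] Suc i \<in> horner_sums V a (Suc (Suc i))" by (rule horner_sums_pow[OF V a(1) y(2)])
    moreover have "a [^] i \<otimes> z \<in> horner_sums V a (Suc (Suc i))" by (rule horner_sums_props(3)[OF V a(1) IH])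
    ultimately show ?thesis using horner_sums_props(2)[OF V a(1)] by metis
  qed
qed

section \<open>Cardinality of vector spaces over a finite field\<close>

lemma (in ring) dimension_card:
  assumes F: "subfield F R" "finite F" and E: "dimension n F E"
  shows "finite E" "card E = card F ^ n"
proof -
  obtain Us where Us: "set Us \<subseteq> carrier R" "independent F Us" "length Us = n" "Span F Us = E"
    using exists_base[OF F(1) E] by blast
  define L where "L = {Ks. set Ks \<subseteq> F \<and> length Ks = n}"
  have finL: "finite L" "card L = card F ^ n"
    unfolding L_def using finite_lists_length_eq[OF F(2)] card_lists_length_eq[OF F(2)] by auto
  have "bij_betw (\<lambda>Ks. combine Ks Us) L E"
    unfolding bij_betw_def
  proof
    show "(\<lambda>Ks. combine Ks Us) ` L = E"
      using Span_eq_combine_set_length_version[OF F(1) Us(1)] Us(3,4) unfolding L_def by auto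
    then show "inj_on (\<lambda>Ks. combine Ks Us) L"
      using unique_decomposition[OF F(1) Us(2)] Us(3,4) unfolding L_def
      by (intro inj_onI) (metis (mono_tags, lifting) image_eqI mem_Collect_eq)
  qed
  then show "finite E" "card E = card F ^ n"
    using finL bij_betw_finite bij_betw_same_card by metis+
qed

lemma (in ring) finite_subalgebra_dim:
  assumes F: "subfield F R" "finite F" and E: "subalgebra F E R" "finite E"
  shows "card E = card F ^ dim F E"
proof -
  obtain us where us: "set us = E" using finite_list[OF E(2)] by blast
  have ER: "set us \<subseteq> carrier R" using us subalgebra_in_carrier[OF E(1)] by simp
  have "Span F us \<subseteq> E"
  proof (rule Span_min[OF F(1) ER subalgebra.axioms(1)[OF E(1)]])
    show "F <#> set us \<subseteq> E"
      unfolding us set_mult_def using subalgebra.smult_closed[OF E(1)] by auto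
  qed
  then have "Span F us = E" using Span_base_incl[OF F(1) ER] us by auto
  then have "finite_dimension F E" using Span_finite_dimension[OF F(1) ER] by simp
  then have "dimension (dim F E) F E" using finite_dimensionE[OF F(1)] unfolding over_def by blast
  then show ?thesis using dimension_card[OF F] by blast
qed

section \<open>Chevalley's argument: every non-constant has a pole\<close>

context global_function_field
begin

lemma subfield_constant_field: "subfield (constant_field K) K"
  using subfield_of_algebraics[OF subfield_prime_subfield] unfolding constant_field_def over_def .

text \<open>An algebraic element generates a finite ring over the finite prime field, so two of its
  powers coincide.\<close>

lemma constant_root_of_unity:
  assumes c: "c \<in> constant_field K" "c \<noteq> \<zero>"
  obtains n :: nat where "n > 0" "c [^] n = \<one>"
proof -
  have cc: "c \<in> carrier K" and alg: "(algebraic over (prime_subfield K)) c"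
    using c unfolding constant_field_def over_def by auto
  have "finite_dimension (prime_subfield K) (simple_extension (prime_subfield K) c)"
    using finite_dimension_simple_extension[OF subfield_prime_subfield cc] alg by simp
  then have fin: "finite (simple_extension (prime_subfield K) c)"
    using dimension_card[OF subfield_prime_subfield finite_prime_subfield] unfolding finite_dimension_def
    by blast
  have sub: "subring (simple_extension (prime_subfield K) c) K"
    using simple_extension_is_subring[OF subfieldE(1)[OF subfield_prime_subfield] cc] .
  have "c \<in> simple_extension (prime_subfield K) c"
    using simple_extension_mem[OF subfieldE(1)[OF subfield_prime_subfield] cc] .
  then have "range (\<lambda>n :: nat. c [^] n) \<subseteq> simple_extension (prime_subfield K) c"
    using subring_nat_pow[OF sub] by blast
  then have "\<not> inj (\<lambda>n :: nat. c [^] n)"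
    using fin finite_subset finite_imageD infinite_UNIV_nat by metis
  then obtain i j :: nat where ij: "c [^] i = c [^] j" "i \<noteq> j" unfolding inj_def by blast
  have key: "\<exists>n :: nat. n > 0 \<and> c [^] n = \<one>" if "c [^] i = c [^] j" "i < j" for i j :: nat
  proof -
    have "c [^] i \<otimes> c [^] (j - i) = c [^] i \<otimes> \<one>"
      using nat_pow_mult[OF cc, of i "j - i"] that cc by simp
    then have "c [^] (j - i) = \<one>"
      using m_lcancel[of "c [^] i" "c [^] (j - i)" \<one>] nat_pow_nonzero[OF cc c(2)] cc by simp
    then show ?thesis using that by (intro exI[of _ "j - i"]) simp
  qed
  show thesis
    using key[of i j] key[of j i] ij that by (metis nat_neq_iff)
qed

text \<open>An identity 1/x = p(x) would make x a root of X p(X) - 1, which is not the zero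
  polynomial because its value at 0 is -1.\<close>

lemma inverse_not_in_simple_extension:
  assumes x: "x \<in> carrier K" "x \<noteq> \<zero>" "x \<notin> constant_field K"
  shows "inv x \<notin> simple_extension (prime_subfield K) x"
proof
  let ?k = "prime_subfield K"
  assume "inv x \<in> simple_extension ?k x"
  have sub: "subring ?k K" using subfieldE(1)[OF subfield_prime_subfield] .
  then obtain p where p: "p \<in> carrier (?k [X])" "inv x = eval p x"
    using \<open>inv x \<in> _\<close> simple_extension_as_eval_img[OF subringE(1)[OF sub] x(1)] by blast
  interpret UP: domain "?k [X]" using univ_poly_is_domain[OF sub] .
  interpret ev: ring_hom_ring "?k [X]" K "\<lambda>p. eval p x" using eval_ring_hom[OF sub x(1)] .
  interpret ev0: ring_hom_ring "?k [X]" K "\<lambda>p. eval p \<zero>" using eval_ring_hom[OF sub zero_closed] .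
  have X: "X \<in> carrier (?k [X])" using var_closed(1)[OF sub] .
  define r where "r = X \<otimes>\<^bsub>?k [X]\<^esub> p \<ominus>\<^bsub>?k [X]\<^esub> \<one>\<^bsub>?k [X]\<^esub>"
  have r: "r \<in> carrier (?k [X])" unfolding r_def using X p by simp
  have "eval r x = x \<otimes> inv x \<ominus> \<one>"
    unfolding r_def a_minus_def using X p x(1) eval_var by simp
  then have "eval r x = \<zero>" using inv_closed_nonzero[OF x(1,2)] by simp
  moreover have "eval r \<zero> = \<ominus> \<one>"
    unfolding r_def a_minus_def using X p eval_var[OF zero_closed] by simp
  then have "r \<noteq> []"
    using one_not_zero minus_minus[OF one_closed] minus_zero by force
  ultimately have "(algebraic over ?k) x" using algebraicI[OF r] by blast
  then show False using x unfolding constant_field_def over_def by simp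
qed

text \<open>Zorn's lemma. The family of subrings is nonempty because 1/z is again non-constant, so z
  is not a polynomial in 1/z over the prime field.\<close>

lemma ex_maximal_subring_avoiding:
  assumes z: "z \<in> carrier K" "z \<notin> constant_field K"
  obtains V where "subring V K" "inv z \<in> V" "z \<notin> V"
    "\<And>W. subring W K \<Longrightarrow> V \<subseteq> W \<Longrightarrow> z \<notin> W \<Longrightarrow> W = V"
proof -
  have z0: "z \<noteq> \<zero>" using z subringE(2)[OF subfieldE(1)[OF subfield_constant_field]] by auto
  note iz = inv_closed_nonzero[OF z(1) z0]
  have izk: "inv z \<notin> constant_field K"
  proof
    assume "inv z \<in> constant_field K"
    then have "inv (inv z) \<in> constant_field K"
      using subfield_m_inv(1)[OF subfield_constant_field, of "inv z"] iz by simp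
    then show False using z z0 field_Units by simp
  qed
  define A where "A = {V. subring V K \<and> inv z \<in> V \<and> z \<notin> V}"
  have sub: "subring (prime_subfield K) K" using subfieldE(1)[OF subfield_prime_subfield] .
  have start: "simple_extension (prime_subfield K) (inv z) \<in> A"
    unfolding A_def using simple_extension_is_subring[OF sub iz(1)] simple_extension_mem[OF sub iz(1)]
      inverse_not_in_simple_extension[OF iz(1,2) izk] z z0 field_Units by simp
  have "\<exists>M\<in>A. \<forall>Y\<in>A. M \<subseteq> Y \<longrightarrow> Y = M"
  proof (rule subset_Zorn_nonempty)
    show "A \<noteq> {}" using start by blast
  next
    fix C :: "'a set set" assume C: "C \<noteq> {}" "subset.chain A C"
    have CA: "C \<subseteq> A" and tot: "\<And>Y Y2. Y \<in> C \<Longrightarrow> Y2 \<in> C \<Longrightarrow> Y \<subseteq> Y2 \<or> Y2 \<subseteq> Y"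
      using C(2) unfolding subset_chain_def by blast+
    have S: "subring Y K" if "Y \<in> C" for Y using that CA unfolding A_def by blast
    have "subring (\<Union>C) K"
    proof (rule subringI)
      show "\<Union>C \<subseteq> carrier K" using subringE(1)[OF S] by blast
      show "\<one> \<in> \<Union>C" using C(1) subringE(3)[OF S] by blast
    next
      fix h assume "h \<in> \<Union>C" then show "\<ominus> h \<in> \<Union>C" using subringE(5)[OF S] by blast
    next
      fix h1 h2 assume "h1 \<in> \<Union>C" "h2 \<in> \<Union>C"
      then obtain Y where Y: "Y \<in> C" "h1 \<in> Y" "h2 \<in> Y" using tot by (metis UnionE subsetD)
      then show "h1 \<otimes> h2 \<in> \<Union>C" "h1 \<oplus> h2 \<in> \<Union>C" using subringE(6,7)[OF S[OF Y(1)]] by blast+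
    qed
    then show "\<Union>C \<in> A" using C(1) CA unfolding A_def by blast
  qed
  then obtain V where V: "V \<in> A" "\<And>W. W \<in> A \<Longrightarrow> V \<subseteq> W \<Longrightarrow> W = V" by blast
  show thesis
    using that[of V] V unfolding A_def by blast
qed

text \<open>Suppose that neither a nor 1/a lies in V. By maximality z is a polynomial over V in a,
  and also one in 1/a. Of the two shortest expressions the longer one can be shortened with the help
  of the other, because 1/z lies in the Jacobson radical of V.\<close>

lemma maximal_avoiding_is_valuation:
  assumes z: "z \<in> carrier K" "z \<noteq> \<zero>" and V: "subring V K" "inv z \<in> V" "z \<notin> V"
    and max: "\<And>W. subring W K \<Longrightarrow> V \<subseteq> W \<Longrightarrow> z \<notin> W \<Longrightarrow> W = V"
  shows "valuation_subring V"
proof -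
  have VK: "V \<subseteq> carrier K" using subringE(1)[OF V(1)] .
  define x where "x = inv z"
  have x: "x \<in> carrier K" "x \<noteq> \<zero>" "x \<in> V" "x \<otimes> z = \<one>" "z \<otimes> x = \<one>"
    using inv_closed_nonzero[OF z] V(2) unfolding x_def by auto
  have ext: "\<exists>n. z \<in> horner_sums V a n" if a: "a \<in> carrier K" "a \<notin> V" for a
  proof -
    have "z \<in> simple_extension V a"
    proof (rule ccontr)
      assume "z \<notin> simple_extension V a"
      then have "simple_extension V a = V"
        using max[of "simple_extension V a"] simple_extension_is_subring[OF V(1) a(1)]
          simple_extension_incl[OF VK a(1)] by blast
      then show False using simple_extension_mem[OF V(1) a(1)] a(2) by simp
    qed
    then show ?thesis using simple_extension_horner[OF V(1) a(1)] is_cring by blast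
  qed
  \<comment> \<open>If 1/s were outside V, then z would be a polynomial in 1/s. The power s^n clears
    its denominators and has the form 1 - x b', so z (1 - x b') = z - b' lies in V, and with it
    z.\<close>
  have unit: "unit_in V (\<one> \<ominus> x \<otimes> b)" if b: "b \<in> V" for b
  proof -
    have bc: "b \<in> carrier K" using b VK by auto
    define s where "s = \<one> \<ominus> x \<otimes> b"
    have s: "s \<in> V" "s \<in> carrier K"
      unfolding s_def a_minus_def using b x bc subringE(3,5,6,7)[OF V(1)] by auto
    have s0: "s \<noteq> \<zero>"
    proof
      assume "s = \<zero>"
      then have "x \<otimes> b = \<one>" using r_right_minus_eq[of \<one> "x \<otimes> b"] x bc unfolding s_def by simp
      then have "z = z \<otimes> (x \<otimes> b)" using z by simp
      also have "\<dots> = (z \<otimes> x) \<otimes> b" using z(1) x(1) bc by (simp add: m_assoc)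
      also have "\<dots> = b" unfolding x(5) using bc by simp
      finally show False using b V by simp
    qed
    note is' = inv_closed_nonzero[OF s(2) s0]
    have "inv s \<in> V"
    proof (rule ccontr)
      assume "inv s \<notin> V"
      then obtain n where n: "z \<in> horner_sums V (inv s) n" using ext is' by blast
      have clear: "s [^] n \<otimes> y \<in> V" if "y \<in> horner_sums V (inv s) n" for y n
        using that
      proof (induction n arbitrary: y)
        case 0
        then show ?case using subringE(2)[OF V(1)] by simp
      next
        case (Suc n)
        obtain e w where y: "y = e \<oplus> inv s \<otimes> w" "e \<in> V" "w \<in> horner_sums V (inv s) n"
          using horner_sums_SucE[OF Suc.prems] .
        have c: "e \<in> carrier K" "w \<in> carrier K" "s [^] n \<in> carrier K"
          using y VK horner_sums_closed[OF VK is'(1)] s by auto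
        have "s [^] Suc n \<otimes> y = s [^] Suc n \<otimes> e \<oplus> (s \<otimes> inv s) \<otimes> (s [^] n \<otimes> w)"
          unfolding y(1) nat_pow_Suc using c s(2) is'(1) by algebra
        also have "\<dots> = s [^] Suc n \<otimes> e \<oplus> s [^] n \<otimes> w"
          unfolding is'(3) using c s by simp
        also have "\<dots> \<in> V"
          using Suc.IH[OF y(3)] y(2) subring_nat_pow[OF V(1) s(1)] subringE(6,7)[OF V(1)] by blast
        finally show ?case .
      qed
      have spow: "\<exists>b'\<in>V. s [^] n = \<one> \<ominus> x \<otimes> b'" for n :: nat
      proof (induction n)
        case 0
        have "\<one> = \<one> \<ominus> x \<otimes> \<zero>" using x by (simp add: a_minus_def)
        then show ?case using subringE(2)[OF V(1)] by auto
      next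
        case (Suc n)
        then obtain b' where b': "b' \<in> V" "s [^] n = \<one> \<ominus> x \<otimes> b'" by blast
        have bc': "b' \<in> carrier K" using b' VK by auto
        have "s [^] Suc n = \<one> \<ominus> x \<otimes> (b \<oplus> b' \<ominus> x \<otimes> b' \<otimes> b)"
          unfolding nat_pow_Suc b'(2) unfolding s_def using x(1) bc bc' by algebra
        moreover have "b \<oplus> b' \<ominus> x \<otimes> b' \<otimes> b \<in> V"
          unfolding a_minus_def using b b' x subringE(5,6,7)[OF V(1)] by auto
        ultimately show ?case by blast
      qed
      obtain b' where b': "b' \<in> V" "s [^] n = \<one> \<ominus> x \<otimes> b'" using spow by blast
      have bc': "b' \<in> carrier K" using b' VK by auto
      have "(\<one> \<ominus> x \<otimes> b') \<otimes> z \<in> V" using clear[OF n] unfolding b'(2) .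
      moreover have "(\<one> \<ominus> x \<otimes> b') \<otimes> z = z \<ominus> (x \<otimes> z) \<otimes> b'"
        using x(1) z(1) bc' by algebra
      ultimately have "z \<ominus> b' \<in> V" unfolding x(4) using bc' by simp
      then have "(z \<ominus> b') \<oplus> b' \<in> V" using b' subringE(7)[OF V(1)] by blast
      moreover have "(z \<ominus> b') \<oplus> b' = z" using z(1) bc' by algebra
      ultimately show False using V by simp
    qed
    then show ?thesis using s s0 unfolding unit_in_def s_def by simp
  qed
  \<comment> \<open>The expression in b = 1/a shows u = 1 - x d = x (z - d) = x b y, so the unit u
    carries a factor 1/a. Multiplying z = g + c a^n by u therefore lowers the top degree, and
    dividing by u again contradicts the minimality of n.\<close>
  have core: False
    if ab: "a \<in> carrier K" "b \<in> carrier K" "a \<otimes> b = \<one>"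
      and n: "z \<in> horner_sums V a (Suc n)" "z \<notin> horner_sums V a n"
      and m: "z \<in> horner_sums V b (Suc m)" and le: "m \<le> n" for a b n m
  proof -
    have "m \<noteq> 0"
    proof
      assume "m = 0"
      then obtain e where "z = e \<oplus> b \<otimes> \<zero>" "e \<in> V" using m by (auto elim: horner_sums_SucE)
      then have "z \<in> V" using ab VK by auto
      then show False using V by simp
    qed
    then obtain i where i: "n = Suc i" using le by (cases n) auto
    obtain g c where g: "g \<in> horner_sums V a n" "c \<in> V" "z = g \<oplus> c \<otimes> a [^] n"
      using horner_sums_top[OF V(1) ab(1) n(1)] by blast
    obtain d y where d: "z = d \<oplus> b \<otimes> y" "d \<in> V" "y \<in> horner_sums V b m"
      using horner_sums_SucE[OF m] .
    have cl: "g \<in> carrier K" "c \<in> carrier K" "d \<in> carrier K" "y \<in> carrier K" "a [^] i \<in> carrier K"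
      using g(1,2) d(2,3) VK horner_sums_closed[OF VK ab(1), of n] horner_sums_closed[OF VK ab(2), of m] ab(1)
      by auto
    define u where "u = \<one> \<ominus> x \<otimes> d"
    have u: "unit_in V u" unfolding u_def using unit[OF d(2)] .
    have uc: "u \<in> carrier K" "u \<noteq> \<zero>" "u \<in> V" "inv u \<in> V" using u VK unfolding unit_in_def by auto
    have "u = x \<otimes> z \<ominus> x \<otimes> d" unfolding u_def x(4) ..
    also have "\<dots> = x \<otimes> (b \<otimes> y)" unfolding d(1) using x(1) cl ab(1,2) by algebra
    finally have ux: "u = x \<otimes> (b \<otimes> y)" .
    have "u \<otimes> z = u \<otimes> g \<oplus> (c \<otimes> a [^] n) \<otimes> u"
      unfolding g(3) using uc(1) cl(1,2) nat_pow_closed[OF ab(1), of n] by (simp add: r_distr m_comm)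
    also have "(c \<otimes> a [^] n) \<otimes> u = (c \<otimes> x) \<otimes> (a [^] i \<otimes> ((a \<otimes> b) \<otimes> y))"
      unfolding i ux nat_pow_Suc using cl ab(1,2) x(1) by algebra
    also have "\<dots> = (c \<otimes> x) \<otimes> (a [^] i \<otimes> y)" unfolding ab(3) using cl by simp
    finally have uz: "u \<otimes> z = u \<otimes> g \<oplus> (c \<otimes> x) \<otimes> (a [^] i \<otimes> y)" .
    have "a [^] i \<otimes> y \<in> horner_sums V a n"
      unfolding i using horner_sums_shift[OF V(1) ab d(3)] le i by simp
    then have "(c \<otimes> x) \<otimes> (a [^] i \<otimes> y) \<in> horner_sums V a n"
      using horner_sums_smult[OF V(1) ab(1)] subringE(6)[OF V(1) g(2) x(3)] by blast
    moreover have "u \<otimes> g \<in> horner_sums V a n" using horner_sums_smult[OF V(1) ab(1) uc(3) g(1)] .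
    ultimately have "u \<otimes> z \<in> horner_sums V a n" unfolding uz using horner_sums_props(2)[OF V(1) ab(1)] by blast
    then have "inv u \<otimes> (u \<otimes> z) \<in> horner_sums V a n" using horner_sums_smult[OF V(1) ab(1) uc(4)] by blast
    moreover have "inv u \<otimes> (u \<otimes> z) = z"
      using m_assoc[of "inv u" u z] inv_closed_nonzero[OF uc(1,2)] uc(1) z by simp
    ultimately show False using n by simp
  qed
  have minimal: "\<exists>n. z \<in> horner_sums V a (Suc n) \<and> z \<notin> horner_sums V a n"
    if "\<exists>n. z \<in> horner_sums V a n" for a
  proof -
    define N where "N = (LEAST n. z \<in> horner_sums V a n)"
    have N: "z \<in> horner_sums V a N" unfolding N_def using LeastI_ex[OF that] .
    then have "N \<noteq> 0" using z by (metis horner_sums.simps(1) singletonD)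
    then obtain n where n: "N = Suc n" using not0_implies_Suc by blast
    then have "z \<notin> horner_sums V a n" unfolding N_def using not_less_Least by (metis lessI)
    then show ?thesis using N n by blast
  qed
  show ?thesis
    unfolding valuation_subring_def
  proof (intro conjI ballI impI V(1))
    fix a assume a: "a \<in> carrier K" "a \<noteq> \<zero>"
    note ia = inv_closed_nonzero[OF a]
    show "a \<in> V \<or> inv a \<in> V"
    proof (rule ccontr)
      assume "\<not> (a \<in> V \<or> inv a \<in> V)"
      then obtain n m where n: "z \<in> horner_sums V a (Suc n)" "z \<notin> horner_sums V a n"
        and m: "z \<in> horner_sums V (inv a) (Suc m)" "z \<notin> horner_sums V (inv a) m"
        using minimal[OF ext[OF a(1)]] minimal[OF ext[OF ia(1)]] by blast
      show False
      proof (cases "m \<le> n")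
        case True
        then show ?thesis using core[OF a(1) ia(1) ia(3) n m(1)] by blast
      next
        case False
        then show ?thesis using core[OF ia(1) a(1) ia(4) m n(1)] by simp
      qed
    qed
  qed
qed

text \<open>A subring maximal among those that contain 1/z but not z is a valuation ring in which
  1/z is a nonzero nonunit; the counting bound then makes it discrete.\<close>

theorem ex_place_avoiding:
  assumes z: "z \<in> carrier K" "z \<notin> constant_field K"
  obtains P where "P \<in> places K" "z \<notin> P"
proof -
  have z0: "z \<noteq> \<zero>" using z subringE(2)[OF subfieldE(1)[OF subfield_constant_field]] by auto
  obtain V where V: "subring V K" "inv z \<in> V" "z \<notin> V"
    and max: "\<And>W. subring W K \<Longrightarrow> V \<subseteq> W \<Longrightarrow> z \<notin> W \<Longrightarrow> W = V"
    using ex_maximal_subring_avoiding[OF z] by blast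
  have val: "valuation_subring V" using maximal_avoiding_is_valuation[OF z(1) z0 V max] .
  have VK: "V \<subseteq> carrier K" using subringE(1)[OF V(1)] .
  have "\<not> unit_in V (inv z)"
    using V(3) z(1) z0 field_Units unfolding unit_in_def by simp
  then obtain t where t: "t \<in> V" "t \<noteq> \<zero>" "\<not> unit_in V t"
    and gen: "\<And>a. a \<in> V \<Longrightarrow> \<not> unit_in V a \<Longrightarrow> \<exists>b\<in>V. a = t \<otimes> b"
    using valuation_generator[OF val V(2) inv_closed_nonzero(2)[OF z(1) z0]] by blast
  have dvr: "discrete_valuation_ring (K\<lparr>carrier := V\<rparr>)"
    using discrete_valuation_ringI[OF V(1) t valuation_element_form[OF val t gen]] by blast
  \<comment> \<open>Nonzero constants are roots of unity. If c were outside V, then 1/c would be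
    inside, and c = (1/c)^(n-1) as well.\<close>
  have const: "constant_field K \<subseteq> V"
  proof
    fix c assume c: "c \<in> constant_field K"
    show "c \<in> V"
    proof (cases "c = \<zero>")
      case True
      then show ?thesis using subringE(2)[OF V(1)] by simp
    next
      case False
      obtain n :: nat where n: "n > 0" "c [^] n = \<one>" using constant_root_of_unity[OF c False] .
      have cc: "c \<in> carrier K" using c unfolding constant_field_def by simp
      show ?thesis
      proof (rule ccontr)
        assume cV: "c \<notin> V"
        then have iV: "inv c \<in> V" using val cc False unfolding valuation_subring_def by blast
        obtain m where m: "n = Suc m" using n(1) gr0_implies_Suc by blast
        note ic = inv_closed_nonzero[OF cc False]
        have "inv c [^] m = c"
        proof -
          have "c [^] m \<otimes> inv c [^] m = \<one>"
          proof (induction m)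
            case (Suc m)
            have "c [^] Suc m \<otimes> inv c [^] Suc m = (c [^] m \<otimes> inv c [^] m) \<otimes> (c \<otimes> inv c)"
              using cc ic(1) by (simp add: m_ac)
            then show ?case unfolding Suc ic(3) by simp
          qed simp
          moreover have "c [^] m \<otimes> c = \<one>" using n m by simp
          ultimately show ?thesis
            using cc ic(1) m_lcancel[of "c [^] m" "inv c [^] m" c] nat_pow_nonzero[OF cc False] by simp
        qed
        then show False using subring_nat_pow[OF V(1) iV, of m] cV by simp
      qed
    qed
  qed
  have "carrier K = {a \<otimes> inv b | a b. a \<in> V \<and> b \<in> V \<and> b \<noteq> \<zero>}"
  proof
    show "{a \<otimes> inv b | a b. a \<in> V \<and> b \<in> V \<and> b \<noteq> \<zero>} \<subseteq> carrier K"
      using VK inv_closed_nonzero(1) by auto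
    show "carrier K \<subseteq> {a \<otimes> inv b | a b. a \<in> V \<and> b \<in> V \<and> b \<noteq> \<zero>}"
    proof
      fix c assume c: "c \<in> carrier K"
      show "c \<in> {a \<otimes> inv b | a b. a \<in> V \<and> b \<in> V \<and> b \<noteq> \<zero>}"
      proof (cases "c \<in> V")
        case True
        have "c = c \<otimes> inv \<one>" using c by simp
        then show ?thesis using True subringE(3)[OF V(1)] one_not_zero by blast
      next
        case False
        then have c0: "c \<noteq> \<zero>" using subringE(2)[OF V(1)] by auto
        then have iV: "inv c \<in> V" using val c False unfolding valuation_subring_def by blast
        have "c = \<one> \<otimes> inv (inv c)" using c c0 field_Units by simp
        then show ?thesis using iV subringE(3)[OF V(1)] inv_closed_nonzero(2)[OF c c0] by blast
      qed
    qed
  qed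
  then have "V \<in> places K"
    unfolding places_def using V(1) const dvr by blast
  then show thesis using that V(3) by blast
qed

end

subsection \<open>Residue fields\<close>

lemma (in ring) subring_uminus:
  assumes V: "subring V R" and b: "b \<in> V"
  shows "\<ominus>\<^bsub>R\<lparr>carrier := V\<rparr>\<^esub> b = \<ominus> b"
proof -
  interpret A: ring "R\<lparr>carrier := V\<rparr>" using subring_is_ring[OF V] .
  have "\<ominus> b \<in> V" "b \<in> carrier R" using subringE(1,5)[OF V] b by auto
  then show ?thesis using A.minus_equality[of "\<ominus> b" b] b by (simp add: l_neg)
qed

context global_function_field
begin

definition vset :: "'a set \<Rightarrow> int \<Rightarrow> 'a set" where
  "vset P n = {a \<in> carrier K. a = \<zero> \<or> n \<le> place_ord K P a}"

lemma vset_closed: "a \<in> vset P n \<Longrightarrow> a \<in> carrier K"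
  unfolding vset_def by simp

lemma vset_zero: "\<zero> \<in> vset P n"
  unfolding vset_def by simp

lemma vset_mono: "m \<le> n \<Longrightarrow> a \<in> vset P n \<Longrightarrow> a \<in> vset P m"
  unfolding vset_def by auto

lemma vset_0:
  assumes P: "P \<in> places K"
  shows "vset P 0 = P"
proof (intro equalityI subsetI)
  fix a assume "a \<in> vset P 0"
  then show "a \<in> P"
    using place_ord_nonneg_iff[OF P, of a] subringE(2)[OF place_subring[OF P]] unfolding vset_def by auto
next
  fix a assume "a \<in> P"
  then show "a \<in> vset P 0"
    using place_ord_nonneg_iff[OF P, of a] place_carrier[OF P] unfolding vset_def by auto
qed

lemma vset_1:
  assumes P: "P \<in> places K"
  shows "vset P 1 = place_ideal K P"
proof -
  interpret M: maximalideal "place_ideal K P" "K\<lparr>carrier := P\<rparr>"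
    by (rule place_maximalideal[OF P])
  have "place_ideal K P \<subseteq> P" using M.a_subset by simp
  moreover have "\<zero> \<in> place_ideal K P" using additive_subgroup.zero_closed[OF M.additive_subgroup_axioms] by simp
  ultimately show ?thesis
    using mem_place_ideal_iff[OF P] place_carrier[OF P] unfolding vset_def by auto
qed

lemma vset_uminus:
  assumes P: "P \<in> places K" and a: "a \<in> vset P n"
  shows "\<ominus> a \<in> vset P n"
proof (cases "a = \<zero>")
  case True
  then show ?thesis using vset_zero by simp
next
  case False
  then show ?thesis using a place_ord_uminus[OF P _ False] unfolding vset_def by simp
qed

lemma vset_add:
  assumes P: "P \<in> places K" and a: "a \<in> vset P n" and b: "b \<in> vset P n"
  shows "a \<oplus> b \<in> vset P n"
proof (cases "a = \<zero> \<or> b = \<zero> \<or> a \<oplus> b = \<zero>")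
  case True
  then show ?thesis using a b vset_zero unfolding vset_def by auto
next
  case False
  have c: "a \<in> carrier K" "b \<in> carrier K" using a b vset_closed by auto
  have na: "n \<le> place_ord K P a" "n \<le> place_ord K P b" using a b False unfolding vset_def by auto
  show ?thesis
  proof (cases "place_ord K P a \<le> place_ord K P b")
    case True
    then show ?thesis using place_ord_add[OF P c(1) _ c(2)] False na c unfolding vset_def by force
  next
    case le: False
    then show ?thesis
      using place_ord_add[OF P c(2) _ c(1)] a_comm[OF c] False na c unfolding vset_def by force
  qed
qed

lemma vset_minus:
  assumes P: "P \<in> places K" and "a \<in> vset P n" and "b \<in> vset P n"
  shows "a \<ominus> b \<in> vset P n"
  unfolding a_minus_def using vset_add[OF P] vset_uminus[OF P] assms by blast

lemma vset_mult:
  assumes P: "P \<in> places K" and a: "a \<in> vset P n" and b: "b \<in> vset P m"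
  shows "a \<otimes> b \<in> vset P (n + m)"
proof (cases "a = \<zero> \<or> b = \<zero>")
  case True
  then show ?thesis using a b vset_zero unfolding vset_def by auto
next
  case False
  then show ?thesis using a b place_ord_mult[OF P] unfolding vset_def by force
qed

lemma vset_mult_integral:
  assumes P: "P \<in> places K" and a: "a \<in> P" and b: "b \<in> vset P m"
  shows "a \<otimes> b \<in> vset P m"
  using vset_mult[OF P _ b, of a 0] a vset_0[OF P] by simp

lemma vset_eqD:
  assumes P: "P \<in> places K" and a: "a \<in> carrier K" "a \<noteq> \<zero>"
  shows "a \<in> vset P n \<longleftrightarrow> n \<le> place_ord K P a"
  using a unfolding vset_def by simp

definition residue :: "'a set \<Rightarrow> 'a \<Rightarrow> 'a set" where
  "residue P a = place_ideal K P +>\<^bsub>K\<lparr>carrier := P\<rparr>\<^esub> a"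

lemma residue_eq_iff:
  assumes P: "P \<in> places K" and a: "a \<in> P" "b \<in> P"
  shows "residue P a = residue P b \<longleftrightarrow> a \<ominus> b \<in> vset P 1"
proof -
  interpret M: maximalideal "place_ideal K P" "K\<lparr>carrier := P\<rparr>"
    by (rule place_maximalideal[OF P])
  interpret A: domain "K\<lparr>carrier := P\<rparr>" using subring_is_domain[OF place_subring[OF P]] .
  have "a \<ominus>\<^bsub>K\<lparr>carrier := P\<rparr>\<^esub> b = a \<ominus> b"
    unfolding a_minus_def using subring_uminus[OF place_subring[OF P] a(2)] by simp
  then show ?thesis
    using ring.quotient_eq_iff_same_a_r_cos[OF subring_is_ring[OF place_subring[OF P]] M.ideal_axioms, of a b] a vset_1[OF P]
    unfolding residue_def by simp
qed

lemma residue_field_carrier: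
  "carrier (residue_field K P) = residue P ` P"
  unfolding residue_field_def FactRing_def A_RCOSETS_def' residue_def by auto

lemma residue_field_field:
  assumes P: "P \<in> places K"
  shows "field (residue_field K P)"
proof -
  interpret A: domain "K\<lparr>carrier := P\<rparr>" using subring_is_domain[OF place_subring[OF P]] .
  show ?thesis
    unfolding residue_field_def using maximalideal.quotient_is_field[OF place_maximalideal[OF P] A.is_cring] .
qed

lemma residue_hom:
  assumes P: "P \<in> places K"
  shows "ring_hom_ring (K\<lparr>carrier := P\<rparr>) (residue_field K P) (residue P)"
  unfolding residue_field_def residue_def
  using ideal.rcos_ring_hom_ring[OF maximalideal.axioms(1)[OF place_maximalideal[OF P]]] .

text \<open>Representatives of distinct residue classes are incongruent modulo a uniformizer, so the
  counting bound applies to them.\<close>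

lemma finite_residue_field:
  assumes P: "P \<in> places K"
  shows "finite (carrier (residue_field K P))"
proof -
  obtain t where t: "uniformizer P t" using ex_uniformizer[OF P] .
  have tc: "t \<in> P" "t \<noteq> \<zero>" using uniformizerE[OF P t] t unfolding uniformizer_def by auto
  define r where "r A = (SOME a. a \<in> P \<and> residue P a = A)" for A
  have r: "r A \<in> P \<and> residue P (r A) = A" if "A \<in> residue P ` P" for A
    unfolding r_def using that by (intro someI_ex[of "\<lambda>a. a \<in> P \<and> residue P a = A"]) auto
  have "finite (r ` residue P ` P)"
  proof (rule finite_incongruent[OF place_subring[OF P] tc])
    show "r ` residue P ` P \<subseteq> P" using r by blast
    fix e e' y assume e: "e \<in> r ` residue P ` P" "e' \<in> r ` residue P ` P" "y \<in> P" "e \<ominus> e' = t \<otimes> y"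
    obtain A A' where A: "A \<in> residue P ` P" "e = r A" "A' \<in> residue P ` P" "e' = r A'" using e by blast
    have "t \<otimes> y = y \<otimes> t" using tc(1) e(3) place_carrier[OF P] by (intro m_comm) auto
    then have "e \<ominus> e' \<in> vset P 1"
      using e uniformizerE(4)[OF P t] vset_1[OF P] by auto
    then have "residue P e = residue P e'" using residue_eq_iff[OF P, of e e'] A r by metis
    then have "A = A'" using A r by metis
    then show "e = e'" using A by simp
  qed
  moreover have "inj_on r (residue P ` P)" using r by (metis inj_onI)
  ultimately show ?thesis unfolding residue_field_carrier using finite_imageD by blast
qed

lemma constants_subfield_place:
  assumes P: "P \<in> places K"
  shows "subfield (constant_field K) (K\<lparr>carrier := P\<rparr>)"
proof -
  interpret A: domain "K\<lparr>carrier := P\<rparr>" using subring_is_domain[OF place_subring[OF P]] .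
  have "field (K\<lparr>carrier := P, carrier := constant_field K\<rparr>)"
    using subfield_iff(2)[OF subfield_constant_field] by simp
  then show ?thesis using A.subfield_iff(1) place_constants[OF P] by simp
qed

lemma residue_constants:
  assumes P: "P \<in> places K"
  shows "inj_on (residue P) (constant_field K)" "subfield (residue P ` constant_field K) (residue_field K P)"
  using ring_hom_ring.img_is_subfield[OF residue_hom[OF P] constants_subfield_place[OF P]]
    domain.one_not_zero[OF field.axioms(1)[OF residue_field_field[OF P]]] by auto

lemma ex_place: "\<exists>P. P \<in> places K"
proof -
  obtain x where "x \<in> carrier K" "(transcendental over prime_subfield K) x"
    using finite_over_rational_function_field by blast
  then have "x \<in> carrier K" "x \<notin> constant_field K" unfolding constant_field_def over_def by auto
  then show ?thesis using ex_place_avoiding by blast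
qed

text \<open>The constants embed into the residue field of any place.\<close>

lemma finite_constant_field: "finite (constant_field K)"
proof -
  obtain P where P: "P \<in> places K" using ex_place by blast
  have "residue P ` constant_field K \<subseteq> carrier (residue_field K P)"
    unfolding residue_field_carrier using place_constants[OF P] by blast
  then show ?thesis
    using finite_residue_field[OF P] residue_constants(1)[OF P] finite_imageD finite_subset by blast
qed

definition q where "q = card (constant_field K)"

lemma q_ge_2: "q \<ge> 2"
proof -
  have "{\<zero>, \<one>} \<subseteq> constant_field K"
    using subringE(2,3)[OF subfieldE(1)[OF subfield_constant_field]] by simp
  then have "card {\<zero>, \<one>} \<le> q" unfolding q_def using card_mono[OF finite_constant_field] by blast
  then show ?thesis using one_not_zero by (simp add: card_insert_if)
qed

lemma card_residue_field:
  assumes P: "P \<in> places K"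
  shows "card (carrier (residue_field K P)) = q ^ place_degree K P"
proof -
  interpret F: field "residue_field K P" by (rule residue_field_field[OF P])
  have "card (residue P ` constant_field K) = q"
    unfolding q_def using card_image[OF residue_constants(1)[OF P]] .
  moreover have "finite (residue P ` constant_field K)" using finite_constant_field by simp
  moreover have "subalgebra (residue P ` constant_field K) (carrier (residue_field K P)) (residue_field K P)"
    using F.carrier_is_subalgebra[of "residue P ` constant_field K"] residue_field_carrier[of P]
      image_mono[OF place_constants[OF P], of "residue P"] by simp
  ultimately show ?thesis
    using F.finite_subalgebra_dim[OF residue_constants(2)[OF P] _ _ finite_residue_field[OF P]]
    unfolding place_degree_def residue_def by simp
qed

lemma place_degree_pos:
  assumes P: "P \<in> places K"
  shows "place_degree K P > 0"
proof (rule ccontr)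
  interpret F: field "residue_field K P" by (rule residue_field_field[OF P])
  assume "\<not> place_degree K P > 0"
  then have "card (carrier (residue_field K P)) = 1" using card_residue_field[OF P] by simp
  then show False
    using F.one_not_zero F.one_closed F.zero_closed by (metis card_1_singletonE singletonD)
qed

lemma residue_system:
  assumes P: "P \<in> places K"
  obtains A where "A \<subseteq> P" "finite A" "card A = q ^ place_degree K P"
    "\<And>a. a \<in> P \<Longrightarrow> \<exists>r\<in>A. a \<ominus> r \<in> vset P 1"
    "\<And>r r'. r \<in> A \<Longrightarrow> r' \<in> A \<Longrightarrow> r \<ominus> r' \<in> vset P 1 \<Longrightarrow> r = r'"
proof -
  define r where "r A = (SOME a. a \<in> P \<and> residue P a = A)" for A
  have r: "r A \<in> P \<and> residue P (r A) = A" if "A \<in> residue P ` P" for A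
    unfolding r_def using that by (intro someI_ex[of "\<lambda>a. a \<in> P \<and> residue P a = A"]) auto
  define A where "A = r ` residue P ` P"
  have AP: "A \<subseteq> P" unfolding A_def using r by blast
  show thesis
  proof (rule that[OF AP])
    show "finite A" unfolding A_def using finite_residue_field[OF P] residue_field_carrier by auto
    have "inj_on r (residue P ` P)" using r by (metis inj_onI)
    then show "card A = q ^ place_degree K P"
      unfolding A_def using card_image card_residue_field[OF P] residue_field_carrier by metis
    fix a assume a: "a \<in> P"
    then have "residue P a = residue P (r (residue P a))" using r by auto
    then have "a \<ominus> r (residue P a) \<in> vset P 1" using residue_eq_iff[OF P a] r a by blast
    then show "\<exists>r\<in>A. a \<ominus> r \<in> vset P 1" unfolding A_def using a by blast
  next
    fix s s' assume s: "s \<in> A" "s' \<in> A" "s \<ominus> s' \<in> vset P 1"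
    then have "residue P s = residue P s'" using residue_eq_iff[OF P] AP by blast
    then show "s = s'" using s r unfolding A_def by (metis imageE)
  qed
qed

subsection \<open>Weak approximation\<close>

lemma place_ord_pow:
  assumes P: "P \<in> places K" and a: "a \<in> carrier K" "a \<noteq> \<zero>"
  shows "place_ord K P (a [^] (n :: nat)) = int n * place_ord K P a"
proof (induction n)
  case 0
  then show ?case using place_ord_one[OF P] by simp
next
  case (Suc n)
  then show ?case
    using place_ord_mult[OF P _ _ a, of "a [^] n"] nat_pow_nonzero[OF a] a by (simp add: distrib_right)
qed

lemma place_ord_add_strict:
  assumes P: "P \<in> places K" and a: "a \<in> carrier K" "a \<noteq> \<zero>" and b: "b \<in> vset P (place_ord K P a + 1)"
  shows "a \<oplus> b \<noteq> \<zero>" "place_ord K P (a \<oplus> b) = place_ord K P a"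
proof -
  have bc: "b \<in> carrier K" using b vset_closed by blast
  have na: "a \<notin> vset P (place_ord K P a + 1)" using vset_eqD[OF P a] by simp
  have nab: "a \<oplus> b \<notin> vset P (place_ord K P a + 1)"
  proof
    assume "a \<oplus> b \<in> vset P (place_ord K P a + 1)"
    then have "(a \<oplus> b) \<ominus> b \<in> vset P (place_ord K P a + 1)" using vset_minus[OF P _ b] by blast
    moreover have "(a \<oplus> b) \<ominus> b = a" using a bc by algebra
    ultimately show False using na by simp
  qed
  then show nz: "a \<oplus> b \<noteq> \<zero>" using vset_zero by metis
  have "a \<oplus> b \<in> vset P (place_ord K P a)"
    using vset_add[OF P, of a "place_ord K P a" b] vset_eqD[OF P a] vset_mono[OF _ b] by simp
  then show "place_ord K P (a \<oplus> b) = place_ord K P a"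
    using nab vset_eqD[OF P _ nz] a bc by (simp add: vset_def)
qed

text \<open>A discrete valuation ring is a maximal proper subring. If Q is contained in P and b lies
  in P but not in Q, then every s enters Q after division by a high power of b, so s itself lies in
  P; an s of order -1 at P refutes this.\<close>

lemma place_not_subset:
  assumes P: "P \<in> places K" and Q: "Q \<in> places K" and ne: "P \<noteq> Q"
  shows "\<exists>b. b \<in> Q \<and> b \<notin> P"
proof (rule ccontr)
  assume "\<nexists>b. b \<in> Q \<and> b \<notin> P"
  then have QP: "Q \<subseteq> P" by blast
  then obtain b where b: "b \<in> P" "b \<notin> Q" using ne by blast
  have bc: "b \<in> carrier K" "b \<noteq> \<zero>"
    using b place_carrier[OF P] subringE(2)[OF place_subring[OF Q]] by auto
  have ob: "place_ord K Q b < 0" using place_ord_nonneg_iff[OF Q bc] b by simp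
  obtain s where s: "s \<in> carrier K" "s \<noteq> \<zero>" "place_ord K P s = - 1" using ex_place_ord[OF P] .
  define j where "j = nat \<bar>place_ord K Q s\<bar>"
  note ib = inv_closed_nonzero[OF bc]
  have ibj: "inv b [^] j \<in> carrier K" "inv b [^] j \<noteq> \<zero>" using ib nat_pow_nonzero[OF ib(1,2)] by auto
  define c where "c = s \<otimes> inv b [^] j"
  have c: "c \<in> carrier K" "c \<noteq> \<zero>" unfolding c_def using s ibj integral by auto
  have "place_ord K Q c = place_ord K Q s - int j * place_ord K Q b"
    unfolding c_def using place_ord_mult[OF Q s(1,2) ibj] place_ord_pow[OF Q ib(1,2)] place_ord_inv[OF Q bc]
    by simp
  moreover have "int j * place_ord K Q b \<le> int j * (- 1)"
    using ob by (intro mult_left_mono) auto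
  ultimately have "0 \<le> place_ord K Q c" unfolding j_def by linarith
  then have "c \<in> P" using place_ord_nonneg_iff[OF Q c] QP by blast
  moreover have "b [^] j \<in> P" using subring_nat_pow[OF place_subring[OF P] b(1)] .
  ultimately have "c \<otimes> b [^] j \<in> P" using subringE(6)[OF place_subring[OF P]] by blast
  then have "0 \<le> place_ord K P (c \<otimes> b [^] j)"
    using place_ord_nonneg_iff[OF P, of "c \<otimes> b [^] j"] inv_mult_field(2)[OF c nat_pow_closed[OF bc(1)]
        nat_pow_nonzero[OF bc]] c bc by simp
  moreover have "place_ord K P (c \<otimes> b [^] j) = place_ord K P c + int j * place_ord K P b"
    using place_ord_mult[OF P c nat_pow_closed[OF bc(1)] nat_pow_nonzero[OF bc]] place_ord_pow[OF P bc]
    by simp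
  moreover have "place_ord K P c = place_ord K P s - int j * place_ord K P b"
    unfolding c_def using place_ord_mult[OF P s(1,2) ibj] place_ord_pow[OF P ib(1,2)] place_ord_inv[OF P bc]
    by simp
  ultimately show False using s by simp
qed

lemma separate_two_places:
  assumes P: "P \<in> places K" and Q: "Q \<in> places K" and ne: "P \<noteq> Q"
  shows "\<exists>c\<in>carrier K. c \<noteq> \<zero> \<and> 0 < place_ord K P c \<and> place_ord K Q c < 0"
proof -
  obtain a where a: "a \<in> P" "a \<notin> Q" using place_not_subset[OF Q P] ne by blast
  obtain b where b: "b \<in> Q" "b \<notin> P" using place_not_subset[OF P Q ne] by blast
  have ac: "a \<in> carrier K" "a \<noteq> \<zero>"
    using a place_carrier[OF P] subringE(2)[OF place_subring[OF Q]] by auto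
  have bc: "b \<in> carrier K" "b \<noteq> \<zero>"
    using b place_carrier[OF Q] subringE(2)[OF place_subring[OF P]] by auto
  note ib = inv_closed_nonzero[OF bc]
  have "a \<otimes> inv b \<in> carrier K" "a \<otimes> inv b \<noteq> \<zero>"
    using ac ib inv_mult_field(2)[OF ac ib(1,2)] by auto
  moreover have "0 < place_ord K P (a \<otimes> inv b)"
    using place_ord_mult[OF P ac ib(1,2)] place_ord_inv[OF P bc] place_ord_nonneg_iff[OF P ac]
      place_ord_nonneg_iff[OF P bc] a b by simp
  moreover have "place_ord K Q (a \<otimes> inv b) < 0"
    using place_ord_mult[OF Q ac ib(1,2)] place_ord_inv[OF Q bc] place_ord_nonneg_iff[OF Q ac]
      place_ord_nonneg_iff[OF Q bc] a b by simp
  ultimately show ?thesis by blast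
qed

text \<open>The new element is c + d^m, where d separates P from the new place R. Since m exceeds
  every |ord_Q c|, the orders of c and d^m at Q cannot agree, and with distinct orders nothing
  cancels.\<close>

lemma separate_places:
  assumes "finite T" "T \<subseteq> places K" and P: "P \<in> places K" "P \<notin> T"
  shows "\<exists>c\<in>carrier K. c \<noteq> \<zero> \<and> 0 < place_ord K P c \<and> (\<forall>Q\<in>T. place_ord K Q c < 0)"
  using assms(1,2) P(2)
proof (induction T rule: finite_induct)
  case empty
  obtain s where "s \<in> carrier K" "s \<noteq> \<zero>" "place_ord K P s = 1" by (rule ex_place_ord[OF P(1)])
  then show ?case by (intro bexI[of _ s]) auto
next
  case (insert R T)
  then obtain c where c: "c \<in> carrier K" "c \<noteq> \<zero>" "0 < place_ord K P c" "\<forall>Q\<in>T. place_ord K Q c < 0"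
    by auto
  have R: "R \<in> places K" "P \<noteq> R" using insert.prems by auto
  have T: "Q \<in> places K" if "Q \<in> T" for Q using insert.prems that by auto
  obtain d where d: "d \<in> carrier K" "d \<noteq> \<zero>" "0 < place_ord K P d" "place_ord K R d < 0"
    using separate_two_places[OF P(1) R] by blast
  show ?case
  proof (cases "place_ord K R c < 0")
    case True
    then show ?thesis using c by auto
  next
    case False
    define m where "m = Suc (nat (\<Sum>Q\<in>T. \<bar>place_ord K Q c\<bar>))"
    have m: "\<bar>place_ord K Q c\<bar> < int m" if "Q \<in> T" for Q
      using member_le_sum[OF that, of "\<lambda>Q. \<bar>place_ord K Q c\<bar>"] insert.hyps unfolding m_def by simp
    have mpos: "0 < int m" unfolding m_def by linarith
    have dm: "d [^] m \<in> carrier K" "d [^] m \<noteq> \<zero>" using d nat_pow_nonzero by auto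
    note od = place_ord_pow[OF _ d(1,2), of _ m]
    have "place_ord K R (d [^] m) < 0" unfolding od[OF R(1)] using d(4) mpos by (rule mult_pos_neg[rotated])
    then have "c \<in> vset R (place_ord K R (d [^] m) + 1)"
      using False vset_eqD[OF R(1) c(1,2)] by simp
    from place_ord_add_strict[OF R(1) dm this]
    have nz: "d [^] m \<oplus> c \<noteq> \<zero>" and oR: "place_ord K R (d [^] m \<oplus> c) < 0"
      using \<open>place_ord K R (d [^] m) < 0\<close> by auto
    have "0 < place_ord K P (d [^] m)" unfolding od[OF P(1)] using mpos d(3) by (rule mult_pos_pos)
    then have "d [^] m \<oplus> c \<in> vset P 1"
      by (intro vset_add[OF P(1)]) (use c(1,3) dm in \<open>auto simp: vset_def\<close>)
    then have oP: "0 < place_ord K P (d [^] m \<oplus> c)" using nz unfolding vset_def by simp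
    have oT: "place_ord K Q (d [^] m \<oplus> c) < 0" if Q: "Q \<in> T" for Q
    proof (cases "place_ord K Q (d [^] m) < place_ord K Q c")
      case True
      then have "c \<in> vset Q (place_ord K Q (d [^] m) + 1)" using vset_eqD[OF T[OF Q] c(1,2)] by simp
      then show ?thesis using place_ord_add_strict(2)[OF T[OF Q] dm] True c(4) Q by fastforce
    next
      case le: False
      have "place_ord K Q (d [^] m) \<noteq> place_ord K Q c"
      proof
        assume eq: "place_ord K Q (d [^] m) = place_ord K Q c"
        then have e: "place_ord K Q c = int m * place_ord K Q d" unfolding od[OF T[OF Q]] by simp
        then have "place_ord K Q d \<noteq> 0" using c(4) Q by auto
        then have "int m * 1 \<le> int m * \<bar>place_ord K Q d\<bar>" by (intro mult_left_mono) auto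
        then show False using e m[OF Q] by (simp add: abs_mult)
      qed
      then have "d [^] m \<in> vset Q (place_ord K Q c + 1)" using le vset_eqD[OF T[OF Q] dm] by simp
      then have "place_ord K Q (c \<oplus> d [^] m) = place_ord K Q c"
        using place_ord_add_strict(2)[OF T[OF Q] c(1,2)] by blast
      then show ?thesis using c(4) Q a_comm[OF c(1) dm(1)] by simp
    qed
    have "d [^] m \<oplus> c \<in> carrier K" using dm c by simp
    then show ?thesis using nz oR oP oT by blast
  qed
qed

text \<open>The element 1 / (1 + c^n) is close to 1 at a zero of c and close to 0 at a pole of c,
  the better the larger n is.\<close>

lemma approximate_idempotent:
  assumes T: "finite T" "T \<subseteq> places K" and P: "P \<in> places K" "P \<notin> T"
  shows "\<exists>w\<in>carrier K. w \<ominus> \<one> \<in> vset P (int N) \<and> (\<forall>Q\<in>T. w \<in> vset Q (int N))"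
proof -
  obtain c where c: "c \<in> carrier K" "c \<noteq> \<zero>" "0 < place_ord K P c" "\<forall>Q\<in>T. place_ord K Q c < 0"
    using separate_places[OF T P] by blast
  define n where "n = Suc N"
  have cn: "c [^] n \<in> carrier K" "c [^] n \<noteq> \<zero>" using c nat_pow_nonzero by auto
  have oP: "int n \<le> place_ord K P (c [^] n)"
    using mult_left_mono[of 1 "place_ord K P c" "int n"] c(3) place_ord_pow[OF P(1) c(1,2)] by simp
  have "c [^] n \<in> vset P (place_ord K P \<one> + 1)"
    using oP vset_eqD[OF P(1) cn] place_ord_one[OF P(1)] unfolding n_def by simp
  from place_ord_add_strict[OF P(1) one_closed one_not_zero this]
  have s0: "\<one> \<oplus> c [^] n \<noteq> \<zero>" and sP: "place_ord K P (\<one> \<oplus> c [^] n) = 0"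
    using place_ord_one[OF P(1)] by auto
  define s where "s = \<one> \<oplus> c [^] n"
  have s: "s \<in> carrier K" "s \<noteq> \<zero>" unfolding s_def using cn s0 by auto
  note is' = inv_closed_nonzero[OF s]
  have "inv s \<ominus> \<one> = inv s \<ominus> inv s \<otimes> s" using is' by simp
  also have "\<dots> = \<ominus> (inv s \<otimes> c [^] n)" unfolding s_def[symmetric] using is'(1) cn(1) s
    by (simp add: s_def) algebra
  finally have eq: "inv s \<ominus> \<one> = \<ominus> (inv s \<otimes> c [^] n)" .
  have "inv s \<in> vset P 0"
    using vset_eqD[OF P(1) is'(1,2)] place_ord_inv[OF P(1) s] sP unfolding s_def by simp
  then have "inv s \<otimes> c [^] n \<in> vset P (0 + int N)"
    using oP vset_eqD[OF P(1) cn] unfolding n_def by (intro vset_mult[OF P(1)]) auto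
  then have "inv s \<ominus> \<one> \<in> vset P (int N)" unfolding eq using vset_uminus[OF P(1)] by simp
  moreover have "inv s \<in> vset Q (int N)" if Q: "Q \<in> T" for Q
  proof -
    have Qp: "Q \<in> places K" using T Q by auto
    have oQ: "place_ord K Q (c [^] n) \<le> - int n"
    proof -
      have "place_ord K Q c \<le> - 1" using c(4) Q by fastforce
      then show ?thesis
        using mult_left_mono[of "place_ord K Q c" "- 1" "int n"] place_ord_pow[OF Qp c(1,2), of n] by simp
    qed
    then have "\<one> \<in> vset Q (place_ord K Q (c [^] n) + 1)"
      using vset_eqD[OF Qp one_closed one_not_zero] place_ord_one[OF Qp] unfolding n_def by simp
    then have "place_ord K Q (c [^] n \<oplus> \<one>) = place_ord K Q (c [^] n)"
      using place_ord_add_strict(2)[OF Qp cn] by blast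
    then have "place_ord K Q s \<le> - int n" unfolding s_def using a_comm[OF one_closed cn(1)] oQ by simp
    then show ?thesis using vset_eqD[OF Qp is'(1,2)] place_ord_inv[OF Qp s] unfolding n_def by simp
  qed
  ultimately show ?thesis using is'(1) by blast
qed

text \<open>The new place R is served by adding w (f R - a), with w near 1 at R and near 0 on
  T.\<close>

theorem weak_approximation:
  assumes "finite T" "T \<subseteq> places K" and f: "\<And>P. P \<in> T \<Longrightarrow> f P \<in> carrier K"
  shows "\<exists>a\<in>carrier K. \<forall>P\<in>T. a \<ominus> f P \<in> vset P N"
  using assms
proof (induction T rule: finite_induct)
  case empty
  then show ?case by blast
next
  case (insert R T)
  then obtain a where a: "a \<in> carrier K" "\<forall>P\<in>T. a \<ominus> f P \<in> vset P N" by auto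
  have R: "R \<in> places K" "R \<notin> T" and T: "T \<subseteq> places K" using insert by auto
  have fR: "f R \<in> carrier K" using insert.prems by simp
  define g where "g = f R \<ominus> a"
  have g: "g \<in> carrier K" unfolding g_def using fR a by simp
  \<comment> \<open>The factor g may have poles at the places involved. The precision demanded of w
    is raised by the absolute values of all these orders.\<close>
  define M where "M = nat (\<bar>N\<bar> + (\<Sum>P\<in>insert R T. \<bar>place_ord K P g\<bar>))"
  have M: "N - place_ord K P g \<le> int M" if "P \<in> insert R T" for P
  proof -
    have "\<bar>place_ord K P g\<bar> \<le> (\<Sum>P\<in>insert R T. \<bar>place_ord K P g\<bar>)"
      using insert.hyps by (intro member_le_sum[OF that]) auto
    then show ?thesis unfolding M_def by linarith
  qed
  have wg: "w \<otimes> g \<in> vset P N" if "P \<in> insert R T" "w \<in> vset P (int M)" for w P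
  proof (cases "g = \<zero>")
    case True
    then show ?thesis using that vset_closed vset_zero by simp
  next
    case False
    have P: "P \<in> places K" using that R T by auto
    have "w \<otimes> g \<in> vset P (int M + place_ord K P g)"
      using vset_eqD[OF P g False] by (intro vset_mult[OF P that(2)]) simp
    then show ?thesis using M[OF that(1)] by (intro vset_mono[of N "int M + place_ord K P g"]) auto
  qed
  obtain w where w: "w \<in> carrier K" "w \<ominus> \<one> \<in> vset R (int M)" "\<forall>Q\<in>T. w \<in> vset Q (int M)"
    using approximate_idempotent[OF insert.hyps(1) T R] by blast
  define b where "b = a \<oplus> w \<otimes> g"
  have b: "b \<in> carrier K" unfolding b_def using a w g by simp
  have "b \<ominus> f R = (w \<ominus> \<one>) \<otimes> g"
    unfolding b_def g_def using a(1) w(1) fR by algebra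
  then have "b \<ominus> f R \<in> vset R N" using wg[of R "w \<ominus> \<one>"] w(2) by simp
  moreover have "b \<ominus> f Q \<in> vset Q N" if Q: "Q \<in> T" for Q
  proof -
    have fQ: "f Q \<in> carrier K" using insert.prems Q by simp
    have "b \<ominus> f Q = (a \<ominus> f Q) \<oplus> w \<otimes> g"
      unfolding b_def using a(1) w(1) fQ g by algebra
    moreover have "w \<otimes> g \<in> vset Q N" using wg[of Q w] w(3) Q by simp
    ultimately show ?thesis using vset_add a(2) Q T by auto
  qed
  ultimately show ?case using b by blast
qed

text \<open>Given M + 1 zeros, weak approximation yields elements of the intersection V of their
  valuation rings, one for each zero P, near 1 at P and near 0 at the other zeros. They are pairwise
  incongruent modulo w, since w vanishes at every P. That is one too many for the bound M, which is
  the same for all subrings.\<close>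

lemma finite_zeros:
  assumes w: "w \<in> carrier K" "w \<noteq> \<zero>"
  shows "finite {P \<in> places K. 0 < place_ord K P w}"
proof (rule ccontr)
  obtain M where M: "\<forall>V E. subring V K \<longrightarrow> w \<in> V \<longrightarrow> E \<subseteq> V \<longrightarrow>
    (\<forall>e\<in>E. \<forall>e'\<in>E. \<forall>y\<in>V. e \<ominus> e' = w \<otimes> y \<longrightarrow> e = e') \<longrightarrow> finite E \<and> card E \<le> M"
    using subring_quotient_bounded[OF w] by blast
  assume "infinite {P \<in> places K. 0 < place_ord K P w}"
  then obtain T where T: "T \<subseteq> {P \<in> places K. 0 < place_ord K P w}" "finite T" "card T = Suc M"
    by (meson infinite_arbitrarily_large)
  have Tp: "P \<in> places K" "0 < place_ord K P w" if "P \<in> T" for P using T that by auto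
  have "T \<noteq> {}" using T(3) by auto
  define V where "V = \<Inter>T"
  have V: "subring V K"
    unfolding V_def using subring_Inter[of T] place_subring[OF Tp(1)] \<open>T \<noteq> {}\<close> by blast
  have wV: "w \<in> V"
    unfolding V_def using place_ord_nonneg_iff[OF Tp(1) w] Tp(2) by (metis InterI less_imp_le)
  have w1: "w \<in> vset P 1" if "P \<in> T" for P using vset_eqD[OF Tp(1)[OF that] w] Tp(2)[OF that] by simp
  have "\<exists>a\<in>carrier K. \<forall>Q\<in>T. a \<ominus> (if Q = P then \<one> else \<zero>) \<in> vset Q 1" for P
    by (rule weak_approximation[OF T(2)]) (use Tp in auto)
  then obtain e where e: "\<And>P. e P \<in> carrier K" "\<And>P Q. Q \<in> T \<Longrightarrow> e P \<ominus> (if Q = P then \<one> else \<zero>) \<in> vset Q 1"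
    by metis
  have eV: "e P \<in> Q" if "Q \<in> T" for P Q
  proof -
    have Q: "Q \<in> places K" using Tp that by simp
    have "e P \<ominus> (if Q = P then \<one> else \<zero>) \<in> vset Q 0" using vset_mono[OF _ e(2)[OF that]] by simp
    moreover have "(if Q = P then \<one> else \<zero>) \<in> vset Q 0"
      using vset_0[OF Q] subringE(2,3)[OF place_subring[OF Q]] by auto
    ultimately have "(e P \<ominus> (if Q = P then \<one> else \<zero>)) \<oplus> (if Q = P then \<one> else \<zero>) \<in> vset Q 0"
      using vset_add[OF Q] by blast
    moreover have "(e P \<ominus> (if Q = P then \<one> else \<zero>)) \<oplus> (if Q = P then \<one> else \<zero>) = e P"
      using e(1)[of P] by (simp add: a_minus_def a_assoc l_neg)
    ultimately show ?thesis using vset_0[OF Q] by simp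
  qed
  have sep: "P = Q" if P: "P \<in> T" "Q \<in> T" "y \<in> V" "e P \<ominus> e Q = w \<otimes> y" for P Q y
  proof (rule ccontr)
    assume ne: "P \<noteq> Q"
    have Pp: "P \<in> places K" using Tp P by simp
    have yP: "y \<in> P" using P unfolding V_def by blast
    have yc: "y \<in> carrier K" using yP place_carrier[OF Pp] by auto
    have "y \<otimes> w \<in> vset P 1" using vset_mult_integral[OF Pp yP w1[OF P(1)]] .
    then have "e P \<ominus> e Q \<in> vset P 1" using P(4) m_comm[OF w(1) yc] by simp
    moreover have "e P \<ominus> \<one> \<in> vset P 1" using e(2)[OF P(1), of P] by simp
    moreover have "e Q \<in> vset P 1" using e(2)[OF P(1), of Q] ne e(1)[of Q] by (simp add: a_minus_def)
    ultimately have "((e P \<ominus> e Q) \<ominus> (e P \<ominus> \<one>)) \<oplus> e Q \<in> vset P 1"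
      using vset_minus[OF Pp] vset_add[OF Pp] by blast
    moreover have "((e P \<ominus> e Q) \<ominus> (e P \<ominus> \<one>)) \<oplus> e Q = \<one>" using e(1) by algebra
    ultimately show False using vset_eqD[OF Pp one_closed one_not_zero] place_ord_one[OF Pp] by simp
  qed
  have "finite (e ` T) \<and> card (e ` T) \<le> M"
  proof (rule M[rule_format, OF V wV])
    show "e ` T \<subseteq> V" unfolding V_def using eV by blast
    fix a a' y assume "a \<in> e ` T" "a' \<in> e ` T" "y \<in> V" "a \<ominus> a' = w \<otimes> y"
    then show "a = a'" using sep by blast
  qed
  moreover have "inj_on e T"
  proof (rule inj_onI)
    fix P Q assume PQ: "P \<in> T" "Q \<in> T" "e P = e Q"
    have "e P \<ominus> e Q = w \<otimes> \<zero>" using PQ(3) e(1) w by simp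
    then show "P = Q" using sep[OF PQ(1,2) subringE(2)[OF V]] by simp
  qed
  ultimately show False using T card_image[of e T] by simp
qed

lemma finite_poles:
  assumes w: "w \<in> carrier K" "w \<noteq> \<zero>"
  shows "finite {P \<in> places K. place_ord K P w < 0}"
proof -
  note iw = inv_closed_nonzero[OF w]
  have "{P \<in> places K. place_ord K P w < 0} = {P \<in> places K. 0 < place_ord K P (inv w)}"
    using place_ord_inv[OF _ w] by auto
  then show ?thesis using finite_zeros[OF iw(1,2)] by simp
qed

lemma finite_support:
  assumes w: "w \<in> carrier K" "w \<noteq> \<zero>"
  shows "finite {P \<in> places K. place_ord K P w \<noteq> 0}"
proof -
  have "{P \<in> places K. place_ord K P w \<noteq> 0}
      = {P \<in> places K. 0 < place_ord K P w} \<union> {P \<in> places K. place_ord K P w < 0}" by auto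
  then show ?thesis using finite_zeros[OF w] finite_poles[OF w] by simp
qed

text \<open>At a place of degree at most d where x is integral, two of the powers x^0, ..., x^N with
  N = q^d have the same residue, so the place is a zero of one of the finitely many differences x^i
  - x^j. The remaining places are poles of x.\<close>

lemma finite_places_degree_le: "finite {P \<in> places K. place_degree K P \<le> d}"
proof -
  obtain x where x0: "x \<in> carrier K" "(transcendental over prime_subfield K) x"
    using finite_over_rational_function_field by blast
  then have x: "x \<in> carrier K" "x \<notin> constant_field K" unfolding constant_field_def over_def by auto
  then have xn: "x \<noteq> \<zero>" using subringE(2)[OF subfieldE(1)[OF subfield_constant_field]] by auto
  obtain P0 where P0: "P0 \<in> places K" "x \<notin> P0" using ex_place_avoiding[OF x] by blast
  have oP0: "place_ord K P0 x < 0" using place_ord_nonneg_iff[OF P0(1) x(1) xn] P0(2) by simp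
  \<comment> \<open>At a pole of x distinct powers of x have distinct orders.\<close>
  have ne: "x [^] i \<ominus> x [^] j \<noteq> \<zero>" if "i \<noteq> j" for i j :: nat
  proof
    assume "x [^] i \<ominus> x [^] j = \<zero>"
    then have "x [^] i = x [^] j" using r_right_minus_eq[of "x [^] i" "x [^] j"] x by simp
    then have "int i * place_ord K P0 x = int j * place_ord K P0 x"
      using place_ord_pow[OF P0(1) x(1) xn] by metis
    then show False using oP0 that by simp
  qed
  define N where "N = q ^ d"
  define Z where "Z = (\<Union>(i, j) \<in> {(i, j). i \<in> {..N} \<and> j \<in> {..N} \<and> i \<noteq> j}.
    {P \<in> places K. 0 < place_ord K P (x [^] i \<ominus> x [^] j)})"
  have fin: "finite {(i, j). i \<in> {..N} \<and> j \<in> {..N} \<and> i \<noteq> j}"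
    by (rule finite_subset[of _ "{..N} \<times> {..N}"]) auto
  have finZ: "finite Z"
    unfolding Z_def using fin finite_zeros ne x by (intro finite_UN_I) auto
  have "{P \<in> places K. place_degree K P \<le> d} \<subseteq> Z \<union> {P \<in> places K. place_ord K P x < 0}"
  proof
    fix P assume P: "P \<in> {P \<in> places K. place_degree K P \<le> d}"
    then have Pp: "P \<in> places K" by simp
    show "P \<in> Z \<union> {P \<in> places K. place_ord K P x < 0}"
    proof (cases "place_ord K P x < 0")
      case False
      then have xP: "x \<in> P" using place_ord_nonneg_iff[OF Pp x(1) xn] by simp
      have xi: "x [^] i \<in> P" for i :: nat using subring_nat_pow[OF place_subring[OF Pp] xP] .
      have "card (carrier (residue_field K P)) \<le> N"
        unfolding card_residue_field[OF Pp] N_def using P q_ge_2 by (intro power_increasing) auto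
      moreover have "(\<lambda>i. residue P (x [^] i)) ` {..N} \<subseteq> carrier (residue_field K P)"
        unfolding residue_field_carrier using xi by blast
      ultimately have "\<not> inj_on (\<lambda>i. residue P (x [^] i)) {..N}"
        using card_inj_on_le[of "\<lambda>i. residue P (x [^] i)" "{..N}" "carrier (residue_field K P)"]
          finite_residue_field[OF Pp] by fastforce
      then obtain i j where ij: "i \<in> {..N}" "j \<in> {..N}" "i \<noteq> j" "residue P (x [^] i) = residue P (x [^] j)"
        unfolding inj_on_def by blast
      then have "x [^] i \<ominus> x [^] j \<in> vset P 1" using residue_eq_iff[OF Pp xi xi] by blast
      then have "0 < place_ord K P (x [^] i \<ominus> x [^] j)" using ne[OF ij(3)] unfolding vset_def by simp
      then have "P \<in> Z" unfolding Z_def using ij Pp by blast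
      then show ?thesis by simp
    qed (use Pp in simp)
  qed
  then show ?thesis using finite_poles[OF x(1) xn] finZ finite_subset by blast
qed

end

subsection \<open>Divisors\<close>

definition pos_part :: "('p \<Rightarrow>\<^sub>0 int) \<Rightarrow> 'p \<Rightarrow>\<^sub>0 int" where
  "pos_part D = Poly_Mapping.map (max 0) D"

lemma lookup_pos_part: "Poly_Mapping.lookup (pos_part D) P = max 0 (Poly_Mapping.lookup D P)"
  unfolding pos_part_def by (simp add: Poly_Mapping.map.rep_eq when_def)

lemma keys_pos_part: "Poly_Mapping.keys (pos_part D) \<subseteq> Poly_Mapping.keys D"
  by (auto simp: in_keys_iff lookup_pos_part)

lemma pos_part_diff: "pos_part D - pos_part (- D) = D"
  by (rule poly_mapping_eqI) (simp add: lookup_minus lookup_pos_part)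

context global_function_field
begin

abbreviation dcoeff :: "('a set \<Rightarrow>\<^sub>0 int) \<Rightarrow> 'a set \<Rightarrow> int" where
  "dcoeff \<equiv> Poly_Mapping.lookup"

definition divisor :: "('a set \<Rightarrow>\<^sub>0 int) \<Rightarrow> bool" where
  "divisor D \<longleftrightarrow> Poly_Mapping.keys D \<subseteq> places K"

lemma divisor_iff: "divisor D \<longleftrightarrow> D \<in> carrier (divisor_group K)"
  unfolding divisor_def by simp

lemma effective_iff: "D \<in> effective_divisors K \<longleftrightarrow> divisor D \<and> (\<forall>P. 0 \<le> dcoeff D P)"
  unfolding effective_divisors_def divisor_def by simp

lemma effective_divisor: "D \<in> effective_divisors K \<Longrightarrow> divisor D"
  unfolding effective_iff by simp

lemma divisor_add: "divisor D \<Longrightarrow> divisor E \<Longrightarrow> divisor (D + E)"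
  unfolding divisor_def using keys_add[of D E] by blast

lemma divisor_uminus: "divisor D \<Longrightarrow> divisor (- D)"
  unfolding divisor_def by simp

lemma divisor_diff: "divisor D \<Longrightarrow> divisor E \<Longrightarrow> divisor (D - E)"
  using divisor_add[of D "- E"] divisor_uminus[of E] by simp

lemma divisor_zero: "divisor 0"
  unfolding divisor_def by simp

lemma divisor_single: "P \<in> places K \<Longrightarrow> divisor (Poly_Mapping.single P n)"
  unfolding divisor_def by simp

lemma divisor_pos_part: "divisor D \<Longrightarrow> divisor (pos_part D)"
  unfolding divisor_def using keys_pos_part[of D] by blast

lemma effective_pos_part: "divisor D \<Longrightarrow> pos_part D \<in> effective_divisors K"
  unfolding effective_iff using divisor_pos_part by (simp add: lookup_pos_part)

lemma effective_add:
  "D \<in> effective_divisors K \<Longrightarrow> E \<in> effective_divisors K \<Longrightarrow> D + E \<in> effective_divisors K"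
  unfolding effective_iff using divisor_add by (simp add: lookup_add)

lemma effective_zero: "0 \<in> effective_divisors K"
  unfolding effective_iff using divisor_zero by simp

lemma effective_single: "P \<in> places K \<Longrightarrow> Poly_Mapping.single P 1 \<in> effective_divisors K"
  unfolding effective_iff using divisor_single by (simp add: lookup_single when_def)

lemma div_degree_superset:
  assumes "finite A" "Poly_Mapping.keys D \<subseteq> A"
  shows "div_degree K D = (\<Sum>P\<in>A. dcoeff D P * int (place_degree K P))"
  unfolding div_degree_def using assms
  by (intro sum.mono_neutral_left) (auto simp: in_keys_iff)

lemma div_degree_add: "div_degree K (D + E) = div_degree K D + div_degree K E"
proof -
  let ?A = "Poly_Mapping.keys D \<union> Poly_Mapping.keys E"
  have "div_degree K (D + E) = (\<Sum>P\<in>?A. dcoeff (D + E) P * int (place_degree K P))"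
    using keys_add[of D E] by (intro div_degree_superset) auto
  also have "\<dots> = (\<Sum>P\<in>?A. dcoeff D P * int (place_degree K P)) + (\<Sum>P\<in>?A. dcoeff E P * int (place_degree K P))"
    by (simp add: lookup_add distrib_right sum.distrib)
  also have "\<dots> = div_degree K D + div_degree K E"
    using div_degree_superset[of ?A D] div_degree_superset[of ?A E] by simp
  finally show ?thesis .
qed

lemma div_degree_zero: "div_degree K 0 = 0"
  unfolding div_degree_def by simp

lemma div_degree_diff: "div_degree K (D - E) = div_degree K D - div_degree K E"
  using div_degree_add[of "D - E" E] by simp

lemma div_degree_single: "div_degree K (Poly_Mapping.single P n) = n * int (place_degree K P)"
  unfolding div_degree_def by simp

lemma div_degree_effective: "D \<in> effective_divisors K \<Longrightarrow> 0 \<le> div_degree K D"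
  unfolding div_degree_def effective_iff by (intro sum_nonneg) simp

lemma effective_remove_prime:
  assumes D: "D \<in> effective_divisors K" and P: "P \<in> Poly_Mapping.keys D"
  shows "D - Poly_Mapping.single P 1 \<in> effective_divisors K" "P \<in> places K"
proof -
  show Pp: "P \<in> places K" using D P unfolding effective_iff divisor_def by blast
  have "dcoeff D P \<noteq> 0" using P by (simp add: in_keys_iff)
  moreover have "0 \<le> dcoeff D P" using D unfolding effective_iff by blast
  ultimately have "1 \<le> dcoeff D P" by linarith
  then have "0 \<le> dcoeff (D - Poly_Mapping.single P 1) Q" for Q
    using D unfolding effective_iff by (simp add: lookup_minus lookup_single when_def)
  then show "D - Poly_Mapping.single P 1 \<in> effective_divisors K"
    using D divisor_diff divisor_single[OF Pp] unfolding effective_iff by blast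
qed

lemma effective_degree_zero:
  assumes D: "D \<in> effective_divisors K" and "div_degree K D = 0"
  shows "D = 0"
proof (rule ccontr)
  assume "D \<noteq> 0"
  then obtain P where P: "P \<in> Poly_Mapping.keys D" by (metis keys_eq_empty equals0I)
  have "0 \<le> div_degree K (D - Poly_Mapping.single P 1)"
    using div_degree_effective effective_remove_prime[OF D P] by blast
  then show False
    using assms(2) place_degree_pos[OF effective_remove_prime(2)[OF D P]]
    by (simp add: div_degree_diff div_degree_single)
qed

lemma effective_induct [consumes 1, case_names zero add]:
  assumes D: "D \<in> effective_divisors K" and zero: "Q 0"
    and add: "\<And>D P. D \<in> effective_divisors K \<Longrightarrow> P \<in> places K \<Longrightarrow> Q D \<Longrightarrow> Q (D + Poly_Mapping.single P 1)"
  shows "Q D"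
  using D
proof (induction "nat (div_degree K D)" arbitrary: D rule: less_induct)
  case less
  show ?case
  proof (cases "D = 0")
    case True
    then show ?thesis using zero by simp
  next
    case False
    then obtain P where P: "P \<in> Poly_Mapping.keys D" by (metis keys_eq_empty equals0I)
    note E = effective_remove_prime[OF less.prems P]
    have "div_degree K (D - Poly_Mapping.single P 1) < div_degree K D"
      using place_degree_pos[OF E(2)] by (simp add: div_degree_diff div_degree_single)
    then have "Q (D - Poly_Mapping.single P 1)"
      using less.hyps E(1) div_degree_effective[OF E(1)] by simp
    then show ?thesis using add[OF E] by simp
  qed
qed

subsection \<open>Riemann--Roch spaces\<close>

abbreviation "rr \<equiv> riemann_roch_space K"

lemma rr_iff: "a \<in> rr D \<longleftrightarrow> a \<in> carrier K \<and> (\<forall>P\<in>places K. a \<in> vset P (- dcoeff D P))"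
proof -
  have "0 \<le> place_ord K P a + dcoeff D P \<longleftrightarrow> - dcoeff D P \<le> place_ord K P a" for P
    by linarith
  then show ?thesis unfolding riemann_roch_space_def vset_def by auto
qed

lemma rr_closed: "a \<in> rr D \<Longrightarrow> a \<in> carrier K"
  unfolding rr_iff by simp

lemma rr_0_mem: "\<zero> \<in> rr D"
  unfolding rr_iff using vset_zero by simp

lemma rr_add: "a \<in> rr D \<Longrightarrow> b \<in> rr D \<Longrightarrow> a \<oplus> b \<in> rr D"
  unfolding rr_iff using vset_add by simp

lemma rr_minus: "a \<in> rr D \<Longrightarrow> b \<in> rr D \<Longrightarrow> a \<ominus> b \<in> rr D"
  unfolding rr_iff using vset_minus by simp

lemma rr_mono:
  assumes "\<And>P. P \<in> places K \<Longrightarrow> dcoeff D P \<le> dcoeff E P"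
  shows "rr D \<subseteq> rr E"
proof
  fix a assume a: "a \<in> rr D"
  have "a \<in> vset P (- dcoeff E P)" if P: "P \<in> places K" for P
    using a P assms[OF P] unfolding rr_iff by (intro vset_mono[of "- dcoeff E P" "- dcoeff D P"]) auto
  then show "a \<in> rr E" using a unfolding rr_iff by simp
qed

lemma rr_mult: "a \<in> rr D \<Longrightarrow> b \<in> rr E \<Longrightarrow> a \<otimes> b \<in> rr (D + E)"
  unfolding rr_iff lookup_add using vset_mult[of _ a "- dcoeff D _" b "- dcoeff E _"] by (simp add: m_closed)

text \<open>A non-constant has a pole by \<open>ex_place_avoiding\<close>, and constants lie in
  every valuation ring.\<close>

lemma rr_zero: "rr 0 = constant_field K"
proof (intro equalityI subsetI)
  fix a assume a: "a \<in> rr 0"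
  show "a \<in> constant_field K"
  proof (rule ccontr)
    assume "a \<notin> constant_field K"
    then obtain P where P: "P \<in> places K" "a \<notin> P" using ex_place_avoiding rr_closed[OF a] by blast
    have "a \<in> vset P 0" using a P(1) unfolding rr_iff by auto
    then show False using P(2) vset_0[OF P(1)] by simp
  qed
next
  fix a assume a: "a \<in> constant_field K"
  then show "a \<in> rr 0"
    using place_constants vset_0 unfolding rr_iff constant_field_def by fastforce
qed

lemma rr_subalgebra: "subalgebra (constant_field K) (rr D) K"
proof (rule subalgebra.intro)
  show "subgroup (rr D) (add_monoid K)"
  proof (rule add.subgroupI)
    show "rr D \<subseteq> carrier K" using rr_closed by blast
    show "rr D \<noteq> {}" using rr_0_mem by blast
    fix a assume a: "a \<in> rr D"
    then show "\<ominus> a \<in> rr D" unfolding rr_iff using vset_uminus by simp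
    fix b assume "b \<in> rr D"
    then show "a \<oplus> b \<in> rr D" using rr_add[OF a] by simp
  qed
  show "subalgebra_axioms (constant_field K) (rr D) K"
  proof
    fix k v assume "k \<in> constant_field K" "v \<in> rr D"
    then show "k \<otimes> v \<in> rr D" using rr_mult[of k 0 v D] rr_zero by simp
  qed
qed

text \<open>Multiplication by s, of order D(P) + 1 at P, makes the elements of the larger space
  integral at P, and two with the same residue differ by an element of \<open>rr D\<close>. A
  reference element for each residue then embeds the larger space into residues times
  \<open>rr D\<close>.\<close>

lemma rr_step:
  assumes P: "P \<in> places K" and fin: "finite (rr D)"
  shows "finite (rr (D + Poly_Mapping.single P 1)) \<and>
    card (rr (D + Poly_Mapping.single P 1)) \<le> q ^ place_degree K P * card (rr D)"
proof -
  let ?E = "D + Poly_Mapping.single P 1"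
  obtain A where A: "A \<subseteq> P" "finite A" "card A = q ^ place_degree K P"
    "\<And>a. a \<in> P \<Longrightarrow> \<exists>r\<in>A. a \<ominus> r \<in> vset P 1"
    using residue_system[OF P] by metis
  obtain s where s: "s \<in> carrier K" "s \<noteq> \<zero>" "place_ord K P s = dcoeff D P + 1"
    by (rule ex_place_ord[OF P])
  have sP: "s \<in> vset P (dcoeff D P + 1)" using vset_eqD[OF P s(1,2)] s(3) by simp
  have as: "a \<otimes> s \<in> P" if "a \<in> rr ?E" for a
  proof -
    have "a \<in> vset P (- dcoeff D P - 1)"
      using that P unfolding rr_iff by (auto simp: lookup_add)
    then have "a \<otimes> s \<in> vset P ((- dcoeff D P - 1) + (dcoeff D P + 1))" using vset_mult[OF P _ sP] by blast
    then show ?thesis using vset_0[OF P] by simp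
  qed
  define \<rho> where "\<rho> a = (SOME r. r \<in> A \<and> (a \<otimes> s) \<ominus> r \<in> vset P 1)" for a
  have \<rho>: "\<rho> a \<in> A \<and> (a \<otimes> s) \<ominus> \<rho> a \<in> vset P 1" if "a \<in> rr ?E" for a
    unfolding \<rho>_def using A(4)[OF as[OF that]] by (intro someI_ex[of "\<lambda>r. r \<in> A \<and> (a \<otimes> s) \<ominus> r \<in> vset P 1"]) blast
  have diff: "a \<ominus> b \<in> rr D" if a: "a \<in> rr ?E" and b: "b \<in> rr ?E" and eq: "\<rho> a = \<rho> b" for a b
  proof -
    have c: "a \<in> carrier K" "b \<in> carrier K" using a b rr_closed by auto
    have rc: "\<rho> a \<in> carrier K" using \<rho>[OF a] A(1) place_carrier[OF P] by blast
    have "((a \<otimes> s) \<ominus> \<rho> a) \<ominus> ((b \<otimes> s) \<ominus> \<rho> a) \<in> vset P 1"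
      using \<rho>[OF a] \<rho>[OF b] eq vset_minus[OF P] by metis
    moreover have "((a \<otimes> s) \<ominus> \<rho> a) \<ominus> ((b \<otimes> s) \<ominus> \<rho> a) = (a \<ominus> b) \<otimes> s"
      using c s(1) rc by algebra
    ultimately have v: "(a \<ominus> b) \<otimes> s \<in> vset P 1" by simp
    have ab: "a \<ominus> b \<in> rr ?E" using rr_minus[OF a b] .
    have abc: "a \<ominus> b \<in> carrier K" using c by simp
    have "a \<ominus> b \<in> vset P (- dcoeff D P)"
    proof (cases "a \<ominus> b = \<zero>")
      case True
      then show ?thesis using vset_zero by simp
    next
      case False
      then have "1 \<le> place_ord K P (a \<ominus> b) + place_ord K P s"
        using v vset_eqD[OF P, of "(a \<ominus> b) \<otimes> s"] inv_mult_field(2)[OF abc False s(1,2)] abc s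
          place_ord_mult[OF P abc False s(1,2)] by simp
      then show ?thesis using s(3) vset_eqD[OF P abc False] by simp
    qed
    moreover have "a \<ominus> b \<in> vset Q (- dcoeff D Q)" if "Q \<in> places K" "Q \<noteq> P" for Q
    proof -
      have "dcoeff ?E Q = dcoeff D Q" using that(2) by (simp add: lookup_add lookup_single when_def)
      then show ?thesis using ab that(1) unfolding rr_iff by metis
    qed
    ultimately show ?thesis using abc unfolding rr_iff by auto
  qed
  define \<sigma> where "\<sigma> r = (SOME b. b \<in> rr ?E \<and> \<rho> b = r)" for r
  have \<sigma>: "\<sigma> (\<rho> a) \<in> rr ?E \<and> \<rho> (\<sigma> (\<rho> a)) = \<rho> a" if "a \<in> rr ?E" for a
    unfolding \<sigma>_def using that by (intro someI_ex[of "\<lambda>b. b \<in> rr ?E \<and> \<rho> b = \<rho> a"]) blast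
  let ?F = "\<lambda>a. (\<rho> a, a \<ominus> \<sigma> (\<rho> a))"
  have inj: "inj_on ?F (rr ?E)"
  proof (rule inj_onI)
    fix a b assume ab: "a \<in> rr ?E" "b \<in> rr ?E" "?F a = ?F b"
    have c: "a \<in> carrier K" "b \<in> carrier K" "\<sigma> (\<rho> a) \<in> carrier K"
      using ab rr_closed \<sigma> by auto
    have "a = (a \<ominus> \<sigma> (\<rho> a)) \<oplus> \<sigma> (\<rho> a)" using c by algebra
    also have "a \<ominus> \<sigma> (\<rho> a) = b \<ominus> \<sigma> (\<rho> a)" using ab(3) by (metis prod.inject)
    also have "(b \<ominus> \<sigma> (\<rho> a)) \<oplus> \<sigma> (\<rho> a) = b" using c by algebra
    finally show "a = b" .
  qed
  have img: "?F ` rr ?E \<subseteq> A \<times> rr D"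
  proof
    fix p assume "p \<in> ?F ` rr ?E"
    then obtain a where a: "a \<in> rr ?E" "p = ?F a" by blast
    have "a \<ominus> \<sigma> (\<rho> a) \<in> rr D"
      using diff[OF a(1)] \<sigma>[OF a(1)] by simp
    then show "p \<in> A \<times> rr D" using \<rho>[OF a(1)] a(2) by simp
  qed
  have finAD: "finite (A \<times> rr D)" using A(2) fin by simp
  have "finite (rr ?E)" using inj_on_finite[OF inj img finAD] .
  moreover have "card (rr ?E) \<le> card (A \<times> rr D)" using card_inj_on_le[OF inj img finAD] .
  ultimately show ?thesis using A(3) by (simp add: card_cartesian_product)
qed

lemma rr_growth:
  assumes E: "E \<in> effective_divisors K" and fin: "finite (rr D)"
  shows "finite (rr (D + E)) \<and> card (rr (D + E)) \<le> q ^ nat (div_degree K E) * card (rr D)"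
  using E
proof (induction rule: effective_induct)
  case zero
  then show ?case using fin div_degree_zero by simp
next
  case (add E P)
  have deg: "nat (div_degree K (E + Poly_Mapping.single P 1)) = nat (div_degree K E) + place_degree K P"
    using div_degree_effective[OF add(1)] by (simp add: div_degree_add div_degree_single nat_add_distrib)
  have "finite (rr (D + E + Poly_Mapping.single P 1)) \<and>
      card (rr (D + E + Poly_Mapping.single P 1)) \<le> q ^ place_degree K P * card (rr (D + E))"
    using rr_step[OF add(2)] add(3) by blast
  moreover have "q ^ place_degree K P * card (rr (D + E))
      \<le> q ^ place_degree K P * (q ^ nat (div_degree K E) * card (rr D))"
    using add(3) by (intro mult_left_mono) auto
  ultimately have "finite (rr (D + E + Poly_Mapping.single P 1)) \<and> card (rr (D + E + Poly_Mapping.single P 1))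
      \<le> q ^ place_degree K P * (q ^ nat (div_degree K E) * card (rr D))"
    using order_trans by blast
  moreover have "q ^ nat (div_degree K (E + Poly_Mapping.single P 1)) * card (rr D)
      = q ^ place_degree K P * (q ^ nat (div_degree K E) * card (rr D))"
    unfolding deg power_add by simp
  ultimately show ?case by (simp only: add.assoc)
qed

lemma finite_rr: "divisor D \<Longrightarrow> finite (rr D)"
proof -
  assume D: "divisor D"
  have "finite (rr (0 + pos_part D))"
    using rr_growth[OF effective_pos_part[OF D], of 0] rr_zero finite_constant_field by simp
  moreover have "rr D \<subseteq> rr (pos_part D)" by (rule rr_mono) (simp add: lookup_pos_part)
  ultimately show ?thesis using finite_subset by auto
qed

definition ell :: "('a set \<Rightarrow>\<^sub>0 int) \<Rightarrow> nat" where
  "ell D = dim (constant_field K) (rr D)"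

text \<open>Estimates for \<open>ell\<close> are obtained by counting the elements of the spaces and
  comparing powers of q.\<close>

lemma card_rr: "divisor D \<Longrightarrow> card (rr D) = q ^ ell D"
  unfolding ell_def q_def
  using finite_subalgebra_dim[OF subfield_constant_field finite_constant_field rr_subalgebra finite_rr] .

lemma ell_zero: "ell 0 = 1"
proof -
  have "q ^ ell 0 = q ^ 1" using card_rr[OF divisor_zero] rr_zero q_def by simp
  then show ?thesis using q_ge_2 by (metis less_le_trans one_less_numeral_iff power_inject_exp semiring_norm(76))
qed

lemma ell_growth:
  assumes D: "divisor D" and E: "E \<in> effective_divisors K"
  shows "ell D \<le> ell (D + E)" "int (ell (D + E)) \<le> int (ell D) + div_degree K E"
proof -
  have q: "1 < q" using q_ge_2 by simp
  have DE: "divisor (D + E)" using divisor_add[OF D effective_divisor[OF E]] .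
  have "rr D \<subseteq> rr (D + E)" using E unfolding effective_iff by (intro rr_mono) (simp add: lookup_add)
  then have "q ^ ell D \<le> q ^ ell (D + E)"
    using card_mono[OF finite_rr[OF DE]] card_rr[OF D] card_rr[OF DE] by metis
  then show "ell D \<le> ell (D + E)" using power_le_imp_le_exp[OF q] by blast
  have "q ^ ell (D + E) \<le> q ^ (nat (div_degree K E) + ell D)"
    using rr_growth[OF E finite_rr[OF D]] card_rr[OF D] card_rr[OF DE] by (simp add: power_add)
  then have "ell (D + E) \<le> nat (div_degree K E) + ell D" using power_le_imp_le_exp[OF q] by blast
  then show "int (ell (D + E)) \<le> int (ell D) + div_degree K E"
    using div_degree_effective[OF E] by linarith
qed

subsection \<open>Principal divisors have degree zero\<close>

text \<open>For nonzero a the support is finite by \<open>finite_support\<close>. The positive part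
  of \<open>princ a\<close> is the divisor of zeros of a, that of \<open>- princ a\<close> the
  divisor of poles.\<close>

definition princ :: "'a \<Rightarrow> 'a set \<Rightarrow>\<^sub>0 int" where
  "princ a = Abs_poly_mapping (\<lambda>P. if P \<in> places K then place_ord K P a else 0)"

lemma lookup_princ:
  assumes "a \<in> carrier K" "a \<noteq> \<zero>"
  shows "dcoeff (princ a) P = (if P \<in> places K then place_ord K P a else 0)"
proof -
  have "{P. (if P \<in> places K then place_ord K P a else 0) \<noteq> 0} = {P \<in> places K. place_ord K P a \<noteq> 0}"
    by auto
  then show ?thesis unfolding princ_def using finite_support[OF assms] by (subst lookup_Abs_poly_mapping) auto
qed

lemma divisor_princ: "a \<in> carrier K \<Longrightarrow> a \<noteq> \<zero> \<Longrightarrow> divisor (princ a)"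
  unfolding divisor_def using lookup_princ by (auto simp: in_keys_iff split: if_splits)

lemma princ_mult:
  assumes "a \<in> carrier K" "a \<noteq> \<zero>" "b \<in> carrier K" "b \<noteq> \<zero>"
  shows "princ (a \<otimes> b) = princ a + princ b"
  using assms inv_mult_field(2)[OF assms] place_ord_mult[OF _ assms]
  by (intro poly_mapping_eqI) (simp add: lookup_add lookup_princ)

lemma princ_inv:
  assumes "a \<in> carrier K" "a \<noteq> \<zero>"
  shows "princ (inv a) = - princ a"
  using assms inv_closed_nonzero[OF assms] place_ord_inv[OF _ assms]
  by (intro poly_mapping_eqI) (simp add: lookup_princ)

lemma mem_rr_iff_princ:
  assumes "a \<in> carrier K" "a \<noteq> \<zero>"
  shows "a \<in> rr D \<longleftrightarrow> (\<forall>P\<in>places K. 0 \<le> dcoeff (princ a + D) P)"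
  using assms vset_eqD[OF _ assms] unfolding rr_iff by (force simp: lookup_add lookup_princ)

lemma rr_shift:
  assumes b: "b \<in> carrier K" "b \<noteq> \<zero>"
  shows "bij_betw (\<lambda>a. a \<otimes> b) (rr D) (rr (D - princ b))"
proof (rule bij_betwI[where g = "\<lambda>a. a \<otimes> inv b"])
  note ib = inv_closed_nonzero[OF b]
  have self: "c \<in> rr (- princ c)" if "c \<in> carrier K" "c \<noteq> \<zero>" for c
    using mem_rr_iff_princ[OF that, of "- princ c"] by simp
  show "(\<lambda>a. a \<otimes> b) \<in> rr D \<rightarrow> rr (D - princ b)"
    using rr_mult[OF _ self[OF b], of _ D] by auto
  show "(\<lambda>a. a \<otimes> inv b) \<in> rr (D - princ b) \<rightarrow> rr D"
    using rr_mult[OF _ self[OF ib(1,2)], of _ "D - princ b"] princ_inv[OF b] by auto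
  show "a \<otimes> b \<otimes> inv b = a" if "a \<in> rr D" for a
    using rr_closed[OF that] b ib by (simp add: m_assoc)
  show "a \<otimes> inv b \<otimes> b = a" if "a \<in> rr (D - princ b)" for a
    using rr_closed[OF that] b ib by (simp add: m_assoc)
qed

lemma ell_shift:
  assumes D: "divisor D" and b: "b \<in> carrier K" "b \<noteq> \<zero>"
  shows "ell (D - princ b) = ell D"
proof -
  have "q ^ ell (D - princ b) = q ^ ell D"
    using bij_betw_same_card[OF rr_shift[OF b, of D]] card_rr[OF D]
      card_rr[OF divisor_diff[OF D divisor_princ[OF b]]] by simp
  then show ?thesis using q_ge_2
    by (metis less_le_trans one_less_numeral_iff power_inject_exp semiring_norm(76))
qed

text \<open>The witness is the set of n-digit expansions in a uniformizer t with representatives of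
  the residue field as digits. The digits are recovered one by one, by reducing modulo t and
  dividing by t.\<close>

lemma local_residue_system:
  assumes P: "P \<in> places K"
  obtains S where "S \<subseteq> P" "finite S" "card S = q ^ (n * place_degree K P)"
    "\<forall>s\<in>S. \<forall>s'\<in>S. s \<ominus> s' \<in> vset P (int n) \<longrightarrow> s = s'"
proof -
  obtain A where A: "A \<subseteq> P" "finite A" "card A = q ^ place_degree K P"
    "\<And>r r'. r \<in> A \<Longrightarrow> r' \<in> A \<Longrightarrow> r \<ominus> r' \<in> vset P 1 \<Longrightarrow> r = r'"
    using residue_system[OF P] by metis
  obtain t where t: "t \<in> carrier K" "t \<noteq> \<zero>" "place_ord K P t = 1" by (rule ex_place_ord[OF P])
  have tP: "t \<in> P" using place_ord_nonneg_iff[OF P t(1,2)] t(3) by simp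
  have t1: "t \<in> vset P 1" using vset_eqD[OF P t(1,2)] t(3) by simp
  have sub: "horner_sums A t n \<subseteq> P" for n using horner_sums_subring[OF place_subring[OF P] A(1) tP] .
  have ty: "t \<otimes> y \<in> vset P 1" if "y \<in> P" for y
    using vset_mult_integral[OF P that t1] m_comm[OF t(1)] that place_carrier[OF P] by auto
  have card: "finite (horner_sums A t n) \<and> card (horner_sums A t n) = card A ^ n" for n
  proof (rule card_horner_sums[OF place_subring[OF P] A(1) tP t(2) A(2)])
    fix e e' y assume "e \<in> A" "e' \<in> A" "y \<in> P" "e \<ominus> e' = t \<otimes> y"
    then show "e = e'" using A(4) ty by simp
  qed
  have dist: "s = s'" if "s \<in> horner_sums A t n" "s' \<in> horner_sums A t n" "s \<ominus> s' \<in> vset P (int n)" for s s' n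
    using that
  proof (induction n arbitrary: s s')
    case 0
    then show ?case by simp
  next
    case (Suc n)
    obtain e y where s: "s = e \<oplus> t \<otimes> y" "e \<in> A" "y \<in> horner_sums A t n"
      using horner_sums_SucE[OF Suc.prems(1)] .
    obtain e' y' where s': "s' = e' \<oplus> t \<otimes> y'" "e' \<in> A" "y' \<in> horner_sums A t n"
      using horner_sums_SucE[OF Suc.prems(2)] .
    have yP: "y \<in> P" "y' \<in> P" using s s' sub by auto
    have c: "e \<in> carrier K" "e' \<in> carrier K" "y \<in> carrier K" "y' \<in> carrier K"
      using s s' A(1) yP place_carrier[OF P] by auto
    have d1: "s \<ominus> s' \<in> vset P 1" using Suc.prems(3) by (rule vset_mono[rotated]) simp
    have "e \<ominus> e' = (s \<ominus> s') \<ominus> (t \<otimes> y \<ominus> t \<otimes> y')"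
      unfolding s(1) s'(1) using c t(1) by algebra
    moreover have "\<dots> \<in> vset P 1"
      using d1 ty[OF yP(1)] ty[OF yP(2)] vset_minus[OF P] by blast
    ultimately have ee: "e = e'" using A(4) s(2) s'(2) by simp
    have "s \<ominus> s' = t \<otimes> (y \<ominus> y')" unfolding s(1) s'(1) ee using c t(1) by algebra
    then have v: "t \<otimes> (y \<ominus> y') \<in> vset P (int (Suc n))" using Suc.prems(3) by simp
    have yc: "y \<ominus> y' \<in> carrier K" using c by simp
    have "y \<ominus> y' \<in> vset P (int n)"
    proof (cases "y \<ominus> y' = \<zero>")
      case True
      then show ?thesis using vset_zero by simp
    next
      case False
      have "int (Suc n) \<le> place_ord K P (t \<otimes> (y \<ominus> y'))"
        using v vset_eqD[OF P, of "t \<otimes> (y \<ominus> y')"] inv_mult_field(2)[OF t(1,2) yc False] t yc by simp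
      then have "int n \<le> place_ord K P (y \<ominus> y')"
        using place_ord_mult[OF P t(1,2) yc False] t(3) by simp
      then show ?thesis using vset_eqD[OF P yc False] by simp
    qed
    then have "y = y'" using Suc.IH[OF s(3) s'(3)] by simp
    then show ?case using s s' ee by simp
  qed
  show thesis
  proof (rule that[of "horner_sums A t n"])
    show "card (horner_sums A t n) = q ^ (n * place_degree K P)"
      using card A(3) by (simp add: power_mult[symmetric] mult.commute)
  qed (use sub card dist in auto)
qed

text \<open>Chinese remaindering: weak approximation glues every choice of local representatives at
  the zeros of z into one element of the intersection V. The number of choices is a product over the
  zeros, and its exponent adds up to the degree of the divisor of zeros.\<close>

lemma zero_residue_system:
  assumes z: "z \<in> carrier K" "z \<noteq> \<zero>"
  obtains V E where "subring V K" "z \<in> V" "E \<subseteq> V" "finite E"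
    "\<forall>e\<in>E. \<forall>e'\<in>E. \<forall>y\<in>V. e \<ominus> e' = z \<otimes> y \<longrightarrow> e = e'"
    "card E = q ^ nat (div_degree K (pos_part (princ z)))"
proof -
  define T where "T = {P \<in> places K. 0 < place_ord K P z}"
  define n where "n P = nat (place_ord K P z)" for P
  have finT: "finite T" unfolding T_def using finite_zeros[OF z] .
  have Tp: "P \<in> places K" "int (n P) = place_ord K P z" if "P \<in> T" for P
    using that unfolding T_def n_def by auto
  \<comment> \<open>The carrier is inserted so that V is a subring of K even if z has no
    zeros.\<close>
  define V where "V = \<Inter>(insert (carrier K) T)"
  have V: "subring V K"
    unfolding V_def using place_subring Tp carrier_is_subring by (intro subring_Inter) auto
  have zn: "z \<in> vset P (int (n P))" if "P \<in> T" for P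
    using vset_eqD[OF Tp(1)[OF that] z] Tp(2)[OF that] by simp
  have zV: "z \<in> V"
    unfolding V_def using z place_ord_nonneg_iff[OF Tp(1) z] Tp(2) by (auto simp: T_def)
  have "\<forall>P. \<exists>S. P \<in> T \<longrightarrow> (S \<subseteq> P \<and> finite S \<and> card S = q ^ (n P * place_degree K P) \<and>
    (\<forall>s\<in>S. \<forall>s'\<in>S. s \<ominus> s' \<in> vset P (int (n P)) \<longrightarrow> s = s'))"
  proof
    fix P
    show "\<exists>S. P \<in> T \<longrightarrow> (S \<subseteq> P \<and> finite S \<and> card S = q ^ (n P * place_degree K P) \<and>
      (\<forall>s\<in>S. \<forall>s'\<in>S. s \<ominus> s' \<in> vset P (int (n P)) \<longrightarrow> s = s'))"
    proof (cases "P \<in> T")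
      case True
      obtain S where "S \<subseteq> P" "finite S" "card S = q ^ (n P * place_degree K P)"
        "\<forall>s\<in>S. \<forall>s'\<in>S. s \<ominus> s' \<in> vset P (int (n P)) \<longrightarrow> s = s'"
        using local_residue_system[OF Tp(1)[OF True], of "n P"] .
      then show ?thesis by blast
    qed blast
  qed
  then obtain S where S: "\<forall>P. P \<in> T \<longrightarrow> (S P \<subseteq> P \<and> finite (S P) \<and> card (S P) = q ^ (n P * place_degree K P) \<and>
    (\<forall>s\<in>S P. \<forall>s'\<in>S P. s \<ominus> s' \<in> vset P (int (n P)) \<longrightarrow> s = s'))"
    by (rule choice[THEN exE])
  define F where "F = Pi\<^sub>E T S"
  \<comment> \<open>Weak approximation works with one precision for all places; the sum of the
    orders dominates each of them.\<close>
  define N where "N = (\<Sum>P\<in>T. int (n P))"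
  have nN: "int (n P) \<le> N" if "P \<in> T" for P
    unfolding N_def using finT by (intro member_le_sum[OF that]) auto
  have "\<forall>f. \<exists>a. f \<in> F \<longrightarrow> a \<in> carrier K \<and> (\<forall>P\<in>T. a \<ominus> f P \<in> vset P N)"
  proof
    fix f
    show "\<exists>a. f \<in> F \<longrightarrow> a \<in> carrier K \<and> (\<forall>P\<in>T. a \<ominus> f P \<in> vset P N)"
    proof (cases "f \<in> F")
      case True
      have "f P \<in> carrier K" if P: "P \<in> T" for P
      proof -
        have "f P \<in> S P" using True P unfolding F_def by (auto simp: PiE_def Pi_def)
        then show ?thesis using S P place_carrier[OF Tp(1)[OF P]] by blast
      qed
      then show ?thesis using weak_approximation[OF finT, of f N] Tp by blast
    qed blast
  qed
  then obtain a where a: "\<forall>f. f \<in> F \<longrightarrow> a f \<in> carrier K \<and> (\<forall>P\<in>T. a f \<ominus> f P \<in> vset P N)"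
    by (rule choice[THEN exE])
  have fS: "f P \<in> S P" "f P \<in> P" "f P \<in> carrier K" if f: "f \<in> F" and P: "P \<in> T" for f P
  proof -
    show "f P \<in> S P" using f P unfolding F_def by (auto simp: PiE_def Pi_def)
    then show "f P \<in> P" using S P by blast
    then show "f P \<in> carrier K" using place_carrier[OF Tp(1)[OF P]] by blast
  qed
  have af: "a f \<ominus> f P \<in> vset P (int (n P))" if "f \<in> F" "P \<in> T" for f P
    using a that nN vset_mono by blast
  have aV: "a f \<in> V" if f: "f \<in> F" for f
  proof -
    have "a f \<in> P" if P: "P \<in> T" for P
    proof -
      have "a f \<ominus> f P \<in> P" using vset_mono[OF _ af[OF f P], of 0] vset_0[OF Tp(1)[OF P]] by simp
      then have "(a f \<ominus> f P) \<oplus> f P \<in> P" using fS(2)[OF f P] subringE(7)[OF place_subring[OF Tp(1)[OF P]]] by blast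
      moreover have "(a f \<ominus> f P) \<oplus> f P = a f" using a f fS(3)[OF f P] by (simp add: a_minus_def a_assoc l_neg)
      ultimately show ?thesis by simp
    qed
    then show ?thesis unfolding V_def using a f by blast
  qed
  have key: "f = g" if f: "f \<in> F" and g: "g \<in> F" and y: "y \<in> V" and eq: "a f \<ominus> a g = z \<otimes> y" for f g y
  proof -
    have "f P = g P" if P: "P \<in> T" for P
    proof -
      have Pp: "P \<in> places K" using Tp P by simp
      have yP: "y \<in> P" "y \<in> carrier K" using y P unfolding V_def by auto
      have "z \<otimes> y \<in> vset P (int (n P))"
        using vset_mult_integral[OF Pp yP(1) zn[OF P]] m_comm[OF z(1) yP(2)] by simp
      then have "a f \<ominus> a g \<in> vset P (int (n P))" using eq by simp
      then have "((a f \<ominus> a g) \<ominus> (a f \<ominus> f P)) \<oplus> (a g \<ominus> g P) \<in> vset P (int (n P))"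
        using af[OF f P] af[OF g P] vset_minus[OF Pp] vset_add[OF Pp] by blast
      moreover have "((a f \<ominus> a g) \<ominus> (a f \<ominus> f P)) \<oplus> (a g \<ominus> g P) = f P \<ominus> g P"
      proof -
        have "a f \<in> carrier K" "a g \<in> carrier K" "f P \<in> carrier K" "g P \<in> carrier K"
          using a f g fS[OF f P] fS[OF g P] by auto
        then show ?thesis by algebra
      qed
      ultimately show ?thesis using S P fS(1)[OF f P] fS(1)[OF g P] by metis
    qed
    then show ?thesis using f g unfolding F_def by (meson PiE_ext)
  qed
  have inj: "inj_on a F"
  proof (rule inj_onI)
    fix f g assume fg: "f \<in> F" "g \<in> F" "a f = a g"
    then have "a f \<ominus> a g = z \<otimes> \<zero>" using a z by (simp add: r_right_minus_eq)
    then show "f = g" using key[OF fg(1,2) subringE(2)[OF V]] by simp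
  qed
  have finF: "finite F" unfolding F_def using finT S by (intro finite_PiE) auto
  have "card F = (\<Prod>P\<in>T. q ^ (n P * place_degree K P))"
    unfolding F_def card_PiE[OF finT] using S by (intro prod.cong) auto
  also have "\<dots> = q ^ (\<Sum>P\<in>T. n P * place_degree K P)" by (simp add: power_sum)
  also have "(\<Sum>P\<in>T. n P * place_degree K P) = nat (div_degree K (pos_part (princ z)))"
  proof -
    have keys: "Poly_Mapping.keys (pos_part (princ z)) \<subseteq> T"
      unfolding T_def using lookup_princ[OF z] by (auto simp: in_keys_iff lookup_pos_part split: if_splits)
    have "div_degree K (pos_part (princ z)) = (\<Sum>P\<in>T. dcoeff (pos_part (princ z)) P * int (place_degree K P))"
      by (rule div_degree_superset[OF finT keys])
    also have "\<dots> = (\<Sum>P\<in>T. int (n P * place_degree K P))"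
    proof (rule sum.cong[OF refl])
      fix P assume P: "P \<in> T"
      then have "dcoeff (pos_part (princ z)) P = int (n P)"
        using lookup_princ[OF z] unfolding lookup_pos_part T_def n_def by auto
      then show "dcoeff (pos_part (princ z)) P * int (place_degree K P) = int (n P * place_degree K P)" by simp
    qed
    finally have "div_degree K (pos_part (princ z)) = int (\<Sum>P\<in>T. n P * place_degree K P)" by simp
    then show ?thesis by (metis nat_int)
  qed
  finally have cardF: "card F = q ^ nat (div_degree K (pos_part (princ z)))" .
  show thesis
  proof (rule that[OF V zV])
    show "a ` F \<subseteq> V" using aV by blast
    show "finite (a ` F)" using finF by simp
    show "card (a ` F) = q ^ nat (div_degree K (pos_part (princ z)))" using card_image[OF inj] cardF by simp
    show "\<forall>e\<in>a ` F. \<forall>e'\<in>a ` F. \<forall>y\<in>V. e \<ominus> e' = z \<otimes> y \<longrightarrow> e = e'" using key by blast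
  qed
qed

lemma common_pole_bound:
  assumes "finite E" "E \<subseteq> carrier K"
  shows "\<exists>C\<in>effective_divisors K. E \<subseteq> rr C"
  using assms
proof (induction E rule: finite_induct)
  case empty
  then show ?case using effective_zero by blast
next
  case (insert e E)
  then obtain C where C: "C \<in> effective_divisors K" "E \<subseteq> rr C" by auto
  show ?case
  proof (cases "e = \<zero>")
    case True
    then show ?thesis using C rr_0_mem by blast
  next
    case False
    have e: "e \<in> carrier K" using insert.prems by simp
    let ?B = "pos_part (- princ e)"
    have B: "?B \<in> effective_divisors K" using effective_pos_part[OF divisor_uminus[OF divisor_princ[OF e False]]] .
    have "e \<in> rr ?B" unfolding mem_rr_iff_princ[OF e False] by (auto simp: lookup_add lookup_pos_part max_def)
    moreover have "rr ?B \<subseteq> rr (C + ?B)" "rr C \<subseteq> rr (C + ?B)"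
      using B C(1) unfolding effective_iff by (auto intro!: rr_mono simp: lookup_add)
    ultimately show ?thesis using effective_add[OF C(1) B] C(2) by blast
  qed
qed

text \<open>Expansions in base z with the digits of \<open>zero_residue_system\<close>. With n
  digits there are q^(n deg Z) of them, Z being the divisor of zeros, and their poles are bounded by
  n B + C, where B is the pole divisor of z and C absorbs the poles of the digits. The iterated
  addition expresses n B + C.\<close>

lemma multiples_of_pole_divisor:
  assumes z: "z \<in> carrier K" "z \<noteq> \<zero>"
  obtains C where "C \<in> effective_divisors K"
    "\<forall>n. int n * div_degree K (pos_part (princ z)) \<le> int (ell ((((+) (pos_part (- princ z))) ^^ n) C))"
proof -
  let ?B = "pos_part (- princ z)" and ?Z = "pos_part (princ z)"
  have B: "?B \<in> effective_divisors K" using effective_pos_part[OF divisor_uminus[OF divisor_princ[OF z]]] .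
  have Z: "?Z \<in> effective_divisors K" using effective_pos_part[OF divisor_princ[OF z]] .
  obtain V E where V: "subring V K" "z \<in> V" "E \<subseteq> V" "finite E"
    "\<forall>e\<in>E. \<forall>e'\<in>E. \<forall>y\<in>V. e \<ominus> e' = z \<otimes> y \<longrightarrow> e = e'"
    "card E = q ^ nat (div_degree K ?Z)"
    using zero_residue_system[OF z] .
  have EK: "E \<subseteq> carrier K" using V(3) subringE(1)[OF V(1)] by blast
  obtain C where C: "C \<in> effective_divisors K" "E \<subseteq> rr C" using common_pole_bound[OF V(4) EK] by blast
  define M where "M n = (((+) ?B) ^^ n) C" for n :: nat
  have MS: "M (Suc n) = ?B + M n" and M0: "M 0 = C" for n unfolding M_def by simp_all
  have eff: "M n \<in> effective_divisors K \<and> rr C \<subseteq> rr (M n)" for n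
  proof (induction n)
    case 0
    then show ?case using C M0 by simp
  next
    case (Suc n)
    have "rr (M n) \<subseteq> rr (?B + M n)" using B unfolding effective_iff by (intro rr_mono) (simp add: lookup_add)
    then show ?case using Suc effective_add[OF B] MS by auto
  qed
  have zB: "z \<in> rr ?B" unfolding mem_rr_iff_princ[OF z] by (auto simp: lookup_add lookup_pos_part max_def)
  have sub: "horner_sums E z n \<subseteq> rr (M n)" for n
  proof (induction n)
    case 0
    then show ?case using rr_0_mem by simp
  next
    case (Suc n)
    show ?case
    proof
      fix y assume "y \<in> horner_sums E z (Suc n)"
      then obtain e w where y: "y = e \<oplus> z \<otimes> w" "e \<in> E" "w \<in> horner_sums E z n" by (rule horner_sums_SucE)
      have "z \<otimes> w \<in> rr (M (Suc n))" using rr_mult[OF zB, of w "M n"] Suc y(3) MS by auto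
      moreover have "e \<in> rr (M (Suc n))" using y(2) C(2) eff[of "Suc n"] by blast
      ultimately show "y \<in> rr (M (Suc n))" using rr_add y(1) by simp
    qed
  qed
  have "int n * div_degree K ?Z \<le> int (ell (M n))" for n
  proof -
    have "card (horner_sums E z n) = card E ^ n"
      by (rule conjunct2[OF card_horner_sums[OF V(1,3,2) z(2) V(4)]]) (use V(5) in blast)
    then have "q ^ (nat (div_degree K ?Z) * n) = card (horner_sums E z n)"
      unfolding V(6) by (simp add: power_mult)
    also have "\<dots> \<le> card (rr (M n))"
      using card_mono[OF finite_rr[OF effective_divisor] sub] eff by blast
    also have "\<dots> = q ^ ell (M n)" using card_rr[OF effective_divisor] eff by blast
    finally have "q ^ (nat (div_degree K ?Z) * n) \<le> q ^ ell (M n)" .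
    moreover have "1 < q" using q_ge_2 by simp
    ultimately have "nat (div_degree K ?Z) * n \<le> ell (M n)" by (rule power_le_imp_le_exp[rotated])
    then have "int (nat (div_degree K ?Z)) * int n \<le> int (ell (M n))"
      by (metis of_nat_le_iff of_nat_mult)
    then show ?thesis using div_degree_effective[OF Z] by (simp add: mult.commute)
  qed
  then show thesis using that[OF C(1)] unfolding M_def by blast
qed

lemma ell_effective_le:
  assumes E: "E \<in> effective_divisors K"
  shows "int (ell E) \<le> div_degree K E + 1"
  using ell_growth(2)[OF divisor_zero E] ell_zero by simp

lemma iterated_sum_degree:
  "div_degree K ((((+) B) ^^ n) C) = int n * div_degree K B + div_degree K C"
  by (induction n) (simp_all add: div_degree_add distrib_right)

lemma effective_iterated_sum:
  "B \<in> effective_divisors K \<Longrightarrow> C \<in> effective_divisors K \<Longrightarrow> (((+) B) ^^ n) C \<in> effective_divisors K"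
  by (induction n) (simp_all add: effective_add)

text \<open>For every n the chain n deg Z <= l(n B + C) <= n deg B + deg C + 1 holds, and a large n
  makes the constants negligible.\<close>

lemma zeros_le_poles:
  assumes z: "z \<in> carrier K" "z \<noteq> \<zero>"
  shows "div_degree K (pos_part (princ z)) \<le> div_degree K (pos_part (- princ z))"
proof -
  let ?B = "pos_part (- princ z)" and ?Z = "pos_part (princ z)"
  have B: "?B \<in> effective_divisors K" using effective_pos_part[OF divisor_uminus[OF divisor_princ[OF z]]] .
  obtain C where C: "C \<in> effective_divisors K"
    "\<forall>n. int n * div_degree K ?Z \<le> int (ell ((((+) ?B) ^^ n) C))"
    by (rule multiples_of_pole_divisor[OF z])
  have bound: "int n * div_degree K ?Z \<le> int n * div_degree K ?B + div_degree K C + 1" for n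
    using C(2)[rule_format, of n] ell_effective_le[OF effective_iterated_sum[OF B C(1)], of n]
      iterated_sum_degree[of n ?B C] by linarith
  show ?thesis
  proof (rule ccontr)
    assume "\<not> ?thesis"
    then have "div_degree K ?B + 1 \<le> div_degree K ?Z" by simp
    \<comment> \<open>Just beyond the slack deg C + 1 of the linear bound.\<close>
    define n where "n = nat (div_degree K C + 2)"
    have n: "int n = div_degree K C + 2" unfolding n_def using div_degree_effective[OF C(1)] by simp
    have "int n * (div_degree K ?B + 1) \<le> int n * div_degree K ?Z"
      using \<open>div_degree K ?B + 1 \<le> _\<close> by (intro mult_left_mono) auto
    then show False using bound[of n] n by (simp add: distrib_left)
  qed
qed

text \<open>Passing from z to 1/z exchanges zeros and poles, so the inequality between their degrees
  holds in both directions.\<close>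

theorem div_degree_princ:
  assumes z: "z \<in> carrier K" "z \<noteq> \<zero>"
  shows "div_degree K (princ z) = 0"
proof -
  note iz = inv_closed_nonzero[OF z]
  have "div_degree K (pos_part (princ z)) = div_degree K (pos_part (- princ z))"
    using zeros_le_poles[OF z] zeros_le_poles[OF iz(1,2)] princ_inv[OF z] by simp
  then show ?thesis using div_degree_diff pos_part_diff[of "princ z"] by (metis diff_self)
qed

subsection \<open>Riemann's theorem\<close>

text \<open>The defect deg D - l(D) does not decrease when D grows, and it depends only on the class
  of D. On the divisors M n = n B + C it is at most deg C, because l(M n) >= n deg B. Every D is
  equivalent to a divisor below some M n, so deg C bounds all defects.\<close>

lemma riemann_inequality: "\<exists>\<gamma>. \<forall>D. divisor D \<longrightarrow> div_degree K D - int (ell D) \<le> \<gamma>"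
proof -
  obtain x where x0: "x \<in> carrier K" "(transcendental over prime_subfield K) x"
    using finite_over_rational_function_field by blast
  then have x: "x \<in> carrier K" "x \<notin> constant_field K" unfolding constant_field_def over_def by auto
  then have xn: "x \<noteq> \<zero>" using subringE(2)[OF subfieldE(1)[OF subfield_constant_field]] by auto
  let ?B = "pos_part (- princ x)" and ?Z = "pos_part (princ x)"
  have B: "?B \<in> effective_divisors K" using effective_pos_part[OF divisor_uminus[OF divisor_princ[OF x(1) xn]]] .
  have ZB: "div_degree K ?Z = div_degree K ?B"
    using div_degree_princ[OF x(1) xn] div_degree_diff[of ?Z ?B] pos_part_diff[of "princ x"] by simp
  obtain P where P: "P \<in> places K" "x \<notin> P" using ex_place_avoiding[OF x] by blast
  have "place_ord K P x < 0" using place_ord_nonneg_iff[OF P(1) x(1) xn] P(2) by simp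
  then have "dcoeff ?B P \<noteq> 0" using lookup_princ[OF x(1) xn] P by (simp add: lookup_pos_part)
  then have "?B \<noteq> 0" by auto
  then have Bpos: "1 \<le> div_degree K ?B"
    using effective_degree_zero[OF B] div_degree_effective[OF B] by fastforce
  obtain C where C: "C \<in> effective_divisors K"
    "\<forall>n. int n * div_degree K ?Z \<le> int (ell ((((+) ?B) ^^ n) C))"
    by (rule multiples_of_pole_divisor[OF x(1) xn])
  define M where "M n = (((+) ?B) ^^ n) C" for n :: nat
  have M: "M n \<in> effective_divisors K" "div_degree K (M n) = int n * div_degree K ?B + div_degree K C"
    "int n * div_degree K ?B \<le> int (ell (M n))" for n
    unfolding M_def using effective_iterated_sum[OF B C(1)] iterated_sum_degree C(2) ZB by auto
  have "div_degree K D - int (ell D) \<le> div_degree K C" if D: "divisor D" for D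
  proof -
    let ?P = "pos_part D"
    have Pe: "?P \<in> effective_divisors K" using effective_pos_part[OF D] .
    \<comment> \<open>This makes l(M n) exceed the degree of the positive part of D, so that
      subtracting this part from M n leaves a nonzero space. Its elements move D below M n.\<close>
    define n where "n = nat (div_degree K ?P + 1)"
    have n: "int n = div_degree K ?P + 1" unfolding n_def using div_degree_effective[OF Pe] by simp
    have MD: "divisor (M n)" "divisor (M n - ?P)"
      using effective_divisor[OF M(1)] divisor_diff effective_divisor[OF Pe] by auto
    have "int n * 1 \<le> int n * div_degree K ?B" using Bpos by (intro mult_left_mono) auto
    moreover have "int (ell (M n)) \<le> int (ell (M n - ?P)) + div_degree K ?P"
      using ell_growth(2)[OF MD(2) Pe] by simp
    ultimately have "1 \<le> ell (M n - ?P)" using M(3)[of n] n by linarith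
    then have "q ^ 1 \<le> card (rr (M n - ?P))"
      unfolding card_rr[OF MD(2)] using q_ge_2 by (intro power_increasing) auto
    then have "2 \<le> card (rr (M n - ?P))" using q_ge_2 by simp
    then obtain z where z: "z \<in> rr (M n - ?P)" "z \<noteq> \<zero>"
      by (metis card_le_Suc0_iff_eq finite_rr[OF MD(2)] not_less_eq_eq numeral_2_eq_2 rr_0_mem)
    have zc: "z \<in> carrier K" using rr_closed[OF z(1)] .
    define D' where "D' = D - princ z"
    have D': "divisor D'" unfolding D'_def using divisor_diff[OF D divisor_princ[OF zc z(2)]] .
    have eff: "M n - D' \<in> effective_divisors K"
      unfolding effective_iff
    proof (intro conjI allI)
      show "divisor (M n - D')" using divisor_diff[OF MD(1) D'] .
      fix Q
      show "0 \<le> dcoeff (M n - D') Q"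
      proof (cases "Q \<in> places K")
        case True
        then have "0 \<le> dcoeff (princ z + (M n - ?P)) Q" using z mem_rr_iff_princ[OF zc z(2)] by blast
        then show ?thesis unfolding D'_def by (simp add: lookup_add lookup_minus lookup_pos_part)
      next
        case False
        then have "Q \<notin> Poly_Mapping.keys (M n - D')" using divisor_diff[OF MD(1) D'] unfolding divisor_def by blast
        then show ?thesis by (simp add: in_keys_iff)
      qed
    qed
    have "int (ell (M n)) \<le> int (ell D') + div_degree K (M n - D')"
      using ell_growth(2)[OF D' eff] by simp
    moreover have "ell D' = ell D" unfolding D'_def using ell_shift[OF D zc z(2)] .
    moreover have "div_degree K D' = div_degree K D"
      unfolding D'_def div_degree_diff using div_degree_princ[OF zc z(2)] by simp
    ultimately show ?thesis using M(2,3)[of n] by (simp add: div_degree_diff)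
  qed
  then show ?thesis by blast
qed

lemma nonzero_in_rr:
  assumes D: "divisor D" and l: "1 \<le> ell D"
  obtains z where "z \<in> rr D" "z \<in> carrier K" "z \<noteq> \<zero>"
proof -
  have "q ^ 1 \<le> card (rr D)"
    unfolding card_rr[OF D] using q_ge_2 l by (intro power_increasing) auto
  then have "2 \<le> card (rr D)" using q_ge_2 by simp
  then obtain z where "z \<in> rr D" "z \<noteq> \<zero>"
    by (metis card_le_Suc0_iff_eq finite_rr[OF D] not_less_eq_eq numeral_2_eq_2 rr_0_mem)
  then show thesis using that rr_closed by blast
qed

text \<open>\<open>GREATEST\<close> yields a maximum only for values that are bounded above; the
  bound is Riemann's inequality. Cutting at a member g0 makes the set of values finite.\<close>

lemma genus_attained:
  obtains D where "divisor D" "genus K = div_degree K D - int (ell D) + 1"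
    and "\<forall>E. divisor E \<longrightarrow> div_degree K E - int (ell E) + 1 \<le> genus K"
proof -
  define A where "A = {g. \<exists>D. divisor D \<and> g = div_degree K D - int (ell D) + 1}"
  obtain \<gamma> where \<gamma>: "\<And>D. divisor D \<Longrightarrow> div_degree K D - int (ell D) \<le> \<gamma>" using riemann_inequality by blast
  have "A \<noteq> {}" unfolding A_def using divisor_zero by blast
  then obtain g0 where g0: "g0 \<in> A" by blast
  have fin: "finite (A \<inter> {g0..})"
    by (rule finite_subset[of _ "{g0..\<gamma> + 1}"]) (use \<gamma> in \<open>auto simp: A_def\<close>)
  have ne: "A \<inter> {g0..} \<noteq> {}" using g0 by auto
  define g where "g = Max (A \<inter> {g0..})"
  have gA: "g \<in> A" unfolding g_def using Max_in[OF fin ne] by blast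
  have gmax: "h \<le> g" if "h \<in> A" for h
  proof (cases "h \<ge> g0")
    case True
    then show ?thesis unfolding g_def using that by (intro Max_ge[OF fin]) auto
  next
    case False
    moreover have "g0 \<le> g" unfolding g_def using g0 by (intro Max_ge[OF fin]) auto
    ultimately show ?thesis by simp
  qed
  have "genus K = g"
    unfolding genus_def
  proof (rule Greatest_equality)
    show "\<exists>D\<in>carrier (divisor_group K). g = div_degree K D - int (dim (constant_field K) (rr D)) + 1"
      using gA unfolding A_def divisor_iff ell_def by blast
    fix h assume "\<exists>D\<in>carrier (divisor_group K). h = div_degree K D - int (dim (constant_field K) (rr D)) + 1"
    then show "h \<le> g" using gmax unfolding A_def divisor_iff ell_def by blast
  qed
  then show thesis using that gA gmax unfolding A_def by blast
qed

text \<open>In large degree L(D - D0) is nonzero, so D is equivalent to a divisor above D0, where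
  the defect is already maximal. As the defect cannot drop when the divisor grows, D has the maximal
  defect too.\<close>

theorem riemann_theorem: "\<exists>N. \<forall>D. divisor D \<longrightarrow> N \<le> div_degree K D \<longrightarrow> int (ell D) = div_degree K D + 1 - genus K"
proof -
  obtain D0 where D0: "divisor D0" "genus K = div_degree K D0 - int (ell D0) + 1"
    and max': "\<forall>E. divisor E \<longrightarrow> div_degree K E - int (ell E) + 1 \<le> genus K"
    by (rule genus_attained)
  note max = max'[rule_format]
  have "int (ell D) = div_degree K D + 1 - genus K" if D: "divisor D" and le: "div_degree K D0 + genus K \<le> div_degree K D" for D
  proof -
    have DD: "divisor (D - D0)" using divisor_diff[OF D D0(1)] .
    have "1 \<le> ell (D - D0)" using max[OF DD] le by (simp add: div_degree_diff)
    then obtain z where z: "z \<in> rr (D - D0)" "z \<in> carrier K" "z \<noteq> \<zero>" by (rule nonzero_in_rr[OF DD])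
    note iz = inv_closed_nonzero[OF z(2,3)]
    define D' where "D' = D - princ (inv z)"
    have D': "divisor D'" unfolding D'_def using divisor_diff[OF D divisor_princ[OF iz(1,2)]] .
    have eff: "D' - D0 \<in> effective_divisors K"
      unfolding effective_iff
    proof (intro conjI allI)
      show dv: "divisor (D' - D0)" using divisor_diff[OF D' D0(1)] .
      fix Q
      show "0 \<le> dcoeff (D' - D0) Q"
      proof (cases "Q \<in> places K")
        case True
        then have "0 \<le> dcoeff (princ z + (D - D0)) Q" using z mem_rr_iff_princ[OF z(2,3)] by blast
        then show ?thesis unfolding D'_def princ_inv[OF z(2,3)] by (simp add: lookup_add lookup_minus)
      next
        case False
        then have "Q \<notin> Poly_Mapping.keys (D' - D0)" using dv unfolding divisor_def by blast
        then show ?thesis by (simp add: in_keys_iff)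
      qed
    qed
    have "int (ell D') \<le> int (ell D0) + div_degree K (D' - D0)"
      using ell_growth(2)[OF D0(1) eff] by simp
    moreover have "ell D' = ell D" unfolding D'_def using ell_shift[OF D iz(1,2)] .
    moreover have "div_degree K D' = div_degree K D"
      unfolding D'_def div_degree_diff using div_degree_princ[OF iz(1,2)] by simp
    ultimately show ?thesis using D0(2) max[OF D] by (simp add: div_degree_diff)
  qed
  then show ?thesis by blast
qed

subsection \<open>Counting effective divisors\<close>

definition eff :: "nat \<Rightarrow> ('a set \<Rightarrow>\<^sub>0 int) set" where
  "eff n = {A \<in> effective_divisors K. div_degree K A = int n}"

lemma eff_coeff_bound:
  assumes A: "A \<in> eff n"
  shows "dcoeff A P * int (place_degree K P) \<le> int n"
proof (cases "P \<in> Poly_Mapping.keys A")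
  case True
  have "dcoeff A P * int (place_degree K P) \<le> div_degree K A"
    unfolding div_degree_def using A unfolding eff_def effective_iff
    by (intro member_le_sum[OF True, of "\<lambda>P. dcoeff A P * int (place_degree K P)"]) auto
  then show ?thesis using A unfolding eff_def by simp
next
  case False
  then show ?thesis by (simp add: in_keys_iff)
qed

lemma eff_key_degree:
  assumes A: "A \<in> eff n" and P: "P \<in> Poly_Mapping.keys A"
  shows "P \<in> places K" "place_degree K P \<le> n" "dcoeff A P \<le> int n"
proof -
  show Pp: "P \<in> places K" using A P effective_remove_prime(2) unfolding eff_def by blast
  have "dcoeff A P \<noteq> 0" "0 \<le> dcoeff A P" using A P unfolding eff_def effective_iff by (auto simp: in_keys_iff)
  then have c: "1 \<le> dcoeff A P" by linarith
  have "1 * int (place_degree K P) \<le> dcoeff A P * int (place_degree K P)"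
    using c by (intro mult_right_mono) auto
  then show "place_degree K P \<le> n" using eff_coeff_bound[OF A, of P] by simp
  have "dcoeff A P * 1 \<le> dcoeff A P * int (place_degree K P)"
    using c place_degree_pos[OF Pp] by (intro mult_left_mono) auto
  then show "dcoeff A P \<le> int n" using eff_coeff_bound[OF A, of P] by simp
qed

text \<open>Only finitely many places have degree at most n, and a coefficient is at most n because
  places have positive degree.\<close>

lemma finite_eff: "finite (eff n)"
proof -
  define F where "F = {P \<in> places K. place_degree K P \<le> n}"
  have F: "finite F" unfolding F_def by (rule finite_places_degree_le)
  have key: "P \<in> F" if "A \<in> eff n" "dcoeff A P \<noteq> 0" for A P
    using eff_key_degree[OF that(1), of P] that(2) unfolding F_def by (simp add: in_keys_iff)
  have "inj_on (\<lambda>A. restrict (dcoeff A) F) (eff n)"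
  proof (rule inj_onI)
    fix A B assume AB: "A \<in> eff n" "B \<in> eff n" "restrict (dcoeff A) F = restrict (dcoeff B) F"
    show "A = B"
    proof (rule poly_mapping_eqI)
      fix P
      show "dcoeff A P = dcoeff B P"
      proof (cases "P \<in> F")
        case True
        then show ?thesis using AB(3) by (metis restrict_apply')
      next
        case False
        then have "dcoeff A P = 0" "dcoeff B P = 0" using key AB(1,2) by metis+
        then show ?thesis by simp
      qed
    qed
  qed
  moreover have "(\<lambda>A. restrict (dcoeff A) F) ` eff n \<subseteq> Pi\<^sub>E F (\<lambda>_. {0..int n})"
  proof
    fix f assume "f \<in> (\<lambda>A. restrict (dcoeff A) F) ` eff n"
    then obtain A where A: "A \<in> eff n" "f = restrict (dcoeff A) F" by blast
    have "dcoeff A P \<in> {0..int n}" for P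
    proof (cases "dcoeff A P = 0")
      case False
      then show ?thesis
        using eff_key_degree(3)[OF A(1), of P] A(1) unfolding eff_def effective_iff by (simp add: in_keys_iff)
    qed simp
    then show "f \<in> Pi\<^sub>E F (\<lambda>_. {0..int n})" unfolding A(2) by auto
  qed
  moreover have "finite (Pi\<^sub>E F (\<lambda>_. {0..int n}))" using F by (intro finite_PiE) auto
  ultimately show ?thesis by (rule inj_on_finite)
qed

lemma mem_principal_divisors: "D \<in> principal_divisors K \<longleftrightarrow> (\<exists>a\<in>carrier K - {\<zero>}. D = princ a)"
proof
  assume "D \<in> principal_divisors K"
  then obtain a where a: "a \<in> carrier K - {\<zero>}" "divisor D" "\<forall>P\<in>places K. dcoeff D P = place_ord K P a"
    unfolding principal_divisors_def divisor_iff by blast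
  have "D = princ a"
  proof (rule poly_mapping_eqI)
    fix P
    show "dcoeff D P = dcoeff (princ a) P"
    proof (cases "P \<in> places K")
      case True
      then show ?thesis using a lookup_princ[of a P] by simp
    next
      case False
      then have "P \<notin> Poly_Mapping.keys D" using a(2) unfolding divisor_def by blast
      then show ?thesis using False a(1) lookup_princ[of a P] by (simp add: in_keys_iff)
    qed
  qed
  then show "\<exists>a\<in>carrier K - {\<zero>}. D = princ a" using a(1) by blast
next
  assume "\<exists>a\<in>carrier K - {\<zero>}. D = princ a"
  then obtain a where a: "a \<in> carrier K" "a \<noteq> \<zero>" "D = princ a" by blast
  then show "D \<in> principal_divisors K"
    unfolding principal_divisors_def using divisor_princ[OF a(1,2)] lookup_princ[OF a(1,2)] unfolding divisor_iff by auto
qed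

definition dclass :: "('a set \<Rightarrow>\<^sub>0 int) \<Rightarrow> ('a set \<Rightarrow>\<^sub>0 int) set" where
  "dclass D = (\<lambda>H. H + D) ` principal_divisors K"

lemma princ_one: "princ \<one> = 0"
  using place_ord_one by (intro poly_mapping_eqI) (simp add: lookup_princ)

lemma dclass_eq_iff:
  "dclass D = dclass E \<longleftrightarrow> (\<exists>a\<in>carrier K - {\<zero>}. D = E + princ a)"
proof
  assume eq: "dclass D = dclass E"
  have "princ \<one> \<in> principal_divisors K" using mem_principal_divisors one_not_zero one_closed by blast
  then have "princ \<one> + D \<in> dclass D" unfolding dclass_def by (rule imageI)
  then have "D \<in> dclass D" unfolding princ_one by simp
  then have "D \<in> dclass E" using eq by simp
  then obtain H where H: "H \<in> principal_divisors K" "D = H + E"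
    unfolding dclass_def by auto
  then obtain a where a: "a \<in> carrier K - {\<zero>}" "H = princ a"
    using mem_principal_divisors[THEN iffD1, OF H(1)] by blast
  then have "D = E + princ a" using H(2) by (simp add: add.commute)
  then show "\<exists>a\<in>carrier K - {\<zero>}. D = E + princ a" using a(1) by blast
next
  have sub: "dclass D \<subseteq> dclass E" if a: "a \<in> carrier K - {\<zero>}" "D = E + princ a" for D E a
  proof
    fix X' assume "X' \<in> dclass D"
    then obtain H where H: "H \<in> principal_divisors K" "X' = H + D"
      unfolding dclass_def by auto
    then obtain b where b: "b \<in> carrier K - {\<zero>}" "H = princ b"
      using mem_principal_divisors[THEN iffD1, OF H(1)] by blast
    have "princ (b \<otimes> a) = princ b + princ a" using princ_mult a b by simp
    then have "X' = princ (b \<otimes> a) + E" using a b H(2) by simp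
    moreover have "b \<otimes> a \<in> carrier K - {\<zero>}" using a b inv_mult_field(2)[of b a] by simp
    ultimately show "X' \<in> dclass E"
      unfolding dclass_def using mem_principal_divisors[THEN iffD2, of "princ (b \<otimes> a)"] by blast
  qed
  assume "\<exists>a\<in>carrier K - {\<zero>}. D = E + princ a"
  then obtain a where a: "a \<in> carrier K - {\<zero>}" "D = E + princ a" by blast
  have ia: "inv a \<in> carrier K - {\<zero>}" using a inv_closed_nonzero[of a] by simp
  have "E = D + princ (inv a)" using a princ_inv[of a] by simp
  then show "dclass D = dclass E" using sub[OF a] sub[OF ia] by blast
qed

lemma class_number_eq: "class_number K = card (dclass ` {D. divisor D \<and> div_degree K D = 0})"
proof -
  let ?G = "degree_zero_divisor_group K"
  have "principal_divisors K #>\<^bsub>?G\<^esub> D = dclass D" for D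
    unfolding r_coset_def dclass_def degree_zero_divisor_group_def by auto
  then have "carrier (?G Mod principal_divisors K) = dclass ` {D. divisor D \<and> div_degree K D = 0}"
    unfolding FactGroup_def RCOSETS_def by (auto simp: degree_zero_divisor_group_def divisor_def)
  then show ?thesis unfolding class_number_def Coset.order_def by simp
qed

lemma princ_eq_iff:
  assumes a: "a \<in> carrier K" "a \<noteq> \<zero>" and b: "b \<in> carrier K" "b \<noteq> \<zero>"
  shows "princ a = princ b \<longleftrightarrow> (\<exists>c\<in>constant_field K - {\<zero>}. a = c \<otimes> b)"
proof
  assume eq: "princ a = princ b"
  note ib = inv_closed_nonzero[OF b]
  let ?c = "a \<otimes> inv b"
  have c: "?c \<in> carrier K" "?c \<noteq> \<zero>" using a ib inv_mult_field(2)[OF a ib(1,2)] by auto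
  have "princ ?c = 0" using princ_mult[OF a ib(1,2)] princ_inv[OF b] eq by simp
  then have "?c \<in> rr 0" using mem_rr_iff_princ[OF c, of 0] by simp
  moreover have "a = ?c \<otimes> b" using a b ib by (simp add: m_assoc)
  ultimately show "\<exists>c\<in>constant_field K - {\<zero>}. a = c \<otimes> b" using rr_zero c by blast
next
  assume "\<exists>c\<in>constant_field K - {\<zero>}. a = c \<otimes> b"
  then obtain c where c: "c \<in> constant_field K" "c \<noteq> \<zero>" "a = c \<otimes> b" by blast
  have cc: "c \<in> carrier K" using c(1) unfolding constant_field_def by simp
  have ik: "inv c \<in> constant_field K" using subfield_m_inv(1)[OF subfield_constant_field] c by auto
  note ic = inv_closed_nonzero[OF cc c(2)]
  have "0 \<le> dcoeff (princ c) P" "0 \<le> dcoeff (princ (inv c)) P" if "P \<in> places K" for P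
    using c(1) ik rr_zero mem_rr_iff_princ[OF cc c(2), of 0] mem_rr_iff_princ[OF ic(1,2), of 0] that by auto
  then have "dcoeff (princ c) P = 0" for P
    using princ_inv[OF cc c(2)] lookup_princ[OF cc c(2), of P] by (cases "P \<in> places K") force+
  then have "princ c = 0" by (intro poly_mapping_eqI) simp
  then show "princ a = princ b" unfolding c(3) using princ_mult[OF cc c(2) b] by simp
qed

text \<open>Sending a to D + (a) maps the nonzero elements of L(D) onto the effective divisors
  equivalent to D. The fibres are the orbits of the q - 1 nonzero constants.\<close>

lemma effective_class_count:
  assumes D: "divisor D" and deg: "div_degree K D = int n"
  shows "(q - 1) * card {A \<in> eff n. \<exists>a\<in>carrier K - {\<zero>}. A = D + princ a} = q ^ ell D - 1"
proof -
  define S where "S = rr D - {\<zero>}"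
  define F where "F = {A \<in> eff n. \<exists>a\<in>carrier K - {\<zero>}. A = D + princ a}"
  have finS: "finite S" unfolding S_def using finite_rr[OF D] by simp
  have finF: "finite F" unfolding F_def using finite_eff by simp
  have Sc: "a \<in> carrier K" "a \<noteq> \<zero>" if "a \<in> S" for a using that rr_closed unfolding S_def by auto
  have img: "(\<lambda>a. D + princ a) ` S = F"
  proof (intro equalityI subsetI)
    fix A assume "A \<in> (\<lambda>a. D + princ a) ` S"
    then obtain a where a: "a \<in> S" "A = D + princ a" by blast
    note ac = Sc[OF a(1)]
    have dv: "divisor A" unfolding a(2) using divisor_add[OF D divisor_princ[OF ac]] .
    have "0 \<le> dcoeff A P" for P
    proof (cases "P \<in> places K")
      case True
      then show ?thesis using a mem_rr_iff_princ[OF ac, of D] unfolding S_def by (simp add: add.commute)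
    next
      case False
      then have "P \<notin> Poly_Mapping.keys A" using dv unfolding divisor_def by blast
      then show ?thesis by (simp add: in_keys_iff)
    qed
    moreover have "div_degree K A = int n" unfolding a(2) div_degree_add using deg div_degree_princ[OF ac] by simp
    ultimately have "A \<in> eff n" unfolding eff_def effective_iff using dv by blast
    then show "A \<in> F" unfolding F_def using a(2) ac by blast
  next
    fix A assume "A \<in> F"
    then obtain a where a: "A \<in> eff n" "a \<in> carrier K" "a \<noteq> \<zero>" "A = D + princ a" unfolding F_def by blast
    have "a \<in> rr D" using a(1) unfolding mem_rr_iff_princ[OF a(2,3)] eff_def effective_iff a(4)
      by (simp add: add.commute)
    then show "A \<in> (\<lambda>a. D + princ a) ` S" unfolding S_def using a by blast
  qed
  have fiber: "card {b \<in> S. D + princ b = A} = q - 1" if AF: "A \<in> F" for A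
  proof -
    obtain a where a: "a \<in> S" "A = D + princ a" using AF img by blast
    note ac = Sc[OF a(1)]
    have "{b \<in> S. D + princ b = A} = (\<lambda>c. c \<otimes> a) ` (constant_field K - {\<zero>})"
    proof (intro equalityI subsetI)
      fix b assume b: "b \<in> {b \<in> S. D + princ b = A}"
      then have "princ b = princ a" using a(2) by simp
      then show "b \<in> (\<lambda>c. c \<otimes> a) ` (constant_field K - {\<zero>})"
        using princ_eq_iff[of b a] Sc b ac by blast
    next
      fix b assume "b \<in> (\<lambda>c. c \<otimes> a) ` (constant_field K - {\<zero>})"
      then obtain c where c: "c \<in> constant_field K" "c \<noteq> \<zero>" "b = c \<otimes> a" by blast
      have cc: "c \<in> carrier K" using c(1) unfolding constant_field_def by simp
      have bc: "b \<in> carrier K" "b \<noteq> \<zero>" unfolding c(3) using cc c(2) ac inv_mult_field(2)[OF cc c(2) ac] by auto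
      have "b \<in> rr D" using rr_mult[of c 0 a D] c rr_zero a(1) unfolding S_def by simp
      moreover have "princ b = princ a" using princ_eq_iff[OF bc ac] c by blast
      ultimately show "b \<in> {b \<in> S. D + princ b = A}" using bc a(2) unfolding S_def by simp
    qed
    moreover have "inj_on (\<lambda>c. c \<otimes> a) (constant_field K - {\<zero>})"
      using m_rcancel[of a] ac unfolding constant_field_def by (intro inj_onI) auto
    ultimately have "card {b \<in> S. D + princ b = A} = card (constant_field K - {\<zero>})" using card_image by metis
    then show ?thesis
      using card_Diff_singleton[of \<zero> "constant_field K"] subringE(2)[OF subfieldE(1)[OF subfield_constant_field]]
      unfolding q_def by simp
  qed
  have "card S = (\<Sum>A\<in>F. \<Sum>b\<in>{b \<in> S. D + princ b = A}. 1)"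
    using sum.group[OF finS finF, of "\<lambda>a. D + princ a" "\<lambda>_. 1 :: nat"] img by simp
  also have "\<dots> = (\<Sum>A\<in>F. q - 1)" using fiber by (intro sum.cong) auto
  finally have "card S = (q - 1) * card F" by simp
  moreover have "card S = q ^ ell D - 1"
    unfolding S_def using card_Diff_singleton[OF rr_0_mem, of D] card_rr[OF D] by simp
  ultimately show ?thesis unfolding F_def by simp
qed

text \<open>In large degree n every class has dimension n + 1 - g by Riemann's theorem, hence
  contains (q^(n + 1 - g) - 1) / (q - 1) effective divisors; summation over the h classes gives the
  formula. The number of classes is finite because in a fixed large degree each of them contains one
  of finitely many effective divisors. In a degree without divisors there is nothing to count,
  whence the condition on n.\<close>

theorem card_eff_large:
  "\<exists>N. \<forall>n \<ge> N. (\<exists>D. divisor D \<and> div_degree K D = int n) \<longrightarrow>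
    real (card (eff n)) = c_const K * real q ^ n - real (class_number K) / (real q - 1)"
  and class_number_pos: "class_number K > 0"
proof -
  define Cl where "Cl = dclass ` {D. divisor D \<and> div_degree K D = 0}"
  have h: "class_number K = card Cl" unfolding Cl_def using class_number_eq .
  obtain N where N: "\<forall>D. divisor D \<longrightarrow> N \<le> div_degree K D \<longrightarrow> int (ell D) = div_degree K D + 1 - genus K"
    using riemann_theorem by blast
  \<comment> \<open>The genus is included so that n + 1 - g is at least 1 and every class of degree
    n contains an effective divisor.\<close>
  define N' where "N' = nat (max N (genus K))"
  have big: "int (ell D) = int n + 1 - genus K \<and> 1 \<le> ell D"
    if "n \<ge> N'" "divisor D" "div_degree K D = int n" for n D
  proof -
    have "N \<le> int n" "genus K \<le> int n" using that(1) unfolding N'_def by linarith+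
    then show ?thesis using N[rule_format, OF that(2)] that(3) by linarith
  qed
  have surj: "Cl \<subseteq> (\<lambda>A. dclass (A - D0)) ` eff n"
    if n: "n \<ge> N'" and D0: "divisor D0" "div_degree K D0 = int n" for n D0
  proof
    fix Y assume "Y \<in> Cl"
    then obtain D where D: "divisor D" "div_degree K D = 0" "Y = dclass D" unfolding Cl_def by blast
    have DD: "divisor (D + D0)" "div_degree K (D + D0) = int n"
      using divisor_add[OF D(1) D0(1)] D(2) D0(2) div_degree_add by auto
    have "1 \<le> ell (D + D0)" using big[OF n DD] by simp
    then have "1 < q ^ ell (D + D0)" using q_ge_2 by (intro one_less_power) auto
    then have "(q - 1) * card {A \<in> eff n. \<exists>a\<in>carrier K - {\<zero>}. A = (D + D0) + princ a} \<noteq> 0"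
      using effective_class_count[OF DD] by simp
    then have "{A \<in> eff n. \<exists>a\<in>carrier K - {\<zero>}. A = (D + D0) + princ a} \<noteq> {}"
      by (metis card.empty mult_0_right)
    then obtain A a where A: "A \<in> eff n" "a \<in> carrier K - {\<zero>}" "A = (D + D0) + princ a" by blast
    have "A - D0 = D + princ a" using A(3) by simp
    then have "dclass (A - D0) = dclass D" using dclass_eq_iff A(2) by blast
    then show "Y \<in> (\<lambda>A. dclass (A - D0)) ` eff n" using A(1) D(3) by blast
  qed
  \<comment> \<open>A multiple of a single place serves as base divisor of sufficiently large
    degree.\<close>
  have finCl: "finite Cl"
  proof -
    obtain P where P: "P \<in> places K" using ex_place by blast
    define n where "n = Suc N' * place_degree K P"
    have "Suc N' * 1 \<le> n" unfolding n_def using place_degree_pos[OF P] by (intro mult_le_mono) auto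
    then have "N' \<le> n" by simp
    moreover have "div_degree K (Poly_Mapping.single P (int (Suc N'))) = int n"
      unfolding div_degree_single n_def by (simp add: distrib_right)
    ultimately have "Cl \<subseteq> (\<lambda>A. dclass (A - Poly_Mapping.single P (int (Suc N')))) ` eff n"
      by (intro surj divisor_single[OF P])
    then show ?thesis by (rule finite_subset[OF _ finite_imageI[OF finite_eff]])
  qed
  have "Cl \<noteq> {}" unfolding Cl_def using divisor_zero div_degree_zero by blast
  then show hpos: "class_number K > 0" unfolding h using finCl by (simp add: card_gt_0_iff)
  have "real (card (eff n)) = c_const K * real q ^ n - real (class_number K) / (real q - 1)"
    if n: "n \<ge> N'" and D0: "divisor D0" "div_degree K D0 = int n" for n D0
  proof -
    define l where "l = ell D0"
    have l: "int l = int n + 1 - genus K" unfolding l_def using big[OF n D0] by simp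
    have "card (eff n) = (\<Sum>Y\<in>Cl. \<Sum>A\<in>{A \<in> eff n. dclass (A - D0) = Y}. 1)"
    proof -
      have "(\<lambda>A. dclass (A - D0)) ` eff n \<subseteq> Cl"
        unfolding Cl_def using divisor_diff[OF effective_divisor D0(1)] D0(2) div_degree_diff
        by (force simp: eff_def)
      then show ?thesis using sum.group[OF finite_eff finCl, of "\<lambda>A. dclass (A - D0)" n "\<lambda>_. 1 :: nat"] by simp
    qed
    then have "(q - 1) * card (eff n) = (\<Sum>Y\<in>Cl. (q - 1) * card {A \<in> eff n. dclass (A - D0) = Y})"
      by (simp add: sum_distrib_left)
    also have "\<dots> = (\<Sum>Y\<in>Cl. q ^ l - 1)"
    proof (rule sum.cong[OF refl])
      fix Y assume "Y \<in> Cl"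
      then obtain D where D: "divisor D" "div_degree K D = 0" "Y = dclass D" unfolding Cl_def by blast
      have DD: "divisor (D + D0)" "div_degree K (D + D0) = int n"
        using divisor_add[OF D(1) D0(1)] D(2) D0(2) div_degree_add by auto
      have "{A \<in> eff n. dclass (A - D0) = Y} = {A \<in> eff n. \<exists>a\<in>carrier K - {\<zero>}. A = (D + D0) + princ a}"
        unfolding D(3) dclass_eq_iff by (auto simp: algebra_simps)
      moreover have "ell (D + D0) = l" using big[OF n DD] l by linarith
      ultimately show "(q - 1) * card {A \<in> eff n. dclass (A - D0) = Y} = q ^ l - 1"
        using effective_class_count[OF DD] by simp
    qed
    also have "\<dots> = card Cl * (q ^ l - 1)" by simp
    finally have eq: "(q - 1) * card (eff n) = card Cl * (q ^ l - 1)" .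
    have q1: "1 \<le> q" "1 \<le> q ^ l" using q_ge_2 by auto
    have "real ((q - 1) * card (eff n)) = real (card Cl * (q ^ l - 1))" unfolding eq ..
    then have "(real q - 1) * real (card (eff n)) = real (class_number K) * (real q ^ l - 1)"
      using q1 h by (simp add: of_nat_diff)
    then have "real (card (eff n)) = real (class_number K) * (real q ^ l - 1) / (real q - 1)"
      using q_ge_2 by (simp add: field_simps)
    moreover have "real q ^ l = real q powi (1 - genus K) * real q ^ n"
    proof -
      have "real q ^ l = real q powi (int l)" by simp
      also have "int l = (1 - genus K) + int n" using l by simp
      also have "real q powi ((1 - genus K) + int n) = real q powi (1 - genus K) * real q powi (int n)"
        using q_ge_2 by (intro power_int_add) auto
      finally show ?thesis by simp
    qed
    ultimately show ?thesis
      unfolding c_const_def Let_def q_def[symmetric] by (simp add: diff_divide_distrib right_diff_distrib)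
  qed
  then show "\<exists>N. \<forall>n \<ge> N. (\<exists>D. divisor D \<and> div_degree K D = int n) \<longrightarrow>
    real (card (eff n)) = c_const K * real q ^ n - real (class_number K) / (real q - 1)" by blast
qed

lemma c_const_pos: "c_const K > 0"
  unfolding c_const_def Let_def q_def[symmetric] using class_number_pos q_ge_2 by simp

text \<open>The degrees of divisors form a subgroup of the integers; its least positive element
  generates it and is the gcd of the degrees of the places.\<close>

definition degree_gcd :: nat where
  "degree_gcd = (LEAST n. 0 < n \<and> (\<exists>D. divisor D \<and> div_degree K D = int n))"

lemma degree_gcd_pos: "0 < degree_gcd"
  and degree_gcd_attained: "\<exists>D. divisor D \<and> div_degree K D = int degree_gcd"
proof -
  obtain P where P: "P \<in> places K" using ex_place by blast
  have "0 < place_degree K P \<and> (\<exists>D. divisor D \<and> div_degree K D = int (place_degree K P))"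
    using place_degree_pos[OF P] divisor_single[OF P, of 1] div_degree_single[of P 1] by auto
  from LeastI[of "\<lambda>n. 0 < n \<and> (\<exists>D. divisor D \<and> div_degree K D = int n)", OF this]
  show "0 < degree_gcd" "\<exists>D. divisor D \<and> div_degree K D = int degree_gcd" unfolding degree_gcd_def by auto
qed

lemma divisor_of_multiple:
  assumes "degree_gcd dvd n"
  shows "\<exists>D. divisor D \<and> div_degree K D = int n"
proof -
  obtain E where E: "divisor E" "div_degree K E = int degree_gcd" using degree_gcd_attained by blast
  have "\<exists>D. divisor D \<and> div_degree K D = int (degree_gcd * m)" for m
  proof (induction m)
    case 0
    then show ?case using divisor_zero div_degree_zero by auto
  next
    case (Suc m)
    then show ?case using E divisor_add div_degree_add by (metis mult_Suc_right of_nat_add)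
  qed
  then show ?thesis using assms by (auto elim: dvdE)
qed

lemma degree_gcd_dvd_div_degree:
  assumes D: "divisor D"
  shows "int degree_gcd dvd div_degree K D"
proof (rule ccontr)
  let ?e = "int degree_gcd" and ?d = "div_degree K D"
  assume nd: "\<not> ?e dvd ?d"
  have e: "0 < ?e" using degree_gcd_pos by simp
  obtain E where E: "divisor E" "div_degree K E = ?e" using degree_gcd_attained by blast
  have mult: "\<exists>F. divisor F \<and> div_degree K F = k * ?e" for k :: int
  proof (induction k rule: int_induct[of _ 0])
    case base
    then show ?case using divisor_zero div_degree_zero by auto
  next
    case (step1 i)
    then show ?case using E divisor_add div_degree_add by (metis distrib_right mult_1)
  next
    case (step2 i)
    then show ?case using E divisor_diff div_degree_diff by (metis left_diff_distrib mult_1)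
  qed
  obtain F where F: "divisor F" "div_degree K F = (?d div ?e) * ?e" using mult by blast
  have "div_degree K (D - F) = ?d mod ?e" using F(2) div_degree_diff by (simp add: minus_div_mult_eq_mod)
  moreover have "0 < ?d mod ?e" using nd e by (simp add: dvd_eq_mod_eq_0 order.not_eq_order_implies_strict)
  moreover have "divisor (D - F)" using divisor_diff[OF D F(1)] .
  ultimately have "degree_gcd \<le> nat (?d mod ?e)"
    unfolding degree_gcd_def by (intro Least_le) auto
  moreover have "?d mod ?e < ?e" using e by simp
  ultimately show False using \<open>0 < ?d mod ?e\<close> by linarith
qed

lemma degree_gcd_dvd_place: "P \<in> places K \<Longrightarrow> degree_gcd dvd place_degree K P"
  using degree_gcd_dvd_div_degree[OF divisor_single, of P 1] div_degree_single[of P 1] by simp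

subsection \<open>Divisor sums\<close>

abbreviation deg :: "'a set \<Rightarrow> nat" where "deg \<equiv> place_degree K"

abbreviation neff :: "nat \<Rightarrow> nat" where "neff n \<equiv> card (eff n)"

definition below :: "('a set \<Rightarrow>\<^sub>0 int) \<Rightarrow> ('a set \<Rightarrow>\<^sub>0 int) set" where
  "below B = {D \<in> effective_divisors K. B - D \<in> effective_divisors K}"

text \<open>Squarefree divisors are handled as finite sets of places, with \<open>ind\<close> as
  translation and \<open>sq n\<close> for those of degree n. On them the Moebius function is a sign,
  elsewhere it vanishes.\<close>

definition ind :: "'a set set \<Rightarrow> 'a set \<Rightarrow>\<^sub>0 int" where
  "ind T = (\<Sum>P\<in>T. Poly_Mapping.single P 1)"

definition degsum :: "'a set set \<Rightarrow> nat" where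
  "degsum T = (\<Sum>P\<in>T. deg P)"

definition sq :: "nat \<Rightarrow> 'a set set set" where
  "sq n = {T. finite T \<and> T \<subseteq> places K \<and> degsum T = n}"

lemma lookup_ind: "finite T \<Longrightarrow> dcoeff (ind T) P = (if P \<in> T then 1 else 0)"
  unfolding ind_def by (simp add: lookup_sum lookup_single when_def)

lemma keys_ind: "finite T \<Longrightarrow> Poly_Mapping.keys (ind T) = T"
  unfolding set_eq_iff in_keys_iff using lookup_ind[of T] by simp

lemma div_degree_ind: "finite T \<Longrightarrow> div_degree K (ind T) = int (degsum T)"
  unfolding degsum_def by (subst div_degree_superset[of T]) (auto simp: keys_ind lookup_ind)

lemma effective_ind: "finite T \<Longrightarrow> T \<subseteq> places K \<Longrightarrow> ind T \<in> effective_divisors K"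
  unfolding effective_iff divisor_def by (simp add: keys_ind lookup_ind)

lemma ind_in_eff: "T \<in> sq n \<Longrightarrow> ind T \<in> eff n"
  unfolding sq_def eff_def using effective_ind div_degree_ind by simp

lemma moebius_ind: "finite T \<Longrightarrow> div_moebius (ind T) = (- 1) ^ card T"
  unfolding div_moebius_def by (simp add: keys_ind lookup_ind)

lemma moebius_nonzero: "div_moebius D \<noteq> 0 \<Longrightarrow> D = ind (Poly_Mapping.keys D)"
  unfolding div_moebius_def
  by (rule poly_mapping_eqI, subst lookup_ind[OF finite_keys]) (auto simp: not_in_keys_iff_lookup_eq_zero split: if_splits)

lemma inj_ind: "ind T = ind T' \<Longrightarrow> finite T \<Longrightarrow> finite T' \<Longrightarrow> T = T'"
  using keys_ind by metis

lemma finite_sq: "finite (sq n)"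
  using inj_on_finite[of ind "sq n" "eff n"] ind_in_eff inj_ind finite_eff
  unfolding inj_on_def by (auto simp: sq_def)

lemma finite_below:
  assumes B: "B \<in> eff n" shows "finite (below B)"
proof -
  have "below B \<subseteq> (\<Union>k\<le>n. eff k)"
  proof
    fix D assume D: "D \<in> below B"
    then have "0 \<le> div_degree K D" "0 \<le> div_degree K (B - D)" unfolding below_def using div_degree_effective by auto
    then have "div_degree K D \<le> int n" "0 \<le> div_degree K D" using B unfolding eff_def div_degree_diff by auto
    then have "D \<in> eff (nat (div_degree K D))" "nat (div_degree K D) \<le> n" using D unfolding below_def eff_def by auto
    then show "D \<in> (\<Union>k\<le>n. eff k)" by blast
  qed
  then show ?thesis using finite_eff finite_subset by blast
qed

text \<open>A pair (D, A) of effective divisors of total degree n amounts to their sum B together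
  with the part D of B. This is Dirichlet convolution with the constant function 1, graded by
  degree.\<close>

lemma divisor_convolution:
  fixes F :: "('a set \<Rightarrow>\<^sub>0 int) \<Rightarrow> 'c :: comm_ring_1"
  shows "(\<Sum>k\<le>n. (\<Sum>D\<in>eff k. F D) * of_nat (neff (n - k))) = (\<Sum>B\<in>eff n. \<Sum>D\<in>below B. F D)"
proof -
  have "(\<Sum>k\<le>n. (\<Sum>D\<in>eff k. F D) * of_nat (neff (n - k)))
      = (\<Sum>k\<le>n. \<Sum>(D, A)\<in>eff k \<times> eff (n - k). F D)"
    by (simp add: sum.cartesian_product[symmetric] sum_distrib_right mult.commute)
  also have "\<dots> = (\<Sum>(k, D, A)\<in>(SIGMA k:{..n}. eff k \<times> eff (n - k)). F D)"
    by (subst sum.Sigma) (auto simp: finite_eff split_def)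
  also have "\<dots> = (\<Sum>(B, D)\<in>(SIGMA B:eff n. below B). F D)"
  proof (rule sum.reindex_bij_witness[where i = "\<lambda>(B, D). (nat (div_degree K D), D, B - D)"
        and j = "\<lambda>(k, D, A). (D + A, D)"])
    fix x assume "x \<in> (SIGMA k:{..n}. eff k \<times> eff (n - k))"
    then obtain k D A where x: "x = (k, D, A)" "k \<le> n" "D \<in> eff k" "A \<in> eff (n - k)" by auto
    show "(case case x of (k, D, A) \<Rightarrow> (D + A, D) of (B, D) \<Rightarrow> (nat (div_degree K D), D, B - D)) = x"
      using x unfolding eff_def by simp
    show "(case x of (k, D, A) \<Rightarrow> (D + A, D)) \<in> (SIGMA B:eff n. below B)"
      using x effective_add[of D A] unfolding eff_def below_def by (simp add: div_degree_add)
    show "(case case x of (k, D, A) \<Rightarrow> (D + A, D) of (B, D) \<Rightarrow> F D) = (case x of (k, D, A) \<Rightarrow> F D)"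
      using x by simp
  next
    fix y assume "y \<in> (SIGMA B:eff n. below B)"
    then obtain B D where y: "y = (B, D)" "B \<in> eff n" "D \<in> effective_divisors K" "B - D \<in> effective_divisors K"
      unfolding below_def by auto
    have d: "0 \<le> div_degree K D" "0 \<le> div_degree K (B - D)" using y div_degree_effective by auto
    have B: "div_degree K B = int n" using y unfolding eff_def by simp
    show "(case case y of (B, D) \<Rightarrow> (nat (div_degree K D), D, B - D) of (k, D, A) \<Rightarrow> (D + A, D)) = y"
      using y by simp
    show "(case y of (B, D) \<Rightarrow> (nat (div_degree K D), D, B - D)) \<in> (SIGMA k:{..n}. eff k \<times> eff (n - k))"
      using y d B by (auto simp: eff_def div_degree_diff)
  qed
  also have "\<dots> = (\<Sum>B\<in>eff n. \<Sum>D\<in>below B. F D)"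
    by (subst sum.Sigma) (auto simp: finite_eff finite_below)
  finally show ?thesis .
qed

lemma moebius_sum_eff:
  fixes g :: "('a set \<Rightarrow>\<^sub>0 int) \<Rightarrow> 'c :: comm_ring_1"
  shows "(\<Sum>D\<in>eff k. of_int (div_moebius D) * g D) = (\<Sum>T\<in>sq k. (- 1) ^ card T * g (ind T))"
proof -
  have "(\<Sum>T\<in>sq k. (- 1) ^ card T * g (ind T)) = (\<Sum>T\<in>sq k. of_int (div_moebius (ind T)) * g (ind T))"
    by (intro sum.cong) (auto simp: sq_def moebius_ind)
  also have "\<dots> = (\<Sum>D\<in>ind ` sq k. of_int (div_moebius D) * g D)"
    using inj_ind by (subst sum.reindex) (auto simp: inj_on_def sq_def)
  also have "\<dots> = (\<Sum>D\<in>eff k. of_int (div_moebius D) * g D)"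
  proof (rule sum.mono_neutral_left[OF finite_eff])
    show "ind ` sq k \<subseteq> eff k" using ind_in_eff by blast
    show "\<forall>D\<in>eff k - ind ` sq k. of_int (div_moebius D) * g D = 0"
    proof
      fix D assume D: "D \<in> eff k - ind ` sq k"
      have "div_moebius D = 0"
      proof (rule ccontr)
        assume "div_moebius D \<noteq> 0"
        then have eq: "D = ind (Poly_Mapping.keys D)" by (rule moebius_nonzero)
        have "div_degree K D = int k" "Poly_Mapping.keys D \<subseteq> places K"
          using D unfolding eff_def effective_iff divisor_def by auto
        then have "Poly_Mapping.keys D \<in> sq k"
          unfolding sq_def using div_degree_ind[of "Poly_Mapping.keys D"] eq by simp
        then show False using D eq by blast
      qed
      then show "of_int (div_moebius D) * g D = 0" by simp
    qed
  qed
  finally show ?thesis by simp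
qed

text \<open>The squarefree divisors below B correspond to the subsets of its support, so the
  multiplicities in B drop out.\<close>

lemma moebius_sum_below:
  fixes g :: "('a set \<Rightarrow>\<^sub>0 int) \<Rightarrow> 'c :: comm_ring_1"
  assumes B: "B \<in> eff n"
  shows "(\<Sum>D\<in>below B. of_int (div_moebius D) * g D)
    = (\<Sum>T\<in>Pow (Poly_Mapping.keys B). (- 1) ^ card T * g (ind T))"
proof -
  let ?X = "Poly_Mapping.keys B"
  have Xp: "?X \<subseteq> places K" using B unfolding eff_def effective_iff divisor_def by auto
  have fin: "finite T" if "T \<in> Pow ?X" for T using that finite_subset[OF _ finite_keys, of T B] by blast
  have "(\<Sum>T\<in>Pow ?X. (- 1) ^ card T * g (ind T)) = (\<Sum>T\<in>Pow ?X. of_int (div_moebius (ind T)) * g (ind T))"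
    using fin by (intro sum.cong) (auto simp: moebius_ind)
  also have "\<dots> = (\<Sum>D\<in>ind ` Pow ?X. of_int (div_moebius D) * g D)"
    using inj_ind fin by (subst sum.reindex) (auto simp: inj_on_def)
  also have "\<dots> = (\<Sum>D\<in>below B. of_int (div_moebius D) * g D)"
  proof (rule sum.mono_neutral_left[OF finite_below[OF B]])
    show "ind ` Pow ?X \<subseteq> below B"
    proof
      fix D assume "D \<in> ind ` Pow ?X"
      then obtain T where T: "D = ind T" "T \<subseteq> ?X" "finite T" using fin by blast
      have "0 \<le> dcoeff (B - ind T) P" for P
      proof (cases "P \<in> T")
        case True
        then have "dcoeff B P \<noteq> 0" using T(2) unfolding subset_iff in_keys_iff by blast
        moreover have "0 \<le> dcoeff B P" using B unfolding eff_def effective_iff by blast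
        ultimately have "1 \<le> dcoeff B P" by linarith
        then show ?thesis using True T(3) by (simp add: lookup_minus lookup_ind)
      next
        case False
        then show ?thesis using B T(3) unfolding eff_def effective_iff by (simp add: lookup_minus lookup_ind)
      qed
      moreover have e: "ind T \<in> effective_divisors K" using effective_ind[OF T(3)] T(2) Xp by blast
      moreover have "divisor (B - ind T)" using divisor_diff e B unfolding eff_def effective_iff by blast
      ultimately show "D \<in> below B" unfolding below_def T(1) using e effective_iff by blast
    qed
    show "\<forall>D\<in>below B - ind ` Pow ?X. of_int (div_moebius D) * g D = 0"
    proof
      fix D assume D: "D \<in> below B - ind ` Pow ?X"
      have "div_moebius D = 0"
      proof (rule ccontr)
        assume "div_moebius D \<noteq> 0"
        then have eq: "D = ind (Poly_Mapping.keys D)" by (rule moebius_nonzero)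
        have "Poly_Mapping.keys D \<subseteq> ?X"
        proof
          fix P assume P: "P \<in> Poly_Mapping.keys D"
          have "0 \<le> dcoeff D P" "0 \<le> dcoeff (B - D) P" "dcoeff D P \<noteq> 0"
            using D P unfolding below_def effective_iff in_keys_iff by auto
          then have "dcoeff B P \<noteq> 0" by (simp add: lookup_minus)
          then show "P \<in> ?X" unfolding in_keys_iff .
        qed
        then show False using D eq by blast
      qed
      then show "of_int (div_moebius D) * g D = 0" by simp
    qed
  qed
  finally show ?thesis by simp
qed

end

section \<open>Moebius inversion and the logarithmic derivative of the zeta function\<close>

lemma alternating_Pow_sum:
  assumes "finite A"
  shows "(\<Sum>T\<in>Pow A. (- 1) ^ card T) = (if A = {} then 1 else 0 :: 'c :: comm_ring_1)"
  using assms
proof (induction A rule: finite_induct)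
  case (insert x A)
  have inj: "inj_on (insert x) (Pow A)" using insert.hyps by (auto simp: inj_on_def)
  have disj: "Pow A \<inter> insert x ` Pow A = {}" using insert.hyps by auto
  have "(\<Sum>T\<in>Pow (insert x A). (- 1) ^ card T)
      = (\<Sum>T\<in>Pow A. (- 1) ^ card T) + (\<Sum>T\<in>insert x ` Pow A. (- 1 :: 'c) ^ card T)"
    unfolding Pow_insert using insert.hyps disj by (intro sum.union_disjoint) auto
  also have "(\<Sum>T\<in>insert x ` Pow A. (- 1 :: 'c) ^ card T) = (\<Sum>T\<in>Pow A. - ((- 1) ^ card T))"
  proof (subst sum.reindex[OF inj], rule sum.cong[OF refl])
    fix T assume "T \<in> Pow A"
    then have "finite T" "x \<notin> T" using insert.hyps finite_subset by auto
    then show "((\<lambda>T. (- 1 :: 'c) ^ card T) \<circ> insert x) T = - ((- 1) ^ card T)" by simp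
  qed
  finally show ?case by (simp add: sum_negf)
qed simp

context global_function_field
begin

definition moeb_sum :: "nat \<Rightarrow> int" where
  "moeb_sum n = (\<Sum>D\<in>eff n. div_moebius D)"

lemma moebius_inversion: "(\<Sum>k\<le>n. moeb_sum k * int (neff (n - k))) = (if n = 0 then 1 else 0)"
proof -
  have "(\<Sum>k\<le>n. moeb_sum k * int (neff (n - k))) = (\<Sum>B\<in>eff n. \<Sum>D\<in>below B. div_moebius D)"
    unfolding moeb_sum_def using divisor_convolution[of div_moebius n] by simp
  also have "\<dots> = (\<Sum>B\<in>eff n. if B = 0 then 1 else 0)"
  proof (rule sum.cong[OF refl])
    fix B assume B: "B \<in> eff n"
    show "(\<Sum>D\<in>below B. div_moebius D) = (if B = 0 then 1 else 0)"
      using moebius_sum_below[OF B, of "\<lambda>_. 1 :: int"] alternating_Pow_sum[of "Poly_Mapping.keys B"]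
      by (simp add: keys_eq_empty)
  qed
  also have "\<dots> = (if n = 0 then 1 else 0)"
  proof -
    have "0 \<in> eff n \<longleftrightarrow> n = 0" unfolding eff_def using effective_zero div_degree_zero by auto
    then show ?thesis using finite_eff[of n] by (simp add: sum.delta)
  qed
  finally show ?thesis .
qed

lemma moeb_sum_sq: "of_int (moeb_sum k) = (\<Sum>T\<in>sq k. (- 1) ^ card T :: 'c :: comm_ring_1)"
  using moebius_sum_eff[of "\<lambda>_. 1 :: 'c" k] unfolding moeb_sum_def by simp

lemma abs_moeb_sum_le: "\<bar>moeb_sum n\<bar> \<le> int (neff n)"
proof -
  have "\<bar>moeb_sum n\<bar> \<le> (\<Sum>D\<in>eff n. \<bar>div_moebius D\<bar>)" unfolding moeb_sum_def by (rule sum_abs)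
  also have "\<dots> \<le> (\<Sum>D\<in>eff n. 1)" by (intro sum_mono) (auto simp: div_moebius_def power_abs)
  finally show ?thesis by simp
qed

lemma neff_0: "neff 0 = 1"
proof -
  have "eff 0 = {0}" unfolding eff_def using effective_degree_zero effective_zero div_degree_zero by auto
  then show ?thesis by simp
qed

text \<open>The von Mangoldt sums, that is, the coefficients of x Z'/Z. The condition on the size of
  \<open>deg P\<close> matters for k = 0 only, where every degree divides k; there it empties the
  sum.\<close>

definition prime_powers :: "nat \<Rightarrow> nat" where
  "prime_powers k = (\<Sum>P | P \<in> places K \<and> deg P \<le> k \<and> deg P dvd k. deg P)"

lemma prime_powers_double: "prime_powers k \<le> prime_powers (2 * k)"
  unfolding prime_powers_def
proof (rule sum_mono2)
  show "finite {P. P \<in> places K \<and> deg P \<le> 2 * k \<and> deg P dvd 2 * k}"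
    by (rule finite_subset[OF _ finite_places_degree_le[of "2 * k"]]) blast
  show "{P. P \<in> places K \<and> deg P \<le> k \<and> deg P dvd k} \<subseteq> {P. P \<in> places K \<and> deg P \<le> 2 * k \<and> deg P dvd 2 * k}"
  proof
    fix P assume "P \<in> {P. P \<in> places K \<and> deg P \<le> k \<and> deg P dvd k}"
    then have "P \<in> places K" "deg P \<le> 2 * k" "deg P dvd 2 * k" by (simp_all add: dvd_mult)
    then show "P \<in> {P. P \<in> places K \<and> deg P \<le> 2 * k \<and> deg P dvd 2 * k}" by blast
  qed
qed simp

lemma eff_shift:
  assumes P: "P \<in> places K" and k: "j * deg P \<le> n"
  shows "card {A \<in> eff n. int j \<le> dcoeff A P} = neff (n - j * deg P)"
proof -
  let ?J = "Poly_Mapping.single P (int j)"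
  have "bij_betw (\<lambda>A. A + ?J) (eff (n - j * deg P)) {A \<in> eff n. int j \<le> dcoeff A P}"
  proof (rule bij_betwI[where g = "\<lambda>A. A - ?J"])
    show "(\<lambda>A. A + ?J) \<in> eff (n - j * deg P) \<rightarrow> {A \<in> eff n. int j \<le> dcoeff A P}"
    proof
      fix A assume A: "A \<in> eff (n - j * deg P)"
      have "A + ?J \<in> effective_divisors K"
        using A divisor_add divisor_single[OF P] unfolding eff_def effective_iff
        by (auto simp: lookup_add lookup_single when_def)
      moreover have "div_degree K (A + ?J) = int n"
        using A k unfolding eff_def by (simp add: div_degree_add div_degree_single of_nat_diff)
      ultimately show "A + ?J \<in> {A \<in> eff n. int j \<le> dcoeff A P}"
        using A unfolding eff_def effective_iff by (simp add: lookup_add lookup_single)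
    qed
    show "(\<lambda>A. A - ?J) \<in> {A \<in> eff n. int j \<le> dcoeff A P} \<rightarrow> eff (n - j * deg P)"
    proof
      fix A assume A: "A \<in> {A \<in> eff n. int j \<le> dcoeff A P}"
      have "A - ?J \<in> effective_divisors K"
        using A divisor_diff divisor_single[OF P] unfolding eff_def effective_iff
        by (auto simp: lookup_minus lookup_single when_def)
      moreover have "div_degree K (A - ?J) = int (n - j * deg P)"
        using A k unfolding eff_def by (simp add: div_degree_diff div_degree_single of_nat_diff)
      ultimately show "A - ?J \<in> eff (n - j * deg P)" unfolding eff_def by simp
    qed
  qed auto
  then show ?thesis by (rule bij_betw_same_card[symmetric])
qed

text \<open>Double counting of deg A over all A of degree n: it is the sum of v_P(A) deg P, and
  v_P(A) is the number of j >= 1 with j P <= A. For fixed j and P such A are counted by removing j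
  P.\<close>

theorem log_derivative_identity: "n * neff n = (\<Sum>k=1..n. prime_powers k * neff (n - k))"
proof -
  define Pl where "Pl = {P \<in> places K. deg P \<le> n}"
  have finP: "finite Pl" unfolding Pl_def by (rule finite_places_degree_le)
  have Plp: "P \<in> places K" "0 < deg P" "deg P \<le> n" if "P \<in> Pl" for P
    using that place_degree_pos unfolding Pl_def by auto
  have keys: "Poly_Mapping.keys A \<subseteq> Pl" if "A \<in> eff n" for A
    using eff_key_degree[OF that] unfolding Pl_def by blast
  have coeff_sum: "(\<Sum>A\<in>eff n. nat (dcoeff A P)) = (\<Sum>k | k \<in> {1..n} \<and> deg P dvd k. neff (n - k))"
    if P: "P \<in> Pl" for P
  proof -
    note Pp = Plp[OF P]
    have "(\<Sum>A\<in>eff n. nat (dcoeff A P)) = (\<Sum>A\<in>eff n. \<Sum>j | j \<in> {1..n} \<and> j * deg P \<le> n. if int j \<le> dcoeff A P then 1 else 0)"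
    proof (rule sum.cong[OF refl])
      fix A assume A: "A \<in> eff n"
      have nn: "0 \<le> dcoeff A P" using A unfolding eff_def effective_iff by blast
      have "{j. (j \<in> {1..n} \<and> j * deg P \<le> n) \<and> int j \<le> dcoeff A P} = {1..nat (dcoeff A P)}"
      proof (intro equalityI subsetI)
        fix j assume "j \<in> {1..nat (dcoeff A P)}"
        then have j: "1 \<le> j" "int j \<le> dcoeff A P" using nn by auto
        then have "int j * int (deg P) \<le> dcoeff A P * int (deg P)" by (intro mult_right_mono) auto
        then have "int (j * deg P) \<le> int n" using eff_coeff_bound[OF A, of P] by simp
        then have jd: "j * deg P \<le> n" by (simp only: of_nat_le_iff)
        moreover have "j \<le> j * deg P" using Pp by simp
        ultimately have "j \<le> n" by (rule order_trans[rotated])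
        with jd show "j \<in> {j. (j \<in> {1..n} \<and> j * deg P \<le> n) \<and> int j \<le> dcoeff A P}" using j by auto
      qed auto
      then have "card {j. (j \<in> {1..n} \<and> j * deg P \<le> n) \<and> int j \<le> dcoeff A P} = nat (dcoeff A P)" by simp
      then show "nat (dcoeff A P) = (\<Sum>j | j \<in> {1..n} \<and> j * deg P \<le> n. if int j \<le> dcoeff A P then 1 else 0)"
        by (simp add: sum.If_cases Int_def)
    qed
    also have "\<dots> = (\<Sum>j | j \<in> {1..n} \<and> j * deg P \<le> n. \<Sum>A\<in>eff n. if int j \<le> dcoeff A P then 1 else 0)"
      by (rule sum.swap)
    also have "\<dots> = (\<Sum>j | j \<in> {1..n} \<and> j * deg P \<le> n. neff (n - j * deg P))"
    proof (rule sum.cong[OF refl])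
      fix j assume "j \<in> {j. j \<in> {1..n} \<and> j * deg P \<le> n}"
      then show "(\<Sum>A\<in>eff n. if int j \<le> dcoeff A P then 1 else 0) = neff (n - j * deg P)"
        using eff_shift[OF Pp(1), of j n] finite_eff by (simp add: sum.If_cases Int_def)
    qed
    also have "\<dots> = (\<Sum>k | k \<in> {1..n} \<and> deg P dvd k. neff (n - k))"
    proof (rule sum.reindex_bij_witness[where i = "\<lambda>k. k div deg P" and j = "\<lambda>j. j * deg P"])
      fix j assume "j \<in> {j. j \<in> {1..n} \<and> j * deg P \<le> n}"
      then show "j * deg P \<in> {k \<in> {1..n}. deg P dvd k}" using Pp by auto
    next
      fix k assume k: "k \<in> {k \<in> {1..n}. deg P dvd k}"
      then obtain j where j: "k = deg P * j" by (auto elim: dvdE)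
      have "j \<le> deg P * j" using Pp by simp
      also have "\<dots> \<le> n" using k j by simp
      finally have "j \<le> n" .
      then show "k div deg P \<in> {j. j \<in> {1..n} \<and> j * deg P \<le> n}" using k j Pp by (auto simp: mult.commute)
    qed (use Pp in auto)
    finally show ?thesis .
  qed
  have "n * neff n = (\<Sum>A\<in>eff n. n)" by simp
  also have "\<dots> = (\<Sum>A\<in>eff n. \<Sum>P\<in>Pl. nat (dcoeff A P) * deg P)"
  proof (rule sum.cong[OF refl])
    fix A assume A: "A \<in> eff n"
    have nn: "0 \<le> dcoeff A P" for P using A unfolding eff_def effective_iff by blast
    have "int n = div_degree K A" using A unfolding eff_def by simp
    also have "\<dots> = (\<Sum>P\<in>Pl. dcoeff A P * int (deg P))" by (rule div_degree_superset[OF finP keys[OF A]])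
    also have "\<dots> = int (\<Sum>P\<in>Pl. nat (dcoeff A P) * deg P)" using nn by simp
    finally show "n = (\<Sum>P\<in>Pl. nat (dcoeff A P) * deg P)" by (simp only: of_nat_eq_iff)
  qed
  also have "\<dots> = (\<Sum>P\<in>Pl. deg P * (\<Sum>A\<in>eff n. nat (dcoeff A P)))"
    by (subst sum.swap) (simp add: sum_distrib_left mult.commute)
  also have "\<dots> = (\<Sum>P\<in>Pl. deg P * (\<Sum>k | k \<in> {1..n} \<and> deg P dvd k. neff (n - k)))"
    using coeff_sum by (intro sum.cong) auto
  also have "\<dots> = (\<Sum>P\<in>Pl. \<Sum>k=1..n. if deg P dvd k then deg P * neff (n - k) else 0)"
  proof (intro sum.cong refl)
    fix P
    have "{1..n} \<inter> {k. deg P dvd k} = {k. k \<in> {1..n} \<and> deg P dvd k}" by auto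
    then show "deg P * (\<Sum>k | k \<in> {1..n} \<and> deg P dvd k. neff (n - k))
        = (\<Sum>k=1..n. if deg P dvd k then deg P * neff (n - k) else 0)"
      by (simp add: sum.If_cases sum_distrib_left)
  qed
  also have "\<dots> = (\<Sum>k=1..n. \<Sum>P\<in>Pl. if deg P dvd k then deg P * neff (n - k) else 0)" by (rule sum.swap)
  also have "\<dots> = (\<Sum>k=1..n. prime_powers k * neff (n - k))"
  proof (rule sum.cong[OF refl])
    fix k assume k: "k \<in> {1..n}"
    have "Pl \<inter> {P. deg P dvd k} = {P. P \<in> places K \<and> deg P \<le> k \<and> deg P dvd k}"
      unfolding Pl_def using k by (auto dest: dvd_imp_le)
    then show "(\<Sum>P\<in>Pl. if deg P dvd k then deg P * neff (n - k) else 0) = prime_powers k * neff (n - k)"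
      unfolding prime_powers_def using finP by (simp add: sum.If_cases sum_distrib_right)
  qed
  finally show ?thesis .
qed

end

section \<open>Power saving for Moebius sums over divisors\<close>

lemma sum_multiples:
  fixes g :: "nat \<Rightarrow> 'c :: comm_monoid_add"
  assumes e: "0 < e" and g: "\<And>k. k \<le> e * m \<Longrightarrow> \<not> e dvd k \<Longrightarrow> g k = 0"
  shows "(\<Sum>k\<le>e * m. g k) = (\<Sum>j\<le>m. g (e * j))"
    and "(\<Sum>k=1..e * m. g k) = (\<Sum>j=1..m. g (e * j))"
proof -
  have inj: "inj_on ((*) e) I" for I using e by (auto simp: inj_on_def)
  have "(\<Sum>k\<le>e * m. g k) = sum g ((*) e ` {..m})"
  proof (intro sum.mono_neutral_right)
    show "\<forall>k\<in>{..e * m} - (*) e ` {..m}. g k = 0"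
    proof
      fix k assume k: "k \<in> {..e * m} - (*) e ` {..m}"
      have "\<not> e dvd k"
      proof
        assume "e dvd k"
        then obtain j where j: "k = e * j" by (elim dvdE)
        then have "j \<in> {..m}" using k e by auto
        then show False using k j by blast
      qed
      then show "g k = 0" using g k by auto
    qed
  qed auto
  then show "(\<Sum>k\<le>e * m. g k) = (\<Sum>j\<le>m. g (e * j))" by (simp add: sum.reindex[OF inj])
  have "(\<Sum>k=1..e * m. g k) = sum g ((*) e ` {1..m})"
  proof (intro sum.mono_neutral_right)
    show "(*) e ` {1..m} \<subseteq> {1..e * m}" using e by auto
    show "\<forall>k\<in>{1..e * m} - (*) e ` {1..m}. g k = 0"
    proof
      fix k assume k: "k \<in> {1..e * m} - (*) e ` {1..m}"
      have "\<not> e dvd k"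
      proof
        assume "e dvd k"
        then obtain j where j: "k = e * j" by (elim dvdE)
        then have "j \<in> {1..m}" using k e by auto
        then show False using k j by blast
      qed
      then show "g k = 0" using g k by auto
    qed
  qed simp
  then show "(\<Sum>k=1..e * m. g k) = (\<Sum>j=1..m. g (e * j))" by (simp add: sum.reindex[OF inj])
qed

context global_function_field
begin

lemma eff_empty: "\<not> degree_gcd dvd n \<Longrightarrow> eff n = {}"
proof -
  assume n: "\<not> degree_gcd dvd n"
  have False if "D \<in> eff n" for D
    using that degree_gcd_dvd_div_degree[of D] n unfolding eff_def effective_iff by (simp add: int_dvd_int_iff)
  then show ?thesis by blast
qed

lemma neff_nonmultiple: "\<not> degree_gcd dvd n \<Longrightarrow> neff n = 0"
  using eff_empty by simp

lemma moeb_sum_nonmultiple: "\<not> degree_gcd dvd n \<Longrightarrow> moeb_sum n = 0"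
  unfolding moeb_sum_def using eff_empty by simp

text \<open>With e = \<open>degree_gcd\<close> all sequences live on the multiples of e, and the
  zeta series becomes a series in x^e with Q = q^e. The von Mangoldt sums are divided by e because x
  d/dx is e times the Euler operator in x^e. An eth root turns the rate for multiples of e into one
  for all degrees.\<close>

theorem moeb_sum_power_saving:
  "\<exists>r C. 1 < r \<and> r < real q \<and> 0 \<le> C \<and> (\<forall>n. \<bar>real_of_int (moeb_sum n)\<bar> \<le> C * r ^ n)"
proof -
  let ?e = degree_gcd
  obtain N where N: "\<And>n. N \<le> n \<Longrightarrow> (\<exists>D. divisor D \<and> div_degree K D = int n) \<Longrightarrow>
      real (neff n) = c_const K * real q ^ n - real (class_number K) / (real q - 1)"
    using card_eff_large by blast
  have e: "0 < ?e" by (rule degree_gcd_pos)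
  have q: "1 < real q" using q_ge_2 by simp
  interpret zc: zeta_coefficients "\<lambda>m. real (neff (?e * m))" "\<lambda>m. real_of_int (moeb_sum (?e * m))"
    "\<lambda>k. real (prime_powers (?e * k)) / real ?e" "real q ^ ?e" "c_const K" "real (class_number K) / (real q - 1)" N
  proof
    show "1 < real q ^ ?e" using q e by simp
    show "0 < c_const K" by (rule c_const_pos)
    show "real (neff (?e * 0)) = 1" using neff_0 by simp
    show "(\<Sum>k\<le>n. real (neff (?e * k)) * real_of_int (moeb_sum (?e * (n - k)))) = (if n = 0 then 1 else 0)" for n
    proof -
      have "(\<Sum>k\<le>n. real (neff (?e * k)) * real_of_int (moeb_sum (?e * (n - k))))
          = (\<Sum>k\<le>n. real_of_int (moeb_sum (?e * k)) * real (neff (?e * n - ?e * k)))"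
        by (rule sum.reindex_bij_witness[of _ "\<lambda>k. n - k" "\<lambda>k. n - k"]) (auto simp: diff_mult_distrib2)
      also have "\<dots> = (\<Sum>k\<le>?e * n. real_of_int (moeb_sum k) * real (neff (?e * n - k)))"
        by (rule sum_multiples(1)[OF e, symmetric]) (simp add: moeb_sum_nonmultiple)
      also have "\<dots> = real_of_int (\<Sum>k\<le>?e * n. moeb_sum k * int (neff (?e * n - k)))" by simp
      also have "\<dots> = (if n = 0 then 1 else 0)" unfolding moebius_inversion using e by simp
      finally show ?thesis .
    qed
    show "real n * real (neff (?e * n)) = (\<Sum>k=1..n. real (prime_powers (?e * k)) / real ?e * real (neff (?e * (n - k))))" for n
    proof -
      have "?e * n * neff (?e * n) = (\<Sum>k=1..?e * n. prime_powers k * neff (?e * n - k))"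
        by (rule log_derivative_identity)
      also have "\<dots> = (\<Sum>k=1..n. prime_powers (?e * k) * neff (?e * n - ?e * k))"
      proof (rule sum_multiples(2)[OF e])
        fix k assume "k \<le> ?e * n" "\<not> ?e dvd k"
        then have "\<not> ?e dvd ?e * n - k" using dvd_diffD1[of ?e "?e * n" k] by auto
        then show "prime_powers k * neff (?e * n - k) = 0" using neff_nonmultiple by simp
      qed
      finally have "real (?e * n * neff (?e * n)) = real (\<Sum>k=1..n. prime_powers (?e * k) * neff (?e * n - ?e * k))" by simp
      then have "real ?e * (real n * real (neff (?e * n))) = (\<Sum>k=1..n. real (prime_powers (?e * k)) * real (neff (?e * (n - k))))"
        by (simp add: diff_mult_distrib2 mult.assoc)
      then have "real n * real (neff (?e * n)) = (\<Sum>k=1..n. real (prime_powers (?e * k)) * real (neff (?e * (n - k)))) / real ?e"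
        using e by (simp add: field_simps)
      then show ?thesis by (simp add: sum_divide_distrib)
    qed
    show "0 \<le> real (prime_powers (?e * k)) / real ?e" for k by simp
    show "real (prime_powers (?e * k)) / real ?e \<le> real (prime_powers (?e * (2 * k))) / real ?e" for k
      using prime_powers_double[of "?e * k"] e by (simp add: divide_right_mono mult.left_commute)
    show "\<bar>real_of_int (moeb_sum (?e * n))\<bar> \<le> real (neff (?e * n))" for n
    proof -
      have "real_of_int \<bar>moeb_sum (?e * n)\<bar> \<le> real_of_int (int (neff (?e * n)))" using abs_moeb_sum_le by (simp only: of_int_le_iff)
      then show ?thesis by simp
    qed
    show "real (neff (?e * n)) = c_const K * (real q ^ ?e) ^ n - real (class_number K) / (real q - 1)" if n: "N \<le> n" for n
    proof -
      have "n \<le> ?e * n" using e by simp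
      then have "N \<le> ?e * n" using n by linarith
      then show ?thesis using N[of "?e * n"] divisor_of_multiple[of "?e * n"] by (simp add: power_mult)
    qed
  qed
  obtain r C where r: "1 < r" "r < real q ^ ?e" "0 \<le> C" "\<And>n. \<bar>real_of_int (moeb_sum (?e * n))\<bar> \<le> C * r ^ n"
    using zc.moeb_power_saving by blast
  define s where "s = root ?e r"
  have s: "s ^ ?e = r" unfolding s_def using r e by (intro real_root_pow_pos2) auto
  have "1 < s" unfolding s_def using real_root_less_mono[OF e r(1)] e by simp
  moreover have "s < real q"
    unfolding s_def using real_root_less_mono[OF e r(2)] e q by (simp add: real_root_power_cancel)
  moreover have "\<bar>real_of_int (moeb_sum n)\<bar> \<le> C * s ^ n" for n
  proof (cases "?e dvd n")
    case True
    then obtain m where m: "n = ?e * m" by (elim dvdE)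
    show ?thesis using r(4)[of m] unfolding m power_mult s .
  next
    case False
    then show ?thesis using moeb_sum_nonmultiple r(3) \<open>1 < s\<close> by simp
  qed
  ultimately show ?thesis using r(3) by blast
qed

subsection \<open>Divisors without prime factors in a finite set\<close>

text \<open>The coefficients of 1/Z with the Euler factors at T removed, that is, of the product of
  1 - x^(deg P) over the places P outside T.\<close>

definition msum :: "'a set set \<Rightarrow> nat \<Rightarrow> real" where
  "msum T j = (\<Sum>Z | Z \<in> sq j \<and> Z \<inter> T = {}. (- 1) ^ card Z)"

lemma sq_insert:
  assumes P: "P \<in> places K"
  shows "{Z \<in> sq j. P \<in> Z} = (if deg P \<le> j then insert P ` {Z \<in> sq (j - deg P). P \<notin> Z} else {})"
proof -
  have step: "Z - {P} \<in> sq (j - deg P) \<and> deg P \<le> j" if Z: "Z \<in> sq j" "P \<in> Z" for Z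
  proof -
    have Z': "finite Z" "degsum Z = j" "Z \<subseteq> places K" using Z unfolding sq_def by auto
    then have "degsum Z = deg P + degsum (Z - {P})"
      unfolding degsum_def using Z(2) by (intro sum.remove) auto
    with Z' show ?thesis unfolding sq_def by auto
  qed
  have lift: "insert P Z \<in> sq j" if Z: "Z \<in> sq (j - deg P)" "P \<notin> Z" "deg P \<le> j" for Z
    using Z P unfolding sq_def degsum_def by simp
  show ?thesis
  proof (cases "deg P \<le> j")
    case True
    have "{Z \<in> sq j. P \<in> Z} = insert P ` {Z \<in> sq (j - deg P). P \<notin> Z}"
    proof (intro equalityI subsetI)
      fix Z assume Z: "Z \<in> {Z \<in> sq j. P \<in> Z}"
      then have "Z = insert P (Z - {P})" "Z - {P} \<in> {Z \<in> sq (j - deg P). P \<notin> Z}" using step[of Z] by auto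
      then show "Z \<in> insert P ` {Z \<in> sq (j - deg P). P \<notin> Z}" by (rule image_eqI)
    next
      fix Z assume "Z \<in> insert P ` {Z \<in> sq (j - deg P). P \<notin> Z}"
      then obtain Y where "Z = insert P Y" "Y \<in> sq (j - deg P)" "P \<notin> Y" by blast
      then show "Z \<in> {Z \<in> sq j. P \<in> Z}" using lift True by simp
    qed
    then show ?thesis using True by simp
  next
    case False
    then show ?thesis using step by auto
  qed
qed

lemma sum_sq_insert:
  assumes P: "P \<in> places K"
  shows "(\<Sum>Z | Z \<in> sq j \<and> P \<in> Z \<and> R (Z - {P}). (- 1) ^ card Z)
    = (if deg P \<le> j then - (\<Sum>Z | Z \<in> sq (j - deg P) \<and> P \<notin> Z \<and> R Z. (- 1) ^ card Z) else (0 :: 'c :: comm_ring_1))"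
proof (cases "deg P \<le> j")
  case True
  let ?I = "{Z. Z \<in> sq (j - deg P) \<and> P \<notin> Z \<and> R Z}"
  have "{Z. Z \<in> sq j \<and> P \<in> Z \<and> R (Z - {P})} = {Z \<in> {Z \<in> sq j. P \<in> Z}. R (Z - {P})}" by blast
  also have "\<dots> = {Z \<in> insert P ` {Z \<in> sq (j - deg P). P \<notin> Z}. R (Z - {P})}"
    unfolding sq_insert[OF P] using True by simp
  also have "\<dots> = insert P ` {Z \<in> {Z \<in> sq (j - deg P). P \<notin> Z}. R (insert P Z - {P})}" by blast
  also have "{Z \<in> {Z \<in> sq (j - deg P). P \<notin> Z}. R (insert P Z - {P})} = ?I"
    by (rule Collect_cong) (simp add: Diff_insert_absorb cong: conj_cong)
  finally have eq: "{Z. Z \<in> sq j \<and> P \<in> Z \<and> R (Z - {P})} = insert P ` ?I" .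
  have inj: "inj_on (insert P) ?I" by (rule inj_onI) (simp add: insert_ident)
  have "(\<Sum>Z\<in>insert P ` ?I. (- 1 :: 'c) ^ card Z) = (\<Sum>Z\<in>?I. - ((- 1) ^ card Z))"
    unfolding sum.reindex[OF inj] by (rule sum.cong) (auto simp: sq_def)
  then show ?thesis unfolding eq using True by (simp add: sum_negf)
next
  case False
  then have "{Z \<in> sq j. P \<in> Z} = {}" using sq_insert[OF P, of j] by simp
  then have "{Z. Z \<in> sq j \<and> P \<in> Z \<and> R (Z - {P})} = {}" by blast
  then show ?thesis using False by (simp only: if_False sum.empty)
qed

text \<open>Coefficient form of the identity that the series for \<open>T\<close> is 1 - x^(deg P)
  times the series for \<open>insert P T\<close>.\<close>

lemma msum_insert:
  assumes P: "P \<in> places K" "P \<notin> T"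
  shows "msum (insert P T) j = msum T j + (if deg P \<le> j then msum (insert P T) (j - deg P) else 0)"
proof -
  have "{Z. Z \<in> sq j \<and> Z \<inter> T = {}} = {Z. Z \<in> sq j \<and> Z \<inter> insert P T = {}} \<union> {Z. Z \<in> sq j \<and> P \<in> Z \<and> (Z - {P}) \<inter> T = {}}"
    using P(2) by auto
  then have "msum T j = msum (insert P T) j + (\<Sum>Z | Z \<in> sq j \<and> P \<in> Z \<and> (Z - {P}) \<inter> T = {}. (- 1) ^ card Z)"
    unfolding msum_def using finite_sq by (subst sum.union_disjoint[symmetric]) auto
  moreover have "{Z. Z \<in> sq (j - deg P) \<and> P \<notin> Z \<and> Z \<inter> T = {}} = {Z. Z \<in> sq (j - deg P) \<and> Z \<inter> insert P T = {}}"
    by auto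
  ultimately show ?thesis
    using sum_sq_insert[OF P(1), of j "\<lambda>Z. Z \<inter> T = {}", where ?'c = real] unfolding msum_def by simp
qed

text \<open>Dividing by 1 - x^(deg P) introduces poles on the unit circle only, and since r > 1 they
  do not spoil the rate r.\<close>

lemma msum_bound:
  assumes r: "1 < r" and C: "\<And>n. \<bar>real_of_int (moeb_sum n)\<bar> \<le> C * r ^ n"
    and T: "finite T" "T \<subseteq> places K"
  shows "\<exists>C. \<forall>j. \<bar>msum T j\<bar> \<le> C * r ^ j"
  using T
proof (induction T rule: finite_induct)
  case empty
  have "msum {} j = real_of_int (moeb_sum j)" for j unfolding msum_def moeb_sum_sq by simp
  then show ?case using C by auto
next
  case (insert P T)
  have P: "P \<in> places K" and d: "0 < deg P" using insert.prems place_degree_pos by auto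
  obtain C where C: "\<And>j. \<bar>msum T j\<bar> \<le> C * r ^ j" using insert by auto
  have C0: "0 \<le> C" using C[of 0] by simp
  define u where "u = (1 / r) ^ deg P"
  have u: "0 < u" "u < 1" "u * r ^ deg P = 1" unfolding u_def using r d by (auto simp: power_one_over power_strict_decreasing one_less_power)
  \<comment> \<open>The solution of C + C' u = C', the constant which the induction step
    reproduces.\<close>
  define C' where "C' = C / (1 - u)"
  have C': "C + C' * u = C'" "0 \<le> C'" unfolding C'_def using u C0 by (auto simp: field_simps)
  have "\<bar>msum (insert P T) j\<bar> \<le> C' * r ^ j" for j
  proof (induction j rule: less_induct)
    case (less j)
    have eq: "msum (insert P T) j = msum T j + (if deg P \<le> j then msum (insert P T) (j - deg P) else 0)"
      by (rule msum_insert[OF P insert.hyps(2)])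
    show ?case
    proof (cases "deg P \<le> j")
      case True
      have "r ^ j = r ^ (j - deg P) * r ^ deg P" using True by (simp flip: power_add)
      then have "r ^ (j - deg P) = u * r ^ j" using u(3) by (simp add: mult.left_commute)
      then have "\<bar>msum (insert P T) (j - deg P)\<bar> \<le> C' * (u * r ^ j)" using less[of "j - deg P"] d True by simp
      then have "\<bar>msum (insert P T) j\<bar> \<le> C * r ^ j + C' * (u * r ^ j)" using eq C[of j] True by simp
      also have "\<dots> = (C + C' * u) * r ^ j" by (simp add: algebra_simps)
      finally show ?thesis unfolding C'(1) .
    next
      case False
      have "C \<le> C'" using C' u(1) by (smt (verit) mult_nonneg_nonneg)
      then have "C * r ^ j \<le> C' * r ^ j" using r by (intro mult_right_mono) auto
      then show ?thesis using eq C[of j] False by simp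
    qed
  qed
  then show ?case by blast
qed

lemma keys_add_single:
  assumes D: "D \<in> effective_divisors K"
  shows "Poly_Mapping.keys (D + Poly_Mapping.single P 1) = insert P (Poly_Mapping.keys D)"
proof -
  have "0 \<le> dcoeff D Q" for Q using D unfolding effective_iff by blast
  then have "dcoeff D Q + 1 \<noteq> 0" for Q by (smt (verit))
  then show ?thesis unfolding set_eq_iff in_keys_iff insert_iff
    by (auto simp: lookup_add lookup_single when_def)
qed

lemma eff_with_prime:
  assumes P: "P \<in> places K"
  shows "{D \<in> eff n. P \<in> Poly_Mapping.keys D}
    = (if deg P \<le> n then (\<lambda>D. D + Poly_Mapping.single P 1) ` eff (n - deg P) else {})"
proof (cases "deg P \<le> n")
  case True
  have "{D \<in> eff n. P \<in> Poly_Mapping.keys D} = (\<lambda>D. D + Poly_Mapping.single P 1) ` eff (n - deg P)"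
  proof (intro equalityI subsetI)
    fix D assume "D \<in> {D \<in> eff n. P \<in> Poly_Mapping.keys D}"
    then have D: "D \<in> eff n" "dcoeff D P \<noteq> 0" by (auto simp only: in_keys_iff mem_Collect_eq)
    let ?E = "D - Poly_Mapping.single P 1"
    have "0 \<le> dcoeff D P" using D unfolding eff_def effective_iff by blast
    then have "1 \<le> dcoeff D P" using D(2) by linarith
    then have "0 \<le> dcoeff ?E Q" for Q
      using D unfolding eff_def effective_iff by (simp add: lookup_minus lookup_single when_def)
    moreover have "divisor ?E" using D divisor_diff divisor_single[OF P] unfolding eff_def effective_iff by blast
    moreover have "div_degree K ?E = int (n - deg P)"
      using D True unfolding eff_def by (simp add: div_degree_diff div_degree_single of_nat_diff)
    ultimately have "?E \<in> eff (n - deg P)" unfolding eff_def effective_iff by blast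
    then show "D \<in> (\<lambda>D. D + Poly_Mapping.single P 1) ` eff (n - deg P)" by (intro image_eqI[of _ _ ?E]) auto
  next
    fix D assume "D \<in> (\<lambda>D. D + Poly_Mapping.single P 1) ` eff (n - deg P)"
    then obtain E where E: "D = E + Poly_Mapping.single P 1" "E \<in> eff (n - deg P)" by blast
    then have "P \<in> Poly_Mapping.keys D" using keys_add_single[of E P] unfolding eff_def by simp
    moreover have "D \<in> eff n"
      using E effective_add[of E "Poly_Mapping.single P 1"] effective_single[OF P] True unfolding eff_def
      by (simp add: div_degree_add div_degree_single of_nat_diff)
    ultimately show "D \<in> {D \<in> eff n. P \<in> Poly_Mapping.keys D}" by blast
  qed
  then show ?thesis using True by simp
next
  case False
  then have "{D \<in> eff n. P \<in> Poly_Mapping.keys D} = {}" using eff_key_degree by fastforce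
  then show ?thesis using False by simp
qed

lemma card_eff_split_prime:
  assumes P: "P \<in> places K"
  shows "card {D \<in> eff n. R (Poly_Mapping.keys D)} = card {D \<in> eff n. P \<notin> Poly_Mapping.keys D \<and> R (Poly_Mapping.keys D)}
    + (if deg P \<le> n then card {D \<in> eff (n - deg P). R (insert P (Poly_Mapping.keys D))} else 0)"
proof -
  let ?s = "\<lambda>D. D + Poly_Mapping.single P (1 :: int)"
  have "card {D \<in> eff n. R (Poly_Mapping.keys D)} = card ({D \<in> eff n. P \<notin> Poly_Mapping.keys D \<and> R (Poly_Mapping.keys D)}
      \<union> {D \<in> {D \<in> eff n. P \<in> Poly_Mapping.keys D}. R (Poly_Mapping.keys D)})"
    by (rule arg_cong[where f = card]) blast
  also have "\<dots> = card {D \<in> eff n. P \<notin> Poly_Mapping.keys D \<and> R (Poly_Mapping.keys D)}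
      + card {D \<in> {D \<in> eff n. P \<in> Poly_Mapping.keys D}. R (Poly_Mapping.keys D)}"
    using finite_eff by (intro card_Un_disjoint) auto
  also have "card {D \<in> {D \<in> eff n. P \<in> Poly_Mapping.keys D}. R (Poly_Mapping.keys D)}
      = (if deg P \<le> n then card {D \<in> eff (n - deg P). R (insert P (Poly_Mapping.keys D))} else 0)"
  proof (cases "deg P \<le> n")
    case True
    have k: "Poly_Mapping.keys (?s D) = insert P (Poly_Mapping.keys D)" if "D \<in> eff (n - deg P)" for D
      using that keys_add_single[of D P] unfolding eff_def by blast
    have "{D \<in> {D \<in> eff n. P \<in> Poly_Mapping.keys D}. R (Poly_Mapping.keys D)}
        = ?s ` {D \<in> eff (n - deg P). R (insert P (Poly_Mapping.keys D))}"
      unfolding eff_with_prime[OF P] using True k by (auto simp del: keys_single)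
    moreover have "inj_on ?s A" for A by (auto simp: inj_on_def)
    ultimately show ?thesis using True by (simp add: card_image)
  next
    case False
    then show ?thesis unfolding eff_with_prime[OF P] by simp
  qed
  finally show ?thesis .
qed

section \<open>Sieved and smooth divisors, Euler products\<close>

definition sieve :: "'a set set \<Rightarrow> nat \<Rightarrow> nat" where
  "sieve T n = card {D \<in> eff n. Poly_Mapping.keys D \<inter> T = {}}"

definition smooth :: "'a set set \<Rightarrow> nat \<Rightarrow> nat" where
  "smooth T n = card {D \<in> eff n. Poly_Mapping.keys D \<subseteq> T}"

lemma sieve_insert:
  assumes P: "P \<in> places K" "P \<notin> T"
  shows "sieve T n = sieve (insert P T) n + (if deg P \<le> n then sieve T (n - deg P) else 0)"
  unfolding sieve_def using card_eff_split_prime[OF P(1), of n "\<lambda>Z. Z \<inter> T = {}"] P(2) by (simp add: Int_insert_left)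

lemma smooth_insert:
  assumes P: "P \<in> places K" "P \<notin> T"
  shows "smooth (insert P T) n = smooth T n + (if deg P \<le> n then smooth (insert P T) (n - deg P) else 0)"
proof -
  have "P \<notin> Z \<and> Z \<subseteq> insert P T \<longleftrightarrow> Z \<subseteq> T" for Z using P(2) by blast
  then show ?thesis
    unfolding smooth_def using card_eff_split_prime[OF P(1), of n "\<lambda>Z. Z \<subseteq> insert P T"] by simp
qed

definition euler_product :: "'a set set \<Rightarrow> real" where
  "euler_product T = (\<Prod>P\<in>T. 1 - (1 / real q) ^ deg P)"

text \<open>The approximate number of effective divisors of degree n; it is zero in degrees in which
  there are no divisors at all.\<close>

definition main_term :: "nat \<Rightarrow> real" where
  "main_term n = (if degree_gcd dvd n then c_const K * real q ^ n else 0)"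

lemma inv_q: "0 < 1 / real q" "1 / real q < 1"
  using q_ge_2 by auto

lemma euler_factor: "P \<in> places K \<Longrightarrow> 0 < 1 - (1 / real q) ^ deg P"
  using inv_q place_degree_pos[of P] power_Suc_less_one[of "1 / real q" "deg P - 1"] by simp

lemma neff_approx: "\<exists>H. 0 \<le> H \<and> (\<forall>n. \<bar>real (neff n) - main_term n\<bar> \<le> H)"
proof -
  obtain N where N: "\<And>n. N \<le> n \<Longrightarrow> (\<exists>D. divisor D \<and> div_degree K D = int n) \<Longrightarrow>
      real (neff n) = c_const K * real q ^ n - real (class_number K) / (real q - 1)"
    using card_eff_large by blast
  define h where "h = real (class_number K) / (real q - 1)"
  have h: "0 \<le> h" unfolding h_def using q_ge_2 by simp
  define H where "H = h + (\<Sum>n<N. \<bar>real (neff n) - main_term n\<bar>)"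
  have H: "0 \<le> (\<Sum>n<N. \<bar>real (neff n) - main_term n\<bar>)" by (rule sum_nonneg) simp
  have "\<bar>real (neff n) - main_term n\<bar> \<le> H" for n
  proof (cases "n < N")
    case True
    then have "\<bar>real (neff n) - main_term n\<bar> \<le> (\<Sum>n<N. \<bar>real (neff n) - main_term n\<bar>)"
      by (intro member_le_sum) auto
    then show ?thesis unfolding H_def using h by simp
  next
    case False
    show ?thesis
    proof (cases "degree_gcd dvd n")
      case True
      then have "real (neff n) - main_term n = - h"
        using N[of n] divisor_of_multiple False unfolding main_term_def h_def by simp
      then show ?thesis unfolding H_def using h H by simp
    next
      case F: False
      then show ?thesis unfolding H_def main_term_def using neff_nonmultiple[OF F] h H by simp
    qed
  qed
  moreover have "0 \<le> H" unfolding H_def using h H by simp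
  ultimately show ?thesis by blast
qed

lemma main_term_diff:
  assumes "P \<in> places K" "deg P \<le> n"
  shows "main_term (n - deg P) = (1 / real q) ^ deg P * main_term n"
proof -
  have "degree_gcd dvd n - deg P \<longleftrightarrow> degree_gcd dvd n"
    using degree_gcd_dvd_place[OF assms(1)] assms(2) dvd_diff_nat dvd_diffD by blast
  moreover have "real q ^ n = real q ^ (n - deg P) * real q ^ deg P" using assms(2) by (simp flip: power_add)
  ultimately show ?thesis unfolding main_term_def using q_ge_2 by (simp add: power_one_over)
qed

lemma main_term_small:
  assumes "P \<in> places K" "n < deg P"
  shows "0 \<le> (1 / real q) ^ deg P * main_term n" "(1 / real q) ^ deg P * main_term n \<le> c_const K"
proof -
  have "real q ^ n \<le> real q ^ deg P" using assms q_ge_2 by (intro power_increasing) auto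
  then have "c_const K * real q ^ n \<le> c_const K * real q ^ deg P" using c_const_pos by simp
  then show "(1 / real q) ^ deg P * main_term n \<le> c_const K"
    unfolding main_term_def using c_const_pos q_ge_2 by (simp add: power_one_over field_simps)
  show "0 \<le> (1 / real q) ^ deg P * main_term n" unfolding main_term_def using c_const_pos by simp
qed

text \<open>Sieving by one more place subtracts the count in degree n - deg P, which multiplies the
  main term by 1 - q^(-deg P). The error at most doubles, up to a constant that accounts for n < deg
  P, so it stays bounded for a fixed finite T.\<close>

lemma sieve_approx:
  assumes T: "finite T" "T \<subseteq> places K"
  shows "\<exists>C. \<forall>n. \<bar>real (sieve T n) - euler_product T * main_term n\<bar> \<le> C"
  using T
proof (induction T rule: finite_induct)
  case empty
  then show ?case using neff_approx unfolding sieve_def euler_product_def by auto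
next
  case (insert P T)
  have P: "P \<in> places K" using insert.prems by auto
  obtain C where C: "\<And>n. \<bar>real (sieve T n) - euler_product T * main_term n\<bar> \<le> C" using insert by auto
  let ?u = "(1 / real q) ^ deg P"
  have ep: "euler_product (insert P T) = (1 - ?u) * euler_product T"
    unfolding euler_product_def using insert.hyps by simp
  have "\<bar>real (sieve (insert P T) n) - euler_product (insert P T) * main_term n\<bar> \<le> 2 * C + \<bar>euler_product T\<bar> * c_const K" for n
  proof (cases "deg P \<le> n")
    case True
    have "real (sieve (insert P T) n) = real (sieve T n) - real (sieve T (n - deg P))"
      using sieve_insert[OF P insert.hyps(2), of n] True by simp
    moreover have "euler_product (insert P T) * main_term n = euler_product T * main_term n - euler_product T * main_term (n - deg P)"
      unfolding ep main_term_diff[OF P True] by (simp add: algebra_simps)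
    moreover have "0 \<le> \<bar>euler_product T\<bar> * c_const K" using c_const_pos by simp
    ultimately show ?thesis using C[of n] C[of "n - deg P"] by linarith
  next
    case False
    have "real (sieve (insert P T) n) = real (sieve T n)"
      using sieve_insert[OF P insert.hyps(2), of n] False by simp
    moreover have "euler_product (insert P T) * main_term n = euler_product T * main_term n - euler_product T * (?u * main_term n)"
      unfolding ep by (simp add: algebra_simps)
    moreover have "\<bar>euler_product T * (?u * main_term n)\<bar> \<le> \<bar>euler_product T\<bar> * c_const K"
      unfolding abs_mult[of "euler_product T"] using main_term_small[OF P, of n] False by (intro mult_left_mono) auto
    moreover have "0 \<le> C" using C[of 0] by linarith
    ultimately show ?thesis using C[of n] by linarith
  qed
  then show ?case by blast
qed

text \<open>The series of T-smooth divisors is the product of the factors 1 / (1 - x^(deg P)) for P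
  in T. At x = 1/q its terms are nonnegative, so truncation only lowers the value; the induction
  proves this without the infinite series.\<close>

lemma smooth_bound:
  assumes T: "finite T" "T \<subseteq> places K"
  shows "(\<Sum>k\<le>n. real (smooth T k) * (1 / real q) ^ k) * euler_product T \<le> 1"
  using T
proof (induction T rule: finite_induct)
  case empty
  have "smooth {} k = (if k = 0 then 1 else 0)" for k
  proof -
    have "{D \<in> eff k. Poly_Mapping.keys D \<subseteq> {}} = (if k = 0 then {0} else {})"
      unfolding eff_def using effective_zero div_degree_zero by (auto simp: keys_eq_empty)
    then show ?thesis unfolding smooth_def by simp
  qed
  then have "(\<Sum>k\<le>n. real (smooth {} k) * (1 / real q) ^ k) = (\<Sum>k\<le>n. if k = 0 then 1 else 0)"
    by (intro sum.cong) auto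
  then show ?case unfolding euler_product_def by simp
next
  case (insert P T)
  have P: "P \<in> places K" using insert.prems by auto
  let ?x = "1 / real q"
  let ?W = "\<lambda>T. \<Sum>k\<le>n. real (smooth T k) * ?x ^ k"
  have ep: "euler_product (insert P T) = (1 - ?x ^ deg P) * euler_product T"
    unfolding euler_product_def using insert.hyps by simp
  have ep0: "0 \<le> euler_product T"
    unfolding euler_product_def using insert.prems euler_factor by (intro prod_nonneg) (auto intro: less_imp_le)
  have "?W (insert P T) = ?W T + (\<Sum>k\<le>n. if deg P \<le> k then real (smooth (insert P T) (k - deg P)) * ?x ^ k else 0)"
    unfolding sum.distrib[symmetric]
    by (rule sum.cong[OF refl]) (simp add: smooth_insert[OF P insert.hyps(2)] algebra_simps)
  also have "(\<Sum>k\<le>n. if deg P \<le> k then real (smooth (insert P T) (k - deg P)) * ?x ^ k else 0)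
      = (\<Sum>k\<in>{deg P..n}. real (smooth (insert P T) (k - deg P)) * ?x ^ k)"
    by (rule sum.mono_neutral_cong_right) auto
  also have "\<dots> = (\<Sum>k\<in>(\<lambda>k. k - deg P) ` {deg P..n}. real (smooth (insert P T) k) * ?x ^ (k + deg P))"
    by (subst sum.reindex) (auto simp: inj_on_def)
  also have "\<dots> \<le> (\<Sum>k\<le>n. real (smooth (insert P T) k) * ?x ^ (k + deg P))"
    by (rule sum_mono2) auto
  also have "\<dots> = ?x ^ deg P * ?W (insert P T)"
    by (simp add: sum_distrib_left power_add mult_ac)
  finally have "?W (insert P T) * (1 - ?x ^ deg P) \<le> ?W T" by (simp add: algebra_simps)
  then have "?W (insert P T) * (1 - ?x ^ deg P) * euler_product T \<le> ?W T * euler_product T"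
    using ep0 by (rule mult_right_mono)
  also have "\<dots> \<le> 1" using insert by simp
  finally show ?case unfolding ep by (simp add: mult.assoc)
qed

text \<open>This reflects the divergence of Z at 1/q. If all the products were at least \<epsilon>,
  then \<open>smooth_bound\<close> would bound the partial sums of \<open>neff k\<close> q^(-k) by
  1/\<epsilon>, so the terms would tend to zero; along multiples of \<open>degree_gcd\<close> they
  are close to c_K > 0.\<close>

lemma euler_product_small:
  assumes \<epsilon>: "0 < \<epsilon>"
  shows "\<exists>d. euler_product {P \<in> places K. deg P \<le> d} < \<epsilon>"
proof (rule ccontr)
  assume neg: "\<nexists>d. euler_product {P \<in> places K. deg P \<le> d} < \<epsilon>"
  let ?u = "\<lambda>k. real (neff k) * (1 / real q) ^ k"
  have bound: "(\<Sum>k<n. ?u k) \<le> 1 / \<epsilon>" for n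
  proof -
    let ?T = "{P \<in> places K. deg P \<le> n}"
    have "smooth ?T k = neff k" if "k \<le> n" for k
    proof -
      have "Poly_Mapping.keys D \<subseteq> ?T" if "D \<in> eff k" for D
        using eff_key_degree[OF that] \<open>k \<le> n\<close> by fastforce
      then have "{D \<in> eff k. Poly_Mapping.keys D \<subseteq> ?T} = eff k" by blast
      then show ?thesis unfolding smooth_def by simp
    qed
    then have "(\<Sum>k\<le>n. ?u k) = (\<Sum>k\<le>n. real (smooth ?T k) * (1 / real q) ^ k)" by simp
    then have "(\<Sum>k\<le>n. ?u k) * euler_product ?T \<le> 1"
      using smooth_bound[OF finite_places_degree_le[of n]] by auto
    moreover have "(\<Sum>k\<le>n. ?u k) * \<epsilon> \<le> (\<Sum>k\<le>n. ?u k) * euler_product ?T"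
      using neg by (intro mult_left_mono sum_nonneg) (auto simp: not_less)
    ultimately have "(\<Sum>k\<le>n. ?u k) \<le> 1 / \<epsilon>" using \<epsilon> by (simp add: field_simps)
    moreover have "(\<Sum>k<n. ?u k) \<le> (\<Sum>k\<le>n. ?u k)" by (rule sum_mono2) auto
    ultimately show ?thesis by linarith
  qed
  have "summable ?u" by (rule summableI_nonneg_bounded[OF _ bound]) simp
  then have lim0: "?u \<longlonglongrightarrow> 0" by (rule summable_LIMSEQ_zero)
  obtain H where H: "\<And>n. \<bar>real (neff n) - main_term n\<bar> \<le> H" using neff_approx by blast
  have "(\<lambda>k. H * (1 / real q) ^ k) \<longlonglongrightarrow> H * 0"
    using inv_q by (intro tendsto_mult tendsto_const LIMSEQ_power_zero) auto
  then have "(\<lambda>k. ?u k + H * (1 / real q) ^ k) \<longlonglongrightarrow> 0" using tendsto_add[OF lim0] by simp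
  then have "\<forall>\<^sub>F k in sequentially. ?u k + H * (1 / real q) ^ k < c_const K"
    using c_const_pos by (rule order_tendstoD)
  then obtain N where N: "\<And>k. N \<le> k \<Longrightarrow> ?u k + H * (1 / real q) ^ k < c_const K"
    unfolding eventually_sequentially by blast
  let ?k = "degree_gcd * N"
  have "N \<le> ?k" using degree_gcd_pos by simp
  have "c_const K * real q ^ ?k \<le> real (neff ?k) + H" using H[of ?k] unfolding main_term_def by simp
  then have "c_const K * real q ^ ?k * (1 / real q) ^ ?k \<le> (real (neff ?k) + H) * (1 / real q) ^ ?k"
    by (intro mult_right_mono) auto
  moreover have "c_const K * real q ^ ?k * (1 / real q) ^ ?k = c_const K" using q_ge_2 by (simp add: power_one_over)
  ultimately show False using N[OF \<open>N \<le> ?k\<close>] unfolding distrib_right by linarith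
qed

end

text \<open>The averages satisfy y (n + 1) = x y n + u (n + 1). Once |u| stays below \<epsilon>',
  this contraction forgets its starting value and leaves at most \<epsilon>' / (1 - x).\<close>

lemma geometric_average_tendsto_zero:
  fixes u :: "nat \<Rightarrow> real"
  assumes x: "0 < x" "x < 1" and u: "u \<longlonglongrightarrow> 0"
  shows "(\<lambda>n. \<Sum>k\<le>n. u k * x ^ (n - k)) \<longlonglongrightarrow> 0"
proof (rule LIMSEQ_I)
  fix \<epsilon> :: real assume \<epsilon>: "0 < \<epsilon>"
  define y where "y n = (\<Sum>k\<le>n. u k * x ^ (n - k))" for n
  have rec: "y (Suc n) = x * y n + u (Suc n)" for n
  proof -
    have "(\<Sum>k\<le>n. u k * x ^ (Suc n - k)) = x * (\<Sum>k\<le>n. u k * x ^ (n - k))"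
      unfolding sum_distrib_left by (rule sum.cong) (auto simp: Suc_diff_le)
    then show ?thesis unfolding y_def by simp
  qed
  define \<epsilon>' where "\<epsilon>' = \<epsilon> * (1 - x) / 2"
  have \<epsilon>': "0 < \<epsilon>'" "\<epsilon>' / (1 - x) = \<epsilon> / 2" unfolding \<epsilon>'_def using \<epsilon> x by (simp_all add: field_simps)
  obtain N where N: "\<And>k. N \<le> k \<Longrightarrow> norm (u k - 0) < \<epsilon>'" using LIMSEQ_D[OF u \<epsilon>'(1)] by blast
  have bound: "\<bar>y (N + m)\<bar> \<le> x ^ m * \<bar>y N\<bar> + \<epsilon>' / (1 - x)" for m
  proof (induction m)
    case 0
    then show ?case using \<epsilon>' x by simp
  next
    case (Suc m)
    have "\<bar>y (N + Suc m)\<bar> \<le> x * \<bar>y (N + m)\<bar> + \<bar>u (Suc (N + m))\<bar>"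
      using rec[of "N + m"] x by (simp add: abs_mult abs_triangle_ineq order_trans[OF abs_triangle_ineq])
    also have "\<dots> \<le> x * (x ^ m * \<bar>y N\<bar> + \<epsilon>' / (1 - x)) + \<epsilon>'"
      using Suc x N[of "Suc (N + m)"] by (intro add_mono mult_left_mono) auto
    also have "\<dots> = x ^ Suc m * \<bar>y N\<bar> + \<epsilon>' / (1 - x)" using x by (simp add: field_simps)
    finally show ?case .
  qed
  have "(\<lambda>m. x ^ m * \<bar>y N\<bar>) \<longlonglongrightarrow> 0 * \<bar>y N\<bar>" using x by (intro tendsto_mult tendsto_const LIMSEQ_power_zero) auto
  then have "\<exists>m0. \<forall>m\<ge>m0. norm (x ^ m * \<bar>y N\<bar> - 0) < \<epsilon> / 2" using LIMSEQ_D[of "\<lambda>m. x ^ m * \<bar>y N\<bar>" 0 "\<epsilon> / 2"] \<epsilon> by simp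
  then obtain m0 where m0': "\<forall>m\<ge>m0. \<bar>x ^ m * \<bar>y N\<bar>\<bar> < \<epsilon> / 2" by auto
  have m0: "x ^ m * \<bar>y N\<bar> < \<epsilon> / 2" if "m0 \<le> m" for m
    by (rule le_less_trans[OF abs_ge_self]) (use m0' that in blast)
  have "norm (y n - 0) < \<epsilon>" if "n \<ge> N + m0" for n
  proof -
    have "\<bar>y n\<bar> \<le> x ^ (n - N) * \<bar>y N\<bar> + \<epsilon> / 2" using bound[of "n - N"] \<epsilon>'(2) that by simp
    moreover have "m0 \<le> n - N" using that by linarith
    ultimately have "\<bar>y n\<bar> < \<epsilon>" using m0[of "n - N"] by linarith
    then show ?thesis by simp
  qed
  then show "\<exists>n0. \<forall>n\<ge>n0. norm ((\<Sum>k\<le>n. u k * x ^ (n - k)) - 0) < \<epsilon>" unfolding y_def[symmetric] by blast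
qed

context global_function_field
begin

subsection \<open>Duality between largest and smallest prime factors\<close>

text \<open>Either empty or the singleton of P_min. As a set it turns the case distinction in the
  weight into a sum, which can be interchanged with the sum over T.\<close>

definition min_primes :: "'a set set \<Rightarrow> 'a set set \<Rightarrow> 'a set set" where
  "min_primes S T = {P \<in> T. P \<in> S \<and> (\<forall>Q\<in>T - {P}. deg P < deg Q)}"

lemma min_primes_unique: "P \<in> min_primes S T \<Longrightarrow> min_primes S T = {P}"
  unfolding min_primes_def by (auto dest: less_asym)

definition min_weight :: "'a set set \<Rightarrow> (nat \<Rightarrow> complex) \<Rightarrow> ('a set \<Rightarrow>\<^sub>0 int) \<Rightarrow> complex" where
  "min_weight S f D = (if D \<in> distinguishable_divisors K S then f (d_minus K D) else 0)"

lemma min_weight_ind: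
  assumes T: "finite T" "T \<subseteq> places K"
  shows "min_weight S f (ind T) = (\<Sum>P\<in>min_primes S T. f (deg P))"
proof (cases "min_primes S T = {}")
  case False
  then obtain P where P: "P \<in> min_primes S T" by blast
  then have PT: "P \<in> T" "P \<in> S" "\<And>Q. Q \<in> T \<Longrightarrow> Q \<noteq> P \<Longrightarrow> deg P < deg Q" unfolding min_primes_def by auto
  have dm: "d_minus K (ind T) = deg P"
    unfolding d_minus_def keys_ind[OF T(1)]
  proof (rule Min_eqI)
    show "deg P \<le> y" if "y \<in> deg ` T" for y using that PT(3) by (auto intro: less_imp_le)
  qed (use T PT in auto)
  have uni: "Q \<in> Poly_Mapping.keys (ind T) \<and> deg Q = d_minus K (ind T) \<longleftrightarrow> Q = P" for Q
    unfolding keys_ind[OF T(1)] dm using PT by (metis nat_neq_iff)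
  have "ind T \<noteq> 0" using keys_ind[OF T(1)] PT(1) by (metis empty_iff keys_zero)
  then have "distinguishable K (ind T)" unfolding distinguishable_def uni by simp
  moreover have "P_min K (ind T) = P" unfolding P_min_def uni by simp
  ultimately have "ind T \<in> distinguishable_divisors K S"
    unfolding distinguishable_divisors_def using effective_ind[OF T] PT(2) by simp
  then show ?thesis unfolding min_weight_def min_primes_unique[OF P] dm by simp
next
  case True
  have "ind T \<notin> distinguishable_divisors K S"
  proof
    assume d: "ind T \<in> distinguishable_divisors K S"
    let ?R = "\<lambda>P. P \<in> Poly_Mapping.keys (ind T) \<and> deg P = d_minus K (ind T)"
    have ex: "\<exists>!P. ?R P" and S: "P_min K (ind T) \<in> S"
      using d unfolding distinguishable_divisors_def distinguishable_def by auto
    define P where "P = P_min K (ind T)"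
    have P: "?R P" unfolding P_def P_min_def using theI'[OF ex] .
    have "deg P < deg Q" if Q: "Q \<in> T - {P}" for Q
    proof -
      have "d_minus K (ind T) \<le> deg Q" unfolding d_minus_def keys_ind[OF T(1)] using Q T(1) by (intro Min_le) auto
      moreover have "deg Q \<noteq> d_minus K (ind T)" using ex P Q keys_ind[OF T(1)] by blast
      ultimately show ?thesis using P by linarith
    qed
    then have "P \<in> min_primes S T" unfolding min_primes_def using P S keys_ind[OF T(1)] P_def by simp
    then show False using True by blast
  qed
  then show ?thesis unfolding min_weight_def True by simp
qed

text \<open>The subsets of Z with unique least element P arise by adding P to a subset of the
  members of larger degree. Their signs cancel unless there are no such members, that is, unless P
  has the largest degree in Z; the sign that survives is that of {P}. Several members may share the
  largest degree, and each contributes, which is how \<open>Q_count\<close> appears.\<close>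

lemma alladi_duality:
  fixes F :: "'a set \<Rightarrow> complex"
  assumes Z: "finite Z"
  shows "(\<Sum>T\<in>Pow Z. (- 1) ^ card T * (\<Sum>P\<in>min_primes S T. F P))
    = - (\<Sum>P | P \<in> Z \<and> P \<in> S \<and> (\<forall>Q\<in>Z. deg Q \<le> deg P). F P)"
proof -
  have "(\<Sum>T\<in>Pow Z. (- 1) ^ card T * (\<Sum>P\<in>min_primes S T. F P))
      = (\<Sum>T\<in>Pow Z. \<Sum>P\<in>Z \<inter> S. if P \<in> min_primes S T then (- 1) ^ card T * F P else 0)"
  proof (rule sum.cong[OF refl])
    fix T assume "T \<in> Pow Z"
    then have "min_primes S T \<subseteq> Z \<inter> S" unfolding min_primes_def by blast
    then have "(\<Sum>P\<in>Z \<inter> S. if P \<in> min_primes S T then (- 1) ^ card T * F P else 0) = (\<Sum>P\<in>min_primes S T. (- 1) ^ card T * F P)"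
      using Z by (intro sum.mono_neutral_cong_right) auto
    then show "(- 1) ^ card T * (\<Sum>P\<in>min_primes S T. F P) = (\<Sum>P\<in>Z \<inter> S. if P \<in> min_primes S T then (- 1) ^ card T * F P else 0)"
      by (simp add: sum_distrib_left)
  qed
  also have "\<dots> = (\<Sum>P\<in>Z \<inter> S. \<Sum>T\<in>Pow Z. if P \<in> min_primes S T then (- 1) ^ card T * F P else 0)" by (rule sum.swap)
  also have "\<dots> = (\<Sum>P\<in>Z \<inter> S. if \<forall>Q\<in>Z. deg Q \<le> deg P then - F P else 0)"
  proof (rule sum.cong[OF refl])
    fix P assume P: "P \<in> Z \<inter> S"
    let ?U = "{Q \<in> Z. deg P < deg Q}"
    have PU: "P \<notin> ?U" by simp
    have inj: "inj_on (insert P) (Pow ?U)"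
    proof (rule inj_onI)
      fix A B assume "A \<in> Pow ?U" "B \<in> Pow ?U" "insert P A = insert P B"
      then show "A = B" using PU by (subst insert_ident[symmetric, of P]) auto
    qed
    have eq: "{T \<in> Pow Z. P \<in> min_primes S T} = insert P ` Pow ?U"
    proof (intro equalityI subsetI)
      fix T assume T: "T \<in> {T \<in> Pow Z. P \<in> min_primes S T}"
      then have "T - {P} \<in> Pow ?U" "T = insert P (T - {P})" unfolding min_primes_def by auto
      then show "T \<in> insert P ` Pow ?U" by (intro image_eqI)
    next
      fix T assume "T \<in> insert P ` Pow ?U"
      then obtain Y where "T = insert P Y" "Y \<subseteq> ?U" by blast
      then show "T \<in> {T \<in> Pow Z. P \<in> min_primes S T}" unfolding min_primes_def using P by auto
    qed
    have "(\<Sum>T\<in>Pow Z. if P \<in> min_primes S T then (- 1) ^ card T * F P else 0)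
        = (\<Sum>T\<in>{T \<in> Pow Z. P \<in> min_primes S T}. (- 1) ^ card T * F P)"
      using Z by (intro sum.mono_neutral_cong_right) auto
    also have "\<dots> = (\<Sum>T\<in>Pow ?U. (- 1) ^ card (insert P T) * F P)"
      unfolding eq sum.reindex[OF inj] by simp
    also have "\<dots> = (\<Sum>T\<in>Pow ?U. (- 1) ^ card T * (- F P))"
    proof (rule sum.cong[OF refl])
      fix T assume "T \<in> Pow ?U"
      then have "finite T" "P \<notin> T" using finite_subset[of T Z] Z by auto
      then show "(- 1) ^ card (insert P T) * F P = (- 1) ^ card T * (- F P)" by simp
    qed
    also have "\<dots> = (\<Sum>T\<in>Pow ?U. (- 1) ^ card T) * (- F P)" by (simp only: sum_distrib_right)
    also have "\<dots> = (if ?U = {} then 1 else 0) * (- F P)" using Z by (subst alternating_Pow_sum) auto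
    also have "\<dots> = (if \<forall>Q\<in>Z. deg Q \<le> deg P then - F P else 0)"
    proof -
      have "?U = {} \<longleftrightarrow> (\<forall>Q\<in>Z. deg Q \<le> deg P)" by (auto simp: not_less)
      then show ?thesis by simp
    qed
    finally show "(\<Sum>T\<in>Pow Z. if P \<in> min_primes S T then (- 1) ^ card T * F P else 0)
        = (if \<forall>Q\<in>Z. deg Q \<le> deg P then - F P else 0)" .
  qed
  also have "\<dots> = (\<Sum>P | P \<in> Z \<and> P \<in> S \<and> (\<forall>Q\<in>Z. deg Q \<le> deg P). - F P)"
    using Z by (intro sum.mono_neutral_cong_right) auto
  finally show ?thesis by (simp add: sum_negf)
qed

definition Msum :: "'a set set \<Rightarrow> (nat \<Rightarrow> complex) \<Rightarrow> nat \<Rightarrow> complex" where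
  "Msum S f k = (\<Sum>D\<in>eff k. of_int (div_moebius D) * min_weight S f D)"

lemma Msum_sq: "Msum S f k = (\<Sum>T\<in>sq k. (- 1) ^ card T * (\<Sum>P\<in>min_primes S T. f (deg P)))"
  unfolding Msum_def moebius_sum_eff by (rule sum.cong[OF refl]) (auto simp: sq_def min_weight_ind)

lemma Q_count_sum:
  fixes f :: "nat \<Rightarrow> complex"
  shows "(\<Sum>P | P \<in> Poly_Mapping.keys A \<and> P \<in> S \<and> (\<forall>Q\<in>Poly_Mapping.keys A. deg Q \<le> deg P). f (deg P))
    = of_nat (Q_count K S A) * f (d_plus K A)"
proof (cases "A = 0")
  case True
  then show ?thesis unfolding Q_count_def by simp
next
  case False
  let ?Z = "Poly_Mapping.keys A"
  have ne: "?Z \<noteq> {}" using False by (simp add: keys_eq_empty)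
  have dp: "d_plus K A = Max (deg ` ?Z)" unfolding d_plus_def using False by simp
  have iff: "(\<forall>Q\<in>?Z. deg Q \<le> deg P) \<longleftrightarrow> deg P = d_plus K A" if P: "P \<in> ?Z" for P
  proof
    assume "\<forall>Q\<in>?Z. deg Q \<le> deg P"
    then have "Max (deg ` ?Z) = deg P" using P by (intro Max_eqI) auto
    then show "deg P = d_plus K A" using dp by simp
  next
    assume "deg P = d_plus K A"
    then show "\<forall>Q\<in>?Z. deg Q \<le> deg P" unfolding dp by (auto intro: Max_ge)
  qed
  have "{P. P \<in> ?Z \<and> P \<in> S \<and> (\<forall>Q\<in>?Z. deg Q \<le> deg P)} = {P \<in> S. P \<in> ?Z \<and> deg P = d_plus K A}"
    using iff by blast
  then show ?thesis unfolding Q_count_def by simp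
qed

lemma Q_count_sum_eq:
  "(\<Sum>A\<in>eff n. of_nat (Q_count K S A) * f (d_plus K A)) = - (\<Sum>k\<le>n. Msum S f k * of_nat (neff (n - k)))"
proof -
  have "(\<Sum>k\<le>n. Msum S f k * of_nat (neff (n - k)))
      = (\<Sum>A\<in>eff n. \<Sum>D\<in>below A. of_int (div_moebius D) * min_weight S f D)"
    unfolding Msum_def by (rule divisor_convolution)
  also have "\<dots> = (\<Sum>A\<in>eff n. - (of_nat (Q_count K S A) * f (d_plus K A)))"
  proof (rule sum.cong[OF refl])
    fix A assume A: "A \<in> eff n"
    have Zp: "Poly_Mapping.keys A \<subseteq> places K" using eff_key_degree(1)[OF A] by blast
    have "(\<Sum>D\<in>below A. of_int (div_moebius D) * min_weight S f D)
        = (\<Sum>T\<in>Pow (Poly_Mapping.keys A). (- 1) ^ card T * (\<Sum>P\<in>min_primes S T. f (deg P)))"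
      unfolding moebius_sum_below[OF A]
    proof (rule sum.cong[OF refl])
      fix T assume "T \<in> Pow (Poly_Mapping.keys A)"
      then have "finite T" "T \<subseteq> places K" using Zp finite_subset[OF _ finite_keys, of T A] by auto
      then show "(- 1) ^ card T * min_weight S f (ind T) = (- 1) ^ card T * (\<Sum>P\<in>min_primes S T. f (deg P))"
        by (simp add: min_weight_ind)
    qed
    then show "(\<Sum>D\<in>below A. of_int (div_moebius D) * min_weight S f D) = - (of_nat (Q_count K S A) * f (d_plus K A))"
      unfolding alladi_duality[OF finite_keys] Q_count_sum .
  qed
  finally show ?thesis by (simp add: sum_negf)
qed

section \<open>Size of the Moebius sums over distinguishable divisors\<close>

lemma Msum_nonmultiple: "\<not> degree_gcd dvd k \<Longrightarrow> Msum S f k = 0"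
  unfolding Msum_def using eff_empty by simp

lemma Msum_0: "Msum S f 0 = 0"
proof -
  have "min_weight S f D = 0" if "D \<in> eff 0" for D
  proof -
    have "D = 0" using that effective_degree_zero unfolding eff_def by auto
    then show ?thesis unfolding min_weight_def distinguishable_divisors_def distinguishable_def by simp
  qed
  then show ?thesis unfolding Msum_def by simp
qed

text \<open>If T contains a place of degree at most d, its unique least element, if it has one, lies
  in the finite set L, and such T are sorted by that element. The remaining T avoid L altogether and
  are left to the sieve.\<close>

lemma Msum_split:
  fixes d :: nat
  defines "L \<equiv> {P \<in> places K. deg P \<le> d}"
  shows "Msum S f k = (\<Sum>T | T \<in> sq k \<and> T \<inter> L = {}. (- 1) ^ card T * (\<Sum>P\<in>min_primes S T. f (deg P)))
    + (\<Sum>P\<in>L \<inter> S. f (deg P) * (\<Sum>T | T \<in> sq k \<and> P \<in> T \<and> (\<forall>Q\<in>T - {P}. deg P < deg Q). (- 1) ^ card T))"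
proof -
  let ?h = "\<lambda>T. \<Sum>P\<in>min_primes S T. f (deg P)"
  have finL: "finite L" unfolding L_def by (rule finite_places_degree_le)
  have "Msum S f k = (\<Sum>T\<in>sq k. (if T \<inter> L = {} then (- 1) ^ card T * ?h T else 0)
      + (\<Sum>P\<in>L \<inter> S. if P \<in> min_primes S T then f (deg P) * (- 1) ^ card T else 0))"
    unfolding Msum_sq
  proof (rule sum.cong[OF refl])
    fix T assume T: "T \<in> sq k"
    have "(\<Sum>P\<in>L \<inter> S. if P \<in> min_primes S T then f (deg P) * (- 1) ^ card T else 0)
        = (\<Sum>P\<in>min_primes S T \<inter> L. f (deg P) * (- 1) ^ card T)"
      using finL by (intro sum.mono_neutral_cong_right) (auto simp: min_primes_def)
    moreover have "min_primes S T \<inter> L = (if T \<inter> L = {} then {} else min_primes S T)"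
    proof (cases "T \<inter> L = {}")
      case True
      then show ?thesis unfolding min_primes_def by auto
    next
      case False
      then obtain Q where Q: "Q \<in> T" "deg Q \<le> d" unfolding L_def by blast
      have "P \<in> L" if P: "P \<in> min_primes S T" for P
      proof -
        have "deg P \<le> deg Q" using P Q(1) unfolding min_primes_def by (cases "P = Q") (auto intro: less_imp_le)
        moreover have "P \<in> places K" using P T unfolding min_primes_def sq_def by blast
        ultimately show ?thesis unfolding L_def using Q(2) by simp
      qed
      then show ?thesis using False by auto
    qed
    ultimately show "(- 1) ^ card T * ?h T = (if T \<inter> L = {} then (- 1) ^ card T * ?h T else 0)
      + (\<Sum>P\<in>L \<inter> S. if P \<in> min_primes S T then f (deg P) * (- 1) ^ card T else 0)"
      by (simp add: sum_distrib_left mult.commute)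
  qed
  also have "\<dots> = (\<Sum>T\<in>sq k. if T \<inter> L = {} then (- 1) ^ card T * ?h T else 0)
      + (\<Sum>T\<in>sq k. \<Sum>P\<in>L \<inter> S. if P \<in> min_primes S T then f (deg P) * (- 1) ^ card T else 0)" by (rule sum.distrib)
  also have "(\<Sum>T\<in>sq k. if T \<inter> L = {} then (- 1) ^ card T * ?h T else 0)
      = (\<Sum>T | T \<in> sq k \<and> T \<inter> L = {}. (- 1) ^ card T * ?h T)"
    using finite_sq by (intro sum.mono_neutral_cong_right) auto
  also have "(\<Sum>T\<in>sq k. \<Sum>P\<in>L \<inter> S. if P \<in> min_primes S T then f (deg P) * (- 1) ^ card T else 0)
      = (\<Sum>P\<in>L \<inter> S. \<Sum>T\<in>sq k. if P \<in> min_primes S T then f (deg P) * (- 1) ^ card T else 0)" by (rule sum.swap)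
  also have "\<dots> = (\<Sum>P\<in>L \<inter> S. f (deg P) * (\<Sum>T | T \<in> sq k \<and> P \<in> T \<and> (\<forall>Q\<in>T - {P}. deg P < deg Q). (- 1) ^ card T))"
  proof (rule sum.cong[OF refl])
    fix P assume P: "P \<in> L \<inter> S"
    show "(\<Sum>T\<in>sq k. if P \<in> min_primes S T then f (deg P) * (- 1) ^ card T else 0)
        = f (deg P) * (\<Sum>T | T \<in> sq k \<and> P \<in> T \<and> (\<forall>Q\<in>T - {P}. deg P < deg Q). (- 1) ^ card T)"
      unfolding sum_distrib_left using finite_sq P
      by (intro sum.mono_neutral_cong_right) (auto simp: min_primes_def)
  qed
  finally show ?thesis .
qed

text \<open>Removing P costs a sign and leaves a Moebius sum over divisors free of all places of
  degree at most deg P, including P itself.\<close>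

lemma fixed_min_prime_sum:
  assumes P: "P \<in> places K"
  shows "(\<Sum>T | T \<in> sq k \<and> P \<in> T \<and> (\<forall>Q\<in>T - {P}. deg P < deg Q). (- 1) ^ card T)
    = (if deg P \<le> k then - of_real (msum {Q \<in> places K. deg Q \<le> deg P} (k - deg P)) else (0 :: complex))"
proof -
  have "Z \<in> sq j \<and> P \<notin> Z \<and> (\<forall>Q\<in>Z. deg P < deg Q) \<longleftrightarrow> Z \<in> sq j \<and> Z \<inter> {Q \<in> places K. deg Q \<le> deg P} = {}" for Z j
  proof -
    have "Z \<subseteq> places K" if "Z \<in> sq j" using that unfolding sq_def by blast
    then show ?thesis using P by (auto simp: not_le[symmetric])
  qed
  then show ?thesis
    using sum_sq_insert[OF P, of k "\<lambda>Z. \<forall>Q\<in>Z. deg P < deg Q", where ?'c = complex] unfolding msum_def by simp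
qed

lemma Msum_tendsto_zero:
  assumes f: "bounded (range f)"
  shows "(\<lambda>k. norm (Msum S f k) / real q ^ k) \<longlonglongrightarrow> 0"
proof (rule LIMSEQ_I)
  fix \<epsilon> :: real assume \<epsilon>: "0 < \<epsilon>"
  obtain B where B: "0 < B" "\<And>n. norm (f n) \<le> B" using f unfolding bounded_pos by auto
  obtain r C0 where r: "1 < r" "r < real q" "\<And>n. \<bar>real_of_int (moeb_sum n)\<bar> \<le> C0 * r ^ n"
    using moeb_sum_power_saving by blast
  have c: "0 < c_const K" by (rule c_const_pos)
  have q0: "0 < real q" using q_ge_2 by simp
  have "0 < \<epsilon> / (2 * B * c_const K)" using \<epsilon> B(1) c by simp
  \<comment> \<open>The threshold is chosen so that the sieve estimate accounts for less than half
    of \<epsilon>, as f is bounded by B.\<close>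
  then obtain d where d: "euler_product {P \<in> places K. deg P \<le> d} < \<epsilon> / (2 * B * c_const K)"
    using euler_product_small by blast
  define L where "L = {P \<in> places K. deg P \<le> d}"
  have L: "finite L" "L \<subseteq> places K" unfolding L_def using finite_places_degree_le by auto
  define ep where "ep = euler_product L"
  have ep0: "0 \<le> ep" unfolding ep_def euler_product_def using L euler_factor by (intro prod_nonneg) (auto intro: less_imp_le)
  have ep: "B * (ep * c_const K) < \<epsilon> / 2" using d B(1) c unfolding ep_def L_def by (simp add: field_simps)
  obtain C1 where C1: "\<And>n. \<bar>real (sieve L n) - ep * main_term n\<bar> \<le> C1" using sieve_approx[OF L] unfolding ep_def by blast
  \<comment> \<open>One rate r < q serves every P. The constants depend on P, but once d is fixed
    there are only finitely many.\<close>
  have "\<forall>P\<in>L. \<exists>C. \<forall>j. \<bar>msum {Q \<in> places K. deg Q \<le> deg P} j\<bar> \<le> C * r ^ j"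
    using msum_bound[OF r(1) r(3) finite_places_degree_le] by blast
  then obtain cc where cc: "\<And>P j. P \<in> L \<Longrightarrow> \<bar>msum {Q \<in> places K. deg Q \<le> deg P} j\<bar> \<le> cc P * r ^ j"
    using bchoice[of L "\<lambda>P C. \<forall>j. \<bar>msum {Q \<in> places K. deg Q \<le> deg P} j\<bar> \<le> C * r ^ j"] by blast
  define C2 where "C2 = (\<Sum>P\<in>L \<inter> S. B * cc P)"
  have bound: "norm (Msum S f k) \<le> B * (ep * c_const K) * real q ^ k + B * C1 + C2 * r ^ k" for k
  proof -
    let ?T = "{T. T \<in> sq k \<and> T \<inter> L = {}}"
    let ?h = "\<lambda>T. \<Sum>P\<in>min_primes S T. f (deg P)"
    have "norm (\<Sum>T\<in>?T. (- 1) ^ card T * ?h T) \<le> (\<Sum>T\<in>?T. B)"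
    proof (rule sum_norm_le)
      fix T
      show "norm ((- 1) ^ card T * ?h T) \<le> B"
      proof (cases "min_primes S T = {}")
        case True
        then show ?thesis using B by simp
      next
        case False
        then obtain P where "min_primes S T = {P}" using min_primes_unique by blast
        then show ?thesis using B by (simp add: norm_mult norm_power)
      qed
    qed
    also have "\<dots> \<le> B * real (sieve L k)"
    proof -
      have "card ?T \<le> sieve L k"
        unfolding sieve_def
      proof (rule card_inj_on_le[of ind])
        show "inj_on ind ?T" using inj_ind by (intro inj_onI) (auto simp: sq_def)
        show "ind ` ?T \<subseteq> {D \<in> eff k. Poly_Mapping.keys D \<inter> L = {}}"
          using ind_in_eff keys_ind by (fastforce simp: sq_def)
        show "finite {D \<in> eff k. Poly_Mapping.keys D \<inter> L = {}}" using finite_eff by simp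
      qed
      then show ?thesis using B(1) by simp
    qed
    also have "\<dots> \<le> B * (ep * (c_const K * real q ^ k) + C1)"
    proof -
      have "main_term k \<le> c_const K * real q ^ k" unfolding main_term_def using c by simp
      then have "ep * main_term k \<le> ep * (c_const K * real q ^ k)" using ep0 by (rule mult_left_mono)
      then show ?thesis using C1[of k] B(1) by (intro mult_left_mono) auto
    qed
    finally have 1: "norm (\<Sum>T\<in>?T. (- 1) ^ card T * ?h T) \<le> B * (ep * c_const K) * real q ^ k + B * C1"
      by (simp add: algebra_simps)
    have "norm (\<Sum>P\<in>L \<inter> S. f (deg P) * (\<Sum>T | T \<in> sq k \<and> P \<in> T \<and> (\<forall>Q\<in>T - {P}. deg P < deg Q). (- 1) ^ card T))
        \<le> (\<Sum>P\<in>L \<inter> S. B * (cc P * r ^ k))"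
    proof (rule sum_norm_le)
      fix P assume P: "P \<in> L \<inter> S"
      have Pp: "P \<in> places K" using P L by blast
      have cc0: "0 \<le> cc P" using cc[of P 0] P by simp
      have "norm (\<Sum>T | T \<in> sq k \<and> P \<in> T \<and> (\<forall>Q\<in>T - {P}. deg P < deg Q). (- 1 :: complex) ^ card T) \<le> cc P * r ^ k"
      proof (cases "deg P \<le> k")
        case True
        have "\<bar>msum {Q \<in> places K. deg Q \<le> deg P} (k - deg P)\<bar> \<le> cc P * r ^ (k - deg P)" using cc P by blast
        also have "\<dots> \<le> cc P * r ^ k" using cc0 r(1) by (intro mult_left_mono power_increasing) auto
        finally show ?thesis unfolding fixed_min_prime_sum[OF Pp] using True by simp
      next
        case False
        then show ?thesis unfolding fixed_min_prime_sum[OF Pp] using cc0 r(1) by simp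
      qed
      then show "norm (f (deg P) * (\<Sum>T | T \<in> sq k \<and> P \<in> T \<and> (\<forall>Q\<in>T - {P}. deg P < deg Q). (- 1) ^ card T)) \<le> B * (cc P * r ^ k)"
        unfolding norm_mult using B by (intro mult_mono) auto
    qed
    also have "\<dots> = C2 * r ^ k" unfolding C2_def by (simp add: sum_distrib_right mult.assoc)
    finally have 2: "norm (\<Sum>P\<in>L \<inter> S. f (deg P) * (\<Sum>T | T \<in> sq k \<and> P \<in> T \<and> (\<forall>Q\<in>T - {P}. deg P < deg Q). (- 1) ^ card T)) \<le> C2 * r ^ k" .
    show ?thesis
      unfolding Msum_split[of S f k d, folded L_def]
      by (rule order_trans[OF norm_triangle_ineq add_mono[OF 1 2]])
  qed
  have "(\<lambda>k. B * C1 * (1 / real q) ^ k + C2 * (r / real q) ^ k) \<longlonglongrightarrow> B * C1 * 0 + C2 * 0"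
    using inv_q r by (intro tendsto_intros LIMSEQ_power_zero) auto
  then have "\<forall>\<^sub>F k in sequentially. B * C1 * (1 / real q) ^ k + C2 * (r / real q) ^ k < \<epsilon> / 2"
    using \<epsilon> by (intro order_tendstoD(2)[of _ 0]) auto
  then obtain N where N: "\<And>k. N \<le> k \<Longrightarrow> B * C1 * (1 / real q) ^ k + C2 * (r / real q) ^ k < \<epsilon> / 2"
    unfolding eventually_sequentially by blast
  have "norm (norm (Msum S f k) / real q ^ k - 0) < \<epsilon>" if "N \<le> k" for k
  proof -
    have "norm (Msum S f k) / real q ^ k \<le> (B * (ep * c_const K) * real q ^ k + B * C1 + C2 * r ^ k) / real q ^ k"
      using bound q0 by (intro divide_right_mono) auto
    also have "\<dots> = B * (ep * c_const K) + (B * C1 * (1 / real q) ^ k + C2 * (r / real q) ^ k)"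
      using q0 by (simp add: add_divide_distrib power_divide)
    also have "\<dots> < \<epsilon>" using ep N[OF that] by linarith
    finally show ?thesis using q0 by simp
  qed
  then show "\<exists>N. \<forall>k\<ge>N. norm (norm (Msum S f k) / real q ^ k - 0) < \<epsilon>" by blast
qed

text \<open>By a theorem of F. K. Schmidt \<open>degree_gcd = 1\<close>. The argument avoids it: otherwise the quotients
  defining the density are \<open>0/0 = 0\<close> at every \<open>n\<close> that is not a multiple of \<open>degree_gcd\<close>.\<close>

lemma density_zero:
  assumes S: "S \<subseteq> places K" and \<delta>: "has_natural_density K S \<delta>" and e: "1 < degree_gcd"
  shows "\<delta> = 0"
proof -
  let ?u = "\<lambda>n. real (card {P \<in> S. deg P = n}) / real (card {P \<in> places K. deg P = n})"
  have "strict_mono (\<lambda>m. degree_gcd * m + 1)" using e by (intro strict_monoI) simp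
  then have "(\<lambda>m. ?u (degree_gcd * m + 1)) \<longlonglongrightarrow> \<delta>"
    using LIMSEQ_subseq_LIMSEQ[of ?u \<delta> "\<lambda>m. degree_gcd * m + 1"] \<delta> unfolding has_natural_density_def o_def by simp
  moreover have "?u (degree_gcd * m + 1) = 0" for m
  proof -
    have "deg P \<noteq> degree_gcd * m + 1" if "P \<in> S" for P
    proof
      assume "deg P = degree_gcd * m + 1"
      then have "degree_gcd dvd degree_gcd * m + 1" using degree_gcd_dvd_place[of P] that S by auto
      then have "degree_gcd dvd 1" using dvd_add_right_iff[of degree_gcd "degree_gcd * m" 1] by simp
      then show False using e by simp
    qed
    then have "{P \<in> S. deg P = degree_gcd * m + 1} = {}" by blast
    then show ?thesis by (simp only: card.empty of_nat_0 div_0)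
  qed
  ultimately have "(\<lambda>m :: nat. 0) \<longlonglongrightarrow> \<delta>" by (simp only:)
  then show ?thesis by (simp add: LIMSEQ_const_iff)
qed

section \<open>The equivalence of the two limits\<close>

definition Ysum :: "'a set set \<Rightarrow> (nat \<Rightarrow> complex) \<Rightarrow> nat \<Rightarrow> complex" where
  "Ysum S f n = - (\<Sum>k\<le>n. Msum S f k / of_real (real q ^ k))"

text \<open>The divisors are grouped by degree. \<open>Ysum\<close> also includes degree 0, which
  contributes nothing because the zero divisor is not distinguishable.\<close>

lemma Ysum_eq:
  "- (\<Sum>A | A \<in> distinguishable_divisors K S \<and> 1 \<le> div_degree K A \<and> div_degree K A \<le> int n.
      of_int (div_moebius A) * f (d_minus K A) / of_real (div_norm K A)) = Ysum S f n"
proof -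
  let ?I = "\<lambda>k. {A \<in> eff k. A \<in> distinguishable_divisors K S}"
  let ?t = "\<lambda>A. of_int (div_moebius A) * f (d_minus K A) / of_real (div_norm K A)"
  have set: "{A. A \<in> distinguishable_divisors K S \<and> 1 \<le> div_degree K A \<and> div_degree K A \<le> int n} = (\<Union>k\<in>{1..n}. ?I k)"
  proof (intro equalityI subsetI)
    fix A assume A: "A \<in> {A. A \<in> distinguishable_divisors K S \<and> 1 \<le> div_degree K A \<and> div_degree K A \<le> int n}"
    then have "A \<in> eff (nat (div_degree K A))" "nat (div_degree K A) \<in> {1..n}"
      unfolding eff_def distinguishable_divisors_def by auto
    then show "A \<in> (\<Union>k\<in>{1..n}. ?I k)" using A by blast
  next
    fix A assume "A \<in> (\<Union>k\<in>{1..n}. ?I k)"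
    then show "A \<in> {A. A \<in> distinguishable_divisors K S \<and> 1 \<le> div_degree K A \<and> div_degree K A \<le> int n}"
      unfolding eff_def by auto
  qed
  have "(\<Sum>A\<in>(\<Union>k\<in>{1..n}. ?I k). ?t A) = (\<Sum>k\<in>{1..n}. \<Sum>A\<in>?I k. ?t A)"
  proof (rule sum.UNION_disjoint)
    show "\<forall>k\<in>{1..n}. finite (?I k)" using finite_eff by simp
    show "\<forall>i\<in>{1..n}. \<forall>j\<in>{1..n}. i \<noteq> j \<longrightarrow> ?I i \<inter> ?I j = {}" unfolding eff_def by auto
  qed simp
  also have "\<dots> = (\<Sum>k\<in>{1..n}. Msum S f k / of_real (real q ^ k))"
  proof (rule sum.cong[OF refl])
    fix k
    have "(\<Sum>A\<in>?I k. ?t A) = (\<Sum>A\<in>eff k. of_int (div_moebius A) * min_weight S f A / of_real (real q ^ k))"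
    proof (rule sum.mono_neutral_cong_left[OF finite_eff])
      show "?t A = of_int (div_moebius A) * min_weight S f A / of_real (real q ^ k)" if "A \<in> ?I k" for A
        using that unfolding min_weight_def div_norm_def eff_def q_def by simp
    qed (auto simp: min_weight_def)
    then show "(\<Sum>A\<in>?I k. ?t A) = Msum S f k / of_real (real q ^ k)" unfolding Msum_def by (simp add: sum_divide_distrib)
  qed
  also have "\<dots> = (\<Sum>k\<le>n. Msum S f k / of_real (real q ^ k))"
    by (rule sum.mono_neutral_left) (auto simp: Msum_0 not_le)
  finally show ?thesis unfolding set Ysum_def by simp
qed

text \<open>The count \<open>neff\<close> is split into \<open>main_term\<close> and a bounded
  remainder \<eta>. As \<open>Msum\<close> lives on multiples of \<open>degree_gcd\<close>, its
  convolution with \<open>main_term\<close> is c_K q^n times a partial sum if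
  \<open>degree_gcd\<close> divides n and zero otherwise. The convolution with \<eta>, divided by
  q^n, is at most a geometric average with ratio 1/q of a null sequence.\<close>

lemma Q_count_asymptotic:
  assumes f: "bounded (range f)"
  shows "(\<lambda>n. (\<Sum>A\<in>eff n. of_nat (Q_count K S A) * f (d_plus K A)) / of_real (real q ^ n)
    - (if degree_gcd dvd n then of_real (c_const K) * Ysum S f n else 0)) \<longlonglongrightarrow> 0"
proof -
  obtain H where H: "0 \<le> H" "\<And>n. \<bar>real (neff n) - main_term n\<bar> \<le> H" using neff_approx by blast
  have q0: "0 < real q" using q_ge_2 by simp
  define \<eta> where "\<eta> n = real (neff n) - main_term n" for n
  have eq: "(\<Sum>A\<in>eff n. of_nat (Q_count K S A) * f (d_plus K A)) / of_real (real q ^ n)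
      - (if degree_gcd dvd n then of_real (c_const K) * Ysum S f n else 0)
      = - (\<Sum>k\<le>n. Msum S f k * of_real (\<eta> (n - k)) / of_real (real q ^ n))" for n
  proof -
    have summand: "Msum S f k * of_nat (neff (n - k)) / of_real (real q ^ n)
        = (if degree_gcd dvd n then of_real (c_const K) * (Msum S f k / of_real (real q ^ k)) else 0)
          + Msum S f k * of_real (\<eta> (n - k)) / of_real (real q ^ n)" if k: "k \<le> n" for k
    proof -
      have "of_nat (neff (n - k)) = (of_real (main_term (n - k)) + of_real (\<eta> (n - k)) :: complex)"
        unfolding \<eta>_def by simp
      then have "Msum S f k * of_nat (neff (n - k)) / of_real (real q ^ n)
          = Msum S f k * of_real (main_term (n - k)) / of_real (real q ^ n) + Msum S f k * of_real (\<eta> (n - k)) / of_real (real q ^ n)"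
        by (simp add: distrib_left add_divide_distrib)
      moreover have "Msum S f k * of_real (main_term (n - k)) / of_real (real q ^ n)
          = (if degree_gcd dvd n then of_real (c_const K) * (Msum S f k / of_real (real q ^ k)) else 0)"
      \<comment> \<open>For k a multiple of \<open>degree_gcd\<close>, the main term at n - k is
        nonzero exactly if n is a multiple too; for other k the factor \<open>Msum S f k\<close>
        vanishes.\<close>
      proof (cases "degree_gcd dvd k")
        case True
        then have iff: "degree_gcd dvd n - k \<longleftrightarrow> degree_gcd dvd n" using k dvd_diff_nat dvd_diffD by blast
        have "real q ^ n = real q ^ (n - k) * real q ^ k" using k by (simp flip: power_add)
        then show ?thesis unfolding main_term_def iff using q0 by simp
      next
        case False
        then show ?thesis by (simp add: Msum_nonmultiple)
      qed
      ultimately show ?thesis by simp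
    qed
    have "(\<Sum>k\<le>n. Msum S f k * of_nat (neff (n - k))) / of_real (real q ^ n)
        = (\<Sum>k\<le>n. (if degree_gcd dvd n then of_real (c_const K) * (Msum S f k / of_real (real q ^ k)) else 0)
          + Msum S f k * of_real (\<eta> (n - k)) / of_real (real q ^ n))"
      unfolding sum_divide_distrib using summand by (intro sum.cong) auto
    also have "\<dots> = (if degree_gcd dvd n then of_real (c_const K) * (\<Sum>k\<le>n. Msum S f k / of_real (real q ^ k)) else 0)
        + (\<Sum>k\<le>n. Msum S f k * of_real (\<eta> (n - k)) / of_real (real q ^ n))"
      unfolding sum.distrib by (simp add: sum_distrib_left)
    finally show ?thesis unfolding Q_count_sum_eq Ysum_def by simp
  qed
  let ?u = "\<lambda>k. norm (Msum S f k) / real q ^ k"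
  have bound: "norm (- (\<Sum>k\<le>n. Msum S f k * of_real (\<eta> (n - k)) / of_real (real q ^ n))) \<le> H * (\<Sum>k\<le>n. ?u k * (1 / real q) ^ (n - k))" for n
    unfolding norm_minus_cancel sum_distrib_left
  proof (rule sum_norm_le)
    fix k assume "k \<in> {..n}"
    then have "real q ^ n = real q ^ k * real q ^ (n - k)" by (simp flip: power_add)
    then have "norm (Msum S f k * of_real (\<eta> (n - k)) / of_real (real q ^ n)) = \<bar>\<eta> (n - k)\<bar> * (?u k * (1 / real q) ^ (n - k))"
      using q0 by (simp add: norm_mult norm_divide norm_power power_one_over)
    also have "\<dots> \<le> H * (?u k * (1 / real q) ^ (n - k))"
      using H(2) unfolding \<eta>_def by (intro mult_right_mono) auto
    finally show "norm (Msum S f k * of_real (\<eta> (n - k)) / of_real (real q ^ n)) \<le> H * (?u k * (1 / real q) ^ (n - k))" .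
  qed
  have "(\<lambda>n. H * (\<Sum>k\<le>n. ?u k * (1 / real q) ^ (n - k))) \<longlonglongrightarrow> H * 0"
    using inv_q Msum_tendsto_zero[OF f] by (intro tendsto_mult tendsto_const geometric_average_tendsto_zero)
  then have lim: "(\<lambda>n. H * (\<Sum>k\<le>n. ?u k * (1 / real q) ^ (n - k))) \<longlonglongrightarrow> 0" by simp
  show ?thesis unfolding eq by (rule Lim_null_comparison[OF _ lim]) (use bound in simp)
qed

text \<open>Between consecutive multiples of \<open>degree_gcd\<close> no new terms enter the
  partial sum.\<close>

lemma Ysum_div: "Ysum S f n = Ysum S f (degree_gcd * (n div degree_gcd))"
proof -
  let ?m = "degree_gcd * (n div degree_gcd)"
  have "\<not> degree_gcd dvd k" if "k \<le> n" "\<not> k \<le> ?m" for k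
  proof
    assume "degree_gcd dvd k"
    then obtain j where j: "k = degree_gcd * j" by (elim dvdE)
    then have "j \<le> n div degree_gcd" using that(1) degree_gcd_pos by (simp add: less_eq_div_iff_mult_less_eq mult.commute)
    then show False using that(2) j by simp
  qed
  then have "(\<Sum>k\<le>?m. Msum S f k / of_real (real q ^ k)) = (\<Sum>k\<le>n. Msum S f k / of_real (real q ^ k))"
    by (intro sum.mono_neutral_left) (auto simp: Msum_nonmultiple intro: order_trans[OF _ times_div_less_eq_dividend])
  then show ?thesis unfolding Ysum_def by simp
qed

text \<open>If \<open>degree_gcd\<close> exceeds 1, the sequence on the left is zero at all other
  degrees. With the limit 0 this is consistent, and convergence along the multiples suffices because
  \<open>Ysum\<close> is constant between them.\<close>

lemma Ysum_multiples_tendsto: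
  assumes \<delta>: "degree_gcd \<noteq> 1 \<longrightarrow> \<delta> = 0"
  shows "(\<lambda>n. if degree_gcd dvd n then of_real (c_const K) * Ysum S f n else 0) \<longlonglongrightarrow> of_real (\<delta> * c_const K)
    \<longleftrightarrow> Ysum S f \<longlonglongrightarrow> of_real \<delta>"
    (is "?g \<longlonglongrightarrow> _ \<longleftrightarrow> _")
proof (cases "degree_gcd = 1")
  case True
  have c: "complex_of_real (c_const K) \<noteq> 0" using c_const_pos by simp
  have "?g \<longlonglongrightarrow> of_real (\<delta> * c_const K) \<longleftrightarrow> (\<lambda>n. of_real (c_const K) * Ysum S f n) \<longlonglongrightarrow> of_real (c_const K) * of_real \<delta>"
    using True by (simp add: mult.commute)
  also have "\<dots> \<longleftrightarrow> Ysum S f \<longlonglongrightarrow> of_real \<delta>" using tendsto_mult_left_iff[OF c] by blast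
  finally show ?thesis .
next
  case False
  then have d0: "\<delta> = 0" using \<delta> by blast
  have c: "complex_of_real (c_const K) \<noteq> 0" using c_const_pos by simp
  show ?thesis
  proof
    assume g: "?g \<longlonglongrightarrow> of_real (\<delta> * c_const K)"
    \<comment> \<open>The limit is taken along the largest multiple of \<open>degree_gcd\<close> not
      exceeding n, where \<open>Ysum\<close> has the same value as at n.\<close>
    have "filterlim (\<lambda>n. degree_gcd * (n div degree_gcd)) at_top sequentially"
    proof (rule filterlim_at_top_mono[OF filterlim_minus_const_nat_at_top[of degree_gcd]])
      show "\<forall>\<^sub>F n in sequentially. n - degree_gcd \<le> degree_gcd * (n div degree_gcd)"
      proof (rule always_eventually, rule allI)
        fix n
        have "n = degree_gcd * (n div degree_gcd) + n mod degree_gcd" by simp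
        moreover have "n mod degree_gcd < degree_gcd" using degree_gcd_pos by simp
        ultimately show "n - degree_gcd \<le> degree_gcd * (n div degree_gcd)" by linarith
      qed
    qed
    from filterlim_compose[OF g this]
    have "(\<lambda>n. of_real (c_const K) * Ysum S f n) \<longlonglongrightarrow> of_real (c_const K) * 0"
      unfolding Ysum_div[of S f, symmetric] using d0 by simp
    then show "Ysum S f \<longlonglongrightarrow> of_real \<delta>" unfolding tendsto_mult_left_iff[OF c] d0 by simp
  next
    assume "Ysum S f \<longlonglongrightarrow> of_real \<delta>"
    then have "(\<lambda>n. of_real (c_const K) * Ysum S f n) \<longlonglongrightarrow> of_real (c_const K) * of_real \<delta>"
      by (intro tendsto_mult tendsto_const)
    then have "(\<lambda>n. of_real (c_const K) * Ysum S f n) \<longlonglongrightarrow> 0" using d0 by simp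
    then have lim: "(\<lambda>n. norm (of_real (c_const K) * Ysum S f n)) \<longlonglongrightarrow> 0" by (rule tendsto_norm_zero)
    have "?g \<longlonglongrightarrow> 0" by (rule Lim_null_comparison[OF _ lim]) simp
    then show "?g \<longlonglongrightarrow> of_real (\<delta> * c_const K)" using d0 by simp
  qed
qed

end

theorem theorem5p3:
  fixes K :: "('a, 'b) ring_scheme"
    and q :: nat
    and S :: "'a set set"
    and \<delta> :: real
    and f :: "nat \<Rightarrow> complex"
  assumes "global_function_field K"
    and "q = card (constant_field K)"
    and "S \<subseteq> places K"
    and "has_natural_density K S \<delta>"
    and "bounded (range f)"
    and "f 0 = 0"
  shows "(\<lambda>n. (\<Sum>A | A \<in> effective_divisors K \<and> div_degree K A = int n.
                 of_nat (Q_count K S A) * f (d_plus K A))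
              - of_real (\<delta> * c_const K * real q ^ n))
           \<in> o(\<lambda>n. complex_of_real (real q ^ n))
     \<longleftrightarrow>
     (\<lambda>n. - (\<Sum>A | A \<in> distinguishable_divisors K S \<and>
                  1 \<le> div_degree K A \<and> div_degree K A \<le> int n.
                of_int (div_moebius A) * f (d_minus K A) / of_real (div_norm K A)))
       \<longlonglongrightarrow> of_real \<delta>"
proof -
  interpret global_function_field K by (rule assms(1))
  have q: "q = global_function_field.q K" using assms(2) q_def by simp
  have q0: "real (global_function_field.q K) \<noteq> 0" using q_ge_2 by simp
  define L where "L n = (\<Sum>A\<in>eff n. of_nat (Q_count K S A) * f (d_plus K A))" for n
  let ?Q = "\<lambda>n. complex_of_real (real q ^ n)"
  let ?g = "\<lambda>n. if degree_gcd dvd n then of_real (c_const K) * Ysum S f n else 0"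
  have L: "(\<Sum>A | A \<in> effective_divisors K \<and> div_degree K A = int n. of_nat (Q_count K S A) * f (d_plus K A)) = L n" for n
    unfolding L_def eff_def by simp
  have Qn: "?Q n \<noteq> 0" for n using q0 q by simp
  have asym: "(\<lambda>n. L n / ?Q n - ?g n) \<longlonglongrightarrow> 0"
    unfolding L_def q by (rule Q_count_asymptotic[OF assms(5)])
  have "(\<lambda>n. L n - of_real (\<delta> * c_const K * real q ^ n)) \<in> o(?Q)
      \<longleftrightarrow> (\<lambda>n. (L n - of_real (\<delta> * c_const K * real q ^ n)) / ?Q n) \<longlonglongrightarrow> 0"
    (is "?F \<in> _ \<longleftrightarrow> _")
  proof
    show "(\<lambda>n. ?F n / ?Q n) \<longlonglongrightarrow> 0" if "?F \<in> o(?Q)" using that by (rule smalloD_tendsto)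
    show "?F \<in> o(?Q)" if "(\<lambda>n. ?F n / ?Q n) \<longlonglongrightarrow> 0"
      using that by (rule smalloI_tendsto) (use Qn in simp)
  qed
  also have "(\<lambda>n. (L n - of_real (\<delta> * c_const K * real q ^ n)) / ?Q n) = (\<lambda>n. L n / ?Q n - of_real (\<delta> * c_const K))"
    using Qn by (simp add: diff_divide_distrib)
  also have "\<dots> \<longlonglongrightarrow> 0 \<longleftrightarrow> (\<lambda>n. L n / ?Q n) \<longlonglongrightarrow> of_real (\<delta> * c_const K)"
    by (rule LIM_zero_iff)
  also have "\<dots> \<longleftrightarrow> ?g \<longlonglongrightarrow> of_real (\<delta> * c_const K)"
  proof
    assume "(\<lambda>n. L n / ?Q n) \<longlonglongrightarrow> of_real (\<delta> * c_const K)"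
    from tendsto_diff[OF this asym] show "?g \<longlonglongrightarrow> of_real (\<delta> * c_const K)" by simp
  next
    assume "?g \<longlonglongrightarrow> of_real (\<delta> * c_const K)"
    from tendsto_add[OF this asym] show "(\<lambda>n. L n / ?Q n) \<longlonglongrightarrow> of_real (\<delta> * c_const K)" by simp
  qed
  \<comment> \<open>\<open>density_zero\<close> supplies \<delta> = 0 in the case that
    \<open>degree_gcd\<close> is larger than 1.\<close>
  also have "\<dots> \<longleftrightarrow> Ysum S f \<longlonglongrightarrow> of_real \<delta>"
    using density_zero[OF assms(3,4)] degree_gcd_pos by (intro Ysum_multiples_tendsto) auto
  finally show ?thesis unfolding L Ysum_eq .
qed

end
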